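(* Let $N\ge2$, $V_\pm>0$, $\rho_\pm>0$ and $\gamma\ge0$. If $\Omega$ is a minimizer of the problem $(\mathrm{P})$ $$\min\left\{\mathcal F(\Omega):\ \Omega\subset\mathbb R^N \text{ is of finite perimeter},\ \rho_-|\Omega_-|=V_-,\ \rho_+|\Omega_+|=V_+\right\},$$ then each of $\Gamma_-$ and $\Gamma_+$ is either a spherical cap or a sphere.
   Context: Let $\mathbb R^N_-=\{x_1<0\}$, $\mathbb R^N_+=\{x_1>0\}$, $\Sigma=\{x_1=0\}$. For a set of finite perimeter $\Omega\subset\mathbb R^N$ put $\Omega_\pm=\Omega\cap\mathbb R^N_\pm$, $\Gamma_\pm=\partial\Omega\cap\mathbb R^N_\pm$, $\Gamma_0=\partial\Omega\cap\Sigma$. Here $|\cdot|$ is Lebesgue measure, $P(\Omega,A)$ is the relative perimeter of $\Omega$ in $A$ in the sense of De Giorgi, and $\mathcal H^{N-1}$ is Hausdorff measure. The functional is $$\mathcal F(\Omega)=\rho_-P(\Omega,\mathbb R^N_-)+\rho_+P(\Omega,\mathbb R^N_+)+\gamma\,\mathcal H^{N-1}(\Gamma_0).$$ Convention: sets of finite perimeter are identified when they differ by a Lebesgue-null set, and $\partial\Omega$ denotes the topological boundary of a representative with $\partial\Omega=\{x:0<|\Omega\cap B(x,r)|<|B(x,r)|\ \forall r>0\}$ (the support of the Gauss–Green measure). A spherical cap is the part in $\mathbb R^N_\pm$ of a sphere that crosses $\Sigma$; "a sphere" means a whole sphere contained in the closed half-space $\overline{\mathbb R^N_\pm}$ (up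 to its tangency point with $\Sigma$, if any). *)

theory Defs
  imports "HOL-Analysis.Analysis"
begin

subsection \<open>Hausdorff measure\<close>

text \<open>
  The weight of a covering set is normalised so that the m-dimensional measure agrees with
  m-dimensional Lebesgue measure on m-dimensional subspaces. The empty set gets weight 0
  separately because \<open>0 ^ 0 = 1\<close>. Covering sets are required to be bounded since
  \<^const>\<open>diameter\<close> carries no information on unbounded sets.
\<close>

definition hausdorff_weight :: "nat \<Rightarrow> 'a::metric_space set \<Rightarrow> ennreal" where
  "hausdorff_weight m U =
     (if U = {} then 0 else ennreal (unit_ball_vol (real m) * (diameter U / 2) ^ m))"

definition hausdorff_pre :: "nat \<Rightarrow> real \<Rightarrow> 'a::metric_space set \<Rightarrow> ennreal" where
  "hausdorff_pre m \<delta> A =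
     (INF U \<in> {U :: nat \<Rightarrow> 'a set. A \<subseteq> (\<Union>i. U i) \<and> (\<forall>i. bounded (U i) \<and> diameter (U i) \<le> \<delta>)}.
        \<Sum>i. hausdorff_weight m (U i))"

definition hausdorff_measure :: "nat \<Rightarrow> 'a::metric_space set \<Rightarrow> ennreal" where
  "hausdorff_measure m A = (SUP \<delta> \<in> {0<..}. hausdorff_pre m \<delta> A)"

subsection \<open>Perimeter\<close>

definition partial_deriv :: "'n::finite \<Rightarrow> (real^'n \<Rightarrow> real^'n) \<Rightarrow> real^'n \<Rightarrow> real^'n" where
  "partial_deriv i \<phi> x = frechet_derivative \<phi> (at x) (axis i 1)"

definition div_field :: "(real^'n \<Rightarrow> real^'n) \<Rightarrow> real^'n \<Rightarrow> real" where
  "div_field \<phi> x = (\<Sum>i\<in>UNIV. partial_deriv i \<phi> x $ i)"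

text \<open>The fields of class \<open>C\<^sup>1\<close> with compact support in \<open>A\<close> and norm at most 1.\<close>

definition test_fields :: "(real^'n) set \<Rightarrow> (real^'n \<Rightarrow> real^'n) set" where
  "test_fields A = {\<phi>. (\<forall>x. \<phi> differentiable (at x)) \<and>
     (\<forall>i. continuous_on UNIV (partial_deriv i \<phi>)) \<and>
     compact (closure {x. \<phi> x \<noteq> 0}) \<and> closure {x. \<phi> x \<noteq> 0} \<subseteq> A \<and>
     (\<forall>x. norm (\<phi> x) \<le> 1)}"

text \<open>
  \<^const>\<open>ennreal\<close> truncates negative integrals to 0; this does not change the supremum because
  the zero field is admissible.
\<close>

definition perimeter :: "(real^'n) set \<Rightarrow> (real^'n) set \<Rightarrow> ennreal" where
  "perimeter \<Omega> A = (SUP \<phi> \<in> test_fields A. ennreal (LINT x:\<Omega>|lebesgue. div_field \<phi> x))"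

definition finite_perimeter :: "(real^'n) set \<Rightarrow> bool" where
  "finite_perimeter \<Omega> \<longleftrightarrow> \<Omega> \<in> sets lebesgue \<and> perimeter \<Omega> UNIV < \<infinity>"

text \<open>
  The boundary of a set of finite perimeter, taken modulo null sets: it depends only on the
  equivalence class of the set, and by \<open>exists_normalized_representative\<close> below it is the
  topological boundary (\<^const>\<open>frontier\<close>) of a suitable representative.
\<close>

definition bdry :: "(real^'n) set \<Rightarrow> (real^'n) set" where
  "bdry \<Omega> = {x. \<forall>r>0. 0 < emeasure lebesgue (\<Omega> \<inter> ball x r) \<and>
                      emeasure lebesgue (\<Omega> \<inter> ball x r) < emeasure lebesgue (ball x r)}"

subsection \<open>The variational problem\<close>

text \<open>The coordinate \<open>k\<close> plays the role of the first coordinate.\<close>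

definition neg_side :: "'n::finite \<Rightarrow> (real^'n) set" where
  "neg_side k = {x. x $ k < 0}"

definition pos_side :: "'n::finite \<Rightarrow> (real^'n) set" where
  "pos_side k = {x. x $ k > 0}"

definition interface :: "'n::finite \<Rightarrow> (real^'n) set" where
  "interface k = {x. x $ k = 0}"

definition energy :: "'n::finite \<Rightarrow> real \<Rightarrow> real \<Rightarrow> real \<Rightarrow> (real^'n) set \<Rightarrow> ennreal" where
  "energy k \<rho>m \<rho>p \<gamma> \<Omega> =
     ennreal \<rho>m * perimeter \<Omega> (neg_side k) + ennreal \<rho>p * perimeter \<Omega> (pos_side k)
     + ennreal \<gamma> * hausdorff_measure (CARD('n) - 1) (bdry \<Omega> \<inter> interface k)"

definition admissible ::
  "'n::finite \<Rightarrow> real \<Rightarrow> real \<Rightarrow> real \<Rightarrow> real \<Rightarrow> (real^'n) set \<Rightarrow> bool" where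
  "admissible k \<rho>m \<rho>p Vm Vp \<Omega> \<longleftrightarrow> finite_perimeter \<Omega> \<and>
     ennreal \<rho>m * emeasure lebesgue (\<Omega> \<inter> neg_side k) = ennreal Vm \<and>
     ennreal \<rho>p * emeasure lebesgue (\<Omega> \<inter> pos_side k) = ennreal Vp"

subsection \<open>Caps and spheres\<close>

text \<open>Here \<open>H\<close> is one of the open half-spaces \<^term>\<open>neg_side k\<close>, \<^term>\<open>pos_side k\<close>.\<close>

definition spherical_cap :: "'n::finite \<Rightarrow> (real^'n) set \<Rightarrow> (real^'n) set \<Rightarrow> bool" where
  "spherical_cap k H S \<longleftrightarrow> (\<exists>c r. sphere c r \<inter> neg_side k \<noteq> {} \<and> sphere c r \<inter> pos_side k \<noteq> {} \<and>
     S = sphere c r \<inter> H)"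

text \<open>
  A sphere in the closed half-space may touch the interface in one point; that point does not
  belong to \<open>H\<close>, hence not to \<open>S\<close>.
\<close>

definition sphere_in_side :: "'n::finite \<Rightarrow> (real^'n) set \<Rightarrow> (real^'n) set \<Rightarrow> bool" where
  "sphere_in_side k H S \<longleftrightarrow> (\<exists>c r. 0 < r \<and> sphere c r \<subseteq> closure H \<and> S = sphere c r - interface k)"

subsection \<open>Representatives\<close>

lemma bdry_cong:
  fixes \<Omega> \<Omega>' :: "(real^'n) set"
  assumes "\<Omega> \<in> sets lebesgue" "\<Omega>' \<in> sets lebesgue"
    and null: "(\<Omega> - \<Omega>') \<union> (\<Omega>' - \<Omega>) \<in> null_sets lebesgue"
  shows "bdry \<Omega> = bdry \<Omega>'"
proof -
  have "emeasure lebesgue (\<Omega> \<inter> ball x r) = emeasure lebesgue (\<Omega>' \<inter> ball x r)" for x r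
  proof (rule emeasure_eq_AE)
    have "AE y in lebesgue. y \<notin> (\<Omega> - \<Omega>') \<union> (\<Omega>' - \<Omega>)"
      using null by (rule AE_not_in)
    then show "AE y in lebesgue. (y \<in> \<Omega> \<inter> ball x r) = (y \<in> \<Omega>' \<inter> ball x r)"
      by eventually_elim auto
  qed (use assms in auto)
  then show ?thesis unfolding bdry_def by simp
qed

lemma exists_normalized_representative:
  fixes \<Omega> :: "(real^'n) set"
  assumes [measurable]: "\<Omega> \<in> sets lebesgue"
  obtains \<Omega>' where "\<Omega>' \<in> sets lebesgue" "(\<Omega> - \<Omega>') \<union> (\<Omega>' - \<Omega>) \<in> null_sets lebesgue"
    "frontier \<Omega>' = bdry \<Omega>'" "bdry \<Omega>' = bdry \<Omega>"
proof -
  have cover: "open (\<Union>\<B>) \<and> \<Union>\<B> \<inter> E \<in> null_sets lebesgue"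
    if E: "E \<in> sets lebesgue" and \<B>: "\<B> = {ball x r | x r. r > 0 \<and> E \<inter> ball x r \<in> null_sets lebesgue}"
    for E :: "(real^'n) set" and \<B>
  proof
    show "open (\<Union>\<B>)" using \<B> by auto
    obtain \<C> where \<C>: "\<C> \<subseteq> \<B>" "countable \<C>" "\<Union>\<C> = \<Union>\<B>"
      using Lindelof[of \<B>] \<B> by (smt (verit) mem_Collect_eq open_ball)
    have "(\<Union>C\<in>\<C>. E \<inter> C) \<in> null_sets lebesgue"
      using \<C> \<B> by (intro null_sets_UN') auto
    moreover have "(\<Union>C\<in>\<C>. E \<inter> C) = \<Union>\<B> \<inter> E" using \<C>(3) by auto
    ultimately show "\<Union>\<B> \<inter> E \<in> null_sets lebesgue" by simp
  qed
  define A0 where "A0 = \<Union>{ball x r | x r. r > 0 \<and> \<Omega> \<inter> ball x r \<in> null_sets lebesgue}"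
  define A1 where "A1 = \<Union>{ball x r | x r. r > 0 \<and> (- \<Omega>) \<inter> ball x r \<in> null_sets lebesgue}"
  have A0: "open A0" "A0 \<inter> \<Omega> \<in> null_sets lebesgue"
    using cover[OF assms refl] unfolding A0_def by auto
  have cO: "- \<Omega> \<in> sets lebesgue" by (simp add: Compl_in_sets_lebesgue assms)
  have A1: "open A1" "A1 \<inter> (- \<Omega>) \<in> null_sets lebesgue"
    using cover[OF cO refl] unfolding A1_def by auto
  have disj: "A0 \<inter> A1 = {}"
  proof -
    have "A0 \<inter> A1 \<subseteq> (A0 \<inter> \<Omega>) \<union> (A1 \<inter> (- \<Omega>))" by auto
    moreover have "(A0 \<inter> \<Omega>) \<union> (A1 \<inter> (- \<Omega>)) \<in> null_sets lebesgue"
      using A0 A1 by (intro null_sets.Un) auto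
    ultimately have "negligible (A0 \<inter> A1)"
      using negligible_iff_null_sets negligible_subset by blast
    moreover have "open (A0 \<inter> A1)" using A0 A1 by auto
    ultimately show ?thesis using open_not_negligible by blast
  qed
  define \<Omega>' where "\<Omega>' = (\<Omega> \<union> A1) - A0"
  have mO': "\<Omega>' \<in> sets lebesgue"
    unfolding \<Omega>'_def using A0(1) A1(1) assms
    by (intro sets.Diff sets.Un) auto
  have eq: "(\<Omega> - \<Omega>') \<union> (\<Omega>' - \<Omega>) = (A0 \<inter> \<Omega>) \<union> (A1 \<inter> (- \<Omega>))"
    unfolding \<Omega>'_def using disj by auto
  have null: "(\<Omega> - \<Omega>') \<union> (\<Omega>' - \<Omega>) \<in> null_sets lebesgue"
    unfolding eq using A0 A1 by (intro null_sets.Un) auto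
  have b: "bdry \<Omega>' = bdry \<Omega>"
    using bdry_cong[OF assms mO' null] by simp
  have fin: "emeasure lebesgue (ball x r) < \<infinity>" for x :: "real^'n" and r
    using emeasure_lborel_ball_finite[of x r] by simp
  have split: "emeasure lebesgue (ball x r) =
      emeasure lebesgue (E \<inter> ball x r) + emeasure lebesgue ((- E) \<inter> ball x r)"
    if "E \<in> sets lebesgue" for E :: "(real^'n) set" and x r
  proof -
    have "- E \<in> sets lebesgue" by (simp add: Compl_in_sets_lebesgue that)
    then have "emeasure lebesgue (E \<inter> ball x r) + emeasure lebesgue ((- E) \<inter> ball x r)
       = emeasure lebesgue ((E \<inter> ball x r) \<union> ((- E) \<inter> ball x r))"
      using that by (intro plus_emeasure) auto
    also have "(E \<inter> ball x r) \<union> ((- E) \<inter> ball x r) = ball x r" by auto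
    finally show ?thesis by simp
  qed
  have less_iff: "emeasure lebesgue (E \<inter> ball x r) < emeasure lebesgue (ball x r) \<longleftrightarrow>
      emeasure lebesgue ((- E) \<inter> ball x r) > 0"
    if E: "E \<in> sets lebesgue" for E :: "(real^'n) set" and x r
  proof -
    have "emeasure lebesgue (E \<inter> ball x r) < \<infinity>"
      using split[OF E, of x r] fin[of x r] by (metis add_top ennreal_add_eq_top infinity_ennreal_def less_top)
    then show ?thesis
      unfolding split[OF E, of x r]
      by (metis add.right_neutral ennreal_add_left_cancel_less infinity_ennreal_def less_irrefl)
  qed
  have bd: "x \<in> bdry E \<longleftrightarrow> (\<forall>r>0. E \<inter> ball x r \<notin> null_sets lebesgue \<and> (- E) \<inter> ball x r \<notin> null_sets lebesgue)"
    if E: "E \<in> sets lebesgue" for E :: "(real^'n) set" and x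
  proof -
    have "- E \<in> sets lebesgue" by (simp add: Compl_in_sets_lebesgue that)
    then have "E \<inter> ball x r \<in> sets lebesgue" "(- E) \<inter> ball x r \<in> sets lebesgue" for r
      using E by auto
    then have "S \<in> null_sets lebesgue \<longleftrightarrow> \<not> 0 < emeasure lebesgue S"
      if "S = E \<inter> ball x r \<or> S = (- E) \<inter> ball x r" for S r
      using that by (metis null_setsD1 null_setsI not_gr_zero)
    then show ?thesis
      unfolding bdry_def mem_Collect_eq less_iff[OF E] by blast
  qed
  have "frontier \<Omega>' = bdry \<Omega>'"
  proof
    show "bdry \<Omega>' \<subseteq> frontier \<Omega>'"
    proof
      fix x assume x: "x \<in> bdry \<Omega>'"
      have "\<Omega>' \<inter> ball x r \<noteq> {} \<and> (- \<Omega>') \<inter> ball x r \<noteq> {}" if "r > 0" for r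
        using x that unfolding bd[OF mO'] by (metis null_sets.empty_sets)
      then show "x \<in> frontier \<Omega>'"
        unfolding frontier_straddle by (auto simp: disjoint_iff Int_def) 
    qed
    show "frontier \<Omega>' \<subseteq> bdry \<Omega>'"
    proof
      fix x assume x: "x \<in> frontier \<Omega>'"
      have "A0 \<subseteq> - \<Omega>'" unfolding \<Omega>'_def by auto
      then have "A0 \<subseteq> interior (- \<Omega>')" using A0(1) interior_maximal by blast
      then have n0: "x \<notin> A0" using x by (auto simp: frontier_def interior_complement)
      have "A1 \<subseteq> \<Omega>'" unfolding \<Omega>'_def using disj by auto
      then have "A1 \<subseteq> interior \<Omega>'" using A1(1) interior_maximal by blast
      then have n1: "x \<notin> A1" using x by (auto simp: frontier_def)
      show "x \<in> bdry \<Omega>'"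
        unfolding b bd[OF assms]
      proof (intro allI impI conjI)
        fix r :: real assume r: "r > 0"
        show "\<Omega> \<inter> ball x r \<notin> null_sets lebesgue"
          using n0 r unfolding A0_def by force
        show "- \<Omega> \<inter> ball x r \<notin> null_sets lebesgue"
          using n1 r unfolding A1_def by force
      qed
    qed
  qed
  then show ?thesis using that mO' null b by blast
qed

end

theory Submission
 imports Defs "HOL-Probability.Probability"
begin

text \<open>Fix a side and a half-space cap \<open>K\<close>, the part above height \<open>-a\<close> of a unit ball. The Knothe map
 from \<open>E\<close> to \<open>K\<close>, used as a test field, together with the trace of \<open>E\<close> on the interface \<open>\<Sigma>\<close> (a limit of averages over
 thin slabs), gives the sharp inequality \<open>p + a A \<ge> N |K|^(1/N) |E|^(1-1/N)\<close>, where \<open>p\<close> is the perimeter of \<open>E\<close> in the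
 open half-space and \<open>A\<close> the area of its trace. For a minimizer with traces \<open>A\<close> and \<open>A'\<close> on the two sides, the
 caps with the same volumes and traces are an admissible competitor: the part of \<open>\<Sigma>\<close> that bounds \<open>\<Omega>\<close> has measure
 at least \<open>|A - A'|\<close>, which the two caps attain. So equality holds on both sides. Equality makes every
 marginal transport affine, hence \<open>E\<close> and a rescaled cap have the same first and second moments, and the
 bathtub principle identifies \<open>E\<close> with the part of a ball in the half-space.\<close>

text \<open>The Knothe map is triangular and assembled from one-dimensional quantile functions, so
  each component is monotone in its own variable. It need not be smooth and its slopes may be
  unbounded, which shapes the first half: slopes are truncated, increments replace derivatives, and
  mollification discards the singular part with the favourable sign. The trace is never a function,
  only one number; this suffices because the cap enters the boundary term solely through the lower
  bound \<open>-a\<close> for the normal component of the map. The height \<open>a\<close> is tuned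
  afterwards so that the cap with the volume of \<open>E\<close> has exactly the trace
  \<open>A\<close>. Two obstacles remain. Equality in AM-GM gives slopes only where \<open>E\<close>
  has mass, so the transport could still jump across an empty slab; gluing two Knothe maps across
  the slab excludes this. And the interface term is a Hausdorff measure: it is compared with areas
  up to one common factor, the measure of a unit face, which enters both the lower bound for the
  minimizer and the upper bound for the competitor.\<close>

abbreviation nnint :: "('a::euclidean_space => ennreal) => ennreal" (binder "NN " 10)
 where "nnint f == integral\<^sup>N lborel f"

abbreviation lint :: "('a::euclidean_space => real) => real" (binder "LI " 10)
 where "lint f == integral\<^sup>L lborel f"

abbreviation evol :: "'a::euclidean_space set => ennreal" where "evol == emeasure lborel"

abbreviation vol :: "'a::euclidean_space set => real" where "vol == measure lborel"

abbreviation meas :: "('a::topological_space => 'b::topological_space) => bool"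
 where "meas f == f \<in> borel_measurable borel"

abbreviation ind :: "'a set => 'a => 'b::zero_neq_one" where "ind == indicator"

abbreviation intg :: "('a::euclidean_space => 'b::{banach, second_countable_topology}) => bool"
 where "intg == integrable lborel"

abbreviation hmeas :: "nat => 'a::metric_space set => ennreal" where "hmeas == hausdorff_measure"

notation LIMSEQ (infix "---->" 60)

lemmas cont_meas = borel_measurable_continuous_onI
lemmas int_bound = Bochner_Integration.integrable_bound
lemmas set_int_def = set_lebesgue_integral_def

lemma borel_Collect: "Measurable.pred borel P ==> {x. P x} \<in> sets borel"
 by (simp add: pred_def)

section \<open>Iterated integrals over the coordinates\<close>

definition upd :: "real^'n => 'n::finite => real => real^'n" where
 "upd x i s = (\<chi> j. if j = i then s else x $ j)"

lemma upd_nth [simp]: "upd x i s $ j = (if j = i then s else x $ j)"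
 by (simp add: upd_def)

lemma upd_upd_same [simp]: "upd (upd x i s) i t = upd x i t"
 by (simp add: vec_eq_iff)

lemma upd_commute: "i ~= j ==> upd (upd x i s) j t = upd (upd x j t) i s"
 by (simp add: vec_eq_iff)

lemma upd_triv [simp]: "upd x i (x $ i) = x"
 by (simp add: vec_eq_iff)

lemma upd_add_axis: "upd x i (x $ i + s) = x + s *\<^sub>R axis i 1"
 by (simp add: vec_eq_iff axis_def)

lemma borel_measurable_vec:
 fixes f :: "'a => real^'n"
 assumes "!!i. (\<lambda>x. f x $ i) \<in> borel_measurable M"
 shows "f \<in> borel_measurable M"
 using assms by (subst borel_measurable_euclidean_space) (auto simp: Basis_vec_def inner_axis)

lemma measurable_vec_nth [measurable (raw)]:
 fixes f :: "'a => real^'n"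
 assumes "f \<in> borel_measurable M"
 shows "(\<lambda>x. f x $ i) \<in> borel_measurable M"
proof -
 have "(\<lambda>x. f x \<bullet> axis i 1) \<in> borel_measurable M"
  using assms by measurable
 thus ?thesis by (simp add: inner_axis)
qed

lemma measurable_upd [measurable (raw)]:
 assumes [measurable]: "f \<in> borel_measurable M" "g \<in> borel_measurable M"
 shows "(\<lambda>x. upd (f x) i (g x)) \<in> borel_measurable M"
proof (rule borel_measurable_vec)
 fix j
 show "(\<lambda>x. upd (f x) i (g x) $ j) \<in> borel_measurable M"
  by (cases "j = i") auto
qed

text \<open>Iterated integration over the coordinates in a list, outermost first.\<close>

primrec iint :: "'n::finite list => (real^'n => ennreal) => real^'n => ennreal" where
 "iint [] f x = f x"
| "iint (i # is) f x = (NN s. iint is f (upd x i s))"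

lemma measurable_iint [measurable (raw)]:
 assumes "meas f"
 shows "meas (iint is f)"
proof (induction "is")
 case Nil
 show ?case using assms by (simp add: ext[of "iint [] f" f])
next
 case (Cons i "is")
 note [measurable] = Cons.IH
 have "meas (\<lambda>x. NN s. iint is f (upd x i s))"
  by measurable
 thus ?case by simp
qed

lemma measurable_iint' [measurable (raw)]:
 assumes "meas f" "g \<in> borel_measurable M"
 shows "(\<lambda>x. iint is f (g x)) \<in> borel_measurable M"
 using measurable_compose[OF assms(2) measurable_iint[OF assms(1)]] .

lemma iint_cong:
 assumes "!!y. (\<forall>i. i \<notin> set is --> y $ i = x $ i) ==> f y = g y"
 shows "iint is f x = iint is g x"
 using assms
proof (induction "is" arbitrary: x)
 case Nil thus ?case by simp
next
 case (Cons j "is")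
 have "iint is f (upd x j s) = iint is g (upd x j s)" for s
  by (rule Cons.IH) (auto intro!: Cons.prems)
 thus ?case by simp
qed

lemma iint_mono:
 assumes "!!y. f y <= g y" shows "iint is f x <= iint is g x"
proof (induction "is" arbitrary: x)
 case Nil thus ?case using assms by simp
next
 case (Cons j "is")
 thus ?case by (auto intro!: nn_integral_mono)
qed

lemma iint_cmult:
 assumes [measurable]: "meas f"
 shows "iint is (\<lambda>y. c * f y) x = c * iint is f x"
proof (induction "is" arbitrary: x)
 case Nil thus ?case by simp
next
 case (Cons i "is")
 show ?case by (simp add: Cons.IH nn_integral_cmult)
qed

text \<open>Coordinates outside \<open>is\<close> stay frozen at those of \<open>x\<close>, so the
  induction can treat partial lists; the outermost coordinate becomes one more factor of the product
  measure.\<close>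

lemma iint_PiM:
 assumes "distinct is" and [measurable]: "meas f"
 shows "iint is f x = (\<integral>\<^sup>+om. f (\<chi> i. if i \<in> set is then om i else x $ i) \<partial>(PiM (set is) (\<lambda>_. lborel)))"
 using assms(1)
proof (induction "is" arbitrary: x)
 case Nil
 thus ?case by (simp add: PiM_empty nn_integral_count_space_finite)
next
 case (Cons i "is")
 interpret product_sigma_finite "\<lambda>_::'a. lborel :: real measure" by standard
 have m: "(\<lambda>om. f (\<chi> j. if j \<in> set (i # is) then om j else x $ j)) \<in> borel_measurable (PiM (insert i (set is)) (\<lambda>_. lborel))"
 proof (rule measurable_compose[OF borel_measurable_vec assms(2)])
  fix j
  show "(\<lambda>om. (\<chi> j. if j \<in> set (i # is) then om j else x $ j) $ j) \<in> borel_measurable (PiM (insert i (set is)) (\<lambda>_. lborel))"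
   by (cases "j \<in> set (i # is)") auto
 qed
 have "iint (i # is) f x = (NN s. (\<integral>\<^sup>+om. f (\<chi> j. if j \<in> set is then om j else upd x i s $ j) \<partial>(PiM (set is) (\<lambda>_. lborel))))"
  using Cons by simp
 also have "... = (NN s. (\<integral>\<^sup>+om. f (\<chi> j. if j \<in> set (i # is) then (fun_upd om i s) j else x $ j) \<partial>(PiM (set is) (\<lambda>_. lborel))))"
 proof (intro nn_integral_cong arg_cong[of _ _ f])
  show "(\<chi> j. if j \<in> set is then om j else upd x i s $ j) = (\<chi> j. if j \<in> set (i # is) then (fun_upd om i s) j else x $ j)" for om s
   using Cons.prems by (auto simp: vec_eq_iff)
 qed
 also have "... = (\<integral>\<^sup>+om. f (\<chi> j. if j \<in> set (i # is) then om j else x $ j) \<partial>(PiM (insert i (set is)) (\<lambda>_. lborel)))"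
  using Cons.prems m by (subst product_nn_integral_insert_rev) auto
 finally show ?case by simp
qed

text \<open>Lebesgue measure is determined by its values on boxes, and there the product measure
  gives the product of the side lengths.\<close>

lemma lborel_vec_PiM:
 "(lborel :: (real^'n::finite) measure) = distr (PiM UNIV (\<lambda>_. lborel)) borel vec_lambda" (is "_ = ?D")
proof (rule lborel_eqI)
 interpret product_sigma_finite "\<lambda>_::'n. lborel :: real measure" by standard
 interpret finite_product_sigma_finite "\<lambda>_::'n. lborel :: real measure" UNIV by standard auto
 fix l u :: "real^'n"
 assume "!!b. b \<in> Basis ==> l \<bullet> b <= u \<bullet> b"
 from this[of "axis i 1" for i] have lu: "l $ i <= u $ i" for i
  by (simp add: inner_axis)
 have [measurable]: "vec_lambda \<in> borel_measurable (PiM UNIV (\<lambda>_::'n. lborel :: real measure))"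
  by (rule borel_measurable_vec) simp
 have "emeasure ?D (box l u) = emeasure (PiM UNIV (\<lambda>_::'n. lborel)) (vec_lambda -` box l u \<inter> space (PiM UNIV (\<lambda>_::'n. lborel)))"
  by (rule emeasure_distr) auto
 also have "vec_lambda -` box l u \<inter> space (PiM UNIV (\<lambda>_::'n. lborel)) = (\<Pi>\<^sub>E i\<in>UNIV. {l $ i <..< u $ i})"
  by (auto simp: space_PiM box_def Basis_vec_def inner_axis PiE_def Pi_def)
 also have "emeasure (PiM UNIV (\<lambda>_::'n. lborel)) ... = (\<Prod>i\<in>UNIV. evol {l $ i <..< u $ i})"
  by (rule emeasure_PiM) auto
 also have "... = (\<Prod>i\<in>UNIV. ennreal ((u - l) $ i))"
  using lu by (intro prod.cong) auto
 also have "... = ennreal (\<Prod>i\<in>UNIV. (u - l) $ i)"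
  using lu by (intro prod_ennreal) auto
 also have "(\<Prod>i\<in>UNIV. (u - l) $ i) = (\<Prod>b\<in>Basis. (u - l) \<bullet> b)"
 proof -
  have B: "(Basis :: (real^'n) set) = (\<lambda>i. axis i 1) ` UNIV"
   by (auto simp: Basis_vec_def)
  have inj: "inj (\<lambda>i::'n. axis i (1::real))"
   by (auto simp: inj_on_def axis_eq_axis)
  show ?thesis unfolding B by (subst prod.reindex[OF inj]) (simp add: inner_axis)
 qed
 finally show "emeasure ?D (box l u) = (\<Prod>b\<in>Basis. (u - l) \<bullet> b)" .
qed simp

text \<open>When every coordinate is listed, the base point \<open>x\<close> drops out and the order
  of the list is free. This freedom lets any coordinate be transported first.\<close>

lemma iint_full:
 assumes "distinct is" "set is = (UNIV :: 'n::finite set)" and [measurable]: "meas f"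
 shows "iint is f x = (NN y. f y)"
proof -
 have [measurable]: "vec_lambda \<in> borel_measurable (PiM UNIV (\<lambda>_::'n. lborel :: real measure))"
  by (rule borel_measurable_vec) simp
 have "iint is f x = (\<integral>\<^sup>+om. f (vec_lambda om) \<partial>(PiM UNIV (\<lambda>_. lborel)))"
  using assms iint_PiM[OF assms(1,3), of x] by (simp add: assms(2))
 also have "... = (NN y. f y)"
  unfolding lborel_vec_PiM[where 'n='n] by (subst nn_integral_distr) auto
 finally show ?thesis .
qed

lemma coord_list:
 obtains "rest" where "distinct (j # rest)" "set (j # rest) = (UNIV :: 'n::finite set)"
proof -
 obtain xs where "set xs = UNIV - {j}" "distinct xs"
  using finite_distinct_list[of "UNIV - {j}"] by auto
 thus ?thesis by (intro that[of xs]) auto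
qed

section \<open>Monotone transport on the line\<close>

text \<open>The generalized inverse of the distribution function of \<open>\<nu>\<close>, applied to
  that of \<open>\<mu>\<close>. Minimizing over \<open>P\<close> instead of over the whole line
  keeps the infimum finite where \<open>\<mu>\<close> has no mass to the left of \<open>u\<close>,
  and keeps all values in \<open>P\<close>.\<close>

definition quant :: "real measure => real measure => real set => real => real" where
 "quant \<mu> \<nu> P u = Inf {t \<in> P. emeasure \<mu> {..u} <= emeasure \<nu> {..t}}"

text \<open>A source without atoms has a continuous distribution function, which is then uniformly
  distributed under \<open>\<mu>\<close>; this makes the push-forward exact.\<close>

locale transport1 =
 fixes \<mu> \<nu> :: "real measure" and P :: "real set"
 assumes mu: "real_distribution \<mu>" and nu: "real_distribution \<nu>"
  and no_atoms: "!!u. emeasure \<mu> {u} = 0"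
  and P: "compact P" "P ~= {}" "emeasure \<nu> (- P) = 0"

begin

sublocale mu: real_distribution \<mu> by (rule mu)
sublocale nu: real_distribution \<nu> by (rule nu)

lemma le_iff_cdf: "emeasure \<mu> {..u} <= emeasure \<nu> {..t} \<longleftrightarrow> cdf \<mu> u <= cdf \<nu> t"
 by (simp add: cdf_def mu.emeasure_eq_measure nu.emeasure_eq_measure)

lemma P_closed: "closed P" and P_bdd: "bdd_below P" "bdd_above P"
 using P(1) by (auto simp: compact_imp_closed compact_imp_bounded bounded_imp_bdd_below bounded_imp_bdd_above)

lemma cdf_max: "cdf \<nu> (Sup P) = 1"
proof -
 have "prob_space.prob \<nu> (- P) = 0"
  using P(3) by (simp add: measure_def)
 have "{Sup P<..} \<subseteq> - P"
  using cSup_upper[OF _ P_bdd(2)] by (auto simp: not_le[symmetric])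
 hence "emeasure \<nu> {Sup P<..} <= emeasure \<nu> (- P)"
  using P_closed by (intro emeasure_mono) auto
 hence "measure \<nu> {Sup P<..} = 0" using P(3) by (simp add: measure_def)
 moreover have "measure \<nu> {..Sup P} = 1 - measure \<nu> {Sup P<..}"
  using nu.prob_compl[of "{Sup P<..}"] by (simp add: Compl_eq_Diff_UNIV[symmetric])
 ultimately show ?thesis by (simp add: cdf_def)
qed

lemma cdf_below: "t < Inf P ==> cdf \<nu> t = 0"
proof -
 assume "t < Inf P"
 hence "{..t} \<subseteq> - P"
  using cInf_lower[OF _ P_bdd(1)] by force
 hence "emeasure \<nu> {..t} <= emeasure \<nu> (- P)"
  using P_closed by (intro emeasure_mono) auto
 thus ?thesis using P(3) by (simp add: measure_def cdf_def)
qed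

text \<open>The second claim is the Galois property of the quantile; monotonicity, the push-forward
  and the joint measurability of the Knothe steps rest on it. The infimum is attained because
  distribution functions are right continuous and \<open>P\<close> is closed.\<close>

lemma quant_props:
 shows quant_in: "quant \<mu> \<nu> P u \<in> P"
  and quant_le_iff: "quant \<mu> \<nu> P u <= t \<longleftrightarrow> (\<exists>p\<in>P. p <= t) \<and> emeasure \<mu> {..u} <= emeasure \<nu> {..t}"
proof -
 define A where "A = {t \<in> P. cdf \<mu> u <= cdf \<nu> t}"
 have q: "quant \<mu> \<nu> P u = Inf A" by (simp add: quant_def A_def le_iff_cdf)
 have SP: "Sup P \<in> P" using P by (simp add: P_bdd P_closed closed_contains_Sup)
 have ne: "A ~= {}"
  using SP cdf_max mu.cdf_bounded_prob[of u] unfolding A_def by auto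
 have bdd: "bdd_below A" using P_bdd(1) unfolding A_def by (auto intro: bdd_below_mono)
 have InfP: "Inf A \<in> P"
 proof -
  have "Inf A \<in> closure A" using ne bdd by (rule closure_contains_Inf)
  also have "closure A \<subseteq> P" using P_closed by (intro closure_minimal) (auto simp: A_def)
  finally show ?thesis .
 qed
 have up: "cdf \<mu> u <= cdf \<nu> t" if t: "Inf A < t" for t
 proof -
  obtain a where "a \<in> A" "a < t" using t cInf_less_iff[OF ne bdd, of t] by auto
  thus ?thesis using nu.cdf_nondecreasing[of a t] by (auto simp: A_def)
 qed
 have InfA: "Inf A \<in> A"
 proof -
  have "(cdf \<nu> \<longlongrightarrow> cdf \<nu> (Inf A)) (at_right (Inf A))"
   using nu.cdf_is_right_cont by (simp add: continuous_within)
  moreover have "\<forall>\<^sub>F t in at_right (Inf A). cdf \<mu> u <= cdf \<nu> t"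
   using up by (auto simp: eventually_at_right_field intro!: exI[of _ "Inf A + 1"])
  ultimately have "cdf \<mu> u <= cdf \<nu> (Inf A)"
   by (rule tendsto_lowerbound) auto
  thus ?thesis using InfP by (simp add: A_def)
 qed
 show "quant \<mu> \<nu> P u \<in> P" using InfP q by simp
 show "quant \<mu> \<nu> P u <= t \<longleftrightarrow> (\<exists>p\<in>P. p <= t) \<and> emeasure \<mu> {..u} <= emeasure \<nu> {..t}"
  unfolding q le_iff_cdf
 proof
  assume "Inf A <= t"
  thus "(\<exists>p\<in>P. p <= t) \<and> cdf \<mu> u <= cdf \<nu> t"
   using InfA nu.cdf_nondecreasing[of "Inf A" t] by (auto simp: A_def)
 next
  assume a: "(\<exists>p\<in>P. p <= t) \<and> cdf \<mu> u <= cdf \<nu> t"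
  \<comment> \<open>The last point of \<open>P\<close> not beyond \<open>t\<close>. No mass of
    \<open>\<nu>\<close> lies between the two, so \<open>t'\<close> satisfies the same inequality
    and competes in the infimum.\<close>
  define t' where "t' = Sup (P \<inter> {..t})"
  have "P \<inter> {..t} ~= {}" "closed (P \<inter> {..t})" "bdd_above (P \<inter> {..t})"
   using a P_closed P_bdd(2) by (auto intro: bdd_above_mono)
  note ne' = this
  have t': "t' \<in> P \<inter> {..t}"
   unfolding t'_def by (rule closed_contains_Sup[OF ne'(1) ne'(3) ne'(2)])
  have "{t'<..t} \<subseteq> - P"
  proof safe
   fix s assume "s \<in> {t'<..t}" "s \<in> P"
   hence "s <= t'" unfolding t'_def using \<open>bdd_above (P \<inter> {..t})\<close> by (intro cSup_upper) auto
   thus False using \<open>s \<in> {t'<..t}\<close> by simp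
  qed
  hence "emeasure \<nu> {t'<..t} <= emeasure \<nu> (- P)"
   using P_closed by (intro emeasure_mono) auto
  hence "measure \<nu> {t'<..t} = 0" using P(3) by (simp add: measure_def)
  moreover have "measure \<nu> {t'<..t} = cdf \<nu> t - cdf \<nu> t'" if "t' < t"
   using nu.cdf_diff_eq[OF that] by simp
  ultimately have "cdf \<nu> t = cdf \<nu> t'" using t' by (cases "t' = t") auto
  hence "t' \<in> A" using t' a by (auto simp: A_def)
  hence "Inf A <= t'" using bdd by (intro cInf_lower)
  thus "Inf A <= t" using t' by auto
 qed
qed

lemma quant_mono: "u <= u' ==> quant \<mu> \<nu> P u <= quant \<mu> \<nu> P u'"
proof -
 assume "u <= u'"
 hence "emeasure \<mu> {..u} <= emeasure \<mu> {..u'}" by (intro emeasure_mono) auto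
 thus ?thesis
  using quant_le_iff[of u' "quant \<mu> \<nu> P u'"] quant_le_iff[of u "quant \<mu> \<nu> P u'"] by auto
qed

lemma measurable_quant [measurable]: "meas (quant \<mu> \<nu> P)"
 using quant_mono by (intro borel_measurable_mono) (simp add: mono_def)

text \<open>By continuity and monotonicity a sublevel set is empty, the whole line, or a closed
  half-line at whose end the value is exactly \<open>v\<close>. The limits at both infinities settle
  the first two cases.\<close>

lemma cdf_uniform:
 assumes "0 <= v" "v <= 1" shows "measure \<mu> {u. cdf \<mu> u <= v} = v"
proof -
 define S where "S = {u. cdf \<mu> u <= v}"
 have cont: "isCont (cdf \<mu>) u" for u
  using no_atoms[of u] by (simp add: mu.isCont_cdf measure_def)
 have down: "u \<in> S ==> u' <= u ==> u' \<in> S" for u u'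
  using mu.cdf_nondecreasing[of u' u] by (auto simp: S_def)
 consider "S = {}" | "\<not> bdd_above S" | "S ~= {}" "bdd_above S" by blast
 thus ?thesis
 proof cases
  case 1
  have "v = 0"
  proof (rule ccontr)
   assume "v ~= 0"
   hence "\<forall>\<^sub>F u in at_bot. cdf \<mu> u < v"
    using assms mu.cdf_lim_at_bot by (auto simp: order_tendsto_iff)
   then obtain u where "cdf \<mu> u < v" by (auto simp: eventually_at_bot_linorder)
   hence "u \<in> S" by (simp add: S_def)
   thus False using 1 by simp
  qed
  thus ?thesis using 1 by (simp add: S_def)
 next
  case 2
  hence "S = UNIV" using down by (metis UNIV_eq_I bdd_above.I linear)
  have "1 <= v"
  proof (rule ccontr)
   assume "\<not> 1 <= v"
   hence "\<forall>\<^sub>F u in at_top. v < cdf \<mu> u"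
    using mu.cdf_lim_at_top_prob by (auto simp: order_tendsto_iff)
   then obtain u where "v < cdf \<mu> u" by (auto simp: eventually_at_top_linorder)
   moreover have "u \<in> S" using \<open>S = UNIV\<close> by simp
   ultimately show False by (simp add: S_def)
  qed
  thus ?thesis using \<open>S = UNIV\<close> assms mu.prob_space by (simp add: S_def)
 next
  case 3
  define w where "w = Sup S"
  have cl: "closed S"
   unfolding S_def using cont by (intro closed_Collect_le continuous_at_imp_continuous_on) auto
  have wS: "w \<in> S" unfolding w_def using 3 cl by (simp add: closed_contains_Sup)
  have "S = {..w}" using down wS 3 by (auto simp: w_def intro: cSup_upper)
  moreover have "cdf \<mu> w = v"
  proof (rule ccontr)
   assume "cdf \<mu> w ~= v"
   hence "cdf \<mu> w < v" using wS by (simp add: S_def)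
   hence "\<forall>\<^sub>F u in at_right w. cdf \<mu> u < v"
    using cont[of w] by (auto simp: continuous_at_imp_continuous_within order_tendsto_iff isCont_def filterlim_at_split)
   then obtain b where "w < b" "!!u. w < u ==> u < b ==> cdf \<mu> u < v" by (auto simp: eventually_at_right_field)
   hence "(w + b) / 2 \<in> S" by (auto simp: S_def less_imp_le)
   hence "(w + b) / 2 <= w" unfolding w_def using 3 by (intro cSup_upper)
   thus False using \<open>w < b\<close> by simp
  qed
  ultimately show ?thesis by (simp add: S_def cdf_def)
 qed
qed

text \<open>By the Galois property the new distribution function at \<open>t\<close> is the
  \<open>\<mu>\<close>-measure of a sublevel set of \<open>cdf \<mu>\<close>, hence
  \<open>cdf \<nu> t\<close>. To the left of \<open>P\<close> both sides vanish.\<close>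

lemma distr_quant: "distr \<mu> borel (quant \<mu> \<nu> P) = \<nu>"
proof (rule cdf_unique)
 show "real_distribution (distr \<mu> borel (quant \<mu> \<nu> P))"
  by (rule mu.real_distribution_distr) simp
 show "cdf (distr \<mu> borel (quant \<mu> \<nu> P)) = cdf \<nu>"
 proof
  fix t
  have "cdf (distr \<mu> borel (quant \<mu> \<nu> P)) t = measure \<mu> {u. quant \<mu> \<nu> P u <= t}"
   by (simp add: cdf_def measure_distr vimage_def)
  also have "... = cdf \<nu> t"
  proof (cases "\<exists>p\<in>P. p <= t")
   case True
   thus ?thesis
    by (simp add: quant_le_iff le_iff_cdf cdf_uniform nu.cdf_nonneg nu.cdf_bounded_prob)
  next
   case False
   have "t < Inf P"
    using False closed_contains_Inf[OF P(2) P_bdd(1) P_closed] by force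
   thus ?thesis using False by (simp add: quant_le_iff cdf_below)
  qed
  finally show "cdf (distr \<mu> borel (quant \<mu> \<nu> P)) t = cdf \<nu> t" .
 qed
qed (rule nu)

lemma nn_integral_quant:
 "h \<in> borel_measurable borel ==> (\<integral>\<^sup>+u. h (quant \<mu> \<nu> P u) \<partial>\<mu>) = (\<integral>\<^sup>+t. h t \<partial>\<nu>)"
 by (subst distr_quant[symmetric]) (simp add: nn_integral_distr)

end

text \<open>Cancellation fails in \<open>ennreal\<close> when \<open>a\<close> is 0 or
  \<open>\<top>\<close>; in both cases the left side is 0.\<close>

lemma ennreal_mult_div_le: "a * (b / a) <= (b::ennreal)"
proof (cases "a = 0 \<or> a = \<top>")
 case True
 thus ?thesis by (auto simp: ennreal_divide_top)
next
 case False
 thus ?thesis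
  using ennreal_mult_divide_eq[of a b] ennreal_mult_divide_eq[of b a] by (simp add: ennreal_times_divide mult.commute)
qed

lemma prob_density:
 fixes \<rho> :: "real => ennreal"
 assumes [measurable]: "meas \<rho>" and "(NN u. \<rho> u) = m" "0 < m" "m < \<infinity>"
 shows "real_distribution (density lborel (\<lambda>u. \<rho> u / m))"
proof -
 have "emeasure (density lborel (\<lambda>u. \<rho> u / m)) UNIV = 1"
  using assms(2-) by (simp add: emeasure_density nn_integral_divide ennreal_divide_self)
 hence "prob_space (density lborel (\<lambda>u. \<rho> u / m))"
  using prob_spaceI[of "density lborel (\<lambda>u. \<rho> u / m)"] by simp
 thus ?thesis
  by (simp add: real_distribution_def real_distribution_axioms_def)
qed

locale density_transport1 =
 fixes \<rho> kp :: "real => ennreal" and P :: "real set" and m k :: ennreal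
 assumes meas [measurable]: "meas \<rho>" "meas kp"
  and m: "(NN u. \<rho> u) = m" "0 < m" "m < \<infinity>"
  and k: "(NN u. kp u) = k" "0 < k" "k < \<infinity>"
  and P: "compact P" "P ~= {}" "!!t. t \<notin> P ==> kp t = 0"

begin

abbreviation "\<mu> \<equiv> density lborel (\<lambda>u. \<rho> u / m)"

abbreviation "\<nu> \<equiv> density lborel (\<lambda>u. kp u / k)"

sublocale transport1 \<mu> \<nu> P
proof (rule transport1.intro)
 show "real_distribution \<mu>" "real_distribution \<nu>"
  using prob_density[OF meas(1) m] prob_density[OF meas(2) k] by auto
 have "(NN t. kp t / k * ind (- P) t) = (\<integral>\<^sup>+t. 0 \<partial>(lborel::real measure))"
  using P(3) by (intro nn_integral_cong) (auto simp: indicator_def)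
 thus "emeasure \<nu> (- P) = 0"
  using compact_imp_closed[OF P(1)] by (subst emeasure_density) auto
 show "emeasure \<mu> {u} = 0" for u
  by (subst emeasure_density) (auto simp: nn_integral_0_iff_AE intro!: AE_I'[of "{u}"] split: split_indicator)
qed (use P in auto)

lemma push: 
 assumes [measurable]: "meas h"
 shows "(NN u. \<rho> u / m * h (quant \<mu> \<nu> P u)) = (NN t. kp t / k * h t)"
 using nn_integral_quant[OF assms] by (simp add: nn_integral_density)

text \<open>The target gives no mass to the zero set of its density \<open>kp\<close>, so almost no
  source mass lands there.\<close>

lemma AE_quant_nonzero: "AE u in lborel. \<rho> u = 0 \<or> kp (quant \<mu> \<nu> P u) ~= 0"
proof -
 have "(NN u. \<rho> u / m * ind {t. kp t = 0} (quant \<mu> \<nu> P u)) = (NN t. kp t / k * ind {t. kp t = 0} t)"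
  by (rule push) simp
 also have "... = (\<integral>\<^sup>+t. 0 \<partial>(lborel::real measure))"
  by (intro nn_integral_cong) (auto simp: indicator_def)
 finally have "(NN u. \<rho> u / m * ind {t. kp t = 0} (quant \<mu> \<nu> P u)) = 0" by simp
 hence "AE u in lborel. \<rho> u / m * ind {t. kp t = 0} (quant \<mu> \<nu> P u) = 0"
  by (subst (asm) nn_integral_0_iff_AE) auto
 thus ?thesis
  using m by (auto elim!: eventually_mono simp: ennreal_divide_eq_0_iff indicator_def split: if_splits)
qed

text \<open>The factor in front of the indicator is the formal derivative of the quantile map. Its
  integral can only underestimate the increment: jumps and the singular part of a monotone map add
  to the right side.\<close>

lemma increment:
 assumes "s <= s'"
 shows "(NN u. \<rho> u / m * (k / kp (quant \<mu> \<nu> P u)) * ind {s..s'} u)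
   <= ennreal (quant \<mu> \<nu> P s' - quant \<mu> \<nu> P s)"
proof -
 let ?Q = "quant \<mu> \<nu> P"
 have "(NN u. \<rho> u / m * (k / kp (?Q u)) * ind {s..s'} u)
  <= (NN u. \<rho> u / m * (k / kp (?Q u) * ind {?Q s..?Q s'} (?Q u)))"
  by (intro nn_integral_mono) (auto simp: indicator_def quant_mono mult.assoc)
 also have "... = (NN t. kp t / k * (k / kp t * ind {?Q s..?Q s'} t))"
  by (rule push) simp
 also have "... <= (NN t. ind {?Q s..?Q s'} t)"
 proof (intro nn_integral_mono)
  fix t
  have "kp t / k * (k / kp t) <= 1"
  proof -
   have "kp t / k * (k / kp t) = (kp t * (k / kp t)) / k"
    by (simp add: ennreal_times_divide mult.commute)
   also have "... <= k / k"
    by (intro divide_right_mono_ennreal ennreal_mult_div_le)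
   also have "... = 1" using k by (simp add: ennreal_divide_self)
   finally show ?thesis .
  qed
  thus "kp t / k * (k / kp t * ind {?Q s..?Q s'} t) <= ind {?Q s..?Q s'} t"
   by (auto simp: indicator_def)
 qed
 also have "... = ennreal (?Q s' - ?Q s)"
  using quant_mono[OF assms] by simp
 finally show ?thesis .
qed

end

section \<open>The Knothe map\<close>

lemma iint_agree:
 assumes "!!j. j \<notin> set is ==> z $ j = x $ j"
 shows "iint is f z = iint is f x"
 using assms
proof (induction "is" arbitrary: x z)
 case Nil
 hence "z = x" by (simp add: vec_eq_iff)
 thus ?case by simp
next
 case (Cons i "is")
 have "iint is f (upd z i s) = iint is f (upd x i s)" for s
  by (rule Cons.IH) (auto intro: Cons.prems)
 thus ?case by simp
qed

lemma iint_zero [simp]: "iint is (\<lambda>_. 0) x = 0"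
 by (induction "is" arbitrary: x) auto

text \<open>\<open>K\<close> lies in a cube of side \<open>2 * b\<close>, and each integration
  contributes one such factor.\<close>

lemma iint_indicator_finite:
 fixes K :: "(real^'n::finite) set"
 assumes "bounded K" "distinct is"
 shows "iint is (ind K) x < \<infinity>"
proof -
 obtain b where b: "!!y. y \<in> K ==> norm y <= b" and "0 <= b"
  using assms(1) by (meson bounded_pos less_imp_le)
 define C where "C = {y::real^'n. \<forall>i. \<bar>y $ i\<bar> <= b}"
 have "iint is (ind C) x <= ennreal (2 * b) ^ length is"
  using assms(2)
 proof (induction "is" arbitrary: x)
  case Nil thus ?case by (simp add: indicator_def)
 next
  case (Cons i "is")
  have "iint is (ind C) (upd x i s) <= ennreal (2 * b) ^ length is * ind {-b..b} s" for s
  proof (cases "s \<in> {-b..b}")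
   case False
   have "iint is (ind C) (upd x i s) = iint is (\<lambda>_. 0) (upd x i s)"
   proof (rule iint_cong)
    fix y assume "\<forall>j. j \<notin> set is --> y $ j = upd x i s $ j"
    hence "y $ i = s" using Cons.prems by auto
    hence "\<not> \<bar>y $ i\<bar> <= b" using False by auto
    hence "y \<notin> C" by (auto simp: C_def)
    thus "ind C y = (0::ennreal)" by simp
   qed
   thus ?thesis by simp
  qed (use Cons in auto)
  hence "iint (i # is) (ind C) x <= (NN s. ennreal (2 * b) ^ length is * ind {-b..b} s)"
   unfolding iint.simps by (intro nn_integral_mono)
  also have "... = ennreal (2 * b) ^ length (i # is)"
   using \<open>0 <= b\<close> by (subst nn_integral_cmult) (auto simp: mult.commute)
  finally show ?case .
 qed
 moreover have "iint is (ind K) x <= iint is (ind C) x"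
  using b order_trans[OF component_le_norm_cart]
  by (intro iint_mono) (auto simp: C_def indicator_def)
 moreover have "ennreal (2 * b) ^ length is < \<infinity>"
  using \<open>0 <= b\<close> by (simp add: ennreal_power)
 ultimately show ?thesis by (meson order_le_less_trans)
qed

text \<open>The cylinder over the projection of \<open>K\<close> that forgets the coordinates in
  \<open>is\<close>: the points whose remaining coordinates can still be completed to a point of
  \<open>K\<close>.\<close>

definition ext :: "'n::finite list => (real^'n) set => (real^'n) set" where
 "ext is K = {y. \<exists>z\<in>K. \<forall>i. i \<notin> set is --> z $ i = y $ i}"

lemma ext_Nil [simp]: "ext [] K = K"
proof -
 have "ext [] K = {y. \<exists>z\<in>K. z = y}" by (simp add: ext_def vec_eq_iff)
 thus ?thesis by simp
qed

lemma ext_full: "set is = UNIV ==> K ~= {} ==> ext is K = UNIV"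
 by (auto simp: ext_def)

text \<open>Zeroing the coordinates in \<open>is\<close> is continuous, and the cylinder is the
  preimage of the compact image of \<open>K\<close> under this map.\<close>

lemma closed_ext:
 fixes K :: "(real^'n::finite) set"
 assumes "compact K" shows "closed (ext is K)"
proof -
 define g :: "real^'n => real^'n" where "g y = (\<chi> i. if i \<in> set is then 0 else y $ i)" for y
 have cont: "continuous_on UNIV g"
  unfolding g_def
 proof (rule continuous_on_vec_lambda)
  show "continuous_on UNIV (\<lambda>y::real^'n. if i \<in> set is then 0 else y $ i)" for i
   by (cases "i \<in> set is") (auto intro!: continuous_intros)
 qed
 have "ext is K = g -` (g ` K)"
 proof -
  have "(\<forall>i. i \<notin> set is --> z $ i = y $ i) \<longleftrightarrow> g y = g z" for y z
   by (auto simp: g_def vec_eq_iff)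
  thus ?thesis by (auto simp: ext_def image_iff)
 qed
 moreover have "closed (g ` K)"
  using assms by (intro compact_imp_closed compact_continuous_image continuous_on_subset[OF cont]) auto
 ultimately show ?thesis using closed_vimage[OF _ cont] by simp
qed

lemma ext_Cons_iff: "i \<notin> set is ==> y \<in> ext (i # is) K \<longleftrightarrow> (\<exists>t. upd y i t \<in> ext is K)"
proof
 assume "y \<in> ext (i # is) K" "i \<notin> set is"
 then obtain z where "z \<in> K" "\<forall>j. j \<notin> set (i # is) --> z $ j = y $ j" by (auto simp: ext_def)
 hence "upd y i (z $ i) \<in> ext is K" by (auto simp: ext_def intro!: bexI[of _ z])
 thus "\<exists>t. upd y i t \<in> ext is K" ..
next
 assume "i \<notin> set is" "\<exists>t. upd y i t \<in> ext is K"
 then obtain t z where "z \<in> K" "\<forall>j. j \<notin> set is --> z $ j = upd y i t $ j" by (auto simp: ext_def)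
 thus "y \<in> ext (i # is) K" by (auto simp: ext_def intro!: bexI[of _ z])
qed

text \<open>Turns the existence of a target value up to \<open>t\<close> into membership in a
  cylinder, closed when \<open>K\<close> is compact; this is the form used for the measurability of
  \<open>kstep\<close>.\<close>

lemma ext_Cons_le_iff:
 assumes "i \<notin> set is"
 shows "(\<exists>p\<in>{t. upd y i t \<in> ext is K}. p <= t) \<longleftrightarrow> y \<in> ext (i # is) (K \<inter> {z. z $ i <= t})"
proof
 assume "\<exists>p\<in>{t. upd y i t \<in> ext is K}. p <= t"
 then obtain p z where p: "p <= t" "z \<in> K" "\<forall>j. j \<notin> set is --> z $ j = upd y i p $ j" by (auto simp: ext_def)
 hence "z $ i = p" using assms by auto
 thus "y \<in> ext (i # is) (K \<inter> {z. z $ i <= t})" using p by (auto simp: ext_def intro!: bexI[of _ z] split: if_splits)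
next
 assume "y \<in> ext (i # is) (K \<inter> {z. z $ i <= t})"
 then obtain z where z: "z \<in> K" "z $ i <= t" "\<forall>j. j \<notin> set (i # is) --> z $ j = y $ j" by (auto simp: ext_def)
 hence "upd y i (z $ i) \<in> ext is K" by (auto simp: ext_def intro!: bexI[of _ z])
 thus "\<exists>p\<in>{t. upd y i t \<in> ext is K}. p <= t" using z by auto
qed

lemma compact_ext_section:
 fixes K :: "(real^'n::finite) set"
 assumes "compact K" "i \<notin> set is"
 shows "compact {t. upd y i t \<in> ext is K}"
proof -
 have cont: "continuous_on UNIV (\<lambda>t. upd y i t)"
  unfolding upd_def
 proof (rule continuous_on_vec_lambda)
  show "continuous_on UNIV (\<lambda>t. if j = i then t else y $ j)" for j
   by (cases "j = i") (auto intro!: continuous_intros)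
 qed
 have "closed ((\<lambda>t. upd y i t) -` ext is K)"
  using closed_ext[OF assms(1)] cont by (rule closed_vimage)
 moreover obtain b where b: "!!z. z \<in> K ==> norm z <= b"
  using compact_imp_bounded[OF assms(1)] by (auto simp: bounded_iff)
 have "{t. upd y i t \<in> ext is K} \<subseteq> {-b..b}"
 proof safe
  fix t assume "upd y i t \<in> ext is K"
  then obtain z where z: "z \<in> K" "\<forall>j. j \<notin> set is --> z $ j = upd y i t $ j" by (auto simp: ext_def)
  hence "z $ i = t" using assms(2) by auto
  thus "t \<in> {-b..b}" using component_le_norm_cart[of z i] b[OF z(1)] by auto
 qed
 ultimately show ?thesis
  using compact_Int_closed[of "{-b..b}" "{t. upd y i t \<in> ext is K}"] by (simp add: vimage_def Int_absorb1)
qed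

text \<open>The coordinate \<open>i\<close> of the Knothe map; the coordinates before \<open>i\<close> have already been
 assigned the values recorded in \<open>y\<close>, and the coordinates in \<open>rest\<close> come after it.\<close>

definition knondeg :: "'n::finite => 'n list => (real^'n => ennreal) => (real^'n) set => real^'n => real^'n => bool" where
 "knondeg i rest f K x y \<longleftrightarrow> 0 < iint (i # rest) f x \<and> iint (i # rest) f x < \<infinity> \<and> 0 < iint (i # rest) (ind K) y"

text \<open>\<open>x\<close> is the source point, and \<open>y\<close> carries the target
  coordinates already chosen. The default \<open>Inf\<close> in the degenerate case still picks a
  point of the section, so that the map never leaves \<open>K\<close>; the default 0 occurs only
  where no completion in \<open>K\<close> exists.\<close>

definition kstep :: "'n::finite => 'n list => (real^'n => ennreal) => (real^'n) set => real^'n => real^'n => real" where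
 "kstep i rest f K x y =
  (if y \<notin> ext (i # rest) K then 0
   else if knondeg i rest f K x y then
    quant (density lborel (\<lambda>u. iint rest f (upd x i u) / iint (i # rest) f x))
     (density lborel (\<lambda>t. iint rest (ind K) (upd y i t) / iint (i # rest) (ind K) y))
     {t. upd y i t \<in> ext rest K} (x $ i)
   else Inf {t. upd y i t \<in> ext rest K})"

text \<open>The formal derivative of \<open>kstep\<close> in coordinate \<open>i\<close>: the
  normalized source marginal divided by the normalized target marginal at the image.\<close>

definition kslope :: "'n::finite => 'n list => (real^'n => ennreal) => (real^'n) set => real^'n => real^'n => ennreal" where
 "kslope i rest f K x y =
  (if knondeg i rest f K x y then
    iint rest f x / iint (i # rest) f x *
    (iint (i # rest) (ind K) y / iint rest (ind K) (upd y i (kstep i rest f K x y)))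
   else 0)"

lemma knondeg_agree:
 assumes "!!j. j \<notin> set (i # rest) ==> z $ j = x $ j"
 shows "knondeg i rest f K z y = knondeg i rest f K x y"
proof -
 have "iint (i # rest) f z = iint (i # rest) f x"
  by (rule iint_agree) (use assms in auto)
 thus ?thesis by (simp add: knondeg_def del: iint.simps)
qed

text \<open>Triangularity: step \<open>i\<close> integrates over the later coordinates of the source
  and so sees only \<open>x $ i\<close> and the earlier ones.\<close>

lemma kstep_agree:
 assumes "i \<notin> set rest" "!!j. j \<notin> set rest ==> z $ j = x $ j"
 shows "kstep i rest f K z y = kstep i rest f K x y"
proof -
 have 1: "knondeg i rest f K z y = knondeg i rest f K x y"
  using assms by (intro knondeg_agree) auto
 have 2: "iint (i # rest) f z = iint (i # rest) f x"
  using assms by (intro iint_agree) auto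
 have 3: "iint rest f (upd z i u) = iint rest f (upd x i u)" for u
  using assms by (intro iint_agree) auto
 have 4: "z $ i = x $ i" using assms by auto
 show ?thesis unfolding kstep_def 1 2 3 4 ..
qed

context
 fixes K :: "(real^'n::finite) set" and f :: "real^'n => ennreal" and i :: 'n and "rest" :: "'n list"
 assumes K: "compact K" and f [measurable]: "meas f" and dist: "distinct (i # rest)"

begin

lemma K_borel: "K \<in> sets borel"
 by (rule borel_compact[OF K])

lemma k_finite: "distinct is ==> iint is (ind K) y < \<infinity>"
 by (rule iint_indicator_finite[OF compact_imp_bounded[OF K]])

lemma outside_zero: "z \<notin> ext rest K ==> iint rest (ind K) z = 0"
proof -
 assume "z \<notin> ext rest K"
 hence "iint rest (ind K) z = iint rest (\<lambda>_. 0) z"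
  by (intro iint_cong) (auto simp: ext_def indicator_def)
 thus ?thesis by simp
qed

lemma dens:
 assumes "knondeg i rest f K x y" "y \<in> ext (i # rest) K"
 shows "density_transport1 (\<lambda>u. iint rest f (upd x i u)) (\<lambda>t. iint rest (ind K) (upd y i t))
   {t. upd y i t \<in> ext rest K} (iint (i # rest) f x) (iint (i # rest) (ind K) y)"
proof (rule density_transport1.intro)
 note [measurable] = K_borel
 show "meas (\<lambda>u. iint rest f (upd x i u))"
  "meas (\<lambda>t. iint rest (ind K) (upd y i t))"
  by measurable
 show "compact {t. upd y i t \<in> ext rest K}"
  using dist by (intro compact_ext_section K) auto
 show "{t. upd y i t \<in> ext rest K} ~= {}"
  using assms(2) dist by (auto simp: ext_Cons_iff)
qed (use assms(1) dist k_finite[of "i # rest" y] in \<open>auto simp: knondeg_def outside_zero\<close>)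

lemma kstep_in:
 assumes y: "y \<in> ext (i # rest) K"
 shows "upd y i (kstep i rest f K x y) \<in> ext rest K"
proof (cases "knondeg i rest f K x y")
 case True
 interpret density_transport1 "\<lambda>u. iint rest f (upd x i u)" "\<lambda>t. iint rest (ind K) (upd y i t)"
  "{t. upd y i t \<in> ext rest K}" "iint (i # rest) f x" "iint (i # rest) (ind K) y"
  by (rule dens[OF True y])
 show ?thesis using True y quant_in by (simp add: kstep_def)
next
 case False
 have "compact {t. upd y i t \<in> ext rest K}" "{t. upd y i t \<in> ext rest K} ~= {}"
  using y dist by (auto simp: ext_Cons_iff intro!: compact_ext_section K)
 hence "Inf {t. upd y i t \<in> ext rest K} \<in> {t. upd y i t \<in> ext rest K}"
  by (intro closed_contains_Inf) (auto simp: compact_imp_closed compact_imp_bounded bounded_imp_bdd_below)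
 thus ?thesis using False y by (simp add: kstep_def)
qed

lemma kstep_mono:
 assumes y: "y \<in> ext (i # rest) K" and "s <= s'"
 shows "kstep i rest f K (upd x i s) y <= kstep i rest f K (upd x i s') y"
proof -
 have nd: "knondeg i rest f K (upd x i s) y = knondeg i rest f K x y" for s
  by (rule knondeg_agree) auto
 have mm: "iint (i # rest) f (upd x i s) = iint (i # rest) f x" for s
  by (rule iint_agree) auto
 show ?thesis
 proof (cases "knondeg i rest f K x y")
  case True
  interpret density_transport1 "\<lambda>u. iint rest f (upd x i u)" "\<lambda>t. iint rest (ind K) (upd y i t)"
   "{t. upd y i t \<in> ext rest K}" "iint (i # rest) f x" "iint (i # rest) (ind K) y"
   by (rule dens[OF True y])
  show ?thesis using quant_mono[OF assms(2)] y True by (simp add: kstep_def nd mm del: iint.simps)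
 next
  case False
  thus ?thesis by (simp add: kstep_def nd)
 qed
qed

lemma kstep_increment:
 assumes y: "y \<in> ext (i # rest) K" and "s <= s'"
 shows "(NN u. kslope i rest f K (upd x i u) y * ind {s..s'} u)
   <= ennreal (kstep i rest f K (upd x i s') y - kstep i rest f K (upd x i s) y)"
proof -
 have nd: "knondeg i rest f K (upd x i s) y = knondeg i rest f K x y" for s
  by (rule knondeg_agree) auto
 have mm: "iint (i # rest) f (upd x i s) = iint (i # rest) f x" for s
  by (rule iint_agree) auto
 show ?thesis
 proof (cases "knondeg i rest f K x y")
  case True
  interpret density_transport1 "\<lambda>u. iint rest f (upd x i u)" "\<lambda>t. iint rest (ind K) (upd y i t)"
   "{t. upd y i t \<in> ext rest K}" "iint (i # rest) f x" "iint (i # rest) (ind K) y"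
   by (rule dens[OF True y])
  show ?thesis using increment[OF assms(2)] y True by (simp add: kslope_def kstep_def nd mm del: iint.simps)
 next
  case False
  thus ?thesis by (simp add: kstep_def kslope_def nd)
 qed
qed

lemma kstep_null:
 assumes y: "y \<in> ext (i # rest) K" and nd0: "knondeg i rest f K x y"
 shows "AE u in lborel. iint rest f (upd x i u) = 0 \<or>
   iint rest (ind K) (upd y i (kstep i rest f K (upd x i u) y)) ~= 0"
proof -
 have nd: "knondeg i rest f K (upd x i s) y" for s
  using nd0 by (subst knondeg_agree[where x=x]) auto
 have mm: "iint (i # rest) f (upd x i s) = iint (i # rest) f x" for s
  by (rule iint_agree) auto
 interpret density_transport1 "\<lambda>u. iint rest f (upd x i u)" "\<lambda>t. iint rest (ind K) (upd y i t)"
  "{t. upd y i t \<in> ext rest K}" "iint (i # rest) f x" "iint (i # rest) (ind K) y"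
  by (rule dens[OF nd0 y])
 have "kstep i rest f K (upd x i u) y = quant \<mu> \<nu> {t. upd y i t \<in> ext rest K} u" for u
  using y nd by (simp add: kstep_def mm del: iint.simps)
 thus ?thesis using AE_quant_nonzero by simp
qed

lemma measurable_knondeg [measurable]:
 "Measurable.pred (borel \<Otimes>\<^sub>M borel) (\<lambda>p. knondeg i rest f K (fst p) (snd p))"
proof -
 note [measurable] = K_borel
 show ?thesis unfolding knondeg_def by measurable
qed

text \<open>By the Galois property sublevel sets reduce to membership in two closed sets and a
  comparison of two parameter integrals. Measurability must be joint because the second argument is
  itself produced by earlier steps.\<close>

lemma measurable_kstep:
 "(\<lambda>p. kstep i rest f K (fst p) (snd p)) \<in> borel_measurable (borel \<Otimes>\<^sub>M borel)"
proof (rule borel_measurableI_le)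
 fix t :: real
 note [measurable] = K_borel
 have ir: "i \<notin> set rest" using dist by simp
 define A where "A = ext (i # rest) K"
 define B where "B = ext (i # rest) (K \<inter> {z. z $ i <= t})"
 have "closed {z::real^'n. z $ i <= t}"
  by (simp add: closed_halfspace_component_le_cart)
 hence [measurable]: "A \<in> sets borel" "B \<in> sets borel"
  unfolding A_def B_def using K by (auto intro!: borel_closed closed_ext compact_Int_closed)
 define L where "L p = (NN u. iint rest f (upd (fst p) i u) / iint (i # rest) f (fst p) * (if u <= fst p $ i then 1 else 0))" 
  for p :: "(real^'n) \<times> (real^'n)"
 define R where "R p = (NN u. iint rest (ind K) (upd (snd p) i u) / iint (i # rest) (ind K) (snd p) * (if u <= t then 1 else 0))" 
  for p :: "(real^'n) \<times> (real^'n)"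
 have [measurable]: "L \<in> borel_measurable (borel \<Otimes>\<^sub>M borel)" "R \<in> borel_measurable (borel \<Otimes>\<^sub>M borel)"
  unfolding L_def R_def by measurable
 have iff: "kstep i rest f K (fst p) (snd p) <= t \<longleftrightarrow>
   (if snd p \<notin> A then 0 <= t
   else if knondeg i rest f K (fst p) (snd p) then snd p \<in> B \<and> L p <= R p else snd p \<in> B)" for p
 proof -
  define x y where "x = fst p" and "y = snd p"
  consider "y \<notin> A" | "y \<in> A" "knondeg i rest f K x y" | "y \<in> A" "\<not> knondeg i rest f K x y" by blast
  thus ?thesis
   unfolding x_def[symmetric] y_def[symmetric]
  proof cases
   case 2
   interpret density_transport1 "\<lambda>u. iint rest f (upd x i u)" "\<lambda>t. iint rest (ind K) (upd y i t)"
    "{t. upd y i t \<in> ext rest K}" "iint (i # rest) f x" "iint (i # rest) (ind K) y"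
    using 2 by (intro dens) (auto simp: A_def)
   have "emeasure \<mu> {..x $ i} = L p" "emeasure \<nu> {..t} = R p"
    by (auto simp: emeasure_density L_def R_def x_def y_def indicator_def simp del: iint.simps intro!: nn_integral_cong)
   thus "(kstep i rest f K x y <= t) = (if y \<notin> A then 0 <= t else if knondeg i rest f K x y then y \<in> B \<and> L p <= R p else y \<in> B)"
    using 2 quant_le_iff[of "x $ i" t] ext_Cons_le_iff[OF ir, of y K t]
    by (simp add: kstep_def A_def B_def)
  next
   case 3
   have c: "compact {t. upd y i t \<in> ext rest K}" "{t. upd y i t \<in> ext rest K} ~= {}"
    using 3 dist by (auto simp: ext_Cons_iff A_def intro!: compact_ext_section K)
   hence bd: "bdd_below {t. upd y i t \<in> ext rest K}"
    by (simp add: compact_imp_bounded bounded_imp_bdd_below)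
   have "Inf {t. upd y i t \<in> ext rest K} \<in> {t. upd y i t \<in> ext rest K}"
    using c bd by (intro closed_contains_Inf) (auto simp: compact_imp_closed)
   hence "Inf {t. upd y i t \<in> ext rest K} <= t \<longleftrightarrow> (\<exists>p\<in>{t. upd y i t \<in> ext rest K}. p <= t)"
    using cInf_lower[OF _ bd] by (meson order_trans)
   thus "(kstep i rest f K x y <= t) = (if y \<notin> A then 0 <= t else if knondeg i rest f K x y then y \<in> B \<and> L p <= R p else y \<in> B)"
    using 3 ext_Cons_le_iff[OF ir, of y K t] by (simp add: kstep_def A_def B_def)
  qed (simp add: kstep_def A_def)
 qed
 show "{p \<in> space (borel \<Otimes>\<^sub>M borel). kstep i rest f K (fst p) (snd p) <= t} \<in> sets (borel \<Otimes>\<^sub>M borel)"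
  unfolding iff by measurable
qed

lemma measurable_kslope:
 "(\<lambda>p. kslope i rest f K (fst p) (snd p)) \<in> borel_measurable (borel \<Otimes>\<^sub>M borel)"
proof -
 note [measurable] = measurable_kstep K_borel
 show ?thesis unfolding kslope_def by measurable
qed

end

lemma iint_mono_agree:
 assumes "!!y. (\<forall>i. i \<notin> set is --> y $ i = x $ i) ==> f y <= g y"
 shows "iint is f x <= iint is g x"
 using assms
proof (induction "is" arbitrary: x)
 case Nil thus ?case by simp
next
 case (Cons j "is")
 have "iint is f (upd x j s) <= iint is g (upd x j s)" for s
  by (rule Cons.IH) (auto intro!: Cons.prems)
 thus ?case by (auto intro!: nn_integral_mono)
qed

text \<open>All steps read the same source point \<open>x\<close>, while \<open>y\<close> is
  overwritten coordinate by coordinate in the order of the list.\<close>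

primrec knothe :: "'n::finite list => (real^'n => ennreal) => (real^'n) set => real^'n => real^'n => real^'n" where
 "knothe [] f K x y = y"
| "knothe (i # is) f K x y = knothe is f K x (upd y i (kstep i is f K x y))"

text \<open>The diagonal of the triangular Jacobian.\<close>

primrec knothe_slope :: "'n::finite list => (real^'n => ennreal) => (real^'n) set => real^'n => real^'n => 'n => ennreal" where
 "knothe_slope [] f K x y = (\<lambda>j. 0)"
| "knothe_slope (i # is) f K x y =
  (\<lambda>j. if j = i then kslope i is f K x y else knothe_slope is f K x (upd y i (kstep i is f K x y)) j)"

lemma knothe_nth: "j \<notin> set is ==> knothe is f K x y $ j = y $ j"
proof (induction "is" arbitrary: y)
 case (Cons i "is")
 from Cons.prems have "j \<notin> set is" "j ~= i" by simp_all
 thus ?case using Cons.IH[of "upd y i (kstep i is f K x y)"] by simp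
qed simp

text \<open>One step of the telescoping product: the inner source marginal \<open>a\<close> and the
  inner target marginal \<open>r\<close> cancel between one slope and the product of the later
  slopes.\<close>

lemma ennreal_cancel4:
 fixes a m k r f :: ennreal
 assumes "0 < a" "a < \<infinity>" "0 < r" "r < \<infinity>"
 shows "(a / m) * (k / r) * (f * r / a) = f * k / m"
proof -
 have "a / a = 1" "r / r = 1" using assms by simp_all
 hence "a * inverse a = 1" "r * inverse r = 1" unfolding divide_ennreal_def .
 hence "(a * inverse a) * (r * inverse r) * (f * k * inverse m) = f * k * inverse m" by simp
 thus ?thesis unfolding divide_ennreal_def by (simp only: mult_ac)
qed

text \<open>The points where the Jacobian equation of the transport fails. As a set it can be
  weighted with \<open>f\<close> inside an iterated integral, a form that survives the
  induction.\<close>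

definition knothe_bad :: "'n::finite list => (real^'n => ennreal) => (real^'n) set => real^'n => (real^'n) set" where
 "knothe_bad is f K y = {z. (\<Prod>j\<in>set is. knothe_slope is f K z y j) ~= f z * iint is (ind K) y / iint is f z}"

context
 fixes K :: "(real^'n::finite) set" and f :: "real^'n => ennreal"
 assumes K: "compact K" and f [measurable]: "meas f"

begin

lemma knothe_in: "distinct is ==> y \<in> ext is K ==> knothe is f K x y \<in> K"
proof (induction "is" arbitrary: y)
 case (Cons i "is")
 show ?case
  using kstep_in[OF K f Cons.prems] Cons.IH Cons.prems(1) by simp
qed simp

text \<open>Steps before \<open>j\<close> do not see coordinate \<open>j\<close> of the source, and
  steps after it do not touch component \<open>j\<close> of the target; so only the one-dimensional
  step \<open>j\<close> counts.\<close>

lemma knothe_mono: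
 "distinct is ==> y \<in> ext is K ==> j \<in> set is ==> s <= s' ==>
  knothe is f K (upd x j s) y $ j <= knothe is f K (upd x j s') y $ j"
proof (induction "is" arbitrary: y)
 case (Cons i "is")
 show ?case
 proof (cases "j = i")
  case True
  thus ?thesis using kstep_mono[OF K f Cons.prems(1,2,4)] Cons.prems by (simp add: knothe_nth)
 next
  case False
  have "kstep i is f K (upd x j s) y = kstep i is f K x y" for s
   using Cons.prems False by (intro kstep_agree) auto
  thus ?thesis
   using Cons.IH[OF _ kstep_in[OF K f Cons.prems(1,2)]] Cons.prems False by simp
 qed
qed simp

lemma knothe_increment:
 "distinct is ==> y \<in> ext is K ==> j \<in> set is ==> s <= s' ==>
  (NN u. knothe_slope is f K (upd x j u) y j * ind {s..s'} u)
   <= ennreal (knothe is f K (upd x j s') y $ j - knothe is f K (upd x j s) y $ j)"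
proof (induction "is" arbitrary: y)
 case (Cons i "is")
 show ?case
 proof (cases "j = i")
  case True
  thus ?thesis using kstep_increment[OF K f Cons.prems(1,2,4), of x] Cons.prems by (simp add: knothe_nth)
 next
  case False
  have "kstep i is f K (upd x j s) y = kstep i is f K x y" for s
   using Cons.prems False by (intro kstep_agree) auto
  thus ?thesis
   using Cons.IH[OF _ kstep_in[OF K f Cons.prems(1,2)]] Cons.prems False by simp
 qed
qed simp

lemma measurable_knothe_pair:
 "distinct is ==> (\<lambda>p. knothe is f K (fst p) (snd p)) \<in> borel_measurable (borel \<Otimes>\<^sub>M borel)"
proof (induction "is")
 case (Cons i "is")
 note [measurable] = measurable_kstep[OF K f Cons.prems]
 have IH: "(\<lambda>p. knothe is f K (fst p) (snd p)) \<in> borel_measurable (borel \<Otimes>\<^sub>M borel)"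
  using Cons by simp
 have "(\<lambda>p. (fst p, upd (snd p) i (kstep i is f K (fst p) (snd p)))) \<in> (borel \<Otimes>\<^sub>M borel) \<rightarrow>\<^sub>M (borel \<Otimes>\<^sub>M borel)"
  by measurable
 from measurable_compose[OF this IH] show ?case by simp
qed simp

lemma measurable_knothe_slope_pair:
 "distinct is ==> (\<lambda>p. knothe_slope is f K (fst p) (snd p) j) \<in> borel_measurable (borel \<Otimes>\<^sub>M borel)"
proof (induction "is")
 case (Cons i "is")
 note [measurable] = measurable_kstep[OF K f Cons.prems] measurable_kslope[OF K f Cons.prems]
 have IH: "(\<lambda>p. knothe_slope is f K (fst p) (snd p) j) \<in> borel_measurable (borel \<Otimes>\<^sub>M borel)"
  using Cons by simp
 have "(\<lambda>p. (fst p, upd (snd p) i (kstep i is f K (fst p) (snd p)))) \<in> (borel \<Otimes>\<^sub>M borel) \<rightarrow>\<^sub>M (borel \<Otimes>\<^sub>M borel)"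
  by measurable
 from measurable_compose[OF this IH]
 show ?case by (cases "j = i") auto
qed simp

text \<open>The determinant of a triangular map is the product of its diagonal, and here the ratios
  of conditional densities telescope to \<open>f\<close> times the ratio of the masses.\<close>

lemma knothe_slope_prod:
 "distinct is ==> y \<in> ext is K ==> iint is f x < \<infinity> ==> 0 < iint is (ind K) y ==>
  iint is (\<lambda>z. f z * ind (knothe_bad is f K y) z) x = 0"
proof (induction "is" arbitrary: x y)
 case Nil
 hence "ind K y = (1::ennreal)" by (simp add: indicator_def split: if_splits)
 thus ?case using Nil by (cases "f x = 0") (auto simp: knothe_bad_def indicator_def)
next
 case (Cons i "is")
 define m where "m = iint (i # is) f x"
 show ?case
 proof (cases "m = 0")
  case True
  have "iint (i # is) (\<lambda>z. f z * ind (knothe_bad (i # is) f K y) z) x <= iint (i # is) f x"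
   by (rule iint_mono) (simp add: indicator_def)
  thus ?thesis using True m_def by simp
 next
  case False
  hence nd: "knondeg i is f K x y"
   using Cons.prems by (auto simp: knondeg_def m_def zero_less_iff_neq_zero)
  \<comment> \<open>A finite outer integral makes almost all inner marginals finite, so that they
    may be cancelled.\<close>
  have fin: "AE u in lborel. iint is f (upd x i u) ~= \<infinity>"
   using Cons.prems(3) by (intro nn_integral_PInf_AE) auto
  have "AE u in lborel. iint is (\<lambda>z. f z * ind (knothe_bad (i # is) f K y) z) (upd x i u) = 0"
   using fin kstep_null[OF K f Cons.prems(1,2) nd]
  proof eventually_elim
   case (elim u)
   define x' where "x' = upd x i u"
   define a where "a = iint is f x'"
   define y' where "y' = upd y i (kstep i is f K x' y)"
   define r where "r = iint is (ind K) y'"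
   have ir: "i \<notin> set is" using Cons.prems by simp
   show ?case
   proof (cases "a = 0")
    case True
    have "iint is (\<lambda>z. f z * ind (knothe_bad (i # is) f K y) z) x' <= iint is f x'"
     by (rule iint_mono) (simp add: indicator_def)
    thus ?thesis using True a_def x'_def by simp
   next
    case False
    hence r: "0 < r" using elim by (simp add: r_def a_def x'_def y'_def zero_less_iff_neq_zero)
    have rfin: "r < \<infinity>" unfolding r_def using Cons.prems by (intro k_finite[OF K f]) auto
    have a: "0 < a" "a < \<infinity>" using False elim by (auto simp: a_def x'_def zero_less_iff_neq_zero less_top)
    have y': "y' \<in> ext is K" unfolding y'_def by (rule kstep_in[OF K f Cons.prems(1,2)])
    have IH: "iint is (\<lambda>z. f z * ind (knothe_bad is f K y') z) x' = 0"
     using Cons.IH[OF _ y', of x'] Cons.prems a r unfolding a_def r_def by simp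
    \<comment> \<open>On this slice the first step has the constant value recorded in
      \<open>y'\<close>, so a point that is bad for the long list is bad for the short one.\<close>
    have "iint is (\<lambda>z. f z * ind (knothe_bad (i # is) f K y) z) x' <= iint is (\<lambda>z. f z * ind (knothe_bad is f K y') z) x'"
    proof (rule iint_mono_agree)
     fix z assume z: "\<forall>j. j \<notin> set is --> z $ j = x' $ j"
     have ks: "kstep i is f K z y = kstep i is f K x' y"
      using z ir by (intro kstep_agree) auto
     have az: "iint is f z = a" unfolding a_def using z by (intro iint_agree) auto
     have mz: "iint (i # is) f z = m" unfolding m_def using z by (intro iint_agree) (auto simp: x'_def)
     have ndz: "knondeg i is f K z y"
      using nd z by (subst knondeg_agree[where x=x]) (auto simp: x'_def)
     have sl: "kslope i is f K z y = a / m * (iint (i # is) (ind K) y / r)"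
      using ndz unfolding kslope_def az mz ks y'_def[symmetric] r_def[symmetric] by simp
     have pr: "(\<Prod>j\<in>set (i # is). knothe_slope (i # is) f K z y j) = kslope i is f K z y * (\<Prod>j\<in>set is. knothe_slope is f K z y' j)"
     proof -
      have "(\<Prod>j\<in>set is. knothe_slope (i # is) f K z y j) = (\<Prod>j\<in>set is. knothe_slope is f K z y' j)"
       by (rule prod.cong) (use ir in \<open>auto simp: y'_def ks\<close>)
      thus ?thesis using ir by simp
     qed
     have "z \<notin> knothe_bad (i # is) f K y" if "z \<notin> knothe_bad is f K y'"
     proof -
      have "(\<Prod>j\<in>set is. knothe_slope is f K z y' j) = f z * r / a"
       using that by (simp add: knothe_bad_def r_def az)
      hence "(\<Prod>j\<in>set (i # is). knothe_slope (i # is) f K z y j) = f z * iint (i # is) (ind K) y / m"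
       unfolding pr sl using ennreal_cancel4[OF a r rfin] by simp
      thus ?thesis by (simp add: knothe_bad_def mz del: iint.simps knothe_slope.simps)
     qed
     thus "f z * ind (knothe_bad (i # is) f K y) z <= f z * ind (knothe_bad is f K y') z"
      by (auto simp: indicator_def)
    qed
    thus ?thesis using IH x'_def by simp
   qed
  qed
  hence "(NN u. iint is (\<lambda>z. f z * ind (knothe_bad (i # is) f K y) z) (upd x i u)) = (\<integral>\<^sup>+u. 0 \<partial>(lborel :: real measure))"
   by (rule nn_integral_cong_AE)
  thus ?thesis by simp
 qed
qed

end

text \<open>The last two clauses expose the coordinate transported first. Since any \<open>j\<close>
  may be put first, every direction can be analysed through a one-dimensional transport.\<close>

theorem knothe_map:
 fixes K :: "(real^'n::finite) set" and f :: "real^'n => ennreal"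
 assumes K: "compact K" "evol K > 0" and f [measurable]: "meas f"
  and m: "(NN x. f x) < \<infinity>"
  and dist: "distinct (j # rest)" "set (j # rest) = UNIV"
 obtains T :: "real^'n => real^'n" and G :: "real^'n => 'n => ennreal"
 where "meas T" "!!i. meas (\<lambda>x. G x i)"
  "!!x. T x \<in> K"
  "!!x i s s'. s <= s' ==> T (upd x i s) $ i <= T (upd x i s') $ i"
  "!!x i s s'. s <= s' ==>
    (NN u. G (upd x i u) i * ind {s..s'} u) <= ennreal (T (upd x i s') $ i - T (upd x i s) $ i)"
  "AE x in lborel. f x = 0 \<or> (\<Prod>i\<in>UNIV. G x i) = f x * evol K / (NN x. f x)"
  "!!x. T x $ j = kstep j rest f K x 0"
  "!!x. G x j = kslope j rest f K x 0"
proof -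
 define T where "T x = knothe (j # rest) f K x 0" for x
 define G where "G x = knothe_slope (j # rest) f K x 0" for x
 note [measurable] = borel_compact[OF K(1)]
 have ne: "K ~= {}" using K(2) by auto
 \<comment> \<open>The list is exhaustive, so the starting value 0 is arbitrary: every coordinate of
   it gets overwritten.\<close>
 have e0: "0 \<in> ext (j # rest) K" using ext_full[OF dist(2) ne] by simp
 have Tm: "meas T"
  using measurable_compose[OF _ measurable_knothe_pair[OF K(1) f dist(1)], of "\<lambda>x. (x, 0)" borel]
  by (simp add: T_def[abs_def])
 have Gm: "meas (\<lambda>x. G x i)" for i
  using measurable_compose[OF _ measurable_knothe_slope_pair[OF K(1) f dist(1)], of "\<lambda>x. (x, 0)" borel i]
  by (simp add: G_def[abs_def] del: knothe_slope.simps)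
 have mk: "iint (j # rest) (ind K) x = evol K" for x
  using iint_full[OF dist, of "ind K" x] by simp
 have mf: "iint (j # rest) f x = (NN x. f x)" for x
  by (rule iint_full[OF dist f])
 have [measurable]: "meas (\<lambda>x. \<Prod>i\<in>UNIV. G x i)"
  using Gm by measurable
 define B where "B = {z. (\<Prod>i\<in>UNIV. G z i) ~= f z * evol K / (NN x. f x)}"
 define p q where "p z = (\<Prod>i\<in>UNIV. G z i)" and "q z = f z * evol K / (NN x. f x)" for z
 have [measurable]: "meas p" "meas q"
  unfolding p_def q_def using Gm by auto
 have "B = {z \<in> space borel. p z ~= q z}" by (simp only: B_def p_def q_def space_borel UNIV_I simp_thms)
 also have "... \<in> sets borel" by measurable
 finally have B_sets [measurable]: "B \<in> sets borel" .
 define h where "h z = f z * ind B z" for z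
 have [measurable]: "meas h" unfolding h_def[abs_def] using f B_sets by (intro borel_measurable_times_ennreal borel_measurable_indicator)
 have BB: "knothe_bad (j # rest) f K 0 = B"
  unfolding knothe_bad_def B_def mk mf dist(2) G_def ..
 have "iint (j # rest) h 0 = 0"
  using knothe_slope_prod[OF K(1) f dist(1) e0, of 0] K(2) m
  unfolding mk mf BB h_def by simp
 hence "(NN x. h x) = 0" using iint_full[OF dist, of h 0] by simp
 hence "AE x in lborel. h x = 0" by (subst (asm) nn_integral_0_iff_AE) auto
 hence AE: "AE x in lborel. f x = 0 \<or> (\<Prod>i\<in>UNIV. G x i) = f x * evol K / (NN x. f x)"
  by eventually_elim (auto simp: h_def B_def indicator_def split: if_splits)
 have inU: "i \<in> set (j # rest)" for i using dist(2) by auto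
 show ?thesis
 proof (rule that[of T G])
  show "T x \<in> K" for x unfolding T_def by (rule knothe_in[OF K(1) f dist(1) e0])
  show "T (upd x i s) $ i <= T (upd x i s') $ i" if "s <= s'" for x i s s'
   unfolding T_def by (rule knothe_mono[OF K(1) f dist(1) e0 inU that])
  show "(NN u. G (upd x i u) i * ind {s..s'} u) <= ennreal (T (upd x i s') $ i - T (upd x i s) $ i)"
   if "s <= s'" for x i s s'
   unfolding T_def G_def by (rule knothe_increment[OF K(1) f dist(1) e0 inU that])
  show "T x $ j = kstep j rest f K x 0" for x
   using dist(1) by (simp add: T_def knothe_nth)
  show "G x j = kslope j rest f K x 0" for x by (simp add: G_def)
  show "meas T" by (rule Tm)
  show "meas (\<lambda>x. G x i)" for i by (rule Gm)
  show "AE x in lborel. f x = 0 \<or> (\<Prod>i\<in>UNIV. G x i) = f x * evol K / (NN x. f x)"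
   by (rule AE)
 qed
qed

section \<open>Mollification\<close>

text \<open>The bump and the smooth step are built from this function. It is only of class C1, which
  is exactly the class of the test fields.\<close>

definition qp :: "real => real" where "qp u = (max 0 u)\<^sup>2"

lemma DERIV_qp: "(qp has_real_derivative 2 * max 0 u) (at u)"
proof -
 consider "u < 0" | "u = 0" | "u > 0" by linarith
 thus ?thesis
 proof cases
  case 1
  have "((\<lambda>_. 0) has_real_derivative 2 * max 0 u) (at u)" using 1 by simp
  thus ?thesis
   by (rule has_field_derivative_transform_within_open[of _ _ _ "{..<0}"]) (use 1 in \<open>auto simp: qp_def max_def\<close>)
 next
  case 2
  have "((\<lambda>h. qp h / h) \<longlongrightarrow> 0) (at 0)"
  proof (rule Lim_null_comparison[where g="\<lambda>h. \<bar>h\<bar>"])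
   show "\<forall>\<^sub>F h in at 0. norm (qp h / h) <= \<bar>h\<bar>"
    by (auto simp: eventually_at_filter qp_def max_def power2_eq_square)
  qed (auto intro!: tendsto_eq_intros)
  thus ?thesis using 2 by (simp add: DERIV_def qp_def)
 next
  case 3
  have "((\<lambda>u. u\<^sup>2) has_real_derivative 2 * max 0 u) (at u)"
   using 3 by (auto intro!: derivative_eq_intros)
  thus ?thesis
   by (rule has_field_derivative_transform_within_open[of _ _ _ "{0<..}"]) (use 3 in \<open>auto simp: qp_def max_def\<close>)
 qed
qed

definition bump :: "real => 'a::euclidean_space => real" where
 "bump r z = qp (1 - (z \<bullet> z) / r\<^sup>2)"

definition grad_bump :: "real => 'a::euclidean_space => 'a" where
 "grad_bump r z = (- (4 / r\<^sup>2) * max 0 (1 - (z \<bullet> z) / r\<^sup>2)) *\<^sub>R z"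

lemma bump_has_derivative: "(bump r has_derivative (\<lambda>h. grad_bump r z \<bullet> h)) (at z)"
proof -
 have "((\<lambda>z. 1 - (z \<bullet> z) / r\<^sup>2) has_derivative (\<lambda>h. - (2 * (z \<bullet> h)) / r\<^sup>2)) (at z)"
  unfolding divide_inverse by (auto intro!: derivative_eq_intros simp: inner_commute)
 from has_derivative_compose[OF this, of qp "(*) (2 * max 0 (1 - (z \<bullet> z) / r\<^sup>2))"]
  DERIV_qp[of "1 - (z \<bullet> z) / r\<^sup>2"]
 have "((\<lambda>z. qp (1 - (z \<bullet> z) / r\<^sup>2)) has_derivative
   (\<lambda>h. 2 * max 0 (1 - (z \<bullet> z) / r\<^sup>2) * (- (2 * (z \<bullet> h)) / r\<^sup>2))) (at z)"
  by (simp add: has_field_derivative_def)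
 thus ?thesis
  unfolding bump_def[abs_def] grad_bump_def by (simp add: mult_ac)
qed

lemma continuous_bump: "continuous_on A (bump r)"
 unfolding bump_def qp_def by (cases "r = 0") (auto intro!: continuous_intros)

lemma continuous_grad_bump: "continuous_on A (grad_bump r)"
 unfolding grad_bump_def by (cases "r = 0") (auto intro!: continuous_intros)

lemma bump_outside:
 assumes "0 < r" "r <= norm z" shows "bump r z = 0" "grad_bump r z = 0"
proof -
 have "1 <= (z \<bullet> z) / r\<^sup>2"
  using assms by (simp add: power2_norm_eq_inner[symmetric] power_mono)
 thus "bump r z = 0" "grad_bump r z = 0" by (auto simp: bump_def grad_bump_def qp_def max_def)
qed

lemma bump_range: "0 <= bump r z" "bump r z <= 1"
 unfolding bump_def qp_def by (auto simp: max_def power_le_one)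

lemma norm_grad_bump: "0 < r ==> norm (grad_bump r z) <= 4 / r"
proof (cases "norm z <= r")
 case True
 assume r: "0 < r"
 have "norm (grad_bump r z) = (4 / r\<^sup>2) * max 0 (1 - (z \<bullet> z) / r\<^sup>2) * norm z"
  by (simp add: grad_bump_def abs_mult)
 also have "... <= (4 / r\<^sup>2) * 1 * r"
  using True r by (intro mult_mono) auto
 also have "... = 4 / r" using r by (simp add: power2_eq_square)
 finally show ?thesis .
qed (auto simp: bump_outside)

section \<open>Convolution with compactly supported kernels of class C1\<close>

locale C1c =
 fixes c :: "'a::euclidean_space => real" and dc :: "'a => 'a" and r :: real
 assumes deriv: "!!z. (c has_derivative (\<lambda>h. dc z \<bullet> h)) (at z)"
  and cont_d: "continuous_on UNIV dc"
  and support: "!!z. r < norm z ==> c z = 0"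

begin

lemma cont: "continuous_on UNIV c"
 using deriv by (meson differentiableI differentiable_imp_continuous_within continuous_at_imp_continuous_on)

lemma support_d: "r < norm z ==> dc z = 0"
proof -
 assume z: "r < norm z"
 have "((\<lambda>_. 0) has_derivative (\<lambda>h. dc z \<bullet> h)) (at z)"
 proof (rule has_derivative_transform_within_open[OF deriv])
  show "open {z::'a. r < norm z}" by (intro open_Collect_less continuous_intros)
 qed (use z support in auto)
 hence "(\<lambda>h. dc z \<bullet> h) = (\<lambda>h. 0)"
  by (rule has_derivative_unique) simp
 hence "dc z \<bullet> dc z = 0" by metis
 thus ?thesis by simp
qed

end

lemma uniform_cont_support:
 fixes c :: "'a::euclidean_space => 'b::real_normed_vector"
 assumes cont: "continuous_on UNIV c" and supp: "!!z. r < norm z ==> c z = 0" and e: "e > 0"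
 obtains d where "d > 0" "!!z z'. norm (z - z') < d ==> norm (c z - c z') < e"
proof -
 have "uniformly_continuous_on (cball 0 (r + 1)) c"
  by (rule compact_uniformly_continuous) (auto intro: continuous_on_subset[OF cont])
 then obtain d where d: "d > 0" "!!z z'. z \<in> cball 0 (r+1) ==> z' \<in> cball 0 (r+1) ==> dist z' z < d ==> dist (c z') (c z) < e"
  using e unfolding uniformly_continuous_on_def by metis
 \<comment> \<open>Distances below 1 put both points into the ball of radius \<open>r + 1\<close> as
   soon as one of them has norm at most \<open>r\<close>.\<close>
 show ?thesis
 proof (rule that[of "min d 1"])
  fix z z' :: 'a assume zz: "norm (z - z') < min d 1"
  show "norm (c z - c z') < e"
  proof (cases "norm z <= r \<or> norm z' <= r")
   case True
   have "\<bar>norm z - norm z'\<bar> <= norm (z - z')" by (rule norm_triangle_ineq3)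
   hence "z \<in> cball 0 (r+1)" "z' \<in> cball 0 (r+1)" using True zz by auto
   thus ?thesis using d(2)[of z' z] zz by (simp add: dist_norm)
  qed (use supp e in auto)
 qed (use d in auto)
qed

lemma bounded_support:
 fixes c :: "'a::euclidean_space => 'b::real_normed_vector"
 assumes cont: "continuous_on UNIV c" and supp: "!!z. r < norm z ==> c z = 0"
 obtains B where "B > 0" "!!z. norm (c z) <= B"
proof -
 have "compact (c ` cball 0 r)"
  by (intro compact_continuous_image continuous_on_subset[OF cont]) auto
 then obtain B where B: "B > 0" "!!z. z \<in> cball 0 r ==> norm (c z) <= B"
  by (metis bounded_pos compact_imp_bounded imageI)
 show ?thesis
 proof (rule that[OF B(1)])
  fix z show "norm (c z) <= B"
   using B supp[of z] by (cases "norm z <= r") auto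
 qed
qed

lemma integrable_support:
 fixes f :: "'a::euclidean_space => 'b::{banach,second_countable_topology}"
 assumes [measurable]: "meas f" and supp: "!!z. r < norm z ==> f z = 0"
  and B: "!!z. norm (f z) <= B"
 shows "intg f"
proof (rule int_bound)
 show "intg (\<lambda>z::'a. B * ind (cball 0 r) z)"
  using emeasure_lborel_cball_finite[of "0::'a" r] by (intro integrable_mult_right integrable_real_indicator) auto
 have "norm (f z) <= norm (B * ind (cball 0 r) z)" for z
  using supp[of z] B[of z] by (cases "norm z <= r") (auto simp: indicator_def)
 thus "AE z in lborel. norm (f z) <= norm (B * ind (cball 0 r) z)" by simp
qed simp

lemma lborel_reflect: "distr lborel borel (\<lambda>z. x - z) = (lborel :: 'a::euclidean_space measure)"
 using lborel_affine[of "-1" x] by (simp add: density_1)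

lemma integral_reflect:
 fixes f :: "'a::euclidean_space => real"
 assumes [measurable]: "meas f"
 shows "(LI z. f (x - z)) = (LI y. f y)"
 by (subst (2) lborel_reflect[of x, symmetric]) (simp add: integral_distr)

definition conv :: "('a::euclidean_space => real) => ('a => real) => 'a => real" where
 "conv eh t x = (LI z. eh z * t (x - z))"

lemma conv_alt:
 assumes [measurable]: "meas eh" "meas t"
 shows "conv eh t x = (LI y. eh (x - y) * t y)"
 using integral_reflect[of "\<lambda>z. eh z * t (x - z)" x] by (simp add: conv_def)

lemma measurable_conv [measurable]:
 assumes [measurable]: "meas eh" "meas t"
 shows "meas (conv eh t)"
proof -
 have "meas (\<lambda>x. LI z. eh z * t (x - z))" by measurable
 thus ?thesis by (simp add: conv_def[abs_def])
qed

lemma conv_continuous: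
 fixes eh t :: "'a::euclidean_space => real"
 assumes cont: "continuous_on UNIV eh" and supp: "!!z. r < norm z ==> eh z = 0" 
  and t [measurable]: "meas t" and M: "!!x. \<bar>t x\<bar> <= M"
 shows "continuous_on UNIV (conv eh t)"
 unfolding continuous_on_iff
proof safe
 fix x :: 'a and e :: real assume e: "e > 0"
 have [measurable]: "meas eh" using cont by (rule cont_meas)
 obtain B where B: "B > 0" "!!z. norm (eh z) <= B" using bounded_support[OF cont supp] by blast
 define V where "V = vol (cball x (\<bar>r\<bar> + 1))"
 define K where "K = (\<bar>M\<bar> + 1) * (V + 1)"
 have V: "V \<ge> 0" by (simp add: V_def)
 have K: "K > 0" using V by (simp add: K_def)
 obtain d where d: "d > 0" "!!z z'. norm (z - z') < d ==> norm (eh z - eh z') < e / K"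
  using uniform_cont_support[OF cont supp, where e="e / K"] e K by auto
 have int: "intg (\<lambda>y. eh (x - y) * t y)" for x
 proof (rule integrable_support[where r="\<bar>r\<bar> + norm x" and B="B * \<bar>M\<bar>"])
  fix z :: 'a assume "\<bar>r\<bar> + norm x < norm z"
  hence "r < norm (x - z)" using norm_triangle_ineq3[of x z] by auto
  thus "eh (x - z) * t z = 0" using supp by simp
 next
  show "norm (eh (x - z) * t z) <= B * \<bar>M\<bar>" for z
   using B(2)[of "x - z"] M[of z] B(1) by (auto simp: abs_mult intro!: mult_mono)
 qed simp
 show "\<exists>d>0. \<forall>x'\<in>UNIV. dist x' x < d --> dist (conv eh t x') (conv eh t x) < e"
 proof (intro exI[of _ "min d 1"] conjI ballI impI)
  fix x' assume x': "dist x' x < min d 1"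
  have "\<bar>conv eh t x' - conv eh t x\<bar> = \<bar>LI y. (eh (x' - y) - eh (x - y)) * t y\<bar>"
   by (simp add: conv_alt Bochner_Integration.integral_diff[OF int int, symmetric] left_diff_distrib)
  also have "... <= (LI y. \<bar>(eh (x' - y) - eh (x - y)) * t y\<bar>)"
   using integral_norm_bound[of lborel "\<lambda>y. (eh (x' - y) - eh (x - y)) * t y"] by simp
  also have "... <= (LI y. (e / K * \<bar>M\<bar>) * ind (cball x (\<bar>r\<bar> + 1)) y)"
  proof (rule integral_mono)
   show "intg (\<lambda>y. \<bar>(eh (x' - y) - eh (x - y)) * t y\<bar>)"
    using Bochner_Integration.integrable_diff[OF int[of x'] int[of x]] by (simp add: left_diff_distrib)
   show "intg (\<lambda>y. (e / K * \<bar>M\<bar>) * ind (cball x (\<bar>r\<bar> + 1)) y)"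
    using emeasure_lborel_cball_finite[of x "\<bar>r\<bar> + 1"] by (intro integrable_mult_right integrable_real_indicator) auto
   fix y
   show "\<bar>(eh (x' - y) - eh (x - y)) * t y\<bar> <= (e / K * \<bar>M\<bar>) * ind (cball x (\<bar>r\<bar> + 1)) y"
   proof (cases "y \<in> cball x (\<bar>r\<bar> + 1)")
    case True
    have "\<bar>eh (x' - y) - eh (x - y)\<bar> <= e / K"
     using d(2)[of "x' - y" "x - y"] x' by (simp add: dist_norm)
    hence "\<bar>eh (x' - y) - eh (x - y)\<bar> * \<bar>t y\<bar> <= e / K * \<bar>M\<bar>"
     using M[of y] e K by (intro mult_mono) auto
    thus ?thesis using True by (simp add: abs_mult)
   next
    case False
    hence "\<bar>r\<bar> + 1 < norm (x - y)" by (simp add: dist_norm)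
    moreover have "\<bar>norm (x' - y) - norm (x - y)\<bar> <= norm (x' - x)"
     using norm_triangle_ineq3[of "x' - y" "x - y"] by simp
    ultimately have "r < norm (x' - y)" "r < norm (x - y)" using x' by (auto simp: dist_norm)
    thus ?thesis using False supp by simp
   qed
  qed
  also have "... = e / K * \<bar>M\<bar> * V" by (simp add: V_def)
  also have "... < e"
  proof -
   have "\<bar>M\<bar> * V < K" using V unfolding K_def by (simp add: algebra_simps add_strict_increasing2)
   hence "e / K * (\<bar>M\<bar> * V) < e / K * K" using e K by (intro mult_strict_left_mono) auto
   thus ?thesis using K by (simp add: mult.assoc)
  qed
  finally show "dist (conv eh t x') (conv eh t x) < e" by (simp add: dist_real_def)
 qed (use d in auto)
qed

lemma integral_le_cball:
 fixes k t :: "'a::euclidean_space => real"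
 assumes [measurable]: "meas k" "meas t"
  and k: "!!y. \<bar>k y\<bar> <= b" and supp: "!!y. R < dist x y ==> k y = 0" and M: "!!y. \<bar>t y\<bar> <= M"
 shows "\<bar>LI y. k y * t y\<bar> <= b * M * vol (cball x R)"
proof -
 have b0: "0 <= b" "0 <= M" using k M abs_ge_zero order_trans by blast+
 have le: "\<bar>k y * t y\<bar> <= (b * M) * ind (cball x R) y" for y
 proof (cases "y \<in> cball x R")
  case True
  have "\<bar>k y\<bar> * \<bar>t y\<bar> <= b * M" using k M b0 by (intro mult_mono) auto
  thus ?thesis using True by (simp add: abs_mult)
 qed (use supp in auto)
 have int: "intg (\<lambda>y. (b * M) * ind (cball x R) y)"
  using emeasure_lborel_cball_finite[of x R] by (intro integrable_mult_right integrable_real_indicator) auto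
 have i: "intg (\<lambda>y. \<bar>k y * t y\<bar>)"
  by (rule int_bound[OF int]) (use le in \<open>auto intro: order_trans[OF _ abs_ge_self]\<close>)
 have "\<bar>LI y. k y * t y\<bar> <= (LI y. \<bar>k y * t y\<bar>)"
  using integral_norm_bound[of lborel "\<lambda>y. k y * t y"] by simp
 also have "... <= (LI y. (b * M) * ind (cball x R) y)"
  by (rule integral_mono[OF i int le])
 finally show ?thesis by simp
qed

lemma conv_integrable:
 fixes eh t :: "'a::euclidean_space => real"
 assumes cont: "continuous_on UNIV eh" and supp: "!!z. r < norm z ==> eh z = 0"
  and [measurable]: "meas t" and M: "!!x. \<bar>t x\<bar> <= M"
 shows "intg (\<lambda>z. eh z * t (x - z))" "intg (\<lambda>y. eh (x - y) * t y)"
proof -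
 have [measurable]: "meas eh" using cont by (rule cont_meas)
 obtain B where B: "B > 0" "!!z. norm (eh z) <= B" using bounded_support[OF cont supp] by blast
 have le: "norm (eh z * t y) <= B * \<bar>M\<bar>" for z y
  using B(2)[of z] M[of y] B(1) by (auto simp: abs_mult intro!: mult_mono)
 show "intg (\<lambda>z. eh z * t (x - z))"
  by (rule integrable_support[where r=r and B="B * \<bar>M\<bar>"]) (use le supp in auto)
 show "intg (\<lambda>y. eh (x - y) * t y)"
 proof (rule integrable_support[where r="\<bar>r\<bar> + norm x" and B="B * \<bar>M\<bar>"])
  fix z :: 'a assume "\<bar>r\<bar> + norm x < norm z"
  hence "r < norm (x - z)" using norm_triangle_ineq3[of x z] by auto
  thus "eh (x - z) * t z = 0" using supp by simp
 qed (use le in auto)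
qed

context C1c

begin

text \<open>The linearization error is uniform in \<open>z\<close>, by the mean value inequality and
  the uniform continuity of \<open>dc\<close>.\<close>

lemma linear_approx:
 assumes e: "e > 0"
 obtains d where "d > 0" "!!z h. norm h < d ==> \<bar>c (z + h) - c z - dc z \<bullet> h\<bar> <= e * norm h"
proof -
 obtain d where d: "d > 0" "!!z z'. norm (z - z') < d ==> norm (dc z - dc z') < e"
  using uniform_cont_support[OF cont_d support_d e] by blast
 show ?thesis
 proof (rule that[OF d(1)])
  fix z h :: 'a assume h: "norm h < d"
  have "norm (c (z + h) - c z - dc z \<bullet> ((z + h) - z)) <= norm ((z + h) - z) * e"
  proof (rule differentiable_bound_linearization[where S="ball z d" and f'="\<lambda>x h. dc x \<bullet> h"])
   fix s :: real assume "s \<in> {0..1}"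
   hence "\<bar>s\<bar> * norm h <= 1 * norm h" by (intro mult_right_mono) auto
   thus "z + s *\<^sub>R (z + h - z) \<in> ball z d" using h by (simp add: dist_norm)
  next
   fix x assume x: "x \<in> ball z d"
   show "(c has_derivative (\<lambda>h. dc x \<bullet> h)) (at x within ball z d)"
    using deriv by (rule has_derivative_at_withinI)
   show "onorm ((\<bullet>) (dc x) - (\<bullet>) (dc z)) <= e"
   proof (rule onorm_le)
    fix v
    have "\<bar>(dc x - dc z) \<bullet> v\<bar> <= norm (dc x - dc z) * norm v" by (rule Cauchy_Schwarz_ineq2)
    also have "... <= e * norm v"
     using d(2)[of x z] x by (intro mult_right_mono) (auto simp: dist_norm norm_minus_commute)
    finally show "norm (((\<bullet>) (dc x) - (\<bullet>) (dc z)) v) <= e * norm v"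
     by (simp add: inner_diff_left)
   qed
  qed (use d in auto)
  thus "\<bar>c (z + h) - c z - dc z \<bullet> h\<bar> <= e * norm h" by (simp add: mult.commute)
 qed
qed

lemma cont_dir: "continuous_on UNIV (\<lambda>z. dc z \<bullet> b)"
 using cont_d by (intro continuous_intros)

lemma support_dir: "r < norm z ==> dc z \<bullet> b = 0"
 using support_d by simp

text \<open>The derivative falls on the kernel, since \<open>t\<close> is merely bounded and
  measurable; the uniform linearization of the kernel is integrated over one ball that contains all
  shifted supports.\<close>

lemma conv_has_derivative:
 assumes t [measurable]: "meas t" and M: "!!x. \<bar>t x\<bar> <= M"
 shows "(conv c t has_derivative (\<lambda>h. \<Sum>b\<in>Basis. (h \<bullet> b) * conv (\<lambda>z. dc z \<bullet> b) t x)) (at x)"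
 unfolding has_derivative_at_alt
proof (intro conjI allI impI)
 show "bounded_linear (\<lambda>h. \<Sum>b\<in>Basis. (h \<bullet> b) * conv (\<lambda>z. dc z \<bullet> b) t x)"
  by (intro bounded_linear_sum bounded_linear_intros)
 fix e :: real assume e: "e > 0"
 note [measurable] = cont_meas[OF cont] cont_meas[OF cont_d]
 have M0: "0 <= M" using M abs_ge_zero order_trans by blast
 \<comment> \<open>The summand 1 keeps \<open>V\<close> positive when \<open>M\<close> is 0; the
   ball of radius \<open>\<bar>r\<bar> + 1\<close> accommodates shifts shorter than 1.\<close>
 define V where "V = M * vol (cball x (\<bar>r\<bar> + 1)) + 1"
 have V: "V > 0" using M0 by (simp add: V_def add_nonneg_pos)
 obtain d where d: "d > 0" "!!z h. norm h < d ==> \<bar>c (z + h) - c z - dc z \<bullet> h\<bar> <= e / V * norm h"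
  using linear_approx[of "e / V"] e V by auto
 show "\<exists>d>0. \<forall>y. norm (y - x) < d -->
   norm (conv c t y - conv c t x - (\<Sum>b\<in>Basis. ((y - x) \<bullet> b) * conv (\<lambda>z. dc z \<bullet> b) t x)) <= e * norm (y - x)"
 proof (intro exI[of _ "min d 1"] conjI allI impI)
  fix y assume y: "norm (y - x) < min d 1"
  define h where "h = y - x"
  have i1: "intg (\<lambda>w. c (x - w) * t w)" for x
   by (rule conv_integrable[OF cont support t M])
  have i2: "intg (\<lambda>w. (dc (x - w) \<bullet> b) * t w)" for b
   by (rule conv_integrable[OF cont_dir support_dir t M])
  have lin: "(\<Sum>b\<in>Basis. (h \<bullet> b) * conv (\<lambda>z. dc z \<bullet> b) t x) = (LI w. (dc (x - w) \<bullet> h) * t w)"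
  proof -
   have "(\<Sum>b\<in>Basis. (h \<bullet> b) * conv (\<lambda>z. dc z \<bullet> b) t x) = (LI w. (\<Sum>b\<in>Basis. (h \<bullet> b) * ((dc (x - w) \<bullet> b) * t w)))"
    using i2 by (subst Bochner_Integration.integral_sum) (auto simp: conv_alt)
   also have "... = (LI w. (dc (x - w) \<bullet> h) * t w)"
   proof (intro Bochner_Integration.integral_cong refl)
    fix w
    have "dc (x - w) \<bullet> h = (\<Sum>b\<in>Basis. (dc (x - w) \<bullet> b) * (h \<bullet> b))"
     by (rule euclidean_inner)
    thus "(\<Sum>b\<in>Basis. (h \<bullet> b) * ((dc (x - w) \<bullet> b) * t w)) = (dc (x - w) \<bullet> h) * t w"
     by (simp only: sum_distrib_left mult_ac)
   qed
   finally show ?thesis .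
  qed
  have i3: "intg (\<lambda>w. (dc (x - w) \<bullet> h) * t w)" by (rule i2)
  have "conv c t y - conv c t x - (\<Sum>b\<in>Basis. (h \<bullet> b) * conv (\<lambda>z. dc z \<bullet> b) t x)
   = (LI w. (c (x + h - w) - c (x - w) - dc (x - w) \<bullet> h) * t w)"
   using i1[of "x + h"] i1[of x] i3 unfolding lin by (simp add: conv_alt left_diff_distrib h_def)
  also have "\<bar>...\<bar> <= e / V * norm h * M * vol (cball x (\<bar>r\<bar> + 1))"
  proof (rule integral_le_cball)
   show "\<bar>c (x + h - w) - c (x - w) - dc (x - w) \<bullet> h\<bar> <= e / V * norm h" for w
    using d(2)[of h "x - w"] y by (simp add: h_def algebra_simps)
   fix w assume w: "\<bar>r\<bar> + 1 < dist x w"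
   have "norm (x - w) - norm (x + h - w) <= norm h"
    using norm_triangle_ineq2[of "x - w" "x + h - w"] by simp
   hence "r < norm (x + h - w)" "r < norm (x - w)" using w y by (auto simp: dist_norm h_def)
   thus "c (x + h - w) - c (x - w) - dc (x - w) \<bullet> h = 0" using support support_d by simp
  qed (use M in auto)
  also have "... = e * norm h * ((V - 1) / V)" by (simp add: V_def)
  also have "... <= e * norm h * 1"
   using e V by (intro mult_left_mono) auto
  finally show "norm (conv c t y - conv c t x - (\<Sum>b\<in>Basis. ((y - x) \<bullet> b) * conv (\<lambda>z. dc z \<bullet> b) t x)) <= e * norm (y - x)"
   by (simp add: h_def)
 qed (use d in auto)
qed

end

lemma lborel_translate_emeasure:
 fixes A :: "'a::euclidean_space set"
 assumes [measurable]: "A \<in> sets borel"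
 shows "evol {x. x + z \<in> A} = evol A"
proof -
 have "evol A = emeasure (distr lborel borel ((+) z)) A" by (simp add: lborel_distr_plus)
 also have "... = evol ((+) z -` A \<inter> space lborel)" by (rule emeasure_distr) auto
 also have "(+) z -` A \<inter> space lborel = {x. x + z \<in> A}" by (auto simp: add.commute)
 finally show ?thesis by simp
qed

lemma integral_translate:
 fixes f :: "'a::euclidean_space => real"
 assumes [measurable]: "meas f"
 shows "(LI x. f (x + z)) = (LI x. f x)"
 by (subst (2) lborel_distr_plus[of z, symmetric]) (simp add: integral_distr add.commute)

text \<open>Inner and outer regularity enclose \<open>E\<close> between a compact and an open set; a
  short translation moves the compact set within the open one.\<close>

lemma translate_symdiff_small:
 fixes E :: "'a::euclidean_space set"
 assumes E: "E \<in> sets borel" "bounded E" and e: "e > 0"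
 obtains d where "d > 0" "!!z. norm z < d ==> evol {x. (x \<in> E) ~= (x + z \<in> E)} <= ennreal e"
proof -
 \<comment> \<open>Four error sets occur: \<open>E - C\<close>, \<open>U - E\<close> and their
   translates.\<close>
 define q where "q = e / 4"
 have q: "q > 0" using e by (simp add: q_def)
 have EL: "E \<in> sets lebesgue" using E by simp
 obtain U where U: "open U" "E \<subseteq> U" "emeasure lebesgue (U - E) < ennreal q"
  by (rule sets_lebesgue_outer_open[OF EL q])
 obtain C where C: "closed C" "C \<subseteq> E" "emeasure lebesgue (E - C) < ennreal q"
  by (rule sets_lebesgue_inner_closed[OF EL q])
 have "compact C" using C E bounded_subset by (auto simp: compact_eq_bounded_closed)
 then obtain d where d: "d > 0" "(\<Union>x\<in>C. ball x d) \<subseteq> U"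
  using compact_subset_open_imp_ball_epsilon_subset[OF _ U(1)] C U by (metis order_trans)
 note [measurable] = E(1) borel_open[OF U(1)] borel_closed[OF C(1)]
 have UE: "evol (U - E) <= ennreal q" using U(3) by simp
 have EC: "evol (E - C) <= ennreal q" using C(3) by simp
 show ?thesis
 proof (rule that[OF d(1)])
  fix z :: 'a assume z: "norm z < d"
  have "{x. (x \<in> E) ~= (x + z \<in> E)} \<subseteq> ((E - C) \<union> (U - E)) \<union> ({x. x + z \<in> E - C} \<union> {x. x + z \<in> U - E})"
  proof
   fix x assume x: "x \<in> {x. (x \<in> E) ~= (x + z \<in> E)}"
   have "x + z \<in> ball x d" using z by (simp add: dist_norm)
   hence 1: "x + z \<in> U" if "x \<in> C" using d(2) that by blast
   have "x \<in> ball (x + z) d" using z by (simp add: dist_norm)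
   hence 2: "x \<in> U" if "x + z \<in> C" using d(2) that by blast
   show "x \<in> ((E - C) \<union> (U - E)) \<union> ({x. x + z \<in> E - C} \<union> {x. x + z \<in> U - E})"
    using x 1 2 C U by auto
  qed
  hence "evol {x. (x \<in> E) ~= (x + z \<in> E)} <= evol (((E - C) \<union> (U - E)) \<union> ({x. x + z \<in> E - C} \<union> {x. x + z \<in> U - E}))"
   by (intro emeasure_mono) auto
  also have "... <= (evol (E - C) + evol (U - E)) + (evol {x. x + z \<in> E - C} + evol {x. x + z \<in> U - E})"
   by (intro order_trans[OF emeasure_subadditive] add_mono emeasure_subadditive) auto
  also have "... = (evol (E - C) + evol (U - E)) + (evol (E - C) + evol (U - E))"
   by (simp add: lborel_translate_emeasure del: Diff_iff)
  also have "... <= (ennreal q + ennreal q) + (ennreal q + ennreal q)"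
   by (intro add_mono UE EC)
  also have "... = ennreal e" using q by (simp add: q_def ennreal_plus[symmetric] del: ennreal_plus)
  finally show "evol {x. (x \<in> E) ~= (x + z \<in> E)} <= ennreal e" .
 qed
qed

text \<open>Continuity of translations in the mean. Where a point and its translate agree on
  membership, uniform continuity of \<open>c\<close> applies; the points of disagreement form a
  small set.\<close>

lemma L1_translate_small:
 fixes c :: "'a::euclidean_space => real"
 assumes E [measurable]: "E \<in> sets borel" and cont: "continuous_on UNIV c" and supp: "!!z. r < norm z ==> c z = 0" and e: "e > 0"
 obtains d where "d > 0" "!!z. norm z < d ==> (LI x. \<bar>ind E (x + z) * c (x + z) - ind E x * c x\<bar>) <= e"
proof -
 have [measurable]: "meas c" using cont by (rule cont_meas)
 obtain B where B: "B > 0" "!!z. norm (c z) <= B" using bounded_support[OF cont supp] by blast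
 define F where "F = E \<inter> cball 0 \<bar>r\<bar>"
 have F: "F \<in> sets borel" "bounded F" unfolding F_def by auto
 note [measurable] = F(1)
 define D where "D = cball (0::'a) (\<bar>r\<bar> + 1)"
 have Dfin: "evol D < \<infinity>" unfolding D_def by (rule emeasure_lborel_cball_finite)
 have [measurable]: "D \<in> sets borel" by (simp add: D_def)
 define V where "V = vol D + 1"
 have V: "V > 0" by (simp add: V_def add_nonneg_pos)
 obtain d1 where d1: "d1 > 0" "!!z z'. norm (z - z') < d1 ==> norm (c z - c z') < e / 2 / V"
  using uniform_cont_support[OF cont supp, where e="e / 2 / V"] e V by auto
 obtain d2 where d2: "d2 > 0" "!!z. norm z < d2 ==> evol {x. (x \<in> F) ~= (x + z \<in> F)} <= ennreal (e / 2 / B)"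
  using translate_symdiff_small[OF F, of "e / 2 / B"] e B by auto
 show ?thesis
 proof (rule that[of "min (min d1 d2) 1"])
  fix z :: 'a assume z: "norm z < min (min d1 d2) 1"
  define S where "S = {x. (x \<in> F) ~= (x + z \<in> F)}"
  have [measurable]: "S \<in> sets borel"
  unfolding S_def by (rule borel_Collect) measurable
  have S: "evol S <= ennreal (e / 2 / B)" unfolding S_def using d2(2) z by simp
  hence Sfin: "evol S < \<infinity>" by (simp add: le_less_trans)
  have mS: "vol S <= e / 2 / B"
   using S e B unfolding measure_def by (intro enn2real_leI) auto
  have F_eq: "ind E x * c x = ind F x * c x" for x
   using supp[of x] by (cases "norm x <= \<bar>r\<bar>") (auto simp: F_def indicator_def)
  have le: "\<bar>ind E (x + z) * c (x + z) - ind E x * c x\<bar> <= (e / 2 / V) * ind D x + B * ind S x" for x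
  proof -
   have c: "\<bar>c (x + z)\<bar> <= B" "\<bar>c x\<bar> <= B" using B(2)[of x] B(2)[of "x + z"] by auto
   have 1: "\<bar>ind F (x + z) * c (x + z) - ind F x * c x\<bar> <= B * ind S x" if "x \<in> S"
    using that c by (auto simp: S_def indicator_def)
   have 2: "\<bar>ind F (x + z) * c (x + z) - ind F x * c x\<bar> <= (e / 2 / V) * ind D x" if "x \<notin> S"
   proof (cases "x \<in> F")
    case True
    hence "x + z \<in> F" "x \<in> D" using that by (auto simp: S_def F_def D_def)
    thus ?thesis using True d1(2)[of "x + z" x] z by simp
   next
    case False
    thus ?thesis using that e V by (auto simp: S_def indicator_def)
   qed
   have "0 <= (e / 2 / V) * ind D x" "0 <= B * ind S x" using e V B by auto
   thus ?thesis unfolding F_eq using 1 2 by (cases "x \<in> S") auto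
  qed
  have int: "intg (\<lambda>x. (e / 2 / V) * ind D x + B * ind S x)"
   using Dfin Sfin by (intro Bochner_Integration.integrable_add integrable_mult_right integrable_real_indicator) auto
  have "intg (\<lambda>x. \<bar>ind E (x + z) * c (x + z) - ind E x * c x\<bar>)"
   by (rule int_bound[OF int]) (use order_trans[OF le abs_ge_self] in auto)
  hence "(LI x. \<bar>ind E (x + z) * c (x + z) - ind E x * c x\<bar>)
   <= (LI x. (e / 2 / V) * ind D x + B * ind S x)"
   using int le by (intro integral_mono) auto
  also have "... = (e / 2 / V) * vol D + B * vol S"
   using Dfin Sfin by (subst Bochner_Integration.integral_add) (auto intro!: integrable_mult_right integrable_real_indicator)
  also have "... <= (e / 2 / V) * V + B * (e / 2 / B)"
   using mS e V B by (intro add_mono mult_left_mono) (auto simp: V_def)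
  also have "... = e" using V B by simp
  finally show "(LI x. \<bar>ind E (x + z) * c (x + z) - ind E x * c x\<bar>) <= e" .
 qed (use d1 d2 in auto)
qed

text \<open>Fubini and a change of variables move the mollifier from \<open>g\<close> onto
  \<open>h\<close>. Only translations of \<open>h\<close> then have to be small in the mean, while
  \<open>g\<close> enters through its bound.\<close>

lemma conv_pairing:
 fixes h eh g :: "'a::euclidean_space => real"
 assumes [measurable]: "meas h" "meas eh" "meas g"
  and h: "!!x. \<bar>h x\<bar> <= B" "!!x. r < norm x ==> h x = 0"
  and eh: "!!z. 0 <= eh z" "!!z. eh z <= C" "!!z. d <= norm z ==> eh z = 0" "(LI z. eh z) = 1"
  and g: "!!x. \<bar>g x\<bar> <= M"
  and e: "!!z. norm z < d ==> (LI x. \<bar>h (x + z) - h x\<bar>) <= e"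
 shows "\<bar>(LI x. h x * conv eh g x) - (LI x. h x * g x)\<bar> <= M * e"
proof -
 have M0: "0 <= M" using g abs_ge_zero order_trans by blast
 have B0: "0 <= B" using h(1) abs_ge_zero order_trans by blast
 have C0: "0 <= C" using eh(1,2) order_trans by blast
 have ehi: "intg eh"
  using eh(1,2,3) by (intro integrable_support[where r=d and B=C]) auto
 have hi: "intg (\<lambda>x. h (x + z) * g x)" for z
 proof (rule integrable_support[where r="\<bar>r\<bar> + norm z" and B="B * M"])
  fix x :: 'a assume "\<bar>r\<bar> + norm z < norm x"
  hence "r < norm (x + z)" using norm_diff_ineq[of x z] by simp
  thus "h (x + z) * g x = 0" using h by simp
 next
  show "norm (h (x + z) * g x) <= B * M" for x
   using h(1)[of "x + z"] g[of x] B0 by (auto simp: abs_mult intro!: mult_mono)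
 qed simp
 have "intg (\<lambda>p::'a \<times> 'a. h (fst p) * (eh (snd p) * g (fst p - snd p)))"
 proof (rule integrable_support[where r="\<bar>r\<bar> + \<bar>d\<bar>" and B="B * (C * M)"])
  show "meas (\<lambda>p::'a \<times> 'a. h (fst p) * (eh (snd p) * g (fst p - snd p)))"
   unfolding borel_prod[symmetric] by measurable
  fix p :: "'a \<times> 'a" assume "\<bar>r\<bar> + \<bar>d\<bar> < norm p"
  hence "\<bar>r\<bar> < norm (fst p) \<or> \<bar>d\<bar> < norm (snd p)"
   using norm_Pair_le[of "fst p" "snd p"] by auto
  hence "r < norm (fst p) \<or> d <= norm (snd p)" by linarith
  thus "h (fst p) * (eh (snd p) * g (fst p - snd p)) = 0" using h(2)[of "fst p"] eh(3)[of "snd p"] by auto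
 next
  fix p :: "'a \<times> 'a"
  have "\<bar>h (fst p)\<bar> * (\<bar>eh (snd p)\<bar> * \<bar>g (fst p - snd p)\<bar>) <= B * (C * M)"
   using h(1)[of "fst p"] eh(1,2)[of "snd p"] g[of "fst p - snd p"] B0 C0 M0 by (intro mult_mono) auto
  thus "norm (h (fst p) * (eh (snd p) * g (fst p - snd p))) <= B * (C * M)" by (simp add: abs_mult)
 qed
 hence int: "integrable (lborel \<Otimes>\<^sub>M lborel) (\<lambda>(x, z). h x * (eh z * g (x - z)))"
  by (simp add: lborel_prod case_prod_beta')
 have gi: "intg (\<lambda>x. h x * g x)" using hi[of 0] by simp
 have "(LI x. h x * conv eh g x) = (LI x. (LI z. h x * (eh z * g (x - z))))"
  by (simp add: conv_def)
 also have "... = (LI z. (LI x. h x * (eh z * g (x - z))))"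
  using lborel_pair.Fubini_integral[OF int] by simp
 also have "... = (LI z. eh z * (LI x. h (x + z) * g x))"
 proof (intro Bochner_Integration.integral_cong refl)
  fix z
  have "(LI x. h x * (eh z * g (x - z))) = (LI x. h (x + z) * (eh z * g (x + z - z)))"
   by (rule integral_translate[symmetric]) simp
  also have "... = (LI x. eh z * (h (x + z) * g x))" by (simp add: mult_ac)
  finally show "(LI x. h x * (eh z * g (x - z))) = eh z * (LI x. h (x + z) * g x)" by simp
 qed
 finally have 1: "(LI x. h x * conv eh g x) = (LI z. eh z * (LI x. h (x + z) * g x))" .
 define k where "k z = (LI x. h (x + z) * g x) - (LI x. h x * g x)" for z
 have [measurable]: "meas (\<lambda>z. LI x. h (x + z) * g x)" by measurable
 have [measurable]: "meas k" unfolding k_def by measurable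
 have k: "\<bar>k z\<bar> <= M * e" if "norm z < d" for z
 proof -
  have h1: "intg h"
   using h by (intro integrable_support[where r=r and B=B]) auto
  have h2: "intg (\<lambda>x. h (x + z))"
   using h by (intro integrable_support[where r="\<bar>r\<bar> + norm z" and B=B]) (auto intro: h(2) simp: less_le_trans[OF _ norm_diff_ineq])
  have "k z = (LI x. (h (x + z) - h x) * g x)"
   unfolding k_def using hi[of z] gi by (simp add: left_diff_distrib)
  also have "\<bar>...\<bar> <= (LI x. \<bar>(h (x + z) - h x) * g x\<bar>)"
   using integral_norm_bound[of lborel "\<lambda>x. (h (x + z) - h x) * g x"] by simp
  also have "... <= (LI x. M * \<bar>h (x + z) - h x\<bar>)"
  proof (rule integral_mono)
   show "intg (\<lambda>x. \<bar>(h (x + z) - h x) * g x\<bar>)"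
    using Bochner_Integration.integrable_diff[OF hi[of z] gi] by (simp add: left_diff_distrib)
   show "intg (\<lambda>x. M * \<bar>h (x + z) - h x\<bar>)"
    using h1 h2 by (intro integrable_mult_right integrable_abs Bochner_Integration.integrable_diff)
   show "\<bar>(h (x + z) - h x) * g x\<bar> <= M * \<bar>h (x + z) - h x\<bar>" for x
    using g[of x] by (simp add: abs_mult mult.commute mult_right_mono)
  qed
  also have "... <= M * e" using e[OF that] M0 by (simp add: mult_left_mono)
  finally show ?thesis .
 qed
 have "d > 0"
 proof (rule ccontr)
  assume "\<not> d > 0"
  hence "eh z = 0" for z using eh(3)[of z] norm_ge_zero[of z] by linarith
  thus False using eh(4) by simp
 qed
 hence e0: "0 <= M * e" using k[of 0] abs_ge_zero order_trans by fastforce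
 define A0 where "A0 = (LI x. h x * g x)"
 have Ak: "(LI x. h (x + z) * g x) = A0 + k z" for z by (simp add: k_def A0_def)
 have ehk: "\<bar>eh z * k z\<bar> <= eh z * (M * e)" for z
  using k[of z] eh(1)[of z] eh(3)[of z] by (cases "norm z < d") (auto simp: abs_mult intro!: mult_left_mono)
 have ki: "intg (\<lambda>z. eh z * k z)"
  by (rule int_bound[OF integrable_mult_left[OF ehi, of "M * e"]])
    (use ehk in \<open>auto intro: order_trans[OF _ abs_ge_self]\<close>)
 have "(LI x. h x * conv eh g x) = (LI z. eh z * A0 + eh z * k z)"
  unfolding 1 Ak by (simp add: distrib_left)
 also have "... = A0 + (LI z. eh z * k z)"
  using ehi ki eh(4) by (subst Bochner_Integration.integral_add) auto
 finally have "\<bar>(LI x. h x * conv eh g x) - A0\<bar> = \<bar>LI z. eh z * k z\<bar>" by simp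
 also have "... <= (LI z. \<bar>eh z * k z\<bar>)"
  using integral_norm_bound[of lborel "\<lambda>z. eh z * k z"] by simp
 also have "... <= (LI z. eh z * (M * e))"
  using ki ehi ehk by (intro integral_mono) auto
 also have "... = M * e" using eh(4) by simp
 finally show ?thesis by (simp add: A0_def)
qed

text \<open>Averaging with a nonnegative kernel preserves the increment inequality. After averaging,
  the left integrand is continuous and the right side differentiable, so dividing by
  \<open>s\<close> gives a pointwise inequality.\<close>

lemma conv_increment:
 fixes eh t g :: "'a::euclidean_space => real"
 assumes eh: "C1c eh deh r" "!!z. 0 <= eh z"
  and t [measurable]: "meas t" "!!x. \<bar>t x\<bar> <= M"
  and g [measurable]: "meas g" "!!x. \<bar>g x\<bar> <= M"
  and inc: "!!x s. 0 <= s ==> (LINT u:{0..s}|lborel. g (x + u *\<^sub>R b)) <= t (x + s *\<^sub>R b) - t x"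
  and b: "b \<in> Basis"
 shows "conv eh g x <= conv (\<lambda>z. deh z \<bullet> b) t x"
proof -
 interpret C1c eh deh r by (rule eh)
 have M0: "0 <= M" using g(2) abs_ge_zero order_trans by blast
 have [measurable]: "meas eh" using cont by (rule cont_meas)
 obtain B where B: "B > 0" "!!z. norm (eh z) <= B" using bounded_support[OF cont support] by blast
 define G where "G = conv eh g"
 have Gc: "continuous_on UNIV G" unfolding G_def by (rule conv_continuous[OF cont support g])
 have inc': "(LINT u:{0..s}|lborel. G (x + u *\<^sub>R b)) <= conv eh t (x + s *\<^sub>R b) - conv eh t x" if s: "0 <= s" for s
 proof -
  have "intg (\<lambda>p::real \<times> 'a. ind {0..s} (fst p) * (eh (snd p) * g (x + fst p *\<^sub>R b - snd p)))"
  proof (rule integrable_support[where r="s + \<bar>r\<bar>" and B="B * M"])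
   show "meas (\<lambda>p::real \<times> 'a. ind {0..s} (fst p) * (eh (snd p) * g (x + fst p *\<^sub>R b - snd p)))"
    unfolding borel_prod[symmetric] by measurable
   fix p :: "real \<times> 'a" assume "s + \<bar>r\<bar> < norm p"
   hence "s < norm (fst p) \<or> \<bar>r\<bar> < norm (snd p)"
    using norm_Pair_le[of "fst p" "snd p"] by auto
   thus "ind {0..s} (fst p) * (eh (snd p) * g (x + fst p *\<^sub>R b - snd p)) = 0"
    using support[of "snd p"] by (auto simp: indicator_def)
  next
   fix p :: "real \<times> 'a"
   have "\<bar>eh (snd p)\<bar> * \<bar>g (x + fst p *\<^sub>R b - snd p)\<bar> <= B * M"
    using B(2)[of "snd p"] B(1) g(2) by (intro mult_mono) auto
   thus "norm (ind {0..s} (fst p) * (eh (snd p) * g (x + fst p *\<^sub>R b - snd p))) <= B * M"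
    using B M0 by (auto simp: abs_mult indicator_def)
  qed
  hence int: "integrable (lborel \<Otimes>\<^sub>M lborel) (\<lambda>(u, z). ind {0..s} u * (eh z * g (x + u *\<^sub>R b - z)))"
   by (simp add: lborel_prod case_prod_beta')
  have int': "intg (\<lambda>z. LI u. ind {0..s} u * (eh z * g (x + u *\<^sub>R b - z)))"
   using lborel_pair.integrable_snd[OF int] by simp
  have i1: "intg (\<lambda>z. eh z * t (x - z))" for x
   by (rule conv_integrable[OF cont support t])
  have "(LINT u:{0..s}|lborel. G (x + u *\<^sub>R b)) = (LI u. (LI z. ind {0..s} u * (eh z * g (x + u *\<^sub>R b - z))))"
   by (simp add: set_int_def G_def conv_def)
  also have "... = (LI z. (LI u. ind {0..s} u * (eh z * g (x + u *\<^sub>R b - z))))"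
   using lborel_pair.Fubini_integral[OF int] by simp
  also have "... <= (LI z. eh z * t (x + s *\<^sub>R b - z) - eh z * t (x - z))"
  proof (rule integral_mono[OF int'])
   show "intg (\<lambda>z. eh z * t (x + s *\<^sub>R b - z) - eh z * t (x - z))"
    using i1 by (intro Bochner_Integration.integrable_diff)
   fix z
   have "(LI u. ind {0..s} u * (eh z * g (x + u *\<^sub>R b - z))) = eh z * (LINT u:{0..s}|lborel. g ((x - z) + u *\<^sub>R b))"
    unfolding set_int_def by (subst integral_mult_right_zero[symmetric]) (simp add: algebra_simps)
   also have "... <= eh z * (t ((x - z) + s *\<^sub>R b) - t (x - z))"
    using inc[OF s] eh(2) by (intro mult_left_mono) auto
   also have "... = eh z * t (x + s *\<^sub>R b - z) - eh z * t (x - z)" by (simp add: algebra_simps)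
   finally show "(LI u. ind {0..s} u * (eh z * g (x + u *\<^sub>R b - z))) <= eh z * t (x + s *\<^sub>R b - z) - eh z * t (x - z)" .
  qed
  also have "... = conv eh t (x + s *\<^sub>R b) - conv eh t x"
   using i1 by (simp add: conv_def)
  finally show ?thesis .
 qed
 have D: "((\<lambda>s. conv eh t (x + s *\<^sub>R b)) has_real_derivative conv (\<lambda>z. deh z \<bullet> b) t x) (at 0)"
 proof -
  have "((\<lambda>s. x + s *\<^sub>R b) has_derivative (\<lambda>s. s *\<^sub>R b)) (at (0::real))"
   by (auto intro!: derivative_eq_intros)
  from has_derivative_compose[OF this, of "conv eh t" "\<lambda>h. \<Sum>b\<in>Basis. (h \<bullet> b) * conv (\<lambda>z. deh z \<bullet> b) t x"] conv_has_derivative[OF t, of x]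
  have "((\<lambda>s. conv eh t (x + s *\<^sub>R b)) has_derivative (\<lambda>s. \<Sum>b'\<in>Basis. (s *\<^sub>R b \<bullet> b') * conv (\<lambda>z. deh z \<bullet> b') t x)) (at 0)"
   by simp
  moreover have "(\<Sum>b'\<in>Basis. (s *\<^sub>R b \<bullet> b') * conv (\<lambda>z. deh z \<bullet> b') t x) = s * conv (\<lambda>z. deh z \<bullet> b) t x" for s
  proof -
   have "(\<Sum>b'\<in>Basis. (s *\<^sub>R b \<bullet> b') * conv (\<lambda>z. deh z \<bullet> b') t x) = (\<Sum>b'\<in>Basis. if b' = b then s * conv (\<lambda>z. deh z \<bullet> b') t x else 0)"
    using b by (intro sum.cong) (auto simp: inner_Basis)
   thus ?thesis using b by simp
  qed
  ultimately show ?thesis by (simp add: has_field_derivative_def mult.commute[of _ "conv (\<lambda>z. deh z \<bullet> b) t x"])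
 qed
 have "G x <= conv (\<lambda>z. deh z \<bullet> b) t x"
 proof (rule field_le_epsilon)
  fix e :: real assume e: "e > 0"
  obtain d where d: "d > 0" "!!y. dist y x < d ==> dist (G y) (G x) < e"
   using Gc e unfolding continuous_on_iff by (metis UNIV_I)
  have lim: "((\<lambda>s. (conv eh t (x + s *\<^sub>R b) - conv eh t x) / s) \<longlongrightarrow> conv (\<lambda>z. deh z \<bullet> b) t x) (at_right 0)"
   using D by (simp add: has_field_derivative_iff filterlim_at_split)
  have ev: "\<forall>\<^sub>F s in at_right 0. G x - e <= (conv eh t (x + s *\<^sub>R b) - conv eh t x) / s"
   unfolding eventually_at_right_field
  proof (intro exI[of _ d] conjI allI impI)
   fix s :: real assume s: "0 < s" "s < d"
   have "s * (G x - e) = (LINT u:{0..s}|lborel. G x - e)"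
    using s by (simp add: set_int_def)
   also have "... <= (LINT u:{0..s}|lborel. G (x + u *\<^sub>R b))"
   proof (rule set_integral_mono)
    show "set_integrable lborel {0..s} (\<lambda>u. G x - e)"
     by (intro borel_integrable_atLeastAtMost' continuous_intros)
    show "set_integrable lborel {0..s} (\<lambda>u. G (x + u *\<^sub>R b))"
     by (intro borel_integrable_atLeastAtMost' continuous_intros continuous_on_compose2[OF Gc]) auto
    fix u assume "u \<in> {0..s}"
    hence "dist (x + u *\<^sub>R b) x < d" using s b by (simp add: dist_norm)
    thus "G x - e <= G (x + u *\<^sub>R b)" using d(2) by (force simp: dist_real_def abs_diff_less_iff)
   qed
   also have "... <= conv eh t (x + s *\<^sub>R b) - conv eh t x" using inc' s by simp
   finally show "G x - e <= (conv eh t (x + s *\<^sub>R b) - conv eh t x) / s"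
    using s by (simp add: field_simps)
  qed (use d in auto)
  have "G x - e <= conv (\<lambda>z. deh z \<bullet> b) t x"
   by (rule tendsto_lowerbound[OF lim ev]) simp
  thus "G x <= conv (\<lambda>z. deh z \<bullet> b) t x + e" by simp
 qed
 thus ?thesis by (simp add: G_def)
qed

lemma C1c_bump: "0 < r ==> C1c (bump r) (grad_bump r) r"
 by unfold_locales (auto intro: bump_has_derivative continuous_grad_bump bump_outside)

lemma C1c_scale:
 assumes "C1c c dc r" shows "C1c (\<lambda>z. a * c z) (\<lambda>z. a *\<^sub>R dc z) r"
proof -
 interpret C1c c dc r by fact
 show ?thesis
 proof
  show "((\<lambda>z. a * c z) has_derivative (\<bullet>) (a *\<^sub>R dc z)) (at z)" for z
   using has_derivative_mult_right[OF deriv, of a z] unfolding inner_scaleR_left by simp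
  show "continuous_on UNIV (\<lambda>z. a *\<^sub>R dc z)"
   using cont_d by (intro continuous_intros)
 qed (simp add: support)
qed

lemma mollifier_exists:
 assumes d: "(d::real) > 0"
 obtains eh :: "'a::euclidean_space => real" and deh C where "C1c eh deh d" "!!z. 0 <= eh z" "!!z. eh z <= C"
  "!!z. d <= norm z ==> eh z = 0" "(LI z. eh z) = 1"
proof -
 define Z where "Z = (LI z. bump d (z::'a))"
 have m [measurable]: "bump d \<in> borel_measurable (borel :: 'a measure)"
  by (rule cont_meas[OF continuous_bump])
 have int: "intg (bump d :: 'a => real)"
  using d by (intro integrable_support[where r=d and B=1]) (auto simp: bump_outside abs_of_nonneg bump_range)
 \<comment> \<open>On the ball of half the radius the argument of \<open>qp\<close> is at least 3/4,
   whose square is 9/16.\<close>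
 have "(LI z. (9 / 16) * ind (ball (0::'a) (d/2)) z) <= Z"
  unfolding Z_def
 proof (rule integral_mono[OF _ int])
  show "intg (\<lambda>z. (9 / 16) * ind (ball (0::'a) (d/2)) z :: real)"
   using emeasure_lborel_ball_finite[of "0::'a" "d/2"] by (intro integrable_mult_right integrable_real_indicator) auto
  fix z :: 'a
  show "(9 / 16) * ind (ball 0 (d/2)) z <= bump d z"
  proof (cases "z \<in> ball 0 (d/2)")
   case True
   hence "norm z ^ 2 <= (d/2)^2" by (intro power_mono) auto
   hence "(z \<bullet> z) / d\<^sup>2 <= 1 / 4" using d by (simp add: power2_norm_eq_inner field_simps power_divide)
   hence "3 / 4 <= max 0 (1 - (z \<bullet> z) / d\<^sup>2)" by linarith
   hence "(3/4)\<^sup>2 <= (max 0 (1 - (z \<bullet> z) / d\<^sup>2))\<^sup>2" by (rule power_mono) simp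
   thus ?thesis using True by (simp add: bump_def qp_def power2_eq_square)
  qed (simp add: bump_range)
 qed
 moreover have "0 < vol (ball (0::'a) (d/2))" using d content_ball_pos[of "d/2" "0::'a"] by simp
 ultimately have Z: "Z > 0" by (simp, linarith)
 show ?thesis
 proof (rule that[of "\<lambda>z. (1 / Z) * bump d z" "\<lambda>z. (1 / Z) *\<^sub>R grad_bump d z" "1 / Z"])
  show "C1c (\<lambda>z. (1 / Z) * bump d z) (\<lambda>z. (1 / Z) *\<^sub>R grad_bump d z) d"
   by (rule C1c_scale[OF C1c_bump[OF d]])
  show "(1 / Z) * bump d z <= 1 / Z" for z
   using Z bump_range(2)[of d z] by (simp add: divide_right_mono)
  show "(LINT z::'a|lborel. (1 / Z) * bump d z) = 1"
   using Z by (subst integral_mult_right_zero) (simp add: Z_def)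
 qed (use Z d in \<open>auto simp: bump_outside bump_range\<close>)
qed

lemma has_derivative_vec_lambda:
 fixes f :: "'n::finite => 'a::euclidean_space => real"
 assumes "!!i. (f i has_derivative f' i) (at x)"
 shows "((\<lambda>x. \<chi> i. f i x) has_derivative (\<lambda>h. \<chi> i. f' i h)) (at x)"
 by (subst has_derivative_componentwise_within) (auto simp: Basis_vec_def inner_axis intro: assms)

lemma partial_derivI:
 assumes "(ph has_derivative D) (at x)" shows "partial_deriv i ph x = D (axis i 1)"
 unfolding partial_deriv_def using frechet_derivative_at[OF assms] by simp

text \<open>Pairing the average with itself and applying Cauchy-Schwarz under the integral bounds
  its squared norm by its norm.\<close>

lemma norm_conv_le:
 fixes T :: "real^'n::finite => real^'n"
 assumes eh: "C1c eh deh r" "!!z. 0 <= eh z" "(LI z. eh z) = 1"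
  and T [measurable]: "meas T" "!!x. norm (T x) <= 1"
 shows "norm (\<chi> i. conv eh (\<lambda>y. T y $ i) x) <= 1"
proof -
 interpret C1c eh deh r by fact
 define F where "F = (\<chi> i. conv eh (\<lambda>y. T y $ i) x)"
 have Ti: "\<bar>T y $ i\<bar> <= 1" for y i using component_le_norm_cart[of "T y" i] T(2)[of y] by simp
 have int: "intg (\<lambda>z. eh z * T (x - z) $ i)" for i
  by (rule conv_integrable(1)[OF cont support, where t="\<lambda>y. T y $ i" and M=1]) (use Ti in auto)
 have ehi: "intg eh"
  using conv_integrable(1)[OF cont support, where t="\<lambda>_. 1" and M=1 and x=x] by simp
 have "(norm F)\<^sup>2 = (\<Sum>i\<in>UNIV. F $ i * (LI z. eh z * T (x - z) $ i))"
  by (simp add: power2_norm_eq_inner inner_vec_def F_def conv_def)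
 also have "... = (LI z. (\<Sum>i\<in>UNIV. F $ i * (eh z * T (x - z) $ i)))"
  using int by (subst Bochner_Integration.integral_sum) auto
 also have "... = (LI z. eh z * (F \<bullet> T (x - z)))"
  by (simp add: inner_vec_def sum_distrib_left mult_ac)
 also have "... <= (LI z. eh z * norm F)"
 proof (rule integral_mono)
  have "intg (\<lambda>z. (\<Sum>i\<in>UNIV. F $ i * (eh z * T (x - z) $ i)))"
   using int by (intro Bochner_Integration.integrable_sum integrable_mult_right)
  thus "intg (\<lambda>z. eh z * (F \<bullet> T (x - z)))"
   by (simp add: inner_vec_def sum_distrib_left mult_ac)
  show "intg (\<lambda>z. eh z * norm F)" using ehi by simp
  fix z
  have "F \<bullet> T (x - z) <= norm F * norm (T (x - z))" by (rule norm_cauchy_schwarz)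
  also have "... <= norm F * 1" using T(2) by (intro mult_left_mono) auto
  finally show "eh z * (F \<bullet> T (x - z)) <= eh z * norm F" using eh(2) by (simp add: mult_left_mono)
 qed
 also have "... = norm F" using eh(3) by simp
 finally have "norm F * norm F <= norm F * 1" by (simp add: power2_eq_square)
 hence "norm F <= 1"
  by (cases "norm F = 0") (auto dest: mult_left_le_imp_le)
 thus ?thesis by (simp add: F_def)
qed

section \<open>Testing the perimeter with fields that are not smooth\<close>

lemma perimeter_ge_test:
 assumes "ph \<in> test_fields A" shows "ennreal (LINT x:\<Omega>|lebesgue. div_field ph x) <= perimeter \<Omega> A"
 unfolding perimeter_def using assms by (rule SUP_upper)

lemma L1_translate_eventually:
 fixes c :: "'a::euclidean_space => real"
 assumes "E \<in> sets borel" "continuous_on UNIV c" "!!z. r < norm z ==> c z = 0" "e > 0"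
 shows "\<forall>\<^sub>F d in at_right 0. \<forall>z. norm z < d --> (LI x. \<bar>ind E (x + z) * c (x + z) - ind E x * c x\<bar>) <= e"
proof -
 obtain d where "d > 0" "!!z. norm z < d ==> (LI x. \<bar>ind E (x + z) * c (x + z) - ind E x * c x\<bar>) <= e"
  using L1_translate_small[OF assms] by blast
 thus ?thesis unfolding eventually_at_right_field by (auto intro!: exI[of _ d])
qed

text \<open>The perimeter may be tested with fields whose components are monotone up to a bounded density
 in their own variable only; mollification turns them into smooth fields and the singular part of
 the divergence has the good sign.\<close>

theorem perimeter_ge:
 fixes E A :: "(real^'n::finite) set" and T :: "real^'n => real^'n" and g :: "'n => real^'n => real"
 assumes E [measurable]: "E \<in> sets borel"
  and zt: "C1c zt dzt r" "!!x. 0 <= zt x" "!!x. zt x <= 1" "closure {x. zt x ~= 0} \<subseteq> A"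
  and T [measurable]: "meas T" "!!x. norm (T x) <= 1"
  and g [measurable]: "!!i. meas (g i)" "!!i x. \<bar>g i x\<bar> <= M"
  and inc: "!!i x s. 0 <= s ==> (LINT u:{0..s}|lborel. g i (x + u *\<^sub>R axis i 1)) <= T (x + s *\<^sub>R axis i 1) $ i - T x $ i"
 shows "ennreal (LI x. ind E x * (zt x * (\<Sum>i\<in>UNIV. g i x) + dzt x \<bullet> T x)) <= perimeter E A"
proof -
 interpret Z: C1c zt dzt r by fact
 define m where "m = max M 1"
 have m: "m \<ge> 1" by (simp add: m_def)
 have g': "\<bar>g i x\<bar> <= m" for i x using g(2)[of i x] by (simp add: m_def)
 have Ti: "\<bar>T y $ i\<bar> <= 1" for y i using component_le_norm_cart[of "T y" i] T(2)[of y] by simp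
 hence Ti': "\<bar>T y $ i\<bar> <= m" for y i using m order_trans by blast
 have T_meas [measurable]: "meas (\<lambda>y. T y $ i)" for i by measurable
 note [measurable] = cont_meas[OF Z.cont] cont_meas[OF Z.cont_d]
 have dzi: "continuous_on UNIV (\<lambda>x. dzt x $ i)" "!!x. r < norm x ==> dzt x $ i = 0" for i
  using Z.cont_d Z.support_d by (auto intro!: continuous_intros)
 obtain B1 where B1: "!!x. norm (dzt x) <= B1"
  using bounded_support[OF Z.cont_d Z.support_d] by blast
 have B1i: "\<bar>dzt x $ i\<bar> <= B1" for x i using component_le_norm_cart[of "dzt x" i] B1[of x] by simp
 define L where "L = (LI x. ind E x * (zt x * (\<Sum>i\<in>UNIV. g i x) + dzt x \<bullet> T x))"
 have h1: "intg (\<lambda>x. ind E x * zt x * f x)" "intg (\<lambda>x. ind E x * dzt x $ i * f x)"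
  if [measurable]: "meas f" and f: "!!x. \<bar>f x\<bar> <= Q" for f Q i
 proof -
  have Q: "0 <= Q" using f abs_ge_zero order_trans by blast
  have "\<bar>zt x\<bar> * \<bar>f x\<bar> <= 1 * Q" for x using zt(2,3)[of x] f[of x] Q by (intro mult_mono) auto
  thus "intg (\<lambda>x. ind E x * zt x * f x)"
   using Z.support Q by (intro integrable_support[where r=r and B=Q]) (auto simp: indicator_def abs_mult)
  have "\<bar>dzt x $ i\<bar> * \<bar>f x\<bar> <= B1 * Q" for x using B1i[of x i] f[of x] Q by (intro mult_mono) auto
  moreover have "0 <= B1 * Q" using Q B1 norm_ge_zero order_trans by (metis mult_nonneg_nonneg)
  ultimately show "intg (\<lambda>x. ind E x * dzt x $ i * f x)"
   using dzi(2) by (intro integrable_support[where r=r and B="B1 * Q"]) (auto simp: indicator_def abs_mult)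
 qed
 have expand: "(LI x. ind E x * (zt x * (\<Sum>i\<in>UNIV. a i x) + dzt x \<bullet> (\<chi> i. b i x)))
   = (\<Sum>i\<in>UNIV. (LI x. ind E x * zt x * a i x)) + (\<Sum>i\<in>UNIV. (LI x. ind E x * dzt x $ i * b i x))"
  and expand_int: "intg (\<lambda>x. ind E x * (zt x * (\<Sum>i\<in>UNIV. a i x) + dzt x \<bullet> (\<chi> i. b i x)))"
  if "!!i. meas (a i)" "!!i. meas (b i)" "!!i x. \<bar>a i x\<bar> <= Q" "!!i x. \<bar>b i x\<bar> <= Q"
  for a b :: "'n => real^'n => real" and Q
 proof -
  have eq: "ind E x * (zt x * (\<Sum>i\<in>UNIV. a i x) + dzt x \<bullet> (\<chi> i. b i x)) =
    (\<Sum>i\<in>UNIV. ind E x * zt x * a i x) + (\<Sum>i\<in>UNIV. ind E x * dzt x $ i * b i x)" for x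
   by (simp add: inner_vec_def distrib_left sum_distrib_left mult.assoc)
  have i1: "intg (\<lambda>x. ind E x * zt x * a i x)" "intg (\<lambda>x. ind E x * dzt x $ i * b i x)" for i
   using h1(1)[OF that(1,3)] h1(2)[OF that(2,4)] by auto
  show "intg (\<lambda>x. ind E x * (zt x * (\<Sum>i\<in>UNIV. a i x) + dzt x \<bullet> (\<chi> i. b i x)))"
   unfolding eq using i1 by (intro Bochner_Integration.integrable_add Bochner_Integration.integrable_sum)
  show "(LI x. ind E x * (zt x * (\<Sum>i\<in>UNIV. a i x) + dzt x \<bullet> (\<chi> i. b i x)))
   = (\<Sum>i\<in>UNIV. (LI x. ind E x * zt x * a i x)) + (\<Sum>i\<in>UNIV. (LI x. ind E x * dzt x $ i * b i x))"
   unfolding eq using i1 by (simp add: Bochner_Integration.integral_add Bochner_Integration.integrable_sum Bochner_Integration.integral_sum)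
 qed
 have L: "L = (\<Sum>i\<in>UNIV. (LI x. ind E x * zt x * g i x)) + (\<Sum>i\<in>UNIV. (LI x. ind E x * dzt x $ i * T x $ i))"
  unfolding L_def using expand[where a=g and b="\<lambda>i x. T x $ i" and Q=m] g(1) T_meas g' Ti' by simp
 have main: "ennreal (L - e) <= perimeter E A" if e: "e > 0" for e
 proof -
  define N where "N = real CARD('n)"
  have N: "N \<ge> 1" by (simp add: N_def Suc_leI)
  \<comment> \<open>Each of the \<open>2 * N\<close> pairings below contributes an error of at most
    \<open>m * q\<close>, in total \<open>e\<close>.\<close>
  define q where "q = e / (2 * N * m)"
  have q: "q > 0" using e N m by (simp add: q_def)
  have ev1: "\<forall>\<^sub>F d in at_right 0. \<forall>z. norm z < d --> (LI x. \<bar>ind E (x + z) * zt (x + z) - ind E x * zt x\<bar>) <= q"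
   by (rule L1_translate_eventually[OF E Z.cont Z.support q])
  have ev2: "\<forall>\<^sub>F d in at_right 0. \<forall>i\<in>UNIV. \<forall>z. norm z < d --> (LI x. \<bar>ind E (x + z) * dzt (x + z) $ i - ind E x * dzt x $ i\<bar>) <= q"
   by (intro eventually_ball_finite finite ballI L1_translate_eventually[OF E dzi q]) auto
  obtain d where d: "d > 0"
   and d1: "!!z. norm z < d ==> (LI x. \<bar>ind E (x + z) * zt (x + z) - ind E x * zt x\<bar>) <= q"
   and d2: "!!i z. norm z < d ==> (LI x. \<bar>ind E (x + z) * dzt (x + z) $ i - ind E x * dzt x $ i\<bar>) <= q"
  proof -
   have "\<forall>\<^sub>F d in at_right (0::real). d > 0" by (simp add: eventually_at_right_less)
   with ev1 ev2 have "\<forall>\<^sub>F d in at_right 0. d > 0 \<and> (\<forall>z. norm z < d --> (LI x. \<bar>ind E (x + z) * zt (x + z) - ind E x * zt x\<bar>) <= q)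
     \<and> (\<forall>i\<in>UNIV. \<forall>z. norm z < d --> (LI x. \<bar>ind E (x + z) * dzt (x + z) $ i - ind E x * dzt x $ i\<bar>) <= q)"
    by eventually_elim auto
   then obtain d where "d > 0 \<and> (\<forall>z. norm z < d --> (LI x. \<bar>ind E (x + z) * zt (x + z) - ind E x * zt x\<bar>) <= q)
     \<and> (\<forall>i\<in>UNIV. \<forall>z. norm z < d --> (LI x. \<bar>ind E (x + z) * dzt (x + z) $ i - ind E x * dzt x $ i\<bar>) <= q)"
    by (auto dest: eventually_happens)
   thus ?thesis by (intro that[of d]) auto
  qed
  obtain eh :: "real^'n => real" and deh C where eh: "C1c eh deh d" "!!z. 0 <= eh z" "!!z. eh z <= C" "!!z. d <= norm z ==> eh z = 0" "(LI z. eh z) = 1"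
   using mollifier_exists[OF d, where 'a="real^'n"] by blast
  interpret H: C1c eh deh d by fact
  have [measurable]: "meas eh" by (rule cont_meas[OF H.cont])
  define F where "F x = (\<chi> i. conv eh (\<lambda>y. T y $ i) x)" for x
  define DF where "DF x h = (\<chi> i. \<Sum>b\<in>Basis. (h \<bullet> b) * conv (\<lambda>z. deh z \<bullet> b) (\<lambda>y. T y $ i) x)" for x h
  \<comment> \<open>Mollifying first and multiplying by the cut-off afterwards keeps the support
    inside that of \<open>zt\<close>, hence in \<open>A\<close>, however wide the mollifier.\<close>
  define ph where "ph x = zt x *\<^sub>R F x" for x
  have F_der: "(F has_derivative DF x) (at x)" for x
   unfolding F_def[abs_def] DF_def[abs_def] by (intro has_derivative_vec_lambda H.conv_has_derivative[OF T_meas Ti])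
  have ph_der: "(ph has_derivative (\<lambda>h. zt x *\<^sub>R DF x h + (dzt x \<bullet> h) *\<^sub>R F x)) (at x)" for x
   unfolding ph_def[abs_def] by (rule has_derivative_scaleR[OF Z.deriv F_der])
  have Bax: "axis i (1::real) \<in> Basis" for i :: 'n by (simp add: axis_in_Basis_iff)
  have DF_ax: "DF x (axis i 1) = (\<chi> j. conv (\<lambda>z. deh z $ i) (\<lambda>y. T y $ j) x)" for x i
  proof -
   have "(\<Sum>b\<in>Basis. (axis i 1 \<bullet> b) * conv (\<lambda>z. deh z \<bullet> b) (\<lambda>y. T y $ j) x) = (\<Sum>b\<in>Basis. if b = axis i 1 then conv (\<lambda>z. deh z \<bullet> b) (\<lambda>y. T y $ j) x else 0)" for j
    using Bax by (intro sum.cong) (auto simp: inner_Basis)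
   thus ?thesis using Bax by (simp add: DF_def inner_axis)
  qed
  have pd: "partial_deriv i ph x = zt x *\<^sub>R (\<chi> j. conv (\<lambda>z. deh z $ i) (\<lambda>y. T y $ j) x) + (dzt x $ i) *\<^sub>R F x" for i x
   using partial_derivI[OF ph_der] by (simp add: DF_ax inner_axis)
  have dehi: "continuous_on UNIV (\<lambda>z. deh z $ i)" "!!z. d < norm z ==> deh z $ i = 0" for i
   using H.cont_d H.support_d by (auto intro!: continuous_intros)
  have F_cont: "continuous_on UNIV F"
   unfolding F_def[abs_def] by (intro continuous_on_vec_lambda conv_continuous[OF H.cont H.support T_meas Ti])
  have pd_cont: "continuous_on UNIV (partial_deriv i ph)" for i
   unfolding pd[abs_def] using Z.cont dzi(1) F_cont
   by (intro continuous_on_add continuous_on_scaleR continuous_on_vec_lambda conv_continuous[OF dehi T_meas Ti])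
  have F1: "norm (F x) <= 1" for x
   unfolding F_def by (rule norm_conv_le[OF eh(1,2,5) T])
  have supp: "{x. ph x ~= 0} \<subseteq> {x. zt x ~= 0}" by (auto simp: ph_def)
  have "ph \<in> test_fields A"
   unfolding test_fields_def
  proof (safe intro!: differentiableI[OF ph_der] pd_cont)
   have "{x. zt x ~= 0} \<subseteq> cball 0 r" using Z.support by (force simp: not_less[symmetric])
   thus "compact (closure {x. ph x ~= 0})"
    using supp by (intro compact_closure[THEN iffD2] bounded_subset[OF bounded_cball]) blast
   show "x \<in> A" if "x \<in> closure {x. ph x ~= 0}" for x
    using closure_mono[OF supp] zt(4) that by blast
   show "norm (ph x) <= 1" for x
    using F1[of x] zt(2,3)[of x] by (simp add: ph_def mult_le_one)
  qed
  hence per: "ennreal (LINT x:E|lebesgue. div_field ph x) <= perimeter E A" by (rule perimeter_ge_test)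
  have div: "div_field ph x = zt x * (\<Sum>i\<in>UNIV. conv (\<lambda>z. deh z $ i) (\<lambda>y. T y $ i) x) + dzt x \<bullet> F x" for x
   unfolding div_field_def pd by (simp add: sum.distrib sum_distrib_left inner_vec_def)
  have gm: "meas (\<lambda>x. conv c t x)" if "continuous_on UNIV c" "meas t" for c t :: "real^'n => real"
   using that cont_meas by (intro measurable_conv) auto
  have conv_bd: "\<exists>Q. \<forall>x. \<bar>conv c t x\<bar> <= Q" if c: "continuous_on UNIV c" "!!z. d < norm z ==> c z = 0"
   and t: "meas t" "!!x. \<bar>t x\<bar> <= m" for c t :: "real^'n => real"
  proof -
   obtain B where B: "B > 0" "!!z. norm (c z) <= B" using bounded_support[OF c] by blast
   have [measurable]: "meas c" "meas t" using c(1) t(1) cont_meas by auto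
   have "\<bar>conv c t x\<bar> <= B * m * vol (cball (0::real^'n) d)" for x
    unfolding conv_def by (rule integral_le_cball) (use B c t in auto)
   thus ?thesis by blast
  qed
  have Q1: "\<exists>Q. \<forall>i x. \<bar>conv (c i) (t i) x\<bar> <= Q" if "!!i. continuous_on UNIV (c i)" "!!i z. d < norm z ==> c i z = 0"
   "!!i. meas (t i)" "!!i x. \<bar>t i x\<bar> <= m" for c t :: "'n => real^'n => real"
  proof -
   have "\<forall>i. \<exists>Q. \<forall>x. \<bar>conv (c i) (t i) x\<bar> <= Q" using conv_bd that by blast
   then obtain Q where Q: "!!i x. \<bar>conv (c i) (t i) x\<bar> <= Q i" by metis
   have "\<bar>conv (c i) (t i) x\<bar> <= Max (range Q)" for i x
    using Q[of i x] by (meson Max_ge finite finite_imageI order_trans rangeI)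
   thus ?thesis by blast
  qed
  obtain Qa where Qa: "!!i x. \<bar>conv (\<lambda>z. deh z $ i) (\<lambda>y. T y $ i) x\<bar> <= Qa"
   using Q1[where c="\<lambda>i z. deh z $ i" and t="\<lambda>i y. T y $ i"] dehi T_meas Ti' by blast
  obtain Qb where Qb: "!!i x. \<bar>conv eh (g i) x\<bar> <= Qb"
   using Q1[where c="\<lambda>i. eh" and t=g] H.cont H.support g(1) g' by blast
  obtain Qc where Qc: "!!i x. \<bar>conv eh (\<lambda>y. T y $ i) x\<bar> <= Qc"
   using Q1[where c="\<lambda>i. eh" and t="\<lambda>i y. T y $ i"] H.cont H.support T_meas Ti' by blast
  define L' where "L' = (LI x. ind E x * (zt x * (\<Sum>i\<in>UNIV. conv eh (g i) x) + dzt x \<bullet> F x))"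
  have L': "L' = (\<Sum>i\<in>UNIV. (LI x. ind E x * zt x * conv eh (g i) x)) + (\<Sum>i\<in>UNIV. (LI x. ind E x * dzt x $ i * conv eh (\<lambda>y. T y $ i) x))"
   unfolding L'_def F_def
   by (rule expand[where Q="max Qb Qc"]) (use Qb Qc in \<open>auto intro: gm H.cont g T_meas max.coboundedI1 max.coboundedI2\<close>)
  \<comment> \<open>Here the increment hypothesis enters: after mollification the derivative of a
    component in its own direction dominates the mollified density.\<close>
  have "L' <= (LI x. ind E x * (zt x * (\<Sum>i\<in>UNIV. conv (\<lambda>z. deh z $ i) (\<lambda>y. T y $ i) x) + dzt x \<bullet> F x))"
   unfolding L'_def
  proof (rule integral_mono)
   show "intg (\<lambda>x. ind E x * (zt x * (\<Sum>i\<in>UNIV. conv eh (g i) x) + dzt x \<bullet> F x))"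
    unfolding F_def by (rule expand_int[where Q="max Qb Qc"]) (use Qb Qc in \<open>auto intro: gm H.cont g T_meas max.coboundedI1 max.coboundedI2\<close>)
   show "intg (\<lambda>x. ind E x * (zt x * (\<Sum>i\<in>UNIV. conv (\<lambda>z. deh z $ i) (\<lambda>y. T y $ i) x) + dzt x \<bullet> F x))"
    unfolding F_def by (rule expand_int[where Q="max Qa Qc"]) (use Qa Qc in \<open>auto intro: gm H.cont dehi T_meas max.coboundedI1 max.coboundedI2\<close>)
   fix x
   have "conv eh (g i) x <= conv (\<lambda>z. deh z $ i) (\<lambda>y. T y $ i) x" for i
    using conv_increment[OF eh(1,2) T_meas Ti' g(1) g' inc Bax] by (simp add: inner_axis)
   hence "zt x * (\<Sum>i\<in>UNIV. conv eh (g i) x) <= zt x * (\<Sum>i\<in>UNIV. conv (\<lambda>z. deh z $ i) (\<lambda>y. T y $ i) x)"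
    using zt(2) by (intro mult_left_mono sum_mono)
   thus "ind E x * (zt x * (\<Sum>i\<in>UNIV. conv eh (g i) x) + dzt x \<bullet> F x) <= ind E x * (zt x * (\<Sum>i\<in>UNIV. conv (\<lambda>z. deh z $ i) (\<lambda>y. T y $ i) x) + dzt x \<bullet> F x)"
    by (simp add: indicator_def)
  qed
  also have "... = (LINT x:E|lebesgue. div_field ph x)"
  proof -
   have [measurable]: "meas (\<lambda>x. conv (\<lambda>z. deh z $ i) (\<lambda>y. T y $ i) x)" for i by (rule gm[OF dehi(1) T_meas])
   have [measurable]: "meas F" by (rule cont_meas[OF F_cont])
   show ?thesis unfolding set_int_def div by (subst integral_completion) auto
  qed
  finally have LL: "L' <= (LINT x:E|lebesgue. div_field ph x)" .
  have p1: "\<bar>(LI x. ind E x * zt x * conv eh (g i) x) - (LI x. ind E x * zt x * g i x)\<bar> <= m * q" for i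
   by (rule conv_pairing[where B=1 and r=r and C=C and d=d])
     (use eh g g' d1 Z.support zt(2,3) in \<open>auto simp: indicator_def\<close>)
  have p2: "\<bar>(LI x. ind E x * dzt x $ i * conv eh (\<lambda>y. T y $ i) x) - (LI x. ind E x * dzt x $ i * T x $ i)\<bar> <= m * q" for i
   by (rule conv_pairing[where B=B1 and r=r and C=C and d=d])
     (use eh Ti' d2 dzi(2) B1i order_trans[OF abs_ge_zero B1i] in \<open>auto simp: indicator_def\<close>)
  have "(\<Sum>i\<in>UNIV. (LI x. ind E x * zt x * g i x) - m * q) <= (\<Sum>i\<in>UNIV. (LI x. ind E x * zt x * conv eh (g i) x))"
  proof (rule sum_mono)
   show "(LI x. ind E x * zt x * g i x) - m * q <= (LI x. ind E x * zt x * conv eh (g i) x)" for i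
    using p1[of i] by linarith
  qed
  moreover have "(\<Sum>i\<in>UNIV. (LI x. ind E x * dzt x $ i * T x $ i) - m * q) <= (\<Sum>i\<in>UNIV. (LI x. ind E x * dzt x $ i * conv eh (\<lambda>y. T y $ i) x))"
  proof (rule sum_mono)
   show "(LI x. ind E x * dzt x $ i * T x $ i) - m * q <= (LI x. ind E x * dzt x $ i * conv eh (\<lambda>y. T y $ i) x)" for i
    using p2[of i] by linarith
  qed
  moreover have "2 * N * (m * q) = e" using N m by (simp add: q_def)
  ultimately have "L - e <= L'" unfolding L L' by (simp add: sum_subtractf N_def)
  with LL have "ennreal (L - e) <= ennreal (LINT x:E|lebesgue. div_field ph x)" by (intro ennreal_leI) simp
  thus ?thesis using per by (rule order_trans)
 qed
 have "ennreal L <= perimeter E A"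
 proof (rule tendsto_upperbound)
  show "((\<lambda>e. ennreal (L - e)) \<longlongrightarrow> ennreal L) (at_right 0)"
   by (intro tendsto_ennrealI) (auto intro!: tendsto_eq_intros)
  show "\<forall>\<^sub>F e in at_right 0. ennreal (L - e) <= perimeter E A"
   using main eventually_at_right_less[of 0] by (auto elim: eventually_mono)
 qed simp
 thus ?thesis by (simp add: L_def)
qed

section \<open>Traces as slab averages\<close>

text \<open>A tent over the unit interval of height 2, hence of integral 1; it is the derivative of
  \<open>smooth_step\<close>.\<close>

definition tri :: "real => real" where
 "tri t = 4 * max 0 t - 8 * max 0 (t - 1 / 2) + 4 * max 0 (t - 1)"

definition smooth_step :: "real => real" where
 "smooth_step t = 2 * qp t - 4 * qp (t - 1 / 2) + 2 * qp (t - 1)"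

lemma DERIV_smooth_step: "(smooth_step has_real_derivative tri t) (at t)"
proof -
 have qp': "((\<lambda>t. qp (t - c)) has_real_derivative 2 * max 0 (t - c)) (at t)" for c
 proof -
  have "((\<lambda>t. t - c) has_real_derivative 1) (at t)" by (auto intro!: derivative_eq_intros)
  thus ?thesis
   using DERIV_chain2[of qp "2 * max 0 (t - c)" "\<lambda>t. t - c" t 1 UNIV] DERIV_qp[of "t - c"] by simp
 qed
 have "((\<lambda>t. 2 * qp (t - 0) - 4 * qp (t - 1 / 2) + 2 * qp (t - 1)) has_real_derivative
   2 * (2 * max 0 (t - 0)) - 4 * (2 * max 0 (t - 1 / 2)) + 2 * (2 * max 0 (t - 1))) (at t)"
  by (intro DERIV_add DERIV_diff DERIV_cmult qp')
 thus ?thesis by (simp add: smooth_step_def[abs_def] tri_def)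
qed

lemma tri_nonneg: "0 <= tri t" and tri_le: "tri t <= 2"
 by (auto simp: tri_def max_def)

lemma tri_outside: "t <= 0 \<or> 1 <= t ==> tri t = 0"
 by (auto simp: tri_def max_def)

lemma continuous_tri: "continuous_on S tri"
 unfolding tri_def by (intro continuous_intros)

lemma smooth_step_outside: "t <= 0 ==> smooth_step t = 0" "1 <= t ==> smooth_step t = 1"
 by (auto simp: smooth_step_def qp_def max_def power2_eq_square algebra_simps)

lemma smooth_step_mono: "s <= t ==> smooth_step s <= smooth_step t"
 by (rule DERIV_nonneg_imp_nondecreasing) (use DERIV_smooth_step tri_nonneg in blast)+

lemma smooth_step_range: "0 <= smooth_step t" "smooth_step t <= 1"
 using smooth_step_mono[of "min t 0" t] smooth_step_mono[of t "max t 1"] by (auto simp: smooth_step_outside)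

text \<open>The shift by 1 places the transition between the distances \<open>dl\<close> and
  \<open>2 * dl\<close>, so that a function cut off this way has its support inside the open
  half-space.\<close>

definition ramp :: "real => real => real" where "ramp dl t = smooth_step (t / dl - 1)"

definition wt :: "real => real => real" where "wt dl t = tri (t / dl - 1) / dl"

lemma DERIV_ramp: "0 < dl ==> (ramp dl has_real_derivative wt dl t) (at t)"
 unfolding ramp_def[abs_def] wt_def
 by (rule DERIV_chain2[OF DERIV_smooth_step, THEN DERIV_cong]) (auto intro!: derivative_eq_intros)

lemma wt_nonneg: "0 < dl ==> 0 <= wt dl t" and wt_le: "0 < dl ==> wt dl t <= 2 / dl"
 using tri_nonneg tri_le by (auto simp: wt_def divide_right_mono)

lemma wt_outside: "0 < dl ==> t <= dl \<or> 2 * dl <= t ==> wt dl t = 0"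
 unfolding wt_def by (subst tri_outside) (auto simp: field_simps)

lemma continuous_wt: "continuous_on S (wt dl)"
 unfolding wt_def by (cases "dl = 0") (auto intro!: continuous_intros continuous_on_compose2[OF continuous_tri])

lemma continuous_ramp: "continuous_on S (ramp dl)"
proof -
 have "continuous_on UNIV smooth_step"
  using DERIV_smooth_step by (meson DERIV_isCont continuous_at_imp_continuous_on)
 thus ?thesis unfolding ramp_def
  by (cases "dl = 0") (auto intro!: continuous_intros continuous_on_compose2[of UNIV smooth_step])
qed

lemma measurable_wt [measurable]: "meas (wt dl)"
 and measurable_ramp [measurable]: "meas (ramp dl)"
 by (auto intro: cont_meas continuous_wt continuous_ramp)

lemma ramp_range: "0 <= ramp dl t" "ramp dl t <= 1"
 by (simp_all add: ramp_def smooth_step_range)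

lemma ramp_outside: "0 < dl ==> t <= dl ==> ramp dl t = 0" "0 < dl ==> 2 * dl <= t ==> ramp dl t = 1"
 unfolding ramp_def by (auto intro!: smooth_step_outside simp: field_simps)

lemma nn_integral_wt:
 assumes "0 < dl" shows "(NN t. ennreal (wt dl t)) = 1"
proof -
 have "(NN t. ennreal (wt dl t)) = (NN t. ennreal (wt dl t) * ind {0..2 * dl} t)"
  using assms by (intro nn_integral_cong) (auto simp: indicator_def wt_outside)
 also have "... = ennreal (ramp dl (2 * dl) - ramp dl 0)"
  using assms by (intro nn_integral_FTC_Icc) (auto intro: DERIV_ramp has_field_derivative_at_within wt_nonneg)
 also have "... = 1" using assms by (simp add: ramp_outside)
 finally show ?thesis .
qed

definition halfspace :: "'n::finite => real => (real^'n) set" where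
 "halfspace k sg = {x. 0 < sg * x $ k}"

text \<open>A weighted mean of the areas of the slices of \<open>E\<close> at distances between
  \<open>dl\<close> and \<open>2 * dl\<close> from the interface. Its limits stand for the area of
  the trace.\<close>

definition trace_avg :: "'n::finite => real => (real^'n) set => real => real" where
 "trace_avg k sg E dl = (LI x. ind E x * wt dl (sg * x $ k))"

lemma ramp_slab_derivative:
 fixes x :: "real^'n::finite"
 assumes "0 < dl"
 shows "((\<lambda>x. ramp dl (sg * x $ k)) has_derivative (\<lambda>h. ((sg * wt dl (sg * x $ k)) *\<^sub>R axis k 1) \<bullet> h)) (at x)"
proof -
 have "((\<lambda>x. sg * x $ k) has_derivative (\<lambda>h. sg * h $ k)) (at x)"
  by (intro bounded_linear_imp_has_derivative bounded_linear_const_mult bounded_linear_vec_nth)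
 from has_derivative_compose[OF this, of "ramp dl" "(*) (wt dl (sg * x $ k))"] DERIV_ramp[OF assms, of "sg * x $ k"]
 have "((\<lambda>x. ramp dl (sg * x $ k)) has_derivative (\<lambda>h. wt dl (sg * x $ k) * (sg * h $ k))) (at x)"
  by (simp add: has_field_derivative_def)
 thus ?thesis by (simp add: inner_axis' mult_ac)
qed

lemma closure_slab:
 assumes "0 < dl" and "!!x. f x ~= (0::real) ==> dl <= sg * x $ k"
 shows "closure {x::real^'n::finite. f x ~= 0} \<subseteq> halfspace k sg"
proof -
 have "closure {x. f x ~= 0} \<subseteq> {x. dl <= sg * x $ k}"
  using assms(2) by (intro closure_minimal) (auto intro!: closed_Collect_le continuous_intros)
 thus ?thesis using assms(1) by (auto simp: halfspace_def)
qed

lemma integrable_indicator_mult: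
 fixes f :: "'a::euclidean_space => real"
 assumes [measurable]: "E \<in> sets borel" "meas f" and fin: "evol E < \<infinity>" and B: "!!x. \<bar>f x\<bar> <= B"
 shows "intg (\<lambda>x. ind E x * f x)"
proof (rule int_bound)
 show "intg (\<lambda>x. B * ind E x)" using fin by (intro integrable_mult_right integrable_real_indicator) auto
 show "AE x in lborel. norm (ind E x * f x) <= norm (B * ind E x)"
  using B order_trans[OF B abs_ge_self] by (auto simp: indicator_def)
qed measurable

lemma bump_tendsto: "(\<lambda>n. bump (real (Suc n)) x) ----> 1" for x :: "'a::euclidean_space"
proof -
 have "(\<lambda>n. (max 0 (1 - (x \<bullet> x) * (inverse (real (Suc n)))\<^sup>2))\<^sup>2) ----> (max 0 (1 - (x \<bullet> x) * 0\<^sup>2))\<^sup>2"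
  by (intro tendsto_intros LIMSEQ_inverse_real_of_nat)
 thus ?thesis by (simp add: bump_def qp_def divide_inverse power_inverse)
qed

text \<open>The field \<open>T\<close> is multiplied by a weight, a ramp and a wide bump. The
  gradient of the ramp produces the trace term, that of the bump vanishes in the limit, and that of
  the weight costs \<open>c\<close> times the volume. The weight will serve to localize far from the
  origin.\<close>

lemma slab_lower_bound:
 fixes E :: "(real^'n::finite) set" and w :: "real^'n => real" and T :: "real^'n => real^'n" and g :: "'n => real^'n => real"
 assumes E [measurable]: "E \<in> sets borel" and fin: "evol E < \<infinity>" and dl: "0 < dl" and sg: "sg = 1 \<or> sg = -1"
  and w: "!!x. 0 <= w x" "!!x. w x <= 1" "!!x. (w has_derivative (\<lambda>h. dw x \<bullet> h)) (at x)" "continuous_on UNIV dw" "!!x. norm (dw x) <= c"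
  and U: "closure {x. w x ~= 0} \<subseteq> U" and q: "perimeter E (halfspace k sg \<inter> U) <= ennreal q" "0 <= q"
  and T [measurable]: "meas T" "!!x. norm (T x) <= 1" and Ta: "!!x. - a <= sg * T x $ k"
  and g [measurable]: "!!i. meas (g i)" "!!i x. \<bar>g i x\<bar> <= M"
  and inc: "!!i x s. 0 <= s ==> (LINT u:{0..s}|lborel. g i (x + u *\<^sub>R axis i 1)) <= T (x + s *\<^sub>R axis i 1) $ i - T x $ i"
 shows "(LI x. ind E x * (w x * ramp dl (sg * x $ k) * (\<Sum>i\<in>UNIV. g i x)))
  - a * (LI x. ind E x * (w x * wt dl (sg * x $ k))) <= q + c * vol E"
proof -
 define s where "s x = (\<Sum>i\<in>UNIV. g i x)" for x
 have [measurable]: "meas s" unfolding s_def by measurable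
 define Q where "Q = (\<Sum>i\<in>(UNIV::'n set). M)"
 have s: "\<bar>s x\<bar> <= Q" for x
  unfolding s_def Q_def by (intro order_trans[OF sum_abs] sum_mono g)
 have c0: "0 <= c" using order_trans[OF norm_ge_zero w(5)] .
 have w_cont: "continuous_on UNIV w"
  using w(3) by (meson differentiableI differentiable_imp_continuous_within continuous_at_imp_continuous_on)
 have [measurable]: "bump R \<in> borel_measurable (borel :: (real^'n) measure)" for R
  by (auto intro: cont_meas continuous_bump)
 note [measurable] = cont_meas[OF w_cont] cont_meas[OF w(4)]
 define f1 where "f1 R x = w x * bump R x * ramp dl (sg * x $ k) * s x" for R x
 define f2 where "f2 R x = w x * bump R x * wt dl (sg * x $ k)" for R x
 have [measurable]: "meas (f1 R)" "meas (f2 R)" for R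
  unfolding f1_def[abs_def] f2_def[abs_def] by measurable
 have f1: "\<bar>f1 R x\<bar> <= 1 * 1 * 1 * Q" and f2: "\<bar>f2 R x\<bar> <= 1 * 1 * (2 / dl)" for R x
  unfolding f1_def f2_def abs_mult using s[of x] dl w(1,2)[of x] ramp_range[of dl "sg * x $ k"] bump_range[of R x] wt_nonneg[OF dl] wt_le[OF dl]
  by (intro mult_mono; simp)+
 have int: "intg (\<lambda>x. ind E x * f1 R x)" "intg (\<lambda>x. ind E x * f2 R x)" for R
  by (rule integrable_indicator_mult[OF E _ fin f1] integrable_indicator_mult[OF E _ fin f2], measurable)+
 \<comment> \<open>The bump of radius \<open>R\<close> provides compact support; its gradient is at
   most \<open>4 / R\<close>.\<close>
 have step: "(LI x. ind E x * f1 R x) - a * (LI x. ind E x * f2 R x) <= q + (c + 4 / R) * vol E" if R: "0 < R" for R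
 proof -
  define u where "u x = ramp dl (sg * x $ k) * bump R x" for x :: "real^'n"
  define du where "du x = ramp dl (sg * x $ k) *\<^sub>R grad_bump R x + (sg * wt dl (sg * x $ k) * bump R x) *\<^sub>R axis k 1" for x :: "real^'n"
  have u': "(u has_derivative (\<lambda>h. du x \<bullet> h)) (at x)" for x
   unfolding u_def[abs_def]
   by (rule has_derivative_eq_rhs, rule has_derivative_mult[OF ramp_slab_derivative[OF dl] bump_has_derivative])
    (simp add: fun_eq_iff du_def inner_add_left inner_axis' mult_ac)
  have u01: "0 <= u x" "u x <= 1" for x by (auto simp: u_def mult_le_one ramp_range bump_range)
  define zt where "zt x = w x * u x" for x
  define dzt where "dzt x = w x *\<^sub>R du x + u x *\<^sub>R dw x" for x
  have C: "C1c zt dzt R"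
  proof
   show "(zt has_derivative (\<bullet>) (dzt x)) (at x)" for x
    unfolding zt_def[abs_def]
    by (rule has_derivative_eq_rhs, rule has_derivative_mult[OF w(3) u']) (simp add: fun_eq_iff dzt_def inner_add_left mult_ac)
   show "continuous_on UNIV dzt" unfolding dzt_def du_def u_def
    by (intro continuous_intros w_cont w(4) continuous_on_compose2[OF continuous_ramp[of UNIV]] continuous_on_compose2[OF continuous_wt[of UNIV]] continuous_bump continuous_grad_bump) auto
  qed (use R in \<open>simp add: zt_def u_def bump_outside\<close>)
  have r: "0 <= zt x" "zt x <= 1" for x
   using w(1,2) u01 by (auto simp: zt_def mult_le_one)
  have "closure {x. zt x ~= 0} \<subseteq> halfspace k sg"
  proof (rule closure_slab[OF dl])
   show "dl <= sg * x $ k" if "zt x ~= 0" for x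
    using that ramp_outside(1)[OF dl, of "sg * x $ k"] by (force simp: zt_def u_def)
  qed
  moreover have "closure {x. zt x ~= 0} \<subseteq> closure {x. w x ~= 0}" by (rule closure_mono) (auto simp: zt_def)
  ultimately have cl: "closure {x. zt x ~= 0} \<subseteq> halfspace k sg \<inter> U" using U by blast
  have "ennreal (LI x. ind E x * (zt x * s x + dzt x \<bullet> T x)) <= ennreal q"
   unfolding s_def by (rule order_trans[OF perimeter_ge[OF E C r cl T g inc] q(1)])
  hence le: "(LI x. ind E x * (zt x * s x + dzt x \<bullet> T x)) <= q"
   using q(2) by (simp add: ennreal_le_iff)
  have zts: "zt x * s x = f1 R x" for x by (simp add: zt_def u_def f1_def mult_ac)
  have i4: "intg (\<lambda>x. ind E x * (f1 R x + dzt x \<bullet> T x))"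
  proof -
   interpret C1c zt dzt R by (rule C)
   obtain B where B: "B > 0" "!!x. norm (dzt x) <= B" using bounded_support[OF cont_d support_d] by blast
   have [measurable]: "meas dzt" using cont_d by (rule cont_meas)
   have "intg (\<lambda>x. ind E x * (dzt x \<bullet> T x))"
   proof (rule integrable_indicator_mult[OF E _ fin])
    show "\<bar>dzt x \<bullet> T x\<bar> <= B * 1" for x
     using B(2)[of x] T(2)[of x] B(1) by (intro order_trans[OF Cauchy_Schwarz_ineq2] mult_mono) auto
   qed measurable
   thus ?thesis using int(1)[of R] by (simp add: distrib_left)
  qed
  \<comment> \<open>The bound \<open>Ta\<close> is used on the ramp term only; the other two
    gradients are estimated by Cauchy-Schwarz and \<open>norm (T x) <= 1\<close>.\<close>
  have pt: "- a * f2 R x - (c + 4 / R) <= dzt x \<bullet> T x" for x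
  proof -
   have "\<bar>(w x * ramp dl (sg * x $ k)) * (grad_bump R x \<bullet> T x)\<bar> <= 1 * (4 / R * 1)"
    unfolding abs_mult[of "w x * ramp dl (sg * x $ k)"]
    using ramp_range[of dl "sg * x $ k"] w(1,2)[of x] norm_grad_bump[OF R, of x] R T(2)[of x]
    by (intro mult_mono order_trans[OF Cauchy_Schwarz_ineq2]) (auto simp: abs_mult mult_le_one)
   moreover have "\<bar>u x * (dw x \<bullet> T x)\<bar> <= 1 * (c * 1)"
    unfolding abs_mult[of "u x"] using u01[of x] w(5)[of x] c0 T(2)[of x]
    by (intro mult_mono order_trans[OF Cauchy_Schwarz_ineq2]) auto
   moreover have "- a * f2 R x <= sg * T x $ k * f2 R x"
    using Ta[of x] w(1)[of x] wt_nonneg[OF dl] by (intro mult_right_mono) (auto simp: f2_def bump_range)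
   moreover have "dzt x \<bullet> T x = sg * T x $ k * f2 R x + (w x * ramp dl (sg * x $ k)) * (grad_bump R x \<bullet> T x) + u x * (dw x \<bullet> T x)"
    by (simp add: dzt_def du_def f2_def inner_add_left inner_axis' algebra_simps)
   ultimately show ?thesis by linarith
  qed
  have i3: "intg (\<lambda>x. ind E x * f1 R x - a * (ind E x * f2 R x) - (c + 4 / R) * ind E x)"
   using int[of R] fin by (intro Bochner_Integration.integrable_diff integrable_mult_right integrable_real_indicator) auto
  have "(LI x. ind E x * f1 R x - a * (ind E x * f2 R x) - (c + 4 / R) * ind E x)
   <= (LI x. ind E x * (f1 R x + dzt x \<bullet> T x))"
  proof (rule integral_mono[OF i3 i4])
   show "ind E x * f1 R x - a * (ind E x * f2 R x) - (c + 4 / R) * ind E x <= ind E x * (f1 R x + dzt x \<bullet> T x)" for x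
    using pt[of x] by (cases "x \<in> E") auto
  qed
  moreover have "(LI x. ind E x * f1 R x - a * (ind E x * f2 R x) - (c + 4 / R) * ind E x)
   = (LI x. ind E x * f1 R x) - a * (LI x. ind E x * f2 R x) - (c + 4 / R) * vol E"
   using int[of R] fin by (simp add: Bochner_Integration.integral_diff Bochner_Integration.integrable_diff)
  ultimately show ?thesis using le by (simp add: zts)
 qed
 have lim: "(\<lambda>n. LI x. ind E x * f (real (Suc n)) x) ----> (LI x. ind E x * h x)"
  if [measurable]: "!!R. meas (f R)" "meas h" and b: "!!R x. \<bar>f R x\<bar> <= B" and l: "!!x. (\<lambda>n. f (real (Suc n)) x) ----> h x"
  for f :: "real => real^'n => real" and h and B :: real
 proof (rule integral_dominated_convergence[where w="\<lambda>x. ind E x * B"])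
  show "intg (\<lambda>x. ind E x * B)" by (rule integrable_indicator_mult[OF E _ fin, of _ "\<bar>B\<bar>"]) auto
 qed (use l b in \<open>auto intro!: tendsto_intros simp: indicator_def\<close>)
 have "(\<lambda>n. LI x. ind E x * f1 (real (Suc n)) x) ----> (LI x. ind E x * (w x * 1 * ramp dl (sg * x $ k) * s x))"
  by (rule lim[OF _ _ f1], measurable, unfold f1_def, intro tendsto_intros bump_tendsto)
 moreover have "(\<lambda>n. LI x. ind E x * f2 (real (Suc n)) x) ----> (LI x. ind E x * (w x * 1 * wt dl (sg * x $ k)))"
  by (rule lim[OF _ _ f2], measurable, unfold f2_def, intro tendsto_intros bump_tendsto)
 ultimately have "(\<lambda>n. (LI x. ind E x * f1 (real (Suc n)) x) - a * (LI x. ind E x * f2 (real (Suc n)) x)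
   - 4 * inverse (real (Suc n)) * vol E)
   ----> (LI x. ind E x * (w x * 1 * ramp dl (sg * x $ k) * s x)) - a * (LI x. ind E x * (w x * 1 * wt dl (sg * x $ k)))
   - 4 * 0 * vol E"
  by (intro tendsto_intros LIMSEQ_inverse_real_of_nat)
 hence "(LI x. ind E x * (w x * 1 * ramp dl (sg * x $ k) * s x)) - a * (LI x. ind E x * (w x * 1 * wt dl (sg * x $ k)))
   - 4 * 0 * vol E <= q + c * vol E"
 proof (rule LIMSEQ_le_const2, intro exI allI impI)
  fix n :: nat
  show "(LI x. ind E x * f1 (real (Suc n)) x) - a * (LI x. ind E x * f2 (real (Suc n)) x)
   - 4 * inverse (real (Suc n)) * vol E <= q + c * vol E"
   using step[of "real (Suc n)"] by (simp add: divide_inverse distrib_right)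
 qed
 thus ?thesis by (simp add: s_def)
qed

text \<open>\<open>p\<close> is an upper bound for the relative perimeter, and \<open>A\<close> a
  limit of slab averages along one fixed sequence of scales.\<close>

locale half_set =
 fixes k :: "'n::finite" and sg :: real and E :: "(real^'n) set" and p A :: real and ds :: "nat => real"
 assumes sigma: "sg = 1 \<or> sg = -1"
  and E_borel [measurable]: "E \<in> sets borel" and E_sub: "E \<subseteq> halfspace k sg"
  and E_fin: "evol E < \<infinity>"
  and per: "perimeter E (halfspace k sg) <= ennreal p" and p0: "0 <= p"
  and ds: "!!n. 0 < ds n" "ds ----> 0"
  and trace: "(\<lambda>n. trace_avg k sg E (ds n)) ----> A"

begin

text \<open>The weight is constant 1, and the ramps tend to 1 at every point of \<open>E\<close>
  because \<open>E\<close> lies in the open half-space.\<close>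

lemma bounded_lower_bound:
 fixes T :: "real^'n => real^'n" and g :: "'n => real^'n => real"
 assumes T [measurable]: "meas T" "!!x. norm (T x) <= 1" and Ta: "!!x. - a <= sg * T x $ k"
  and g [measurable]: "!!i. meas (g i)" "!!i x. \<bar>g i x\<bar> <= M"
  and inc: "!!i x s. 0 <= s ==> (LINT u:{0..s}|lborel. g i (x + u *\<^sub>R axis i 1)) <= T (x + s *\<^sub>R axis i 1) $ i - T x $ i"
 shows "(LI x. ind E x * (\<Sum>i\<in>UNIV. g i x)) <= p + a * A"
proof -
 define s where "s x = (\<Sum>i\<in>UNIV. g i x)" for x
 have [measurable]: "meas s" unfolding s_def by measurable
 define Q where "Q = real CARD('n) * M"
 have s: "\<bar>s x\<bar> <= Q" for x
 proof -
  have "\<bar>s x\<bar> <= (\<Sum>i\<in>UNIV. \<bar>g i x\<bar>)" unfolding s_def by (rule sum_abs)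
  also have "... <= (\<Sum>i\<in>(UNIV::'n set). M)" using g(2) by (intro sum_mono)
  finally show ?thesis by (simp add: Q_def)
 qed
 hence Q0: "0 <= Q" using abs_ge_zero order_trans by blast
 have step2: "(LI x. ind E x * (ramp dl (sg * x $ k) * s x)) - a * trace_avg k sg E dl <= p"
  if dl: "0 < dl" for dl
  using slab_lower_bound[OF E_borel E_fin dl sigma, where w="\<lambda>_. 1" and dw="\<lambda>_. 0" and c=0 and U=UNIV, OF _ _ _ _ _ _ _ p0 T Ta g inc] per
  by (simp add: trace_avg_def s_def)
 have l1: "(\<lambda>n. LI x. ind E x * (ramp (ds n) (sg * x $ k) * s x)) ----> (LI x. ind E x * s x)"
 proof (rule integral_dominated_convergence[where w="\<lambda>x. ind E x * Q"])
  show "intg (\<lambda>x. ind E x * Q)" by (rule integrable_indicator_mult[OF E_borel _ E_fin, of _ "\<bar>Q\<bar>"]) auto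
  show "AE x in lborel. (\<lambda>n. ind E x * (ramp (ds n) (sg * x $ k) * s x)) ----> ind E x * s x"
  proof (rule AE_I2)
   fix x
   show "(\<lambda>n. ind E x * (ramp (ds n) (sg * x $ k) * s x)) ----> ind E x * s x"
   proof (cases "x \<in> E")
    case True
    hence "0 < sg * x $ k / 2" using E_sub by (auto simp: halfspace_def)
    hence "\<forall>\<^sub>F n in sequentially. ds n < sg * x $ k / 2" by (rule order_tendstoD(2)[OF ds(2)])
    hence "\<forall>\<^sub>F n in sequentially. ind E x * (ramp (ds n) (sg * x $ k) * s x) = ind E x * s x"
     by eventually_elim (use ds(1) in \<open>auto simp: ramp_outside\<close>)
    thus ?thesis by (rule tendsto_eventually)
   qed simp
  qed
  show "AE x in lborel. norm (ind E x * (ramp (ds n) (sg * x $ k) * s x)) <= ind E x * Q" for n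
  proof (rule AE_I2)
   fix x
   have "\<bar>ramp (ds n) (sg * x $ k)\<bar> * \<bar>s x\<bar> <= 1 * Q" using s[of x] ramp_range Q0 by (intro mult_mono) (auto simp: abs_of_nonneg)
   thus "norm (ind E x * (ramp (ds n) (sg * x $ k) * s x)) <= ind E x * Q"
    by (auto simp: indicator_def abs_mult)
  qed
 qed auto
 have "(LI x. ind E x * s x) - a * A <= p"
  by (rule LIMSEQ_le_const2[OF tendsto_diff[OF l1 tendsto_mult_left[OF trace]]]) (use step2 ds(1) in auto)
 thus ?thesis by (simp add: s_def)
qed

end

section \<open>The isoperimetric inequality for caps\<close>

text \<open>The logarithms of \<open>g i / c\<close> sum to 0, so the deficit is a sum of the
  nonnegative terms \<open>x - 1 - ln x\<close>. When it vanishes so does each term, and this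
  happens only at \<open>x = 1\<close>.\<close>

lemma amgm_deficit:
 fixes g :: "'i::finite => real"
 assumes g: "!!i. 0 < g i" and c: "0 < c" and prod: "(\<Prod>i\<in>UNIV. g i) = c ^ CARD('i)"
 shows "real CARD('i) * c <= (\<Sum>i\<in>UNIV. g i)"
  and "(\<Sum>i\<in>UNIV. g i) <= real CARD('i) * c ==> g i = c"
proof -
 define h where "h i = g i / c - 1 - ln (g i / c)" for i
 have h0: "0 <= h i" for i
  using ln_le_minus_one[of "g i / c"] g c by (simp add: h_def)
 have "(\<Prod>i\<in>UNIV. g i / c) = 1"
  using prod c by (simp add: prod_dividef)
 moreover have "ln (\<Prod>i\<in>UNIV. g i / c) = (\<Sum>i\<in>UNIV. ln (g i / c))"
 proof (rule ln_prod)
  show "g i / c ~= 0" for i using g[of i] c by simp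
 qed (use g c in auto)
 ultimately have "(\<Sum>i\<in>UNIV. ln (g i / c)) = 0" by simp
 hence sum: "(\<Sum>i\<in>UNIV. h i) = (\<Sum>i\<in>UNIV. g i) / c - real CARD('i)"
  by (simp add: h_def sum_subtractf sum_divide_distrib)
 have "0 <= (\<Sum>i\<in>UNIV. h i)" using h0 by (intro sum_nonneg)
 thus "real CARD('i) * c <= (\<Sum>i\<in>UNIV. g i)" using sum c by (simp add: field_simps)
 assume "(\<Sum>i\<in>UNIV. g i) <= real CARD('i) * c"
 hence "(\<Sum>i\<in>UNIV. g i) / c <= real CARD('i)" using c by (simp add: divide_le_eq)
 hence "(\<Sum>i\<in>UNIV. h i) <= 0" using sum by simp
 hence "h i = 0"
  using h0 sum_nonneg_eq_0_iff[of UNIV h] by (simp add: order_antisym sum_nonneg)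
 hence "ln (g i / c) = g i / c - 1" by (simp add: h_def)
 hence "g i / c = 1" using ln_eq_minus_one g c by (metis divide_pos_pos)
 thus "g i = c" using c by simp
qed

text \<open>Test fields need bounded real densities, while slopes may be unbounded or infinite.
  Truncations increase with \<open>M\<close>, so monotone convergence recovers the slopes.\<close>

definition trunc :: "real => ennreal => real" where "trunc M a = enn2real (min a (ennreal M))"

lemma measurable_trunc [measurable]: "meas (trunc M)"
 unfolding trunc_def by measurable

lemma trunc_range: "0 <= trunc M a" "0 <= M ==> trunc M a <= M"
proof -
 show "0 <= trunc M a" by (simp add: trunc_def)
 assume "0 <= M"
 thus "trunc M a <= M" unfolding trunc_def by (intro enn2real_leI) auto
qed

lemma ennreal_trunc: "ennreal (trunc M a) = min a (ennreal M)"
 unfolding trunc_def by (rule ennreal_enn2real) (simp add: min_less_iff_disj)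

text \<open>An integrated way of saying that \<open>g\<close> is at most the derivative of component
  \<open>i\<close> in direction \<open>i\<close>; it makes sense although \<open>T\<close> is not
  differentiable.\<close>

definition incr :: "'n::finite => (real^'n => real^'n) => (real^'n => real) => bool" where
 "incr i T g \<longleftrightarrow> (\<forall>x s s'. s <= s' --> (LINT u:{s..s'}|lborel. g (upd x i u)) <= T (upd x i s') $ i - T (upd x i s) $ i)"

lemma incr_shift:
 assumes "incr i T g" "0 <= s"
 shows "(LINT u:{0..s}|lborel. g (x + u *\<^sub>R axis i 1)) <= T (x + s *\<^sub>R axis i 1) $ i - T x $ i"
proof -
 have "(LINT u:{x $ i..x $ i + s}|lborel. g (upd x i u)) = (LI u. ind {x $ i..x $ i + s} (x $ i + u) *\<^sub>R g (upd x i (x $ i + u)))"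
  unfolding set_int_def by (subst lborel_integral_real_affine[of 1 _ "x $ i"]) auto
 also have "... = (LINT u:{0..s}|lborel. g (x + u *\<^sub>R axis i 1))"
  unfolding set_int_def upd_add_axis by (intro Bochner_Integration.integral_cong) (auto simp: indicator_def)
 finally show ?thesis
  using assms unfolding incr_def by (metis upd_add_axis upd_triv le_add_same_cancel1)
qed

lemma trunc_increment:
 fixes G :: "real^'n::finite => ennreal"
 assumes [measurable]: "meas G" and M: "0 <= M" and D: "0 <= D"
  and le: "(NN u. G (upd x i u) * ind {s..s'} u) <= ennreal D"
 shows "(LINT u:{s..s'}|lborel. trunc M (G (upd x i u))) <= D"
proof -
 have "(LINT u:{s..s'}|lborel. trunc M (G (upd x i u))) = enn2real (NN u. ennreal (ind {s..s'} u * trunc M (G (upd x i u))))"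
  unfolding set_int_def by (subst integral_eq_nn_integral) (auto simp: trunc_range)
 also have "... <= D"
 proof (rule enn2real_leI[OF D])
  have "(NN u. ennreal (ind {s..s'} u * trunc M (G (upd x i u)))) <= (NN u. G (upd x i u) * ind {s..s'} u)"
   by (intro nn_integral_mono) (auto simp: indicator_def ennreal_trunc)
  thus "(NN u. ennreal (ind {s..s'} u * trunc M (G (upd x i u)))) <= ennreal D"
   using le by (rule order_trans)
 qed
 finally show ?thesis .
qed

lemma trunc_lim:
 fixes G :: "real^'n::finite => 'n => ennreal"
 assumes [measurable]: "!!i. meas (\<lambda>x. G x i)" "E \<in> sets borel" and fin: "evol E < \<infinity>"
 shows "(\<lambda>n. ennreal (LI x. ind E x * (\<Sum>i\<in>UNIV. trunc (real n) (G x i)))) ----> (NN x. (\<Sum>i\<in>UNIV. G x i) * ind E x)"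
proof -
 have eq: "ennreal (LI x. ind E x * (\<Sum>i\<in>UNIV. trunc (real n) (G x i))) = (NN x. (\<Sum>i\<in>UNIV. min (G x i) (ennreal (real n))) * ind E x)" for n
 proof -
  have "intg (\<lambda>x. ind E x * (\<Sum>i\<in>UNIV. trunc (real n) (G x i)))"
  proof (rule int_bound)
   show "intg (\<lambda>x. (real CARD('n) * real n) * ind E x)"
    using fin by (intro integrable_mult_right integrable_real_indicator) auto
   have "(\<Sum>i\<in>UNIV. trunc (real n) (G x i)) <= (\<Sum>i\<in>(UNIV::'n set). real n)" for x
    by (intro sum_mono) (simp add: trunc_range)
   thus "AE x in lborel. norm (ind E x * (\<Sum>i\<in>UNIV. trunc (real n) (G x i))) <= norm ((real CARD('n) * real n) * ind E x)"
    by (intro AE_I2) (auto simp: indicator_def trunc_range sum_nonneg)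
  qed measurable
  hence "ennreal (LI x. ind E x * (\<Sum>i\<in>UNIV. trunc (real n) (G x i))) = (NN x. ennreal (ind E x * (\<Sum>i\<in>UNIV. trunc (real n) (G x i))))"
   by (subst nn_integral_eq_integral) (auto simp: trunc_range sum_nonneg)
  also have "... = (NN x. (\<Sum>i\<in>UNIV. min (G x i) (ennreal (real n))) * ind E x)"
   by (intro nn_integral_cong) (auto simp: indicator_def sum_ennreal[symmetric] ennreal_trunc trunc_range)
  finally show ?thesis .
 qed
 show ?thesis unfolding eq
 proof (rule nn_integral_LIMSEQ)
  show "incseq (\<lambda>n x. (\<Sum>i\<in>UNIV. min (G x i) (ennreal (real n))) * ind E x)"
   by (intro incseq_SucI le_funI mult_right_mono sum_mono min.mono ennreal_leI) auto
  show "(\<lambda>n. (\<Sum>i\<in>UNIV. min (G x i) (ennreal (real n))) * ind E x) ----> (\<Sum>i\<in>UNIV. G x i) * ind E x" for x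
  proof (cases "x \<in> E")
   case True
   have "(\<lambda>n. min (G x i) (ennreal (real n))) ----> min (G x i) \<top>" for i
    using of_nat_tendsto_top_ennreal by (intro tendsto_min tendsto_const) (simp add: ennreal_of_nat_eq_real_of_nat)
   hence "(\<lambda>n. \<Sum>i\<in>UNIV. min (G x i) (ennreal (real n))) ----> (\<Sum>i\<in>UNIV. G x i)"
    by (intro tendsto_sum) simp
   thus ?thesis using True by simp
  qed simp
 qed measurable
qed

text \<open>A positive product has no factor 0, and then an infinite factor would make the product
  infinite.\<close>

lemma prod_ennreal_pos_finite:
 fixes G :: "'i::finite => ennreal"
 assumes "(\<Prod>i\<in>UNIV. G i) = ennreal w" "0 < w"
 shows "G i = ennreal (enn2real (G i))" "0 < enn2real (G i)" "(\<Prod>i\<in>UNIV. enn2real (G i)) = w"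
proof -
 have nz: "G i ~= 0" for i
  using assms by (metis UNIV_I ennreal_eq_0_iff finite not_le prod_zero)
 have fin: "G i ~= \<top>" for i
 proof
  assume top: "G i = \<top>"
  have "(\<Prod>j\<in>UNIV. G j) = G i * (\<Prod>j\<in>UNIV - {i}. G j)" by (simp add: prod.remove)
  moreover have "(\<Prod>j\<in>UNIV - {i}. G j) ~= 0" using nz by (simp add: prod_zero_iff)
  ultimately have "(\<Prod>j\<in>UNIV. G j) = \<top>" using top by (simp add: ennreal_top_mult)
  thus False using assms by simp
 qed
 show 1: "G i = ennreal (enn2real (G i))" for i using fin by (simp add: less_top)
 show "0 < enn2real (G i)" for i using nz[of i] fin[of i] by (simp add: enn2real_positive_iff less_top zero_less_iff_neq_zero)
 have "ennreal (\<Prod>i\<in>UNIV. enn2real (G i)) = (\<Prod>i\<in>UNIV. G i)"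
  by (subst prod_ennreal[symmetric]) (auto intro!: prod.cong simp: 1[symmetric])
 thus "(\<Prod>i\<in>UNIV. enn2real (G i)) = w"
  using assms by (simp add: prod_nonneg)
qed

text \<open>The expansion factor of an optimal map between sets of volumes \<open>V\<close> and \<open>v\<close>.\<close>

definition dilation :: "'n::finite itself => real => real => real" where
 "dilation _ v V = root CARD('n) (v / V)"

lemma dilation_power: "0 < v ==> 0 < V ==> dilation TYPE('n::finite) v V ^ CARD('n) = v / V"
 by (simp add: dilation_def)

lemma dilation_pos: "0 < v ==> 0 < V ==> 0 < dilation TYPE('n::finite) v V"
 by (simp add: dilation_def)

text \<open>With the indicator of \<open>E\<close> as source density the Jacobian is the constant
  \<open>c ^ N\<close> on \<open>E\<close>, where \<open>N\<close> is the dimension, and AM-GM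
  bounds the divergence below by \<open>N * c\<close>.\<close>

lemma knothe_set:
 fixes K E :: "(real^'n::finite) set"
 assumes K: "compact K" "0 < vol K"
  and E [measurable]: "E \<in> sets borel" and Efin: "evol E < \<infinity>" and Epos: "0 < vol E"
  and dist: "distinct (j # rest)" "set (j # rest) = UNIV"
 defines "c \<equiv> dilation TYPE('n) (vol K) (vol E)"
 obtains T :: "real^'n => real^'n" and G :: "real^'n => 'n => ennreal"
 where "meas T" "!!i. meas (\<lambda>x. G x i)"
  "!!x. T x \<in> K"
  "!!i M. 0 <= M ==> incr i T (\<lambda>x. trunc M (G x i))"
  "AE x in lborel. x \<in> E --> (\<forall>i. 0 < enn2real (G x i) \<and> G x i = ennreal (enn2real (G x i))) \<and> (\<Prod>i\<in>UNIV. enn2real (G x i)) = c ^ CARD('n)"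
  "ennreal (real CARD('n) * c * vol E) <= (NN x. (\<Sum>i\<in>UNIV. G x i) * ind E x)"
  "!!x. T x $ j = kstep j rest (ind E) K x 0"
  "!!x. G x j = kslope j rest (ind E) K x 0"
proof -
 have Kfin: "evol K < \<infinity>"
  using K(1) compact_imp_bounded emeasure_bounded_finite by auto
 have Kpos: "0 < evol K"
  using K(2) by (simp add: measure_def enn2real_positive_iff)
 have c: "c ^ CARD('n) = vol K / vol E" "0 < c"
  unfolding c_def using K Epos by (simp_all add: dilation_power dilation_pos)
 have nE: "(NN x. ind E x) = evol E" by simp
 have Em: "evol E = ennreal (vol E)" using Efin by (simp add: emeasure_eq_ennreal_measure less_top)
 have Km: "evol K = ennreal (vol K)" using Kfin by (simp add: emeasure_eq_ennreal_measure less_top)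
 obtain T G where T: "meas T" and G: "!!i. meas (\<lambda>x. G x i)"
  and TK: "!!x. T x \<in> K"
  and mono: "!!x i s s'. s <= s' ==> T (upd x i s) $ i <= T (upd x i s') $ i"
  and inc: "!!x i s s'. s <= s' ==>
    (NN u. G (upd x i u) i * ind {s..s'} u) <= ennreal (T (upd x i s') $ i - T (upd x i s) $ i)"
  and AE: "AE x in lborel. ind E x = (0::ennreal) \<or> (\<Prod>i\<in>UNIV. G x i) = ind E x * evol K / (NN x. ind E x)"
  and Tj: "!!x. T x $ j = kstep j rest (ind E) K x 0"
  and Gj: "!!x. G x j = kslope j rest (ind E) K x 0"
  by (rule knothe_map[OF K(1) Kpos _ _ dist, where f="ind E"]) (use Efin nE in auto)
 note [measurable] = G
 have incr: "incr i T (\<lambda>x. trunc M (G x i))" if "0 <= M" for i M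
  unfolding incr_def
 proof (intro allI impI)
  fix x :: "real^'n" and s s' :: real assume "s <= s'"
  thus "(LINT u:{s..s'}|lborel. trunc M (G (upd x i u) i)) <= T (upd x i s') $ i - T (upd x i s) $ i"
   using mono[of s s' x i] inc[of s s' x i] that by (intro trunc_increment) auto
 qed
 have AE1: "AE x in lborel. x \<in> E --> (\<forall>i. 0 < enn2real (G x i) \<and> G x i = ennreal (enn2real (G x i))) \<and> (\<Prod>i\<in>UNIV. enn2real (G x i)) = c ^ CARD('n)"
  using AE
 proof eventually_elim
  case (elim x)
  show ?case
  proof
   assume "x \<in> E"
   hence "(\<Prod>i\<in>UNIV. G x i) = ennreal (vol K / vol E)"
    using elim K Epos by (simp add: Em Km divide_ennreal)
   from prod_ennreal_pos_finite[OF this] K Epos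
   show "(\<forall>i. 0 < enn2real (G x i) \<and> G x i = ennreal (enn2real (G x i))) \<and> (\<Prod>i\<in>UNIV. enn2real (G x i)) = c ^ CARD('n)"
    by (simp add: c)
  qed
 qed
 have "ennreal (real CARD('n) * c * vol E) = (NN x. ennreal (real CARD('n) * c) * ind E x)"
  using c by (simp add: nn_integral_cmult Em ennreal_mult)
 also have "... <= (NN x. (\<Sum>i\<in>UNIV. G x i) * ind E x)"
 proof (rule nn_integral_mono_AE)
  show "AE x in lborel. ennreal (real CARD('n) * c) * ind E x <= (\<Sum>i\<in>UNIV. G x i) * ind E x"
   using AE1
  proof eventually_elim
   case (elim x)
   show ?case
   proof (cases "x \<in> E")
    case True
    hence "real CARD('n) * c <= (\<Sum>i\<in>UNIV. enn2real (G x i))"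
     using elim c(2) by (intro amgm_deficit(1)) auto
    hence "ennreal (real CARD('n) * c) <= (\<Sum>i\<in>UNIV. ennreal (enn2real (G x i)))"
     by (simp add: sum_ennreal ennreal_leI)
    also have "... = (\<Sum>i\<in>UNIV. G x i)" using elim True by (intro sum.cong) auto
    finally show ?thesis using True by simp
   qed simp
  qed
 qed
 finally have low: "ennreal (real CARD('n) * c * vol E) <= (NN x. (\<Sum>i\<in>UNIV. G x i) * ind E x)" .
 show ?thesis
  by (rule that[of T G]) (use T G TK incr AE1 low Tj Gj in auto)
qed

text \<open>The right side of the sharp isoperimetric inequality,
  \<open>N * v powr (1/N) * V powr (1 - 1/N)\<close> in dimension \<open>N\<close>.\<close>

definition iso_bound :: "'n::finite itself => real => real => real" where
 "iso_bound t v V = real CARD('n) * dilation t v V * V"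

lemma set_integral_Icc_split:
 fixes f :: "real => real"
 assumes [measurable]: "meas f" and b: "!!u. \<bar>f u\<bar> <= B" and "s <= r" "r <= s'"
 shows "(LINT u:{s..s'}|lborel. f u) = (LINT u:{s..r}|lborel. f u) + (LINT u:{r..s'}|lborel. f u)"
proof -
 have i: "set_integrable lborel {l..l'} f" for l l'
  unfolding set_integrable_def
 proof (rule int_bound)
  show "intg (\<lambda>u::real. B * ind {l..l'} u)"
   by (intro integrable_mult_right integrable_real_indicator) (auto simp: emeasure_lborel_Icc_eq)
  show "AE u in lborel. norm (ind {l..l'} u *\<^sub>R f u) <= norm (B * ind {l..l'} u)"
   using order_trans[OF b abs_ge_self] by (intro AE_I2) (auto simp: indicator_def)
 qed simp
 show ?thesis
  using Henstock_Kurzweil_Integration.integral_combine[OF assms(3,4) set_borel_integral_eq_integral(1)[OF i]]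
  by (simp add: set_borel_integral_eq_integral(2)[OF i])
qed

context half_set

begin

abbreviation "V \<equiv> vol E"

lemma lower_bound_incr:
 fixes T :: "real^'n => real^'n" and g :: "'n => real^'n => real"
 assumes "meas T" "!!x. norm (T x) <= 1" "!!x. - a <= sg * T x $ k"
  and "!!i. meas (g i)" "!!i x. \<bar>g i x\<bar> <= M"
  and "!!i. incr i T (g i)"
 shows "(LI x. ind E x * (\<Sum>i\<in>UNIV. g i x)) <= p + a * A"
 by (rule bounded_lower_bound[OF assms(1-5) incr_shift[OF assms(6)]])

context
 fixes K :: "(real^'n) set" and a :: real
 assumes K: "compact K" "0 < vol K" and K1: "!!y. y \<in> K ==> norm y <= 1" and Ka: "!!y. y \<in> K ==> - a <= sg * y $ k"
  and Epos: "0 < V"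

begin

abbreviation "c0 \<equiv> dilation TYPE('n) (vol K) V"

lemma lower_bound_knothe:
 assumes T: "meas T" "!!x. T x \<in> K"
  and G [measurable]: "!!i. meas (\<lambda>x. G x i)" and inc: "!!i M. 0 <= M ==> incr i T (\<lambda>x. trunc M (G x i))"
 shows "(NN x. (\<Sum>i\<in>UNIV. G x i) * ind E x) <= ennreal (p + a * A)"
proof (rule LIMSEQ_le_const2[OF trunc_lim[OF G E_borel E_fin]])
 have "(LI x. ind E x * (\<Sum>i\<in>UNIV. trunc (real n) (G x i))) <= p + a * A" for n
 proof (rule lower_bound_incr[OF T(1)])
  show "\<bar>trunc (real n) (G x i)\<bar> <= real n" for x i using trunc_range[of "real n" "G x i"] by simp
 qed (use T K1 Ka inc in auto)
 thus "\<exists>N. \<forall>n\<ge>N. ennreal (LI x. ind E x * (\<Sum>i\<in>UNIV. trunc (real n) (G x i))) <= ennreal (p + a * A)"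
  by (auto intro: ennreal_leI)
qed

text \<open>The integral of the Knothe divergence over \<open>E\<close> is squeezed: AM-GM bounds it
  from below, the truncated test fields from above.\<close>

lemma isoperimetric: "iso_bound TYPE('n) (vol K) V <= p + a * A"
proof -
 obtain "rest" where dist: "distinct (k # rest)" "set (k # rest) = (UNIV :: 'n set)" by (rule coord_list)
 obtain T and G :: "real^'n => 'n => ennreal" where T: "meas T" "!!x. T x \<in> K"
  and G: "!!i. meas (\<lambda>x. G x i)" and inc: "!!i M. 0 <= M ==> incr i T (\<lambda>x. trunc M (G x i))"
  and low: "ennreal (real CARD('n) * c0 * V) <= (NN x. (\<Sum>i\<in>UNIV. G x i) * ind E x)"
  by (rule knothe_set[OF K E_borel E_fin Epos dist], rule that) assumption+
 have "ennreal (real CARD('n) * c0 * V) <= ennreal (p + a * A)"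
  using order_trans[OF low lower_bound_knothe[OF T G inc]] .
 moreover have "0 < real CARD('n) * c0 * V"
  using dilation_pos[OF K(2) Epos, where 'n='n] Epos by simp
 ultimately show ?thesis by (simp add: iso_bound_def ennreal_le_iff2)
qed

text \<open>Equality leaves no room in AM-GM at almost every point of \<open>E\<close>, so all
  diagonal slopes equal \<open>c0\<close> there. Only the first one is recorded, since it depends on
  \<open>x\<close> through \<open>x $ j\<close> alone.\<close>

lemma equality_slope:
 assumes eq: "p + a * A <= iso_bound TYPE('n) (vol K) V" and dist: "distinct (j # rest)" "set (j # rest) = (UNIV :: 'n set)"
 shows "AE x in lborel. x \<in> E --> kslope j rest (ind E) K x 0 = ennreal c0"
proof -
 obtain T G where T: "meas T" "!!x. T x \<in> K"
  and G [measurable]: "!!i. meas (\<lambda>x. G x i)" and inc: "!!i M. 0 <= M ==> incr i T (\<lambda>x. trunc M (G x i))"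
  and AE: "AE x in lborel. x \<in> E --> (\<forall>i. 0 < enn2real (G x i) \<and> G x i = ennreal (enn2real (G x i))) \<and> (\<Prod>i\<in>UNIV. enn2real (G x i)) = c0 ^ CARD('n)"
  and Gj: "!!x. G x j = kslope j rest (ind E) K x 0"
  by (rule knothe_set[OF K E_borel E_fin Epos dist], rule that) assumption+
 have c0: "0 < c0" by (rule dilation_pos[OF K(2) Epos])
 define N where "N = real CARD('n)"
 have N: "0 < N" by (simp add: N_def)
 define S where "S x = (\<Sum>i\<in>UNIV. G x i)" for x
 have [measurable]: "meas S" unfolding S_def by measurable
 have V_enn: "evol E = ennreal V" using E_fin by (simp add: emeasure_eq_ennreal_measure less_top)
 have Slow: "AE x in lborel. x \<in> E --> S x = ennreal (\<Sum>i\<in>UNIV. enn2real (G x i)) \<and> N * c0 <= (\<Sum>i\<in>UNIV. enn2real (G x i))"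
  using AE
 proof eventually_elim
  case (elim x)
  show ?case
  proof
   assume "x \<in> E"
   hence e: "!!i. 0 < enn2real (G x i)" "!!i. G x i = ennreal (enn2real (G x i))" "(\<Prod>i\<in>UNIV. enn2real (G x i)) = c0 ^ CARD('n)"
    using elim by auto
   have "S x = (\<Sum>i\<in>UNIV. ennreal (enn2real (G x i)))" unfolding S_def using e(2) by (intro sum.cong) auto
   thus "S x = ennreal (\<Sum>i\<in>UNIV. enn2real (G x i)) \<and> N * c0 <= (\<Sum>i\<in>UNIV. enn2real (G x i))"
    using amgm_deficit(1)[OF e(1) c0 e(3)] by (simp add: N_def sum_ennreal)
  qed
 qed
 have le: "(NN x. S x * ind E x) <= ennreal (N * c0 * V)"
  using lower_bound_knothe[OF T G inc] eq unfolding S_def iso_bound_def N_def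
  by (meson ennreal_leI order_trans)
 have "(NN x. (S x * ind E x - ennreal (N * c0) * ind E x)) = (NN x. S x * ind E x) - (NN x. ennreal (N * c0) * ind E x)"
 proof (rule nn_integral_diff)
  show "(NN x. ennreal (N * c0) * ind E x) ~= \<infinity>"
   by (simp add: nn_integral_cmult V_enn ennreal_mult_eq_top_iff)
  show "AE x in lborel. ennreal (N * c0) * ind E x <= S x * ind E x"
   using Slow by eventually_elim (auto simp: indicator_def ennreal_leI)
 qed measurable
 also have "... = 0"
 proof -
  have "(NN x. ennreal (N * c0) * ind E x) = ennreal (N * c0 * V)"
   using N c0 by (simp add: nn_integral_cmult V_enn ennreal_mult)
  moreover have "(NN x. S x * ind E x) < \<top>"
   using le by (rule le_less_trans) simp
  ultimately show ?thesis using le by (simp add: diff_eq_0_iff_ennreal)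
 qed
 finally have "AE x in lborel. S x * ind E x - ennreal (N * c0) * ind E x = 0"
  by (subst (asm) nn_integral_0_iff_AE) auto
 thus ?thesis
  using Slow AE
 proof eventually_elim
  case (elim x)
  show ?case
  proof
   assume x: "x \<in> E"
   hence e: "!!i. 0 < enn2real (G x i)" "!!i. G x i = ennreal (enn2real (G x i))" "(\<Prod>i\<in>UNIV. enn2real (G x i)) = c0 ^ CARD('n)"
    using elim by auto
   have "ennreal (\<Sum>i\<in>UNIV. enn2real (G x i)) - ennreal (N * c0) = 0" using elim x by simp
   hence "(\<Sum>i\<in>UNIV. enn2real (G x i)) <= N * c0"
    using N c0 by (auto simp: ennreal_minus_eq_0 ennreal_le_iff dest!: ennreal_minus_eq_0)
   hence "enn2real (G x j) = c0" using amgm_deficit(2)[OF e(1) c0 e(3)] by (simp add: N_def)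
   thus "kslope j rest (ind E) K x 0 = ennreal c0" using e(2)[of j] Gj by simp
  qed
 qed
qed

text \<open>A quantitative form of connectedness. The two parts of \<open>E\<close> beyond a slab
  get their own Knothe maps into \<open>K\<close>, glued by convex combination across the slab. The
  slab costs at most \<open>2 / (t' - t)\<close> per unit of volume, while splitting the volume
  strictly raises the isoperimetric bound; so \<open>E\<close> cannot have too little mass in the
  slab.\<close>

lemma gap:
 assumes t: "t < t'" and V1: "0 < vol (E \<inter> {x. x $ j <= t})" and V2: "0 < vol (E \<inter> {x. t' <= x $ j})" and convK: "convex K"
 shows "iso_bound TYPE('n) (vol K) (vol (E \<inter> {x. x $ j <= t})) +
     iso_bound TYPE('n) (vol K) (vol (E \<inter> {x. t' <= x $ j}))
   <= p + a * A + 2 / (t' - t) * vol (E \<inter> {x. t < x $ j \<and> x $ j < t'})"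
proof -
 define E1 where "E1 = E \<inter> {x. x $ j <= t}"
 define E2 where "E2 = E \<inter> {x. t' <= x $ j}"
 define E3 where "E3 = E \<inter> {x. t < x $ j \<and> x $ j < t'}"
 have Es [measurable]: "E1 \<in> sets borel" "E2 \<in> sets borel" "E3 \<in> sets borel"
 proof -
  have "{x \<in> space borel. x \<in> E \<and> x $ j <= t} \<in> sets borel" "{x \<in> space borel. x \<in> E \<and> t' <= x $ j} \<in> sets borel"
   "{x \<in> space borel. x \<in> E \<and> t < x $ j \<and> x $ j < t'} \<in> sets borel" by measurable
  thus "E1 \<in> sets borel" "E2 \<in> sets borel" "E3 \<in> sets borel" by (auto simp: E1_def E2_def E3_def Int_def)
 qed
 have fin: "evol E1 < \<infinity>" "evol E2 < \<infinity>" "evol E3 < \<infinity>"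
  using E_fin by (auto simp: E1_def E2_def E3_def intro: le_less_trans[OF emeasure_mono])
 define dl where "dl = t' - t"
 have dl: "0 < dl" using t by (simp add: dl_def)
 obtain "rest" where dist: "distinct (j # rest)" "set (j # rest) = (UNIV :: 'n set)" by (rule coord_list)
 define c1 where "c1 = dilation TYPE('n) (vol K) (vol E1)"
 define c2 where "c2 = dilation TYPE('n) (vol K) (vol E2)"
 obtain T1 and G1 :: "real^'n => 'n => ennreal" where T1: "meas T1" "!!x. T1 x \<in> K"
  and G1: "!!i. meas (\<lambda>x. G1 x i)" and inc1: "!!i M. 0 <= M ==> incr i T1 (\<lambda>x. trunc M (G1 x i))"
  and low1: "ennreal (real CARD('n) * c1 * vol E1) <= (NN x. (\<Sum>i\<in>UNIV. G1 x i) * ind E1 x)"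
  by (rule knothe_set[OF K Es(1) fin(1) V1[folded E1_def] dist, folded c1_def], rule that) assumption+
 obtain T2 and G2 :: "real^'n => 'n => ennreal" where T2: "meas T2" "!!x. T2 x \<in> K"
  and G2: "!!i. meas (\<lambda>x. G2 x i)" and inc2: "!!i M. 0 <= M ==> incr i T2 (\<lambda>x. trunc M (G2 x i))"
  and low2: "ennreal (real CARD('n) * c2 * vol E2) <= (NN x. (\<Sum>i\<in>UNIV. G2 x i) * ind E2 x)"
  by (rule knothe_set[OF K Es(2) fin(2) V2[folded E2_def] dist, folded c2_def], rule that) assumption+
 note [measurable] = T1(1) T2(1) G1 G2
 define vt where "vt u = max 0 (min 1 ((u - t) / dl))" for u
 have vt: "0 <= vt u" "vt u <= 1" for u by (auto simp: vt_def)
 have vt0: "vt u = 0" if "u <= t" for u using that dl by (simp add: vt_def divide_nonpos_pos)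
 have vt1: "vt u = 1" if "t' <= u" for u using that dl by (simp add: vt_def dl_def)
 have vtm: "vt u = (u - t) / dl" if "t <= u" "u <= t'" for u using that dl by (simp add: vt_def dl_def)
 have [measurable]: "meas vt" unfolding vt_def by measurable
 define T where "T x = (1 - vt (x $ j)) *\<^sub>R T1 x + vt (x $ j) *\<^sub>R T2 x" for x
 have T: "meas T" unfolding T_def by measurable
 have TK: "T x \<in> K" for x
  unfolding T_def using convexD[OF convK T1(2) T2(2), of "1 - vt (x $ j)" "vt (x $ j)" x x] vt[of "x $ j"] by simp
 have TK1: "\<bar>T1 x $ i\<bar> <= 1" "\<bar>T2 x $ i\<bar> <= 1" for x i
  using component_le_norm_cart order_trans K1[OF T1(2)] K1[OF T2(2)] by blast+
 \<comment> \<open>In the slab \<open>vt\<close> has slope \<open>1 / dl\<close>, and component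
   \<open>j\<close> of the two maps differs by at most 2 because \<open>K\<close> lies in the unit
   ball; hence the value \<open>- 2 / dl\<close>. The other components are mixtures of monotone
   functions with a constant weight, so 0 is a valid lower bound.\<close>
 define g where "g M i x = (if x $ j <= t then trunc M (G1 x i) else if t' <= x $ j then trunc M (G2 x i) else if i = j then - 2 / dl else 0)" for M i x
 have gm [measurable]: "meas (g M i)" for M i unfolding g_def by measurable
 have gb: "\<bar>g M i x\<bar> <= M + 2 / dl" if "0 <= M" for M i x
 proof -
  define d where "d = 2 / dl"
  have "0 < d" using dl by (simp add: d_def)
  hence "\<bar>g M i x\<bar> <= M + d"
   using trunc_range[of M "G1 x i"] trunc_range[of M "G2 x i"] that by (simp add: g_def d_def[symmetric])
  thus ?thesis by (simp add: d_def)
 qed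
 have inc: "incr i T (g M i)" if M: "0 <= M" for i M
  unfolding incr_def
 proof (intro allI impI)
  fix x :: "real^'n" and s s' :: real assume ss: "s <= s'"
  define \<gamma> where "\<gamma> u = g M i (upd x i u)" for u
  have [measurable]: "meas \<gamma>" unfolding \<gamma>_def by measurable
  have i1: "(LINT u:{s..s'}|lborel. trunc M (G1 (upd x i u) i)) <= T1 (upd x i s') $ i - T1 (upd x i s) $ i" if "s <= s'" for s s'
   using inc1[OF M, of i] that unfolding incr_def by blast
  have i2: "(LINT u:{s..s'}|lborel. trunc M (G2 (upd x i u) i)) <= T2 (upd x i s') $ i - T2 (upd x i s) $ i" if "s <= s'" for s s'
   using inc2[OF M, of i] that unfolding incr_def by blast
  have nn1: "0 <= T1 (upd x i s') $ i - T1 (upd x i s) $ i" if "s <= s'" for s s'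
   by (rule order_trans[OF _ i1[OF that]]) (simp add: set_int_def trunc_range)
  have nn2: "0 <= T2 (upd x i s') $ i - T2 (upd x i s) $ i" if "s <= s'" for s s'
   by (rule order_trans[OF _ i2[OF that]]) (simp add: set_int_def trunc_range)
  show "(LINT u:{s..s'}|lborel. g M i (upd x i u)) <= T (upd x i s') $ i - T (upd x i s) $ i"
  proof (cases "i = j")
   case False
   hence xj: "upd x i u $ j = x $ j" for u by simp
   have Tc: "T (upd x i s') $ i - T (upd x i s) $ i = (1 - vt (x $ j)) * (T1 (upd x i s') $ i - T1 (upd x i s) $ i) + vt (x $ j) * (T2 (upd x i s') $ i - T2 (upd x i s) $ i)"
    unfolding T_def xj by (simp add: algebra_simps)
   consider "x $ j <= t" | "t' <= x $ j" | "t < x $ j" "x $ j < t'" by linarith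
   thus ?thesis
   proof cases
    case 1
    thus ?thesis unfolding Tc using i1[OF ss] False by (simp add: g_def xj vt0)
   next
    case 2
    thus ?thesis unfolding Tc using i2[OF ss] t False by (simp add: g_def xj vt1)
   next
    case 3
    have "0 <= (1 - vt (x $ j)) * (T1 (upd x i s') $ i - T1 (upd x i s) $ i) + vt (x $ j) * (T2 (upd x i s') $ i - T2 (upd x i s) $ i)"
     using nn1[OF ss] nn2[OF ss] vt[of "x $ j"] by (intro add_nonneg_nonneg mult_nonneg_nonneg) auto
    thus ?thesis unfolding Tc using 3 False by (simp add: g_def set_int_def)
   qed
  next
   case True
   define I where "I l l' = (LINT u:{l..l'}|lborel. \<gamma> u)" for l l'
   define D where "D l l' = T (upd x i l') $ i - T (upd x i l) $ i" for l l'
   have split: "I l l' = I l r + I r l'" if "l <= r" "r <= l'" for l r l'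
    unfolding I_def by (rule set_integral_Icc_split[where B="M + 2 / dl"]) (use that gb[OF M] in \<open>auto simp: \<gamma>_def\<close>)
   have Tu: "T (upd x i u) $ i = (1 - vt u) * T1 (upd x i u) $ i + vt u * T2 (upd x i u) $ i" for u
    using True by (simp add: T_def)
   have cA: "I l l' <= D l l'" if "l <= l'" "l' <= t" for l l'
   proof -
    have "I l l' = (LINT u:{l..l'}|lborel. trunc M (G1 (upd x i u) i))"
     unfolding I_def using that True by (intro set_lebesgue_integral_cong) (auto simp: \<gamma>_def g_def)
    thus ?thesis using i1[OF that(1)] that by (simp add: D_def Tu vt0)
   qed
   have cB: "I l l' <= D l l'" if "t' <= l" "l <= l'" for l l'
   proof -
    have "I l l' = (LINT u:{l..l'}|lborel. trunc M (G2 (upd x i u) i))"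
     unfolding I_def using that True t by (intro set_lebesgue_integral_cong) (auto simp: \<gamma>_def g_def)
    thus ?thesis using i2[OF that(2)] that by (simp add: D_def Tu vt1)
   qed
   \<comment> \<open>The endpoints of the slab, where \<open>g\<close> takes the values of the outer
     regions, form a null set.\<close>
   have cC: "I l l' <= D l l'" if l: "t <= l" "l <= l'" "l' <= t'" for l l'
   proof -
    have "AE u in lborel. u ~= t" "AE u in lborel. u ~= t'" by (simp_all add: AE_lborel_singleton)
    hence "AE u in lborel. u \<in> {l..l'} --> \<gamma> u = - 2 / dl"
     by eventually_elim (use l True in \<open>auto simp: \<gamma>_def g_def\<close>)
    hence "I l l' = (LINT u:{l..l'}|lborel. - 2 / dl)"
     unfolding I_def by (intro set_lebesgue_integral_cong_AE) auto
    also have "... = - 2 * ((l' - l) / dl)" using l by (simp add: set_int_def) (simp add: diff_divide_distrib mult.commute)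
    finally have I: "I l l' = - 2 * (vt l' - vt l)" using l by (simp add: vtm diff_divide_distrib)
    have dth: "0 <= vt l' - vt l" using l dl by (simp add: vtm divide_right_mono)
    have "D l l' = (1 - vt l') * (T1 (upd x i l') $ i - T1 (upd x i l) $ i) + vt l * (T2 (upd x i l') $ i - T2 (upd x i l) $ i)
      + (vt l' - vt l) * (T2 (upd x i l') $ i - T1 (upd x i l) $ i)"
     unfolding D_def Tu by (simp add: algebra_simps)
    moreover have "0 <= (1 - vt l') * (T1 (upd x i l') $ i - T1 (upd x i l) $ i)" "0 <= vt l * (T2 (upd x i l') $ i - T2 (upd x i l) $ i)"
     using nn1[OF l(2)] nn2[OF l(2)] vt by auto
    moreover have "(vt l' - vt l) * (- 2) <= (vt l' - vt l) * (T2 (upd x i l') $ i - T1 (upd x i l) $ i)"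
     using dth TK1(2)[of "upd x i l'" i] TK1(1)[of "upd x i l" i] by (intro mult_left_mono) auto
    ultimately show ?thesis unfolding I by simp
   qed
   \<comment> \<open>The two faces of the slab, clamped to the interval under consideration; pieces
     that are then empty have length 0.\<close>
   define r1 where "r1 = max s (min t s')"
   define r2 where "r2 = max s (min t' s')"
   have r: "s <= r1" "r1 <= r2" "r2 <= s'" using ss t by (auto simp: r1_def r2_def)
   have I0: "I l l <= 0" for l
   proof -
    have "AE u in lborel. u ~= l" by (simp add: AE_lborel_singleton)
    hence "AE u in lborel. u \<in> {l..l} --> \<gamma> u = 0" by eventually_elim auto
    hence "I l l = (LINT u:{l..l}|lborel. 0)"
     unfolding I_def by (intro set_lebesgue_integral_cong_AE) auto
    thus ?thesis by (simp add: set_int_def)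
   qed
   hence same: "I l l <= D l l" for l by (simp add: D_def)
   have "I s r1 <= D s r1"
   proof (cases "s <= t")
    case True thus ?thesis using r by (intro cA) (auto simp: r1_def)
   next
    case False hence "r1 = s" by (simp add: r1_def)
    thus ?thesis using same by simp
   qed
   moreover have "I r1 r2 <= D r1 r2"
   proof (cases "s <= t' \<and> t <= s'")
    case True thus ?thesis using r t by (intro cC) (auto simp: r1_def r2_def)
   next
    case False hence "r1 = r2" using ss t by (auto simp: r1_def r2_def)
    thus ?thesis using same by simp
   qed
   moreover have "I r2 s' <= D r2 s'"
   proof (cases "t' <= s'")
    case True thus ?thesis using r by (intro cB) (auto simp: r2_def)
   next
    case False hence "r2 = s'" using ss by (simp add: r2_def)
    thus ?thesis using same by simp
   qed
   ultimately have "I s s' <= D s s'"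
    using split[of s r1 s'] split[of r1 r2 s'] r by (simp add: D_def)
   thus ?thesis by (simp add: I_def D_def \<gamma>_def)
  qed
 qed
 have bound: "(LI x. ind E1 x * (\<Sum>i\<in>UNIV. trunc M (G1 x i))) + (LI x. ind E2 x * (\<Sum>i\<in>UNIV. trunc M (G2 x i))) <= p + a * A + 2 / dl * vol E3"
  if M: "0 <= M" for M
 proof -
  have "(LI x. ind E x * (\<Sum>i\<in>UNIV. g M i x)) <= p + a * A"
   by (rule lower_bound_incr[OF T]) (use TK K1 Ka gm gb[OF M] inc[OF M] in auto)
  moreover have "(LI x. ind E x * (\<Sum>i\<in>UNIV. g M i x)) = (LI x. ind E1 x * (\<Sum>i\<in>UNIV. trunc M (G1 x i)) + ind E2 x * (\<Sum>i\<in>UNIV. trunc M (G2 x i)) - 2 / dl * ind E3 x)"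
  proof (intro Bochner_Integration.integral_cong refl)
   fix x
   consider "x $ j <= t" | "t' <= x $ j" | "t < x $ j" "x $ j < t'" by linarith
   thus "ind E x * (\<Sum>i\<in>UNIV. g M i x) = ind E1 x * (\<Sum>i\<in>UNIV. trunc M (G1 x i)) + ind E2 x * (\<Sum>i\<in>UNIV. trunc M (G2 x i)) - 2 / dl * ind E3 x"
    using t by cases (auto simp: g_def E1_def E2_def E3_def indicator_def)
  qed
  moreover have "(LI x. ind E1 x * (\<Sum>i\<in>UNIV. trunc M (G1 x i)) + ind E2 x * (\<Sum>i\<in>UNIV. trunc M (G2 x i)) - 2 / dl * ind E3 x)
   = (LI x. ind E1 x * (\<Sum>i\<in>UNIV. trunc M (G1 x i))) + (LI x. ind E2 x * (\<Sum>i\<in>UNIV. trunc M (G2 x i))) - 2 / dl * vol E3"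
  proof -
   have "intg (\<lambda>x. ind F x * (\<Sum>i\<in>UNIV. trunc M (H x i)))"
    if [measurable]: "F \<in> sets borel" "!!i. meas (\<lambda>x. H x i)" and "evol F < \<infinity>" for F and H :: "real^'n => 'n => ennreal"
   proof (rule int_bound)
    show "intg (\<lambda>x. (real CARD('n) * M) * ind F x)"
     using that by (intro integrable_mult_right integrable_real_indicator) auto
    have "(\<Sum>i\<in>UNIV. trunc M (H x i)) <= (\<Sum>i\<in>(UNIV::'n set). M)" for x
     using M by (intro sum_mono) (simp add: trunc_range)
    thus "AE x in lborel. norm (ind F x * (\<Sum>i\<in>UNIV. trunc M (H x i))) <= norm ((real CARD('n) * M) * ind F x)"
     using M by (intro AE_I2) (auto simp: indicator_def trunc_range sum_nonneg)
   qed measurable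
   thus ?thesis using fin G1 G2 by (simp add: Bochner_Integration.integral_diff Bochner_Integration.integral_add)
  qed
  ultimately show ?thesis by linarith
 qed
 have nonneg: "0 <= (LI x. ind F x * (\<Sum>i\<in>UNIV. trunc M (H x i)))" for F M and H :: "real^'n => 'n => ennreal"
  by (intro Bochner_Integration.integral_nonneg mult_nonneg_nonneg sum_nonneg) (auto simp: trunc_range)
 have "(NN x. (\<Sum>i\<in>UNIV. G1 x i) * ind E1 x) + (NN x. (\<Sum>i\<in>UNIV. G2 x i) * ind E2 x) <= ennreal (p + a * A + 2 / dl * vol E3)"
 proof (rule LIMSEQ_le_const2[OF tendsto_add[OF trunc_lim[OF G1 _ fin(1)] trunc_lim[OF G2 _ fin(2)]]])
  show "\<exists>N. \<forall>n\<ge>N. ennreal (LI x. ind E1 x * (\<Sum>i\<in>UNIV. trunc (real n) (G1 x i))) + ennreal (LI x. ind E2 x * (\<Sum>i\<in>UNIV. trunc (real n) (G2 x i)))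
    <= ennreal (p + a * A + 2 / dl * vol E3)"
   using bound nonneg by (auto simp: ennreal_plus[symmetric] simp del: ennreal_plus intro!: ennreal_leI)
 qed auto
 hence "ennreal (real CARD('n) * c1 * vol E1) + ennreal (real CARD('n) * c2 * vol E2) <= ennreal (p + a * A + 2 / dl * vol E3)"
  using low1 low2 by (meson add_mono order_trans)
 moreover have c12: "0 < c1" "0 < c2" unfolding c1_def c2_def using K(2) V1 V2 by (auto intro: dilation_pos simp: E1_def E2_def)
 ultimately have "ennreal (real CARD('n) * c1 * vol E1 + real CARD('n) * c2 * vol E2) <= ennreal (p + a * A + 2 / dl * vol E3)"
  by (simp add: ennreal_plus)
 moreover have "0 < real CARD('n) * c1 * vol E1 + real CARD('n) * c2 * vol E2"
  using c12 V1 V2 by (simp add: E1_def E2_def add_pos_pos)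
 ultimately have "real CARD('n) * c1 * vol E1 + real CARD('n) * c2 * vol E2 <= p + a * A + 2 / dl * vol E3"
  by (simp add: ennreal_le_iff2)
 thus ?thesis by (simp add: iso_bound_def c1_def c2_def E1_def E2_def E3_def dl_def)
qed

end

end

section \<open>The case of equality\<close>

text \<open>A mass bound on intervals passes to the zero set \<open>B\<close> of the density:
  \<open>B\<close> has no mass, so by outer regularity some open neighbourhood has little, and
  filling it with non-overlapping intervals that cover \<open>B\<close> bounds the length of
  \<open>B\<close> by that little mass.\<close>

lemma AE_nonzero_of_interval_bound:
 fixes r :: "real => ennreal"
 assumes [measurable]: "meas r" and fin: "(NN u. r u) < \<infinity>" and ps: "ps > 0" and ab: "ap < bt"
  and le: "!!s t. ap <= s ==> s <= t ==> t <= bt ==> ennreal (ps * (t - s)) <= (NN u. r u * ind {s..t} u)"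
 shows "AE u in lborel. ap < u \<and> u < bt --> r u ~= 0"
proof -
 define M where "M = density lborel r"
 have sM [measurable_cong]: "sets M = sets borel" by (simp add: M_def)
 define B where "B = {u. ap < u \<and> u < bt \<and> r u = 0}"
 have B [measurable]: "B \<in> sets borel"
 proof -
  have "{u \<in> space borel. ap < u \<and> u < bt \<and> r u = 0} \<in> sets borel" by measurable
  thus ?thesis by (simp add: B_def)
 qed
 have "emeasure M B = (NN u. r u * ind B u)" by (simp add: M_def emeasure_density)
 also have "... = (\<integral>\<^sup>+u. 0 \<partial>(lborel::real measure))" by (intro nn_integral_cong) (auto simp: B_def indicator_def)
 finally have MB: "emeasure M B = 0" by simp
 have "emeasure M (space M) ~= \<infinity>" using fin by (simp add: M_def emeasure_density)
 hence reg: "emeasure M B = (INF U \<in> {U. B \<subseteq> U \<and> open U}. emeasure M U)"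
  using outer_regular[OF sM _ B] by simp
 have small: "ennreal ps * evol B <= ennreal e" if e: "e > 0" for e
 proof -
  have "(INF U \<in> {U. B \<subseteq> U \<and> open U}. emeasure M U) < ennreal e"
   using reg MB e by simp
  then obtain U where U: "B \<subseteq> U" "open U" "emeasure M U < ennreal e" by (auto simp: INF_less_iff)
  define U' where "U' = U \<inter> {ap<..<bt}"
  have U': "open U'" "B \<subseteq> U'" using U by (auto simp: U'_def B_def)
  \<comment> \<open>This gauge forces every covering interval into the open neighbourhood
    \<open>U'\<close>.\<close>
  have g: "gauge (\<lambda>x. if x \<in> U' then U' else UNIV)"
   using U' by (auto simp: gauge_def)
  have bx: "B \<subseteq> cbox ap bt" "box ap bt ~= {}" using ab by (auto simp: B_def)
  obtain \<D> where D: "countable \<D>" "\<Union>\<D> \<subseteq> cbox ap bt"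
   "!!K. K \<in> \<D> ==> interior K ~= {} \<and> (\<exists>c d. K = cbox c d)"
   "pairwise (\<lambda>A B. interior A \<inter> interior B = {}) \<D>"
   "!!K. K \<in> \<D> ==> \<exists>x \<in> B \<inter> K. K \<subseteq> (if x \<in> U' then U' else UNIV)"
   "B \<subseteq> \<Union>\<D>"
   by (rule covering_lemma[OF bx g], rule that) assumption+
  have KU: "K \<subseteq> U'" if "K \<in> \<D>" for K using D(5)[OF that] U' by (auto split: if_splits)
  have disj: "disjoint_family_on interior \<D>"
   using D(4) by (auto simp: disjoint_family_on_def pairwise_def)
  have piece: "ennreal ps * evol (interior K) <= emeasure M (interior K)" if K: "K \<in> \<D>" for K
  proof -
   obtain c d where cd: "K = {c..d}" using D(3)[OF K] by auto
   have ne: "c < d" using D(3)[OF K] unfolding cd by auto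
   have "ap <= c" "d <= bt" using D(2) K ne unfolding cd by (auto dest!: subsetD)
   hence "ennreal (ps * (d - c)) <= (NN u. r u * ind {c..d} u)" using le ne by simp
   also have "... = (NN u. r u * ind {c<..<d} u)"
   proof (rule nn_integral_cong_AE)
    have "AE u in lborel. u ~= c" "AE u in lborel. u ~= d" by (simp_all add: AE_lborel_singleton)
    thus "AE u in lborel. r u * ind {c..d} u = r u * ind {c<..<d} u"
     by eventually_elim (auto simp: indicator_def)
   qed
   also have "... = emeasure M {c<..<d}" by (simp add: M_def emeasure_density)
   finally show ?thesis using ne ps unfolding cd by (simp add: ennreal_mult)
  qed
  have sub: "B - (\<Union>K\<in>\<D>. interior K) \<subseteq> (\<Union>K\<in>\<D>. K - interior K)" using D(6) by auto
  have fr: "(\<Union>K\<in>\<D>. K - interior K) \<in> null_sets lborel"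
  proof (intro null_sets_UN' D(1))
   fix K assume K: "K \<in> \<D>"
   obtain c d where "K = {c..d}" using D(3)[OF K] by auto
   hence "K - interior K \<subseteq> {c, d}" by auto
   moreover have "finite {c, d}" by simp
   ultimately have "countable (K - interior K)" using countable_finite countable_subset by blast
   thus "K - interior K \<in> null_sets lborel" by (rule countable_imp_null_set_lborel)
  qed
  have mI: "(\<Union>K\<in>\<D>. interior K) \<in> sets borel" by (intro borel_open open_UN ballI open_interior)
  have "B - (\<Union>K\<in>\<D>. interior K) \<in> sets lborel" using B mI by auto
  from null_sets_subset[OF fr this sub]
  have "B - (\<Union>K\<in>\<D>. interior K) \<in> null_sets lborel" .
  hence "evol B <= evol (\<Union>K\<in>\<D>. interior K)"
  proof -
   assume n: "B - (\<Union>K\<in>\<D>. interior K) \<in> null_sets lborel"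
   have "evol B <= evol ((\<Union>K\<in>\<D>. interior K) \<union> (B - (\<Union>K\<in>\<D>. interior K)))"
    using mI by (intro emeasure_mono) auto
   also have "... = evol (\<Union>K\<in>\<D>. interior K)" using n mI by (intro emeasure_Un_null_set) auto
   finally show ?thesis .
  qed
  also have "... = (\<integral>\<^sup>+K. evol (interior K) \<partial>count_space \<D>)"
   by (rule emeasure_UN_countable[OF _ D(1) disj]) auto
  finally have "ennreal ps * evol B <= ennreal ps * (\<integral>\<^sup>+K. evol (interior K) \<partial>count_space \<D>)"
   by (rule mult_left_mono) simp
  also have "... = (\<integral>\<^sup>+K. ennreal ps * evol (interior K) \<partial>count_space \<D>)"
   by (rule nn_integral_cmult[symmetric]) simp
  also have "... <= (\<integral>\<^sup>+K. emeasure M (interior K) \<partial>count_space \<D>)"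
   using piece by (intro nn_integral_mono) auto
  also have "... = emeasure M (\<Union>K\<in>\<D>. interior K)"
   by (rule emeasure_UN_countable[OF _ D(1) disj, symmetric]) (auto simp: sM)
  also have "... <= emeasure M U"
   using KU interior_subset U(2) by (intro emeasure_mono) (fastforce simp: U'_def sM)+
  finally show ?thesis using U(3) by simp
 qed
 have "ennreal ps * evol B <= 0"
 proof (rule ennreal_le_epsilon)
  fix e :: real assume "0 < e"
  thus "ennreal ps * evol B <= 0 + ennreal e" using small by simp
 qed
 hence "evol B = 0" using ps by (simp add: ennreal_eq_0_iff)
 hence "AE u in lborel. u \<notin> B" using B by (intro AE_not_in) (auto simp: null_sets_def)
 thus ?thesis by eventually_elim (auto simp: B_def)
qed

text \<open>The dilation factor is strictly decreasing in the volume, so each part counts with a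
  larger factor than the whole.\<close>

lemma iso_bound_superadditive:
 assumes "0 < v" "0 < x" "0 < y"
 shows "iso_bound TYPE('n::finite) v (x + y) < iso_bound TYPE('n) v x + iso_bound TYPE('n) v y"
proof -
 have d: "dilation TYPE('n) v (x + y) < dilation TYPE('n) v z" if "z < x + y" "0 < z" for z
  unfolding dilation_def using assms that by (intro real_root_less_mono divide_strict_left_mono) auto
 have "dilation TYPE('n) v (x + y) * (x + y) < dilation TYPE('n) v x * x + dilation TYPE('n) v y * y"
 proof -
  have "dilation TYPE('n) v (x + y) * x < dilation TYPE('n) v x * x" "dilation TYPE('n) v (x + y) * y < dilation TYPE('n) v y * y"
   using d[of x] d[of y] assms by (auto intro!: mult_strict_right_mono)
  thus ?thesis by (simp add: distrib_left)
 qed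
 hence "real CARD('n) * (dilation TYPE('n) v (x + y) * (x + y)) < real CARD('n) * (dilation TYPE('n) v x * x + dilation TYPE('n) v y * y)"
  by (intro mult_strict_left_mono) auto
 thus ?thesis by (simp add: iso_bound_def algebra_simps)
qed

lemma continuous_iso_bound: "continuous_on {0<..} (iso_bound TYPE('n::finite) v)"
 unfolding iso_bound_def dilation_def by (intro continuous_intros) auto

text \<open>Splitting the volume gains at least \<open>2 * eh\<close>, uniformly by compactness. If
  the mass of a slab is below \<open>d\<close>, uniform continuity still leaves the gain
  \<open>eh\<close>, which \<open>gap\<close> converts into mass proportional to the width;
  otherwise the mass is at least \<open>d\<close> anyway.\<close>

lemma cdf_lower_lipschitz:
 fixes G :: "real => real"
 assumes mono: "mono G" and v: "0 < v" and ab: "ap < bt" "0 < G ap" "G bt < V"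
  and gap: "!!t t'. ap <= t ==> t < t' ==> t' <= bt ==>
   iso_bound TYPE('n::finite) v (G t) + iso_bound TYPE('n) v (V - G t') <= iso_bound TYPE('n) v V + 2 / (t' - t) * (G t' - G t)"
 obtains ps where "ps > 0" "!!t t'. ap <= t ==> t <= t' ==> t' <= bt ==> ps * (t' - t) <= G t' - G t"
proof -
 let ?I = "iso_bound TYPE('n) v"
 have Gab: "G ap <= G bt" using mono ab by (simp add: mono_def)
 have V: "0 < V" using ab Gab by simp
 define \<Phi> where "\<Phi> x = ?I x + ?I (V - x) - ?I V" for x
 have cont: "continuous_on {G ap..G bt} \<Phi>"
  unfolding \<Phi>_def using ab Gab
  by (intro continuous_intros continuous_on_compose2[OF continuous_iso_bound]) auto
 obtain x0 where x0: "x0 \<in> {G ap..G bt}" "!!x. x \<in> {G ap..G bt} ==> \<Phi> x0 <= \<Phi> x"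
  using continuous_attains_inf[OF _ _ cont] Gab by auto
 define eh where "eh = \<Phi> x0 / 2"
 have "0 < \<Phi> x0" using iso_bound_superadditive[OF v, of x0 "V - x0", where 'n='n] x0(1) ab by (simp add: \<Phi>_def)
 hence eh: "0 < eh" by (simp add: eh_def)
 have "uniformly_continuous_on {V - G bt..V - G ap} ?I"
  using ab Gab by (intro compact_uniformly_continuous continuous_on_subset[OF continuous_iso_bound]) auto
 then obtain d where d: "d > 0" "!!x y. x \<in> {V - G bt..V - G ap} ==> y \<in> {V - G bt..V - G ap} ==> dist y x < d ==> dist (?I y) (?I x) < eh"
  using eh unfolding uniformly_continuous_on_def by metis
 \<comment> \<open>One entry for each of the two alternatives: the linear growth
   \<open>eh / 2\<close>, and the mass \<open>d\<close> spread over the whole length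
   \<open>bt - ap\<close>.\<close>
 define ps where "ps = min (eh / 2) (d / (bt - ap))"
 have ps: "ps > 0" using eh d ab by (simp add: ps_def)
 have psle: "ps <= eh / 2" "ps <= d / (bt - ap)"
  unfolding ps_def by (rule min.cobounded1 min.cobounded2)+
 show ?thesis
 proof (rule that[OF ps])
  fix t t' assume t: "ap <= t" "t <= t'" "t' <= bt"
  have G: "G ap <= G t" "G t <= G t'" "G t' <= G bt" using mono t by (auto simp: mono_def)
  show "ps * (t' - t) <= G t' - G t"
  proof (cases "t = t'")
   case False
   hence tt: "t < t'" using t by simp
   show ?thesis
   proof (cases "G t' - G t < d")
    case True
    have "dist (?I (V - G t')) (?I (V - G t)) < eh"
     using G True by (intro d(2)) (auto simp: dist_real_def)
    hence "?I (V - G t) - eh <= ?I (V - G t')" by (simp add: dist_real_def)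
    moreover have "2 * eh <= \<Phi> (G t)" using x0(2)[of "G t"] G by (simp add: eh_def)
    ultimately have "eh <= 2 / (t' - t) * (G t' - G t)" using gap[OF t(1) tt t(3)] by (simp add: \<Phi>_def)
    hence "eh / 2 * (t' - t) <= G t' - G t" using tt by (simp add: field_simps)
    moreover have "ps * (t' - t) <= eh / 2 * (t' - t)" using tt psle by (intro mult_right_mono) auto
    ultimately show ?thesis by simp
   next
    case False
    have "ps * (t' - t) <= (d / (bt - ap)) * (bt - ap)"
     using t tt d ab psle by (intro mult_mono) auto
    thus ?thesis using False ab by simp
   qed
  qed simp
 qed
qed

lemma iint_box_pos:
 fixes y :: "real^'n::finite"
 assumes e: "0 < e" and "distinct is" "!!i. i \<notin> set is ==> \<bar>x $ i - y $ i\<bar> < e"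
 shows "0 < iint is (ind {z. \<forall>i. \<bar>z $ i - y $ i\<bar> < e}) x"
 using assms(2,3)
proof (induction "is" arbitrary: x)
 case Nil
 thus ?case by (simp add: indicator_def)
next
 case (Cons i "is")
 define F where "F = {z. \<forall>i. \<bar>z $ i - y $ i\<bar> < e}"
 have [measurable]: "F \<in> sets borel"
 proof -
  have "{z \<in> space borel. \<forall>i. \<bar>z $ i - y $ i\<bar> < e} \<in> sets borel" by measurable
  thus ?thesis by (simp add: F_def)
 qed
 have pos: "0 < iint is (ind F) (upd x i s)" if "s \<in> {y $ i - e<..<y $ i + e}" for s
  unfolding F_def using Cons.prems that by (intro Cons.IH) auto
 have "\<not> (NN s. iint is (ind F) (upd x i s)) = 0"
 proof
  assume "(NN s. iint is (ind F) (upd x i s)) = 0"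
  hence "AE s in lborel. iint is (ind F) (upd x i s) = 0"
   by (subst (asm) nn_integral_0_iff_AE) auto
  hence "AE s in lborel. s \<notin> {y $ i - e<..<y $ i + e}"
   by eventually_elim (use pos in force)
  hence "evol {y $ i - e<..<y $ i + e} = 0"
   by (subst (asm) AE_iff_measurable[where N="{y $ i - e<..<y $ i + e}"]) auto
  thus False using e by simp
 qed
 thus ?case by (simp add: F_def zero_less_iff_neq_zero)
qed

lemma marginal_integral:
 fixes f :: "real^'n::finite => ennreal"
 assumes dist: "distinct (j # rest)" "set (j # rest) = UNIV" and [measurable]: "meas f" "meas h"
 shows "(NN u. iint rest f (upd y j u) * h u) = (NN x. f x * h (x $ j))"
proof -
 have "(NN x. f x * h (x $ j)) = iint (j # rest) (\<lambda>x. h (x $ j) * f x) y"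
  by (subst iint_full[OF dist]) (auto simp: mult.commute)
 also have "... = (NN u. iint rest (\<lambda>x. h u * f x) (upd y j u))"
  unfolding iint.simps using dist(1) by (intro nn_integral_cong iint_cong) auto
 also have "... = (NN u. iint rest f (upd y j u) * h u)"
 proof (intro nn_integral_cong)
  fix u
  have "iint rest (\<lambda>x. h u * f x) (upd y j u) = h u * iint rest f (upd y j u)" by (rule iint_cmult) simp
  thus "iint rest (\<lambda>x. h u * f x) (upd y j u) = iint rest f (upd y j u) * h u" by (simp only: mult.commute)
 qed
 finally show ?thesis by simp
qed

lemma kslope_agree:
 assumes "i \<notin> set rest" "!!j. j \<notin> set rest ==> z $ j = x $ j"
 shows "kslope i rest f K z y = kslope i rest f K x y"
proof -
 have 1: "knondeg i rest f K z y = knondeg i rest f K x y"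
  using assms by (intro knondeg_agree) auto
 have 2: "iint (i # rest) f z = iint (i # rest) f x"
  using assms by (intro iint_agree) auto
 have 3: "iint rest f z = iint rest f x"
  using assms by (intro iint_agree) auto
 have 4: "kstep i rest f K z y = kstep i rest f K x y" by (rule kstep_agree[OF assms])
 show ?thesis unfolding kslope_def 1 2 3 4 ..
qed

text \<open>Equality is recorded as the reverse of the inequality \<open>isoperimetric\<close>.
  Convexity of \<open>K\<close> serves the gluing in \<open>gap\<close> and the positivity of the
  marginals of \<open>K\<close>.\<close>

locale equality_case = half_set k sg E p A ds
 for k :: "'n::finite" and sg E p A ds +
 fixes K :: "(real^'n) set" and a :: real
 assumes K: "compact K" "0 < vol K" and K1: "!!y. y \<in> K ==> norm y <= 1" and Ka: "!!y. y \<in> K ==> - a <= sg * y $ k"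
  and Epos: "0 < vol E" and convK: "convex K"
  and eq: "p + a * A <= iso_bound TYPE('n) (vol K) (vol E)"

begin

abbreviation "v \<equiv> vol K"

definition fac :: real where "fac = dilation TYPE('n) v V"

lemma fac: "0 < fac"
 unfolding fac_def by (rule dilation_pos[OF K(2) Epos])

lemma K_borel: "K \<in> sets borel" by (rule borel_compact[OF K(1)])

lemma emeasure_E: "evol E = ennreal V"
 using E_fin by (simp add: emeasure_eq_ennreal_measure less_top)

lemma emeasure_K: "evol K = ennreal v"
 using emeasure_bounded_finite[OF compact_imp_bounded[OF K(1)]] by (simp add: emeasure_eq_ennreal_measure less_top)

lemma K_ne: "K ~= {}" using K(2) by auto

lemma interior_K: "interior K ~= {}"
proof
 assume "interior K = {}"
 hence "negligible K" using negligible_convex_interior[OF convK] by simp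
 hence "emeasure lebesgue K = 0" by (simp add: negligible_iff_emeasure0 K_borel)
 hence "evol K = 0" using K_borel by simp
 thus False using K(2) by (simp add: measure_def)
qed

context
 fixes j :: 'n and "rest" :: "'n list"
 assumes dist: "distinct (j # rest)" "set (j # rest) = (UNIV :: 'n set)"

begin

text \<open>The marginal density of \<open>E\<close> in direction \<open>j\<close>. All other
  coordinates are integrated out, so the base point 0 is arbitrary; the same convention is used for
  the marginal \<open>kp\<close> of \<open>K\<close>.\<close>

definition r :: "real => ennreal" where "r u = iint rest (ind E) (upd 0 j u)"

definition kp :: "real => ennreal" where "kp t = iint rest (ind K) (upd 0 j t)"

definition P :: "real set" where "P = {t. upd 0 j t \<in> ext rest K}"

definition ta :: "real => real" where "ta u = kstep j rest (ind E) K (upd 0 j u) 0"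

definition s :: "real => ennreal" where "s u = kslope j rest (ind E) K (upd 0 j u) 0"

lemma e0: "0 \<in> ext (j # rest) K"
 using ext_full[OF dist(2) K_ne] by simp

lemma iint_E: "iint (j # rest) (ind E) x = ennreal V"
 by (subst iint_full[OF dist]) (simp_all add: emeasure_E)

lemma iint_K: "iint (j # rest) (ind K) x = ennreal v"
 using K_borel by (subst iint_full[OF dist]) (simp_all add: emeasure_K)

lemma nondeg: "knondeg j rest (ind E) K x y"
 unfolding knondeg_def iint_E iint_K using K(2) Epos by simp

lemma agree: "z $ j = x $ j ==> i \<notin> set rest ==> z $ i = x $ i"
 using dist(2) by (metis UNIV_I set_ConsD)

lemma kslope_eq: "kslope j rest (ind E) K x 0 = s (x $ j)"
 unfolding s_def by (rule kslope_agree[OF _ agree]) (use dist(1) in auto)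

lemma measurable_r: "meas r" and measurable_kp: "meas kp"
proof -
 note [measurable] = K_borel
 show "meas r" "meas kp"
  unfolding r_def[abs_def] kp_def[abs_def] by measurable
qed

lemma P_compact: "compact P" and P_ne: "P ~= {}"
 unfolding P_def using dist(1) e0 by (auto intro!: compact_ext_section K simp: ext_Cons_iff)

lemma P_iff: "t \<in> P \<longleftrightarrow> (\<exists>y\<in>K. y $ j = t)"
proof -
 have "i \<notin> set rest \<longleftrightarrow> i = j" for i using dist by auto
 thus ?thesis by (auto simp: P_def ext_def)
qed

lemma density: "density_transport1 r kp P (ennreal V) (ennreal v)"
 using dens[OF K(1) _ dist(1) nondeg e0, of 0] unfolding iint_E iint_K r_def[abs_def, symmetric] kp_def[abs_def, symmetric] P_def[symmetric]
 by simp

interpretation D: density_transport1 r kp P "ennreal V" "ennreal v"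
 by (rule density)

lemma ta_quant: "ta u = quant D.\<mu> D.\<nu> P u"
 unfolding ta_def kstep_def iint_E iint_K using e0 nondeg
 by (simp add: r_def[symmetric] kp_def[symmetric] P_def[symmetric])

lemma s_eq: "s u = r u / ennreal V * (ennreal v / kp (ta u))"
 unfolding s_def kslope_def iint_E iint_K using nondeg by (simp add: r_def kp_def ta_def)

lemma measurable_ta: "meas ta"
 unfolding ta_quant[abs_def] by simp

lemma measurable_s: "meas s"
proof -
 note [measurable] = measurable_r measurable_kp measurable_ta
 show ?thesis unfolding s_eq[abs_def] by measurable
qed

lemma ta_in: "ta u \<in> P" unfolding ta_quant by (rule D.quant_in)

lemma ta_increment: "u <= u' ==> (NN w. s w * ind {u..u'} w) <= ennreal (ta u' - ta u)"
 using D.increment[of u u'] by (simp add: s_eq ta_quant)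

lemma ta_mono: "u <= u' ==> ta u <= ta u'"
 unfolding ta_quant by (rule D.quant_mono)

lemma push:
 assumes [measurable]: "meas h"
 shows "(NN x. ind E x * h (ta (x $ j))) / ennreal V = (NN y. ind K y * h (y $ j)) / ennreal v"
proof -
 note [measurable] = measurable_r measurable_kp measurable_ta K_borel
 have "(NN u. r u * h (ta u) / ennreal V) = (NN t. kp t * h t / ennreal v)"
  using D.push[OF assms] unfolding ta_quant[symmetric] by (simp add: divide_ennreal_def mult_ac)
 hence "(NN u. r u * h (ta u)) / ennreal V = (NN t. kp t * h t) / ennreal v"
  by (simp add: nn_integral_divide)
 moreover have "(NN u. r u * h (ta u)) = (NN x. ind E x * h (ta (x $ j)))"
  unfolding r_def by (rule marginal_integral[OF dist]) measurable
 moreover have "(NN t. kp t * h t) = (NN y. ind K y * h (y $ j))"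
  unfolding kp_def by (rule marginal_integral[OF dist]) measurable
 ultimately show ?thesis by simp
qed

text \<open>The slope depends on \<open>x $ j\<close> alone, so the exceptional points of
  \<open>E\<close> form a cylinder, and Fubini makes its base null for the marginal.\<close>

lemma AE_slope: "AE u in lborel. r u ~= 0 --> s u = ennreal fac"
proof -
 note [measurable] = measurable_r measurable_s
 define B where "B = {u. s u ~= ennreal fac}"
 have [measurable]: "B \<in> sets borel"
 proof -
  have "{u \<in> space borel. s u ~= ennreal fac} \<in> sets borel" by measurable
  thus ?thesis by (simp add: B_def)
 qed
 have "AE x in lborel. x \<in> E --> s (x $ j) = ennreal fac"
  using equality_slope[OF K K1 Ka Epos eq dist] by (simp add: kslope_eq fac_def)
 hence "AE x in lborel. ind E x * ind B (x $ j) = (0::ennreal)"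
  by eventually_elim (auto simp: indicator_def B_def)
 hence "(NN x. ind E x * ind B (x $ j)) = (0::ennreal)"
  by (subst nn_integral_0_iff_AE) auto
 hence "(NN u. r u * ind B u) = 0"
  unfolding r_def by (subst marginal_integral[OF dist]) auto
 hence "AE u in lborel. r u * ind B u = 0" by (subst (asm) nn_integral_0_iff_AE) auto
 thus ?thesis by eventually_elim (auto simp: B_def indicator_def split: if_splits)
qed

lemma kp_finite: "kp t < \<infinity>"
 unfolding kp_def using dist(1) by (intro iint_indicator_finite compact_imp_bounded K) auto

text \<open>Change of variables: the absolutely continuous part of the transport fills the whole set
  where the target marginal is positive. There is equality because \<open>kp\<close> is finite and
  cancels exactly.\<close>

lemma slope_total: "(NN u. s u) = evol {t. kp t ~= 0}"
proof -
 note [measurable] = measurable_r measurable_kp measurable_ta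
 have [measurable]: "{t. kp t ~= 0} \<in> sets borel"
 proof -
  have "{t \<in> space borel. kp t ~= 0} \<in> sets borel" by measurable
  thus ?thesis by simp
 qed
 have "(NN u. s u) = (NN t. kp t / ennreal v * (ennreal v / kp t))"
  unfolding s_eq ta_quant by (rule D.push) measurable
 also have "... = (NN t. ind {t. kp t ~= 0} t)"
 proof (intro nn_integral_cong)
  fix t
  show "kp t / ennreal v * (ennreal v / kp t) = ind {t. kp t ~= 0} t"
  proof (cases "kp t = 0")
   case False
   have "kp t / kp t = 1" "ennreal v / ennreal v = 1"
    using False kp_finite[of t] K(2) by simp_all
   hence "kp t * inverse (kp t) = 1" "ennreal v * inverse (ennreal v) = 1" unfolding divide_ennreal_def .
   hence "(kp t * inverse (kp t)) * (ennreal v * inverse (ennreal v)) = 1" by simp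
   thus ?thesis using False unfolding divide_ennreal_def by (simp add: mult_ac)
  qed simp
 qed
 finally show ?thesis by simp
qed

lemma P_bdd: "bdd_below P" "bdd_above P"
 using P_compact by (auto simp: compact_imp_bounded bounded_imp_bdd_below bounded_imp_bdd_above)

lemma Inf_P: "Inf P \<in> P"
 by (rule closed_contains_Inf[OF P_ne P_bdd(1) compact_imp_closed[OF P_compact]])

lemma Sup_P: "Sup P \<in> P"
 by (rule closed_contains_Sup[OF P_ne P_bdd(2) compact_imp_closed[OF P_compact]])

text \<open>A convex set with interior has interior points near both extremes in direction
  \<open>j\<close>. The segment between two of them crosses the level \<open>t\<close> in the
  interior, where a small box makes the marginal positive.\<close>

lemma kp_pos: assumes t: "Inf P < t" "t < Sup P" shows "kp t ~= 0"
proof -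
 have cl: "closure (interior K) = K"
  using convex_closure_interior[OF convK interior_K] K(1) by (simp add: compact_imp_closed)
 have near: "\<exists>w\<in>interior K. \<bar>w $ j - z $ j\<bar> < e" if z: "z \<in> K" and e: "0 < e" for z e
 proof -
  have "z \<in> closure (interior K)" using cl z by simp
  then obtain w where "w \<in> interior K" "dist w z < e" using e unfolding closure_approachable by blast
  thus ?thesis using component_le_norm_cart[of "w - z" j] by (auto simp: dist_norm intro!: bexI[of _ w])
 qed
 obtain z1 where z1: "z1 \<in> K" "z1 $ j = Inf P" using Inf_P by (auto simp: P_iff)
 obtain z2 where z2: "z2 \<in> K" "z2 $ j = Sup P" using Sup_P by (auto simp: P_iff)
 obtain w1 where w1: "w1 \<in> interior K" "w1 $ j < t" using near[OF z1(1), of "t - Inf P"] t z1 by force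
 obtain w2 where w2: "w2 \<in> interior K" "t < w2 $ j" using near[OF z2(1), of "Sup P - t"] t z2 by force
 define l where "l = (t - w1 $ j) / (w2 $ j - w1 $ j)"
 have l: "0 <= l" "l <= 1" using w1 w2 by (auto simp: l_def field_simps)
 define y where "y = (1 - l) *\<^sub>R w1 + l *\<^sub>R w2"
 have "y \<in> interior K"
  unfolding y_def using l by (intro convexD[OF convex_interior[OF convK] w1(1) w2(1)]) auto
 have "y $ j = w1 $ j + l * (w2 $ j - w1 $ j)" by (simp add: y_def algebra_simps)
 also have "... = t" using w1 w2 by (simp add: l_def)
 finally have yj: "y $ j = t" .
 obtain d where d: "0 < d" "ball y d \<subseteq> K" using \<open>y \<in> interior K\<close> by (auto simp: mem_interior)
 define e where "e = d / real CARD('n)"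
 have e: "0 < e" using d by (simp add: e_def)
 have sub: "{z. \<forall>i. \<bar>z $ i - y $ i\<bar> < e} \<subseteq> K"
 proof
  fix z assume z: "z \<in> {z. \<forall>i. \<bar>z $ i - y $ i\<bar> < e}"
  have "norm (z - y) <= (\<Sum>i\<in>UNIV. \<bar>(z - y) $ i\<bar>)" by (rule norm_le_l1_cart)
  also have "... < (\<Sum>i\<in>(UNIV::'n set). e)" using z by (intro sum_strict_mono) auto
  also have "... = d" by (simp add: e_def)
  finally show "z \<in> K" using d(2) by (auto simp: dist_norm norm_minus_commute)
 qed
 have "0 < iint rest (ind {z. \<forall>i. \<bar>z $ i - y $ i\<bar> < e}) (upd 0 j t)"
 proof (rule iint_box_pos[OF e])
  fix i assume "i \<notin> set rest"
  hence "i = j" using dist(2) by auto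
  thus "\<bar>upd 0 j t $ i - y $ i\<bar> < e" using yj e by simp
 qed (use dist in auto)
 also have "... <= kp t"
  unfolding kp_def using sub by (intro iint_mono) (auto simp: indicator_def)
 finally show ?thesis by simp
qed

abbreviation "F \<equiv> cdf D.\<mu>"

lemma F_cont: "isCont F u"
 using D.no_atoms[of u] D.mu.isCont_cdf[of u] by (simp add: D.mu.emeasure_eq_measure)

lemma measure_E_slab:
 assumes [measurable]: "B \<in> sets borel"
 shows "vol (E \<inter> {x. x $ j \<in> B}) = V * measure D.\<mu> B"
proof -
 note [measurable] = measurable_r
 have "emeasure D.\<mu> B = (NN u. r u * ind B u) / ennreal V"
  by (subst nn_integral_divide[symmetric]) (auto simp: emeasure_density divide_ennreal_def mult_ac)
 also have "(NN u. r u * ind B u) = (NN x. ind E x * ind B (x $ j))"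
  unfolding r_def by (rule marginal_integral[OF dist]) measurable
 also have "... = (NN x. ind (E \<inter> {x. x $ j \<in> B}) x)"
  by (intro nn_integral_cong) (auto simp: indicator_def)
 also have "... = evol (E \<inter> {x. x $ j \<in> B})"
 proof -
  have "{x \<in> space borel. x \<in> E \<and> x $ j \<in> B} \<in> sets borel" by measurable
  thus ?thesis by (subst nn_integral_indicator) (auto simp: Int_def)
 qed
 finally have e: "emeasure D.\<mu> B = evol (E \<inter> {x. x $ j \<in> B}) / ennreal V" .
 have "evol (E \<inter> {x. x $ j \<in> B}) <= ennreal V"
  unfolding emeasure_E[symmetric] by (rule emeasure_mono) auto
 hence "evol (E \<inter> {x. x $ j \<in> B}) < \<top>" by (rule le_less_trans) simp
 hence "evol (E \<inter> {x. x $ j \<in> B}) = ennreal (vol (E \<inter> {x. x $ j \<in> B}))"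
  by (intro emeasure_eq_ennreal_measure) simp
 hence "ennreal (measure D.\<mu> B) = ennreal (vol (E \<inter> {x. x $ j \<in> B}) / V)"
  using e Epos by (simp add: D.mu.emeasure_eq_measure divide_ennreal)
 hence "measure D.\<mu> B = vol (E \<inter> {x. x $ j \<in> B}) / V"
  using Epos by (subst (asm) ennreal_inj) auto
 thus ?thesis using Epos by simp
qed

lemma measure_lessThan: "measure D.\<mu> {..<u} = F u"
proof -
 have "measure D.\<mu> {..u} = measure D.\<mu> {..<u} + measure D.\<mu> {u}"
  by (subst D.mu.finite_measure_Union[symmetric]) (auto intro!: arg_cong[of _ _ "measure D.\<mu>"])
 thus ?thesis using D.no_atoms[of u] by (simp add: cdf_def D.mu.emeasure_eq_measure)
qed

text \<open>Excludes holes in the marginal of \<open>E\<close>, over which the slope of the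
  transport would be unknown. The interval is kept strictly between the extreme quantiles so that
  both sides of every slab carry mass, as \<open>gap\<close> requires.\<close>

lemma inner_density:
 assumes ab: "ap < bt" "0 < F ap" "F bt < 1"
 shows "AE u in lborel. ap < u \<and> u < bt --> r u ~= 0"
proof -
 note [measurable] = measurable_r
 define G where "G t = V * F t" for t
 have G: "vol (E \<inter> {x. x $ j <= t}) = G t" for t
  using measure_E_slab[of "{..t}"] by (simp add: G_def cdf_def)
 have G2: "vol (E \<inter> {x. t <= x $ j}) = V - G t" for t
 proof -
  have "vol (E \<inter> {x. x $ j \<in> {t..}}) = V * measure D.\<mu> {t..}" by (rule measure_E_slab) simp
  also have "measure D.\<mu> {t..} = 1 - measure D.\<mu> {..<t}"
   using D.mu.prob_compl[of "{..<t}"] by (simp add: Compl_eq_Diff_UNIV[symmetric])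
  finally show ?thesis by (simp add: measure_lessThan G_def algebra_simps)
 qed
 have G3: "vol (E \<inter> {x. t < x $ j \<and> x $ j < t'}) <= G t' - G t" if "t < t'" for t t'
 proof -
  have "vol (E \<inter> {x. x $ j \<in> {t<..<t'}}) = V * measure D.\<mu> {t<..<t'}" by (rule measure_E_slab) simp
  also have "... <= V * measure D.\<mu> {t<..t'}"
   using Epos by (intro mult_left_mono D.mu.finite_measure_mono) auto
  also have "... = G t' - G t" using D.mu.cdf_diff_eq[OF that] by (simp add: G_def algebra_simps)
  finally show ?thesis by simp
 qed
 have mono: "mono G" using Epos D.mu.cdf_nondecreasing by (auto simp: mono_def G_def intro!: mult_left_mono)
 have Gab: "0 < G ap" "G bt < V" using ab Epos by (auto simp: G_def)
 have gap': "iso_bound TYPE('n) v (G t) + iso_bound TYPE('n) v (V - G t') <= iso_bound TYPE('n) v V + 2 / (t' - t) * (G t' - G t)"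
  if t: "ap <= t" "t < t'" "t' <= bt" for t t'
 proof -
  have "0 < G t" using mono t(1) Gab by (meson monoD less_le_trans)
  moreover have "0 < V - G t'" using monoD[OF mono t(3)] Gab by simp
  ultimately have "iso_bound TYPE('n) v (G t) + iso_bound TYPE('n) v (V - G t') <= p + a * A + 2 / (t' - t) * vol (E \<inter> {x. t < x $ j \<and> x $ j < t'})"
   using gap[OF K K1 Ka Epos t(2), of j] convK unfolding G G2 by blast
  also have "... <= iso_bound TYPE('n) v V + 2 / (t' - t) * (G t' - G t)"
   using eq G3[OF t(2)] t by (intro add_mono mult_left_mono) auto
  finally show ?thesis .
 qed
 obtain ps where ps: "ps > 0" "!!t t'. ap <= t ==> t <= t' ==> t' <= bt ==> ps * (t' - t) <= G t' - G t"
  by (rule cdf_lower_lipschitz[OF mono K(2) ab(1) Gab], rule gap', assumption+, rule that) assumption+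
 show ?thesis
 proof (rule AE_nonzero_of_interval_bound[OF measurable_r _ ps(1) ab(1)])
  show "(NN u. r u) < \<infinity>" using D.m by simp
  fix s t assume st: "ap <= s" "s <= t" "t <= bt"
  have "G t - G s <= V * measure D.\<mu> {s..t}"
  proof (cases "s = t")
   case False
   hence "G t - G s = V * measure D.\<mu> {s<..t}" using st D.mu.cdf_diff_eq[of s t] by (simp add: G_def algebra_simps)
   also have "... <= V * measure D.\<mu> {s..t}" using Epos by (intro mult_left_mono D.mu.finite_measure_mono) auto
   finally show ?thesis .
  qed (simp add: Epos less_imp_le)
  hence "ps * (t - s) <= V * measure D.\<mu> {s..t}" using ps(2)[OF st] by simp
  hence "ennreal (ps * (t - s)) <= ennreal V * emeasure D.\<mu> {s..t}"
   using Epos by (simp add: D.mu.emeasure_eq_measure ennreal_mult[symmetric] ennreal_leI)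
  also have "emeasure D.\<mu> {s..t} = (NN u. r u * ind {s..t} u) / ennreal V"
   by (subst nn_integral_divide[symmetric]) (auto simp: emeasure_density divide_ennreal_def mult_ac)
  also have "ennreal V * ... <= (NN u. r u * ind {s..t} u)"
   by (rule ennreal_mult_div_le)
  finally show "ennreal (ps * (t - s)) <= (NN u. r u * ind {s..t} u)" .
 qed
qed

text \<open>Without holes the slope is \<open>fac\<close> almost everywhere, and the increment
  dominates its integral.\<close>

lemma ta_expanding:
 assumes ab: "ap < bt" "0 < F ap" "F bt < 1"
 shows "fac * (bt - ap) <= ta bt - ta ap"
proof -
 have "ennreal (fac * (bt - ap)) = (NN w. ennreal fac * ind {ap..bt} w)"
  using fac ab by (subst nn_integral_cmult) (auto simp: ennreal_mult)
 also have "... = (NN w. s w * ind {ap..bt} w)"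
 proof (rule nn_integral_cong_AE)
  have "AE w in lborel. w ~= ap" "AE w in lborel. w ~= bt" by (simp_all add: AE_lborel_singleton)
  thus "AE w in lborel. ennreal fac * ind {ap..bt} w = s w * ind {ap..bt} w"
   using inner_density[OF ab] AE_slope by eventually_elim (auto simp: indicator_def)
 qed
 also have "... <= ennreal (ta bt - ta ap)" using ab by (intro ta_increment) simp
 finally show ?thesis using ta_mono[of ap bt] ab by (simp add: ennreal_le_iff)
qed

text \<open>The transport expands by at least \<open>fac\<close> over the interval carrying
  \<open>E\<close>, so this interval is no longer than \<open>(Sup P - Inf P) / fac\<close>; the
  total slope shows that it is no shorter either. Hence no jump is left and the map is
  affine.\<close>

lemma ta_affine:
 obtains ap bt where "ap < bt" "!!u. ap < u ==> u < bt ==> ta u = Inf P + fac * (u - ap)"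
  "Sup P - Inf P = fac * (bt - ap)" "!!u. u < ap ==> F u = 0" "!!u. bt < u ==> F u = 1"
  "!!u. ap < u ==> 0 < F u" "!!u. u < bt ==> F u < 1"
proof -
 define S where "S = {u. 0 < F u \<and> F u < 1}"
 have ivt: "\<exists>u. F u = y" if "0 < y" "y < 1" for y
 proof -
  have "\<forall>\<^sub>F u in at_bot. F u < y" using that D.mu.cdf_lim_at_bot by (auto simp: order_tendsto_iff)
  then obtain u1 where u1: "F u1 < y" by (auto simp: eventually_at_bot_linorder)
  have "\<forall>\<^sub>F u in at_top. y < F u" using that D.mu.cdf_lim_at_top_prob by (auto simp: order_tendsto_iff)
  then obtain u2 where u2: "y < F u2" by (auto simp: eventually_at_top_linorder)
  have "u1 <= u2" using D.mu.cdf_nondecreasing[of u2 u1] u1 u2 by linarith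
  thus ?thesis using IVT[of F u1 y u2] u1 u2 F_cont by auto
 qed
 \<comment> \<open>Two interior quantiles ensure that \<open>S\<close> spans an interval of positive
   length.\<close>
 obtain u1 where u1: "F u1 = 1/3" using ivt[of "1/3"] by auto
 obtain u2 where u2: "F u2 = 2/3" using ivt[of "2/3"] by auto
 have u12: "u1 < u2" using D.mu.cdf_nondecreasing[of u2 u1] u1 u2 by linarith
 have uS: "u1 \<in> S" "u2 \<in> S" using u1 u2 by (auto simp: S_def)
 have taP: "Inf P <= ta u" "ta u <= Sup P" for u
  using cInf_lower[OF ta_in P_bdd(1)] cSup_upper[OF ta_in P_bdd(2)] by auto
 have len: "\<bar>x - y\<bar> <= (Sup P - Inf P) / fac" if "x \<in> S" "y \<in> S" for x y
 proof -
  have *: "x - y <= (Sup P - Inf P) / fac" if "x \<in> S" "y \<in> S" "y < x" for x y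
  proof -
   have "fac * (x - y) <= Sup P - Inf P"
    using ta_expanding[of y x] that taP[of x] taP[of y] by (auto simp: S_def)
   thus ?thesis using fac by (simp add: field_simps)
  qed
  have "0 <= (Sup P - Inf P) / fac" using fac taP[of 0] by simp
  thus ?thesis using *[of x y] *[of y x] that by (cases x y rule: linorder_cases) auto
 qed
 have bdd: "bdd_below S" "bdd_above S"
 proof -
  have "u1 - (Sup P - Inf P) / fac <= x" "x <= u1 + (Sup P - Inf P) / fac" if "x \<in> S" for x
   using len[OF that uS(1)] by auto
  thus "bdd_below S" "bdd_above S" by (meson bdd_below.I bdd_above.I)+
 qed
 define ap where "ap = Inf S"
 define bt where "bt = Sup S"
 have ab: "ap <= u1" "u2 <= bt" unfolding ap_def bt_def using bdd uS by (auto intro: cInf_lower cSup_upper)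
 have lt: "ap < bt" using ab u12 by simp
 have ne: "S ~= {}" using uS by auto
 have below: "\<exists>x\<in>S. x < u" if "ap < u" for u
  using that cInf_less_iff[OF ne bdd(1), of u] by (simp add: ap_def)
 have above: "\<exists>y\<in>S. u < y" if "u < bt" for u
  using that less_cSup_iff[OF ne bdd(2), of u] by (simp add: bt_def)
 have Sin: "u \<in> S" if "ap < u" "u < bt" for u
 proof -
  obtain x where x: "x \<in> S" "x < u" using below[OF \<open>ap < u\<close>] by blast
  obtain y where y: "y \<in> S" "u < y" using above[OF \<open>u < bt\<close>] by blast
  show ?thesis
   using x y D.mu.cdf_nondecreasing[of x u] D.mu.cdf_nondecreasing[of u y] by (auto simp: S_def)
 qed
 have F0: "F u = 0" if "u < ap" for u
 proof -
  have "u \<notin> S" using that cInf_lower[OF _ bdd(1), of u] by (auto simp: ap_def)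
  moreover have "F u <= 1/3" using D.mu.cdf_nondecreasing[of u u1] ab that u1 by simp
  ultimately show ?thesis using D.mu.cdf_nonneg[of u] by (auto simp: S_def)
 qed
 have F1: "F u = 1" if "bt < u" for u
 proof -
  have "u \<notin> S" using that cSup_upper[OF _ bdd(2), of u] by (auto simp: bt_def)
  moreover have "2/3 <= F u" using D.mu.cdf_nondecreasing[of u2 u] ab that u2 by simp
  ultimately show ?thesis using D.mu.cdf_bounded_prob[of u] by (auto simp: S_def)
 qed
 have Fpos: "0 < F u" if "ap < u" for u
 proof -
  obtain x where x: "x \<in> S" "x < u" using below[OF \<open>ap < u\<close>] by blast
  thus ?thesis using D.mu.cdf_nondecreasing[of x u] by (auto simp: S_def)
 qed
 have Flt: "F u < 1" if "u < bt" for u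
 proof -
  obtain y where y: "y \<in> S" "u < y" using above[OF \<open>u < bt\<close>] by blast
  thus ?thesis using D.mu.cdf_nondecreasing[of u y] by (auto simp: S_def)
 qed
 have outside: "AE u in lborel. u \<notin> {ap..bt} --> r u = 0"
 proof -
  note [measurable] = measurable_r
  have "isCont F ap" "isCont F bt" by (rule F_cont)+
  have "F ap = 0"
  proof (rule LIMSEQ_unique)
   have "(\<lambda>n. ap - inverse (real (Suc n))) ----> ap - 0" by (intro tendsto_intros LIMSEQ_inverse_real_of_nat)
   thus "(\<lambda>n. F (ap - inverse (real (Suc n)))) ----> F ap" using F_cont[of ap] by (intro isCont_tendsto_compose[of ap F]) auto
   show "(\<lambda>n. F (ap - inverse (real (Suc n)))) ----> 0" by (simp add: F0)
  qed
  moreover have "F bt = 1"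
  proof (rule LIMSEQ_unique)
   have "(\<lambda>n. bt + inverse (real (Suc n))) ----> bt + 0" by (intro tendsto_intros LIMSEQ_inverse_real_of_nat)
   thus "(\<lambda>n. F (bt + inverse (real (Suc n)))) ----> F bt" using F_cont[of bt] by (intro isCont_tendsto_compose[of bt F]) auto
   show "(\<lambda>n. F (bt + inverse (real (Suc n)))) ----> 1" by (simp add: F1)
  qed
  ultimately have "measure D.\<mu> {ap<..bt} = 1" using D.mu.cdf_diff_eq[OF lt] by simp
  hence "AE u in D.\<mu>. u \<in> {ap<..bt}" by (subst D.mu.prob_eq_1[symmetric]) auto
  hence "AE u in lborel. 0 < r u / ennreal V --> u \<in> {ap<..bt}" by (subst (asm) AE_density) auto
  thus ?thesis
   by eventually_elim (use Epos in \<open>auto simp: zero_less_iff_neq_zero ennreal_divide_eq_0_iff\<close>)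
 qed
 \<comment> \<open>The slope is at most \<open>fac\<close> on \<open>{ap..bt}\<close> and 0 outside,
   while its integral is at least the length of the target interval.\<close>
 have "ennreal (Sup P - Inf P) = evol {Inf P<..<Sup P}" using taP[of 0] by simp
 also have "... <= evol {t. kp t ~= 0}"
 proof (rule emeasure_mono)
  note [measurable] = measurable_kp
  have "{t \<in> space borel. kp t ~= 0} \<in> sets borel" by measurable
  thus "{t. kp t ~= 0} \<in> sets lborel" by simp
 qed (use kp_pos in auto)
 also have "... = (NN u. s u)" by (rule slope_total[symmetric])
 also have "... <= (NN u. ennreal fac * ind {ap..bt} u)"
 proof (rule nn_integral_mono_AE)
  show "AE u in lborel. s u <= ennreal fac * ind {ap..bt} u"
   using outside AE_slope
  proof eventually_elim
   case (elim u)
   thus ?case by (cases "r u = 0") (auto simp: s_eq indicator_def)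
  qed
 qed
 also have "... = ennreal (fac * (bt - ap))" using fac lt by (subst nn_integral_cmult) (auto simp: ennreal_mult)
 finally have L: "Sup P - Inf P <= fac * (bt - ap)" using fac lt by (simp add: ennreal_le_iff)
 have low: "Inf P + fac * (u - ap) <= ta u" if "ap < u" "u < bt" for u
 proof (rule field_le_epsilon)
  fix e :: real assume e: "0 < e"
  define w where "w = ap + min ((u - ap) / 2) (e / fac)"
  \<comment> \<open>Expansion is known only strictly inside, so the endpoint is approached by
    \<open>w\<close>, with loss at most \<open>e\<close>.\<close>
  have w: "ap < w" "w < u" "w - ap <= e / fac" using that e fac by (auto simp: w_def min_def field_simps)
  have "fac * (u - w) <= ta u - ta w" using w Sin[of w] Sin[of u] that by (intro ta_expanding) (auto simp: S_def)
  moreover have "fac * (w - ap) <= e" using w(3) fac by (simp add: field_simps)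
  ultimately show "Inf P + fac * (u - ap) <= ta u + e" using taP(1)[of w] by (simp add: algebra_simps)
 qed
 have up: "ta u <= Sup P - fac * (bt - u)" if "ap < u" "u < bt" for u
 proof (rule field_le_epsilon)
  fix e :: real assume e: "0 < e"
  define w where "w = bt - min ((bt - u) / 2) (e / fac)"
  have w: "w < bt" "u < w" "bt - w <= e / fac" using that e fac by (auto simp: w_def min_def field_simps)
  have "fac * (w - u) <= ta w - ta u" using w Sin[of w] Sin[of u] that by (intro ta_expanding) (auto simp: S_def)
  moreover have "fac * (bt - w) <= e" using w(3) fac by (simp add: field_simps)
  ultimately show "ta u <= Sup P - fac * (bt - u) + e" using taP(2)[of w] by (simp add: algebra_simps)
 qed
 have mid: "ap < (ap + bt) / 2" "(ap + bt) / 2 < bt" using lt by auto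
 have eqL: "Sup P - Inf P = fac * (bt - ap)"
 proof (rule order_antisym[OF L])
  have "fac * ((ap + bt) / 2 - ap) + fac * (bt - (ap + bt) / 2) = fac * (bt - ap)"
   by (simp only: distrib_left[symmetric]) (simp add: field_simps)
  thus "fac * (bt - ap) <= Sup P - Inf P"
   using low[OF mid] up[OF mid] by linarith
 qed
 show ?thesis
 proof (rule that[OF lt _ eqL F0 F1 Fpos Flt])
  fix u assume "ap < u" "u < bt"
  thus "ta u = Inf P + fac * (u - ap)"
   using low[of u] up[of u] eqL by (simp add: algebra_simps)
 qed
qed

end

end

context equality_case

begin

context
 fixes j :: 'n and "rest" :: "'n list"
 assumes dist: "distinct (j # rest)" "set (j # rest) = (UNIV :: 'n set)"

begin

text \<open>Pushing the square function forward under the affine map transfers the second moment.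
  The last two clauses say that \<open>E\<close> really reaches both ends of its projected
  interval.\<close>

lemma moment_list:
 "\<exists>t0. (AE x in lborel. x \<in> E --> (INF y\<in>K. y $ j) <= fac * (x $ j - t0) \<and> fac * (x $ j - t0) <= (SUP y\<in>K. y $ j)) \<and>
  (NN x. ind E x * ennreal ((fac * (x $ j - t0))\<^sup>2)) / ennreal V
   = (NN y. ind K y * ennreal ((y $ j)\<^sup>2)) / ennreal v \<and>
  (\<forall>e>0. 0 < vol (E \<inter> {x. x $ j \<in> {..t0 + (INF y\<in>K. y $ j) / fac + e}})) \<and>
  (\<forall>e>0. 0 < vol (E \<inter> {x. x $ j \<in> {t0 + (SUP y\<in>K. y $ j) / fac - e..}}))"
proof -
 define Q where "Q = P j rest"
 have PK: "Q = (\<lambda>y. y $ j) ` K"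
  using P_iff[OF dist] by (auto simp: Q_def)
 note [measurable] = measurable_ta[OF dist]
 interpret D: density_transport1 "r j rest" "kp j rest" "P j rest" "ennreal V" "ennreal v"
  by (rule density[OF dist])
 obtain ap bt where ab: "ap < bt" and aff: "!!u. ap < u ==> u < bt ==> ta j rest u = Inf (P j rest) + fac * (u - ap)"
  and len: "Sup (P j rest) - Inf (P j rest) = fac * (bt - ap)" and F0: "!!u. u < ap ==> cdf D.\<mu> u = 0" and F1: "!!u. bt < u ==> cdf D.\<mu> u = 1"
  and Fp: "!!u. ap < u ==> 0 < cdf D.\<mu> u" and Fl: "!!u. u < bt ==> cdf D.\<mu> u < 1"
  by (rule ta_affine[OF dist], rule that) assumption+
 note aff = aff[folded Q_def] and len = len[folded Q_def]
 \<comment> \<open>Chosen so that the affine transport reads \<open>fac * (u - t0)\<close>.\<close>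
 define t0 where "t0 = ap - Inf Q / fac"
 have al: "ap = t0 + Inf Q / fac" by (simp add: t0_def)
 have be: "bt = t0 + Sup Q / fac" using len fac by (simp add: t0_def field_simps)
 have cont: "isCont (cdf D.\<mu>) u" for u by (rule F_cont[OF dist])
 have Fa: "cdf D.\<mu> ap = 0"
 proof (rule tendsto_unique[OF trivial_limit_at_left_real])
  show "(cdf D.\<mu> \<longlongrightarrow> cdf D.\<mu> ap) (at_left ap)" using cont[of ap] by (simp add: isCont_def filterlim_at_split)
  show "(cdf D.\<mu> \<longlongrightarrow> 0) (at_left ap)"
   by (rule tendsto_eventually) (auto simp: eventually_at_left_field F0 intro!: exI[of _ "ap - 1"])
 qed
 have Fb: "cdf D.\<mu> bt = 1"
 proof (rule tendsto_unique[OF trivial_limit_at_right_real])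
  show "(cdf D.\<mu> \<longlongrightarrow> cdf D.\<mu> bt) (at_right bt)" using cont[of bt] by (simp add: isCont_def filterlim_at_split)
  show "(cdf D.\<mu> \<longlongrightarrow> 1) (at_right bt)"
   by (rule tendsto_eventually) (auto simp: eventually_at_right_field F1 intro!: exI[of _ "bt + 1"])
 qed
 have right: "measure D.\<mu> {u..} = 1 - cdf D.\<mu> u" for u
  using D.mu.prob_compl[of "{..<u}"] measure_lessThan[OF dist, of u] by (simp add: Compl_eq_Diff_UNIV[symmetric])
 have nullE: "AE x in lborel. x \<in> E --> x $ j \<notin> B" if [measurable]: "B \<in> sets borel" and 0: "measure D.\<mu> B = 0" for B
 proof -
  have m: "E \<inter> {x. x $ j \<in> B} \<in> sets borel"
  unfolding Int_def by (rule borel_Collect) measurable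
  have "vol (E \<inter> {x. x $ j \<in> B}) = 0" using measure_E_slab[OF dist, of B] 0 by simp
  moreover have "evol (E \<inter> {x. x $ j \<in> B}) < \<top>"
  proof (rule le_less_trans)
   show "evol (E \<inter> {x. x $ j \<in> B}) <= evol E" by (rule emeasure_mono) auto
  qed (use E_fin in simp)
  ultimately have "evol (E \<inter> {x. x $ j \<in> B}) = 0" by (auto simp: measure_def enn2real_eq_0_iff)
  hence "E \<inter> {x. x $ j \<in> B} \<in> null_sets lborel" using m by (auto simp: null_sets_def)
  from AE_not_in[OF this] show ?thesis by eventually_elim auto
 qed
 have AEin: "AE x in lborel. x \<in> E --> ta j rest (x $ j) = fac * (x $ j - t0)"
 proof -
  have "AE x in lborel. x \<in> E --> x $ j \<notin> {..ap}" by (rule nullE) (use Fa in \<open>auto simp: cdf_def\<close>)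
  moreover have "AE x in lborel. x \<in> E --> x $ j \<notin> {bt..}" by (rule nullE) (use Fb right[of bt] in auto)
  ultimately show ?thesis
  proof eventually_elim
  case (elim x)
  show ?case
  proof
   assume "x \<in> E"
   hence "ta j rest (x $ j) = Inf Q + fac * (x $ j - ap)" using elim by (intro aff) auto
   thus "ta j rest (x $ j) = fac * (x $ j - t0)" using fac by (simp add: t0_def algebra_simps)
  qed
  qed
 qed
 have taQ: "Inf Q <= ta j rest u" "ta j rest u <= Sup Q" for u
  using cInf_lower[OF ta_in[OF dist] P_bdd(1)[OF dist]] cSup_upper[OF ta_in[OF dist] P_bdd(2)[OF dist]] by (auto simp: Q_def)
 have 1: "AE x in lborel. x \<in> E --> Inf Q <= fac * (x $ j - t0) \<and> fac * (x $ j - t0) <= Sup Q"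
  using AEin by eventually_elim (use taQ in metis)
 have "(NN x. ind E x * ennreal ((fac * (x $ j - t0))\<^sup>2)) = (NN x. ind E x * ennreal ((ta j rest (x $ j))\<^sup>2))"
  using AEin by (intro nn_integral_cong_AE) (auto elim!: eventually_mono simp: indicator_def)
 hence 2: "(NN x. ind E x * ennreal ((fac * (x $ j - t0))\<^sup>2)) / ennreal V = (NN y. ind K y * ennreal ((y $ j)\<^sup>2)) / ennreal v"
  using push[OF dist, of "\<lambda>t. ennreal (t\<^sup>2)"] by simp
 have 3: "0 < vol (E \<inter> {x. x $ j \<in> {..ap + e}})" if "0 < e" for e
  using measure_E_slab[OF dist, of "{..ap + e}"] Fp[of "ap + e"] that Epos by (simp add: cdf_def)
 have 4: "0 < vol (E \<inter> {x. x $ j \<in> {bt - e..}})" if "0 < e" for e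
  using measure_E_slab[OF dist, of "{bt - e..}"] Fl[of "bt - e"] that Epos right[of "bt - e"] by simp
 show ?thesis
  using 1 2 3 4 unfolding al be PK by (intro exI[of _ t0] conjI) auto
qed

end

lemma moment:
 obtains t0 where "AE x in lborel. x \<in> E --> (INF y\<in>K. y $ j) <= fac * (x $ j - t0) \<and> fac * (x $ j - t0) <= (SUP y\<in>K. y $ j)"
  "(NN x. ind E x * ennreal ((fac * (x $ j - t0))\<^sup>2)) / ennreal V
   = (NN y. ind K y * ennreal ((y $ j)\<^sup>2)) / ennreal v"
  "!!e. 0 < e ==> 0 < vol (E \<inter> {x. x $ j <= t0 + (INF y\<in>K. y $ j) / fac + e})"
  "!!e. 0 < e ==> 0 < vol (E \<inter> {x. t0 + (SUP y\<in>K. y $ j) / fac - e <= x $ j})"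
proof -
 obtain "rest" where dist: "distinct (j # rest)" "set (j # rest) = (UNIV :: 'n set)" by (rule coord_list)
 show ?thesis using moment_list[OF dist] that by auto
qed

end

text \<open>After removal of the common part, \<open>E - C\<close> and \<open>C - E\<close> have
  equal volume and equal integral of \<open>q\<close>. Since \<open>q\<close> is at most 1 on the
  latter and exceeds 1 almost everywhere on the former, both are null.\<close>

lemma bathtub:
 fixes q :: "'a::euclidean_space => ennreal"
 assumes [measurable]: "E \<in> sets borel" "C \<in> sets borel" "meas q"
  and vol: "evol E = evol C" "evol C < \<infinity>"
  and mom: "(NN x. q x * ind E x) = (NN x. q x * ind C x)" "(NN x. q x * ind C x) < \<infinity>"
  and C: "!!x. x \<in> C ==> q x <= 1" and EC: "AE x in lborel. x \<in> E - C --> 1 < q x"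
 shows "E - C \<in> null_sets lborel \<and> C - E \<in> null_sets lborel"
proof -
 define I where "I S = (NN x. q x * ind S x)" for S
 have split: "I S = I (S \<inter> R) + I (S - R)" if [measurable]: "S \<in> sets borel" "R \<in> sets borel" for S R
 proof -
  have "I S = (NN x. q x * ind (S \<inter> R) x + q x * ind (S - R) x)"
   unfolding I_def by (intro nn_integral_cong) (auto simp: indicator_def)
  also have "... = I (S \<inter> R) + I (S - R)" unfolding I_def by (rule nn_integral_add) measurable
  finally show ?thesis .
 qed
 have esplit: "evol S = evol (S \<inter> R) + evol (S - R)" if [measurable]: "S \<in> sets borel" "R \<in> sets borel" for S R :: "'a set"
 proof -
  have "evol (S \<inter> R) + evol (S - R) = evol ((S \<inter> R) \<union> (S - R))"
   by (rule plus_emeasure) auto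
  thus ?thesis by (simp add: Int_Diff_Un)
 qed
 have le: "I (E \<inter> C) <= I C" unfolding I_def by (intro nn_integral_mono) (auto simp: indicator_def)
 have IEC: "I (E \<inter> C) < \<infinity>" using le mom(2) unfolding I_def by (rule le_less_trans)
 have "I E = I (E \<inter> C) + I (E - C)" "I C = I (E \<inter> C) + I (C - E)"
  using split[of E C] split[of C E] by (simp_all add: Int_commute)
 moreover have "I E = I C" using mom(1) by (simp only: I_def)
 ultimately have "I (E \<inter> C) + I (E - C) = I (E \<inter> C) + I (C - E)" by metis
 hence I: "I (E - C) = I (C - E)" using IEC by (auto simp: ennreal_add_left_cancel)
 have eEC: "evol (E \<inter> C) < \<infinity>"
  by (rule le_less_trans[OF _ vol(2)], rule emeasure_mono) auto
 have "evol E = evol (E \<inter> C) + evol (E - C)" "evol C = evol (E \<inter> C) + evol (C - E)"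
  using esplit[of E C] esplit[of C E] by (simp_all add: Int_commute)
 hence "evol (E \<inter> C) + evol (E - C) = evol (E \<inter> C) + evol (C - E)"
  using vol(1) by metis
 hence e: "evol (E - C) = evol (C - E)" using eEC by (auto simp: ennreal_add_left_cancel)
 have fin: "evol (E - C) < \<infinity>" unfolding e
  by (rule le_less_trans[OF _ vol(2)], rule emeasure_mono) auto
 have "I (C - E) <= (NN x. ind (C - E) x)"
  unfolding I_def using C by (intro nn_integral_mono) (auto simp: indicator_def)
 hence up: "I (E - C) <= evol (E - C)" by (simp add: I e)
 have "(NN x. (q x * ind (E - C) x - ind (E - C) x)) = I (E - C) - (NN x. ind (E - C) x)"
  unfolding I_def
 proof (rule nn_integral_diff)
  show "AE x in lborel. ind (E - C) x <= q x * ind (E - C) x"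
   using EC by eventually_elim (auto simp: indicator_def)
 qed (use fin in auto)
 also have "... = 0" using up fin le_less_trans[OF up fin] by (simp add: diff_eq_0_iff_ennreal)
 finally have "AE x in lborel. q x * ind (E - C) x - ind (E - C) x = 0"
  by (subst (asm) nn_integral_0_iff_AE) auto
 hence "AE x in lborel. x \<notin> E - C"
  using EC
 proof eventually_elim
  case (elim x)
  show ?case
  proof
   assume x: "x \<in> E - C"
   hence "q x - 1 = 0" "1 < q x" using elim by auto
   thus False by (auto dest: ennreal_minus_eq_0)
  qed
 qed
 hence 0: "evol (E - C) = 0"
  by (subst (asm) AE_iff_measurable[where N="E - C"]) auto
 show ?thesis using 0 e by (auto simp: null_sets_def)
qed

lemma nn_integral_affine:
 fixes f :: "'a::euclidean_space => ennreal"
 assumes [measurable]: "meas f" and c: "0 < c"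
 shows "(NN x. f (c *\<^sub>R (x - t))) * ennreal (c ^ DIM('a)) = (NN y. f y)"
proof -
 have "(NN y. f y) = (\<integral>\<^sup>+y. f y \<partial>density (distr lborel borel (\<lambda>x. (- c *\<^sub>R t) + c *\<^sub>R x)) (\<lambda>_. ennreal (\<bar>c\<bar> ^ DIM('a))))"
  using lborel_affine[of c "- c *\<^sub>R t"] c by simp
 also have "... = (NN x. ennreal (c ^ DIM('a)) * f ((- c *\<^sub>R t) + c *\<^sub>R x))"
  using c by (subst nn_integral_density) (auto simp: nn_integral_distr)
 also have "... = (NN x. ennreal (c ^ DIM('a)) * f (c *\<^sub>R (x - t)))"
  by (simp add: algebra_simps)
 also have "... = ennreal (c ^ DIM('a)) * (NN x. f (c *\<^sub>R (x - t)))"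
  by (rule nn_integral_cmult) simp
 finally show ?thesis by (simp add: mult.commute)
qed

section \<open>Caps of the unit ball and rigidity\<close>

definition capset :: "'n::finite => real => real => (real^'n) set" where
 "capset k sg a = {y. norm y <= 1 \<and> - a <= sg * y $ k}"

lemma closed_capset: fixes k :: "'n::finite" shows "closed (capset k sg a)"
proof -
 have "closed {y::real^'n. norm y <= 1}" "closed {y::real^'n. - a <= sg * y $ k}"
  by (intro closed_Collect_le continuous_intros)+
 hence "closed ({y::real^'n. norm y <= 1} \<inter> {y. - a <= sg * y $ k})" by (rule closed_Int)
 thus ?thesis by (simp add: capset_def Int_def)
qed

lemma compact_capset: "compact (capset k sg a)"
proof -
 have "bounded (capset k sg a)" by (rule bounded_subset[OF bounded_cball[of 0 1]]) (auto simp: capset_def)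
 thus ?thesis using closed_capset by (simp add: compact_eq_bounded_closed)
qed

lemma convex_capset: fixes k :: "'n::finite" shows "convex (capset k sg a)"
proof (rule convexI)
 fix x y :: "real^'n" and u v :: real
 assume xy: "x \<in> capset k sg a" "y \<in> capset k sg a" and uv: "0 <= u" "0 <= v" "u + v = 1"
 have "norm (u *\<^sub>R x + v *\<^sub>R y) <= u * norm x + v * norm y"
  using uv by (intro order_trans[OF norm_triangle_ineq]) simp
 also have "... <= u * 1 + v * 1" using xy uv by (intro add_mono mult_left_mono) (auto simp: capset_def)
 finally have n: "norm (u *\<^sub>R x + v *\<^sub>R y) <= 1" using uv by simp
 have "u * (- a) + v * (- a) <= u * (sg * x $ k) + v * (sg * y $ k)"
  using xy uv by (intro add_mono mult_left_mono) (auto simp: capset_def)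
 moreover have "u * (- a) + v * (- a) = - a" using uv(3) by (simp only: distrib_right[symmetric] mult_1)
 ultimately show "u *\<^sub>R x + v *\<^sub>R y \<in> capset k sg a"
  using n by (simp add: capset_def algebra_simps)
qed

context equality_case

begin

text \<open>The centres found for the single coordinates form the point \<open>t\<close>. Summing
  the coordinate moments gives the moment of the squared distance to \<open>t\<close>, and
  coordinate \<open>k\<close> keeps \<open>E\<close> above the flat face of the rescaled cap; so a
  point of \<open>E\<close> outside that cap is outside the ball.\<close>

theorem rigidity:
 assumes Kcap: "K = capset k sg a" and a: "- 1 < a" "a <= 1"
 obtains t where "E - {x. fac *\<^sub>R (x - t) \<in> K} \<in> null_sets lborel" "{x. fac *\<^sub>R (x - t) \<in> K} - E \<in> null_sets lborel"
  "a / fac <= sg * t $ k" "A ~= 0 ==> sg * t $ k = a / fac"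
proof -
 note [measurable] = K_borel
 define W where "W j t0 \<longleftrightarrow> (AE x in lborel. x \<in> E --> (INF y\<in>K. y $ j) <= fac * (x $ j - t0) \<and> fac * (x $ j - t0) <= (SUP y\<in>K. y $ j)) \<and>
  (NN x. ind E x * ennreal ((fac * (x $ j - t0))\<^sup>2)) / ennreal V
   = (NN y. ind K y * ennreal ((y $ j)\<^sup>2)) / ennreal v \<and>
  (\<forall>e>0. 0 < vol (E \<inter> {x. x $ j <= t0 + (INF y\<in>K. y $ j) / fac + e})) \<and>
  (\<forall>e>0. 0 < vol (E \<inter> {x. t0 + (SUP y\<in>K. y $ j) / fac - e <= x $ j}))" for j t0
 have "\<exists>t0. W j t0" for j
  by (rule moment[of j]) (unfold W_def, blast)
 then obtain t1 where W: "!!j. W j (t1 j)" by metis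
 have t1: "!!j. (AE x in lborel. x \<in> E --> (INF y\<in>K. y $ j) <= fac * (x $ j - t1 j) \<and> fac * (x $ j - t1 j) <= (SUP y\<in>K. y $ j))"
  "!!j. (NN x. ind E x * ennreal ((fac * (x $ j - t1 j))\<^sup>2)) / ennreal V
   = (NN y. ind K y * ennreal ((y $ j)\<^sup>2)) / ennreal v"
  "!!j e. 0 < e ==> 0 < vol (E \<inter> {x. x $ j <= t1 j + (INF y\<in>K. y $ j) / fac + e})"
  "!!j e. 0 < e ==> 0 < vol (E \<inter> {x. t1 j + (SUP y\<in>K. y $ j) / fac - e <= x $ j})"
  using W unfolding W_def by blast+
 define t :: "real^'n" where "t = (\<chi> j. t1 j)"
 \<comment> \<open>The point of the cap on its axis at the lowest admissible height
   \<open>-a\<close>.\<close>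
 define pt :: "real^'n" where "pt = (- a * sg) *\<^sub>R axis k 1"
 have ss: "sg * sg = 1" using sigma by auto
 have pt: "pt \<in> K" "pt $ k = - a * sg"
  using a sigma by (auto simp: Kcap capset_def pt_def abs_mult norm_axis_1)
 \<comment> \<open>The height above the interface of the lowest level of the rescaled cap.\<close>
 define \<gamma> where "\<gamma> = sg * t $ k - a / fac"
 have side: "AE x in lborel. x \<in> E --> - a <= sg * (fac * (x $ k - t $ k))"
  and touch: "!!e. 0 < e ==> 0 < vol (E \<inter> {x. sg * x $ k <= \<gamma> + e})"
 proof -
  \<comment> \<open>For \<open>sg = 1\<close> the lowest level is the infimum of
    \<open>y $ k\<close> over \<open>K\<close>, for \<open>sg = -1\<close> it is the
    supremum.\<close>
  consider "sg = 1" | "sg = -1" using sigma by blast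
  hence "(AE x in lborel. x \<in> E --> - a <= sg * (fac * (x $ k - t $ k))) \<and> (\<forall>e>0. 0 < vol (E \<inter> {x. sg * x $ k <= \<gamma> + e}))"
  proof cases
   case 1
   have "(INF y\<in>K. y $ k) = - a"
    by (rule cInf_eq_minimum) (use pt 1 Ka in \<open>auto intro!: image_eqI[of _ _ pt]\<close>)
   thus ?thesis using t1(1)[of k] t1(3)[of _ k] 1 by (auto simp: t_def \<gamma>_def elim: eventually_mono)
  next
   case 2
   have "(SUP y\<in>K. y $ k) = a"
    by (rule cSup_eq_maximum) (use pt 2 Ka in \<open>auto intro!: image_eqI[of _ _ pt]\<close>)
   hence AE: "AE x in lborel. x \<in> E --> fac * (x $ k - t $ k) <= a" and m: "!!e. 0 < e ==> 0 < vol (E \<inter> {x. t $ k + a / fac - e <= x $ k})"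
    using t1(1)[of k] t1(4)[of _ k] by (auto simp: t_def elim: eventually_mono)
   have "{x. sg * x $ k <= \<gamma> + e} = {x. t $ k + a / fac - e <= x $ k}" for e
    using 2 by (auto simp: \<gamma>_def)
   thus ?thesis using AE m 2 by (auto elim: eventually_mono)
  qed
  thus "AE x in lborel. x \<in> E --> - a <= sg * (fac * (x $ k - t $ k))"
   "!!e. 0 < e ==> 0 < vol (E \<inter> {x. sg * x $ k <= \<gamma> + e})" by auto
 qed
 have g0: "0 <= \<gamma>"
 proof (rule ccontr)
  assume "\<not> 0 <= \<gamma>"
  hence "E \<inter> {x. sg * x $ k <= \<gamma> + (- \<gamma> / 2)} = {}" using E_sub by (auto simp: halfspace_def)
  thus False using touch[of "- \<gamma> / 2"] \<open>\<not> 0 <= \<gamma>\<close> by simp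
 qed
 \<comment> \<open>A set that stays away from the interface has slab averages 0 at all small scales,
   so a nonzero trace forces contact.\<close>
 have gA: "\<gamma> = 0" if "A ~= 0"
 proof (rule ccontr)
  assume "\<gamma> ~= 0"
  hence g: "0 < \<gamma>" using g0 by simp
  have far: "AE x in lborel. x \<in> E --> \<gamma> <= sg * x $ k"
   using side
  proof eventually_elim
   case (elim x)
   show ?case
   proof
    assume "x \<in> E"
    hence "- a <= fac * (sg * x $ k - sg * t $ k)" using elim by (simp add: algebra_simps)
    thus "\<gamma> <= sg * x $ k" using fac by (simp add: \<gamma>_def field_simps)
   qed
  qed
  have "\<forall>\<^sub>F n in sequentially. ds n < \<gamma> / 2" using g by (intro order_tendstoD(2)[OF ds(2)]) simp
  hence "\<forall>\<^sub>F n in sequentially. trace_avg k sg E (ds n) = 0"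
  proof eventually_elim
   case (elim n)
   have "trace_avg k sg E (ds n) = (LINT x::real^'n|lborel. 0)"
    unfolding trace_avg_def
   proof (rule integral_cong_AE)
    show "AE x in lborel. ind E x * wt (ds n) (sg * x $ k) = 0"
     using far by eventually_elim (use elim ds(1)[of n] in \<open>auto simp: indicator_def wt_outside\<close>)
   qed measurable
   thus ?case by simp
  qed
  hence "(\<lambda>n. trace_avg k sg E (ds n)) ----> 0" by (rule tendsto_eventually)
  hence "A = 0" using trace by (rule LIMSEQ_unique[OF _ , symmetric])
  thus False using that by simp
 qed
 define C where "C = {x. fac *\<^sub>R (x - t) \<in> K}"
 have Cm [measurable]: "C \<in> sets borel"
  unfolding C_def by (rule borel_Collect) measurable
 define q :: "real^'n => ennreal" where "q x = ennreal ((norm (fac *\<^sub>R (x - t)))\<^sup>2)" for x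
 have [measurable]: "meas q" unfolding q_def by measurable
 have facN: "fac ^ DIM(real^'n) = v / V"
  using dilation_power[OF K(2) Epos, where 'n='n] by (simp add: fac_def)
 have scale: "(NN x. f (fac *\<^sub>R (x - t))) * ennreal (v / V) = (NN y. f y)" if "meas f" for f :: "real^'n => ennreal"
  using nn_integral_affine[OF that fac, of t] unfolding facN .
 have vV: "ennreal (v / V) * ennreal (V / v) = 1"
  using K(2) Epos by (simp add: ennreal_mult[symmetric])
 have cancel: "X = Z * ennreal (V / v)" if "X * ennreal (v / V) = Z" for X Z :: ennreal
 proof -
  have "Z * ennreal (V / v) = X * (ennreal (v / V) * ennreal (V / v))" by (simp only: that[symmetric] mult.assoc)
  thus ?thesis by (simp add: vV)
 qed
 have emC: "evol C = ennreal V"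
 proof -
  have "(NN x. ind K (fac *\<^sub>R (x - t))) = (NN x. ind C x)"
   by (intro nn_integral_cong) (simp add: C_def indicator_def)
  hence "evol C * ennreal (v / V) = ennreal v"
   using scale[of "ind K"] by (simp add: emeasure_K)
  from cancel[OF this] have "evol C = ennreal v * ennreal (V / v)" .
  also have "... = ennreal V" using K(2) Epos by (subst ennreal_mult[symmetric]) auto
  finally show ?thesis .
 qed
 define M where "M j = (NN y. ind K y * ennreal ((y $ j)\<^sup>2))" for j
 have M_fin: "M j < \<infinity>" for j
 proof -
  have "M j <= (NN y. ind K y)"
   unfolding M_def
  proof (intro nn_integral_mono)
   fix y
   have "(y $ j)\<^sup>2 <= 1" if "y \<in> K"
    using component_le_norm_cart[of y j] K1[OF that] by (simp add: abs_square_le_1)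
   thus "ind K y * ennreal ((y $ j)\<^sup>2) <= ind K y" by (auto simp: indicator_def)
  qed
  thus ?thesis by (simp add: emeasure_K le_less_trans)
 qed
 have sq: "(norm y)\<^sup>2 = (\<Sum>j\<in>UNIV. (y $ j)\<^sup>2)" for y :: "real^'n"
  unfolding power2_norm_eq_inner inner_vec_def by (simp add: power2_eq_square)
 have qE: "(NN x. q x * ind E x) * ennreal (v / V) = (\<Sum>j\<in>UNIV. M j)"
 proof -
  have "(NN x. q x * ind E x) = (NN x. (\<Sum>j\<in>UNIV. ind E x * ennreal ((fac * (x $ j - t1 j))\<^sup>2)))"
   by (intro nn_integral_cong) (simp add: q_def sq t_def sum_distrib_left[symmetric] mult.commute sum_ennreal del: norm_scaleR)
  also have "... = (\<Sum>j\<in>UNIV. (NN x. ind E x * ennreal ((fac * (x $ j - t1 j))\<^sup>2)))"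
   by (intro nn_integral_sum) measurable
  finally have "(NN x. q x * ind E x) * ennreal (v / V)
    = (\<Sum>j\<in>UNIV. (NN x. ind E x * ennreal ((fac * (x $ j - t1 j))\<^sup>2)) * ennreal (v / V))"
   by (simp only: sum_distrib_right)
  also have "... = (\<Sum>j\<in>UNIV. M j)"
  proof (intro sum.cong refl)
   fix j
   define X where "X = (NN x. ind E x * ennreal ((fac * (x $ j - t1 j))\<^sup>2))"
   have XM: "X / ennreal V = M j / ennreal v" using t1(2)[of j] by (simp only: X_def M_def)
   have "ennreal v / ennreal v = 1" using K(2) by simp
   hence vv: "inverse (ennreal v) * ennreal v = 1" unfolding divide_ennreal_def by (simp only: mult.commute)
   have "ennreal (v / V) = ennreal v / ennreal V" using K(2) Epos by (simp add: divide_ennreal)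
   hence "X * ennreal (v / V) = (X / ennreal V) * ennreal v" unfolding divide_ennreal_def by (simp only: mult_ac)
   also have "... = M j * (inverse (ennreal v) * ennreal v)" unfolding XM unfolding divide_ennreal_def by (simp only: mult.assoc)
   finally show "X * ennreal (v / V) = M j" by (simp add: vv)
  qed
  finally show ?thesis .
 qed
 have qC: "(NN x. q x * ind C x) * ennreal (v / V) = (\<Sum>j\<in>UNIV. M j)"
 proof -
  have "(NN x. q x * ind C x) = (NN x. (ind K (fac *\<^sub>R (x - t)) * ennreal ((norm (fac *\<^sub>R (x - t)))\<^sup>2)))"
   by (intro nn_integral_cong) (simp add: q_def C_def indicator_def)
  also have "... * ennreal (v / V) = (NN y. ind K y * ennreal ((norm y)\<^sup>2))"
   by (rule scale) measurable
  also have "... = (NN y. (\<Sum>j\<in>UNIV. ind K y * ennreal ((y $ j)\<^sup>2)))"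
   by (intro nn_integral_cong) (simp add: sq sum_distrib_left[symmetric] sum_ennreal)
  also have "... = (\<Sum>j\<in>UNIV. M j)"
   unfolding M_def by (intro nn_integral_sum) measurable
  finally show ?thesis .
 qed
 have "(\<Sum>j\<in>UNIV. M j) < \<top>" using M_fin by (simp add: less_top[symmetric] ennreal_sum_eq_top) 
 hence qfin: "(NN x. q x * ind C x) < \<infinity>"
  unfolding cancel[OF qC] by (simp add: ennreal_mult_less_top)
 have "E - C \<in> null_sets lborel \<and> C - E \<in> null_sets lborel"
 proof (rule bathtub[of E C q])
  show "evol E = evol C" "evol C < \<infinity>" by (simp_all add: emC emeasure_E)
  show "(NN x. q x * ind E x) = (NN x. q x * ind C x)"
   using cancel[OF qE] cancel[OF qC] by simp
  show "q x <= 1" if "x \<in> C" for x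
  proof -
   have "norm (fac *\<^sub>R (x - t)) <= 1" using that K1 unfolding C_def by blast
   hence "(norm (fac *\<^sub>R (x - t)))\<^sup>2 <= 1" by (simp add: power_le_one del: norm_scaleR)
   thus ?thesis unfolding q_def by (metis ennreal_1 ennreal_leI)
  qed
  show "AE x in lborel. x \<in> E - C --> 1 < q x"
   using side
  proof eventually_elim
   case (elim x)
   show ?case
   proof
    assume x: "x \<in> E - C"
    hence "- a <= sg * (fac *\<^sub>R (x - t)) $ k" using elim by simp
    hence "1 < norm (fac *\<^sub>R (x - t))" using x unfolding C_def Kcap capset_def by auto
    hence "1 < (norm (fac *\<^sub>R (x - t)))\<^sup>2" by (intro one_less_power) auto
    thus "1 < q x" unfolding q_def using ennreal_less_iff[of 1] by simp
   qed
  qed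
 qed (use qfin in auto)
 thus ?thesis
  using that[of t] g0 gA unfolding C_def \<gamma>_def by auto
qed

end

section \<open>Perimeter and volume of caps\<close>

lemma test_field_partial:
 fixes ph :: "real^'n::finite => real^'n"
 assumes "ph \<in> test_fields A"
 shows "((\<lambda>s. ph (x + s *\<^sub>R axis i 1) $ i) has_real_derivative partial_deriv i ph (x + s *\<^sub>R axis i 1) $ i) (at s)"
proof -
 let ?y = "x + s *\<^sub>R axis i 1"
 have "(ph has_derivative frechet_derivative ph (at ?y)) (at ?y)"
  using assms by (simp add: test_fields_def frechet_derivative_works)
 moreover have "((\<lambda>s. x + s *\<^sub>R axis i 1) has_derivative (\<lambda>h. h *\<^sub>R axis i 1)) (at s)"
  by (auto intro!: derivative_eq_intros)
 ultimately have "((\<lambda>s. ph (x + s *\<^sub>R axis i 1)) has_derivative (\<lambda>h. frechet_derivative ph (at ?y) (h *\<^sub>R axis i 1))) (at s)"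
  using has_derivative_compose by blast
 hence "((\<lambda>s. ph (x + s *\<^sub>R axis i 1) $ i) has_derivative (\<lambda>h. frechet_derivative ph (at ?y) (h *\<^sub>R axis i 1) $ i)) (at s)"
  by (rule bounded_linear.has_derivative[OF bounded_linear_vec_nth])
 moreover have "linear (frechet_derivative ph (at ?y))"
  using assms by (intro linear_frechet_derivative) (simp add: test_fields_def)
 ultimately show ?thesis
  by (simp add: has_field_derivative_def partial_deriv_def linear_scale mult_commute_abs)
qed

lemma test_field_outside:
 fixes ph :: "real^'n::finite => real^'n"
 assumes "x \<notin> closure {x. ph x ~= 0}"
 shows "ph x = 0" "partial_deriv i ph x = 0"
proof -
 show 0: "ph x = 0" using assms closure_subset[of "{x. ph x ~= 0}"] by auto
 have "(ph has_derivative (\<lambda>h. 0)) (at x)"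
 proof (rule has_derivative_transform_within_open[where f="\<lambda>_. 0"])
  show "open (- closure {x. ph x ~= 0})" by (rule open_Compl[OF closed_closure])
  show "0 = ph y" if "y \<in> - closure {x. ph x ~= 0}" for y
   using that closure_subset[of "{x. ph x ~= 0}"] by auto
 qed (use assms in auto)
 thus "partial_deriv i ph x = 0" by (rule partial_derivI)
qed

lemma test_field_bounds:
 fixes ph :: "real^'n::finite => real^'n"
 assumes "ph \<in> test_fields A"
 obtains B r where "0 < B" "!!x. r < norm x ==> ph x = 0" "!!i x. r < norm x ==> partial_deriv i ph x = 0"
  "!!i x. \<bar>partial_deriv i ph x $ i\<bar> <= B" "continuous_on UNIV ph" "!!i. continuous_on UNIV (\<lambda>x. partial_deriv i ph x $ i)"
proof -
 have "bounded (closure {x. ph x ~= 0})"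
  using assms compact_imp_bounded unfolding test_fields_def by blast
 then obtain r where "\<forall>x\<in>closure {x. ph x ~= 0}. norm x <= r" unfolding bounded_iff by blast
 hence out: "x \<notin> closure {x. ph x ~= 0}" if "r < norm x" for x using that by force
 have c: "continuous_on UNIV (\<lambda>x. partial_deriv i ph x $ i)" for i
  using assms unfolding test_fields_def by (auto intro!: continuous_intros)
 have "\<exists>B>0. \<forall>x. norm (partial_deriv i ph x $ i) <= B" for i
  by (rule bounded_support[OF c, of r]) (use test_field_outside(2)[OF out] in auto)
 then obtain b where b: "!!i. 0 < b i" "!!i x. \<bar>partial_deriv i ph x $ i\<bar> <= b i" by (metis real_norm_def)
 have bm: "b i <= Max (range b)" for i by (rule Max_ge) auto
 show ?thesis
 proof (rule that[of "Max (range b)" r])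
  show "0 < Max (range b)" using b(1) bm less_le_trans by blast
  show "\<bar>partial_deriv i ph x $ i\<bar> <= Max (range b)" for i x using b(2) bm order_trans by blast
  show "continuous_on UNIV ph" using assms unfolding test_fields_def
   by (auto intro!: continuous_at_imp_continuous_on differentiable_imp_continuous_within)
 qed (use test_field_outside[OF out] c in auto)
qed

lemma perimeter_borel:
 fixes E :: "(real^'n::finite) set"
 assumes [measurable]: "E \<in> sets borel" and "ph \<in> test_fields A"
 shows "(LINT x:E|lebesgue. div_field ph x) = (LI x. ind E x * div_field ph x)"
proof -
 obtain B r where c: "!!i. continuous_on UNIV (\<lambda>x. partial_deriv i ph x $ i)"
  using test_field_bounds[OF assms(2)] by metis
 note [measurable] = cont_meas[OF c]
 have [measurable]: "meas (div_field ph)" unfolding div_field_def[abs_def] by measurable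
 show ?thesis unfolding set_int_def by (subst integral_completion) (simp_all add: real_scaleR_def)
qed

text \<open>\<open>f\<close> is only Lipschitz, so difference quotients are moved from the field to
  \<open>f\<close> by translation invariance. Both limits are dominated, one by the bound on the
  partial derivatives, the other by the Lipschitz constant.\<close>

lemma integral_by_parts_axis:
 fixes f :: "real^'n::finite => real" and G :: "real^'n => real^'n"
 assumes f: "!!x. \<bar>f x\<bar> <= 1" "!!x y. \<bar>f x - f y\<bar> <= L * norm (x - y)"
  and der: "AE x in lborel. (f has_derivative (\<lambda>h. G x \<bullet> h)) (at x)"
  and [measurable]: "meas G" and ph: "ph \<in> test_fields A"
 shows "(LI x. f x * partial_deriv i ph x $ i) = - (LI x. ph x $ i * G x $ i)"
proof -
 let ?e = "axis i 1 :: real^'n"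
 obtain B r where B: "0 < B" "!!x. r < norm x ==> ph x = 0" "!!i x. r < norm x ==> partial_deriv i ph x = 0"
  "!!i x. \<bar>partial_deriv i ph x $ i\<bar> <= B" "continuous_on UNIV ph" "!!i. continuous_on UNIV (\<lambda>x. partial_deriv i ph x $ i)"
  by (rule test_field_bounds[OF ph], rule that) assumption+
 have L0: "0 <= L" using order_trans[OF abs_ge_zero f(2)[of ?e 0]] by (simp add: norm_axis_1)
 have f_cont: "continuous_on UNIV f"
  by (rule lipschitz_on_continuous_on[of L]) (use f(2) L0 in \<open>auto simp: lipschitz_on_def dist_norm\<close>)
 note [measurable] = cont_meas[OF B(5)] cont_meas[OF B(6)] cont_meas[OF f_cont]
 have ph1: "\<bar>ph x $ i\<bar> <= 1" for x
  using component_le_norm_cart[of "ph x" i] ph by (auto simp: test_fields_def intro: order_trans)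
 define h where "h n = 1 / real (Suc n)" for n
 have h: "0 < h n" "h n <= 1" for n by (auto simp: h_def)
 have h_lim: "h ----> 0" unfolding h_def using LIMSEQ_inverse_real_of_nat by (simp add: inverse_eq_divide)
 have h_at: "filterlim h (at 0) sequentially" using h_lim h(1) by (auto simp: filterlim_at less_imp_neq[symmetric])
 have dom: "intg (\<lambda>x::real^'n. c * ind (cball 0 (r + 1)) x)" for c :: real
  using emeasure_lborel_cball_finite[of "0::real^'n" "r + 1"] by (intro integrable_mult_right integrable_real_indicator) auto
 have near: "ph (x + s *\<^sub>R ?e) = 0" if "r + 1 < norm x" "\<bar>s\<bar> <= 1" for x s
 proof -
  have "norm x <= norm (x + s *\<^sub>R ?e) + norm (s *\<^sub>R ?e)" using norm_triangle_sub[of x "- (s *\<^sub>R ?e)"] norm_triangle_ineq4[of "x + s *\<^sub>R ?e" "s *\<^sub>R ?e"] by simp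
  thus ?thesis using that B(2) by (simp add: norm_axis_1)
 qed
 define q where "q n x = (ph (x + h n *\<^sub>R ?e) $ i - ph x $ i) / h n" for n x
 have q_bound: "\<bar>q n x\<bar> <= B" for n x
 proof -
  have "\<exists>z. 0 < z \<and> z < h n \<and> ph (x + h n *\<^sub>R ?e) $ i - ph (x + 0 *\<^sub>R ?e) $ i = (h n - 0) * partial_deriv i ph (x + z *\<^sub>R ?e) $ i"
   using h(1)[of n] by (intro MVT2 test_field_partial[OF ph]) auto
  thus ?thesis unfolding q_def using h(1)[of n] B(4) by (auto simp: abs_mult)
 qed
 have q_lim: "(\<lambda>n. q n x) ----> partial_deriv i ph x $ i" for x
 proof -
  have "((\<lambda>s. (ph (x + s *\<^sub>R ?e) $ i - ph x $ i) / s) \<longlongrightarrow> partial_deriv i ph x $ i) (at 0)"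
   using test_field_partial[OF ph, of x i 0] by (simp add: has_field_derivative_iff)
  from filterlim_compose[OF this h_at] show ?thesis by (simp add: q_def)
 qed
 have "(\<lambda>n. LI x. f x * q n x) ----> (LI x. f x * partial_deriv i ph x $ i)"
 proof (rule integral_dominated_convergence[where w="\<lambda>x. B * ind (cball 0 (r + 1)) x"])
  show "AE x in lborel. (\<lambda>n. f x * q n x) ----> f x * partial_deriv i ph x $ i"
   by (intro AE_I2 tendsto_intros q_lim)
  fix n
  show "AE x in lborel. norm (f x * q n x) <= B * ind (cball 0 (r + 1)) x"
  proof (rule AE_I2)
   fix x :: "real^'n"
   have "\<bar>f x\<bar> * \<bar>q n x\<bar> <= 1 * B" using f(1) q_bound B(1) by (intro mult_mono) auto
   moreover have "q n x = 0" if "r + 1 < norm x" using near[OF that, of "h n"] near[OF that, of 0] h[of n] by (simp add: q_def)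
   ultimately show "norm (f x * q n x) <= B * ind (cball 0 (r + 1)) x"
    by (cases "r + 1 < norm x") (auto simp: indicator_def abs_mult)
  qed
 qed (use dom in \<open>auto simp: q_def\<close>)
 moreover have "(LI x. f x * q n x) = (LI x. ph x $ i * ((f (x - h n *\<^sub>R ?e) - f x) / h n))" for n
 proof -
  have m: "meas (\<lambda>x. f (x - h n *\<^sub>R ?e) * ph x $ i)" by measurable
  have i1: "intg (\<lambda>x. f (x + s *\<^sub>R ?e) * ph (x + t *\<^sub>R ?e) $ i)" if "\<bar>t\<bar> <= 1" for s t
  proof (rule integrable_support[where r="r + 1" and B=1])
   show "norm (f (x + s *\<^sub>R ?e) * ph (x + t *\<^sub>R ?e) $ i) <= 1" for x
    using f(1) ph1 by (auto simp: abs_mult intro!: mult_le_one)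
  qed (use near that in auto)
  have "(LI x. f x * q n x) = (LI x. f x * ph (x + h n *\<^sub>R ?e) $ i - f x * ph x $ i) / h n"
   by (simp add: q_def algebra_simps diff_divide_distrib flip: integral_divide_zero)
  also have "... = ((LI x. f x * ph (x + h n *\<^sub>R ?e) $ i) - (LI x. f x * ph x $ i)) / h n"
   using i1[of "h n" 0] i1[of 0 0] h[of n] by simp
  also have "(LI x. f x * ph (x + h n *\<^sub>R ?e) $ i) = (LI x. f (x - h n *\<^sub>R ?e) * ph x $ i)"
   using integral_translate[OF m, of "h n *\<^sub>R ?e"] by simp
  also have "(LI x. f (x - h n *\<^sub>R ?e) * ph x $ i) - (LI x. f x * ph x $ i)
    = (LI x. f (x - h n *\<^sub>R ?e) * ph x $ i - f x * ph x $ i)"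
   using i1[of 0 "- h n"] i1[of 0 0] h[of n] by simp
  finally show ?thesis by (simp add: algebra_simps diff_divide_distrib flip: integral_divide_zero)
 qed
 moreover have "(\<lambda>n. LI x. ph x $ i * ((f (x - h n *\<^sub>R ?e) - f x) / h n)) ----> (LI x. - (ph x $ i * G x $ i))"
 proof (rule integral_dominated_convergence[where w="\<lambda>x. L * ind (cball 0 (r + 1)) x"])
  show "AE x in lborel. (\<lambda>n. ph x $ i * ((f (x - h n *\<^sub>R ?e) - f x) / h n)) ----> - (ph x $ i * G x $ i)"
   using der
  proof eventually_elim
   case (elim x)
   have "((\<lambda>s. x - s *\<^sub>R ?e) has_derivative (\<lambda>h. - (h *\<^sub>R ?e))) (at 0)"
    by (auto intro!: derivative_eq_intros)
   moreover have "(*) (- G x $ i) = (\<lambda>h. - (h * G x $ i))" by (simp add: fun_eq_iff)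
   ultimately
   have "((\<lambda>s. f (x - s *\<^sub>R ?e)) has_real_derivative - G x $ i) (at 0)"
    using has_derivative_compose[of "\<lambda>s. x - s *\<^sub>R ?e" "\<lambda>h. - (h *\<^sub>R ?e)" 0 UNIV f "\<lambda>h. G x \<bullet> h"] elim
    by (simp add: has_field_derivative_def inner_axis)
   hence "((\<lambda>s. (f (x - s *\<^sub>R ?e) - f x) / s) \<longlongrightarrow> - G x $ i) (at 0)"
    by (simp add: has_field_derivative_iff)
   from tendsto_mult_left[OF filterlim_compose[OF this h_at], of "ph x $ i"] show ?case by simp
  qed
  fix n
  show "AE x in lborel. norm (ph x $ i * ((f (x - h n *\<^sub>R ?e) - f x) / h n)) <= L * ind (cball 0 (r + 1)) x"
  proof (rule AE_I2)
   fix x :: "real^'n"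
   have "\<bar>(f (x - h n *\<^sub>R ?e) - f x) / h n\<bar> <= L"
    using f(2)[of "x - h n *\<^sub>R ?e" x] h(1)[of n] by (simp add: norm_axis_1 field_simps)
   hence "\<bar>ph x $ i\<bar> * \<bar>(f (x - h n *\<^sub>R ?e) - f x) / h n\<bar> <= 1 * L" using ph1 L0 by (intro mult_mono) auto
   thus "norm (ph x $ i * ((f (x - h n *\<^sub>R ?e) - f x) / h n)) <= L * ind (cball 0 (r + 1)) x"
    using near[of x 0] L0 by (cases "r + 1 < norm x") (auto simp: indicator_def abs_mult)
  qed
 qed (use dom in auto)
 ultimately show ?thesis by (simp add: LIMSEQ_unique)
qed

text \<open>Lower semicontinuity of the total variation: against a fixed test field the divergence
  integrals of the Lipschitz approximants converge, and each is bounded by its variation in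
  \<open>A\<close>.\<close>

lemma perimeter_le_of_profiles:
 fixes f :: "nat => real^'n::finite => real" and G :: "nat => real^'n => real^'n"
 assumes [measurable]: "E \<in> sets borel" "A \<in> sets borel"
  and f: "!!n x. \<bar>f n x\<bar> <= 1" "!!n x y. \<bar>f n x - f n y\<bar> <= L n * norm (x - y)"
  and der: "!!n. AE x in lborel. (f n has_derivative (\<lambda>h. G n x \<bullet> h)) (at x)"
  and G [measurable]: "!!n. meas (G n)" and GL: "!!n x. norm (G n x) <= L n"
  and lim: "AE x in lborel. x \<in> A --> (\<lambda>n. f n x) ----> ind E x"
  and M: "!!n. (NN x. ind A x * ennreal (norm (G n x))) <= ennreal (M n)" "!!n. 0 <= M n" "M ----> m"
 shows "perimeter E A <= ennreal m"
 unfolding perimeter_def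
proof (rule SUP_least)
 fix ph assume ph: "ph \<in> test_fields A"
 obtain B r where B: "0 < B" "!!x. r < norm x ==> ph x = 0" "!!i x. r < norm x ==> partial_deriv i ph x = 0"
  "!!i x. \<bar>partial_deriv i ph x $ i\<bar> <= B" "continuous_on UNIV ph" "!!i. continuous_on UNIV (\<lambda>x. partial_deriv i ph x $ i)"
  by (rule test_field_bounds[OF ph], rule that) assumption+
 have L0: "0 <= L n" for n using order_trans[OF norm_ge_zero GL] .
 have f_cont: "continuous_on UNIV (f n)" for n
  by (rule lipschitz_on_continuous_on[of "L n"]) (use f(2) L0 in \<open>auto simp: lipschitz_on_def dist_norm\<close>)
 note [measurable] = cont_meas[OF B(5)] cont_meas[OF B(6)] cont_meas[OF f_cont]
 have ph1: "norm (ph x) <= 1" and phA: "x \<notin> A ==> ph x = 0" "x \<notin> A ==> partial_deriv i ph x = 0" for x i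
  using ph test_field_outside[of x ph] unfolding test_fields_def by auto
 have i0: "intg (\<lambda>x. f n x * partial_deriv i ph x $ i)" for n i
 proof (rule integrable_support[where r=r and B=B])
  show "norm (f n x * partial_deriv i ph x $ i) <= B" for x
   using mult_mono[OF f(1)[of n x] B(4)[of i x]] by (simp add: abs_mult)
 qed (use B(3) in auto)
 have i1: "intg (\<lambda>x. ph x $ i * G n x $ i)" for n i
 proof (rule integrable_support[where r=r and B="L n"])
  show "norm (ph x $ i * G n x $ i) <= L n" for x
   using mult_mono[OF order_trans[OF component_le_norm_cart[of _ i] ph1[of x]] order_trans[OF component_le_norm_cart[of _ i] GL[of n x]]] by (simp add: abs_mult)
 qed (use B(2) in auto)
 have "(LI x. f n x * div_field ph x) <= M n" for n
 proof -
  have "(LI x. f n x * div_field ph x) = (\<Sum>i\<in>UNIV. LI x. f n x * partial_deriv i ph x $ i)"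
   unfolding div_field_def sum_distrib_left using i0 by (intro Bochner_Integration.integral_sum) auto
  also have "... = - (\<Sum>i\<in>UNIV. LI x. ph x $ i * G n x $ i)"
   unfolding integral_by_parts_axis[OF f(1) f(2) der G ph] by (simp add: sum_negf)
  also have "... = - (LI x. ph x \<bullet> G n x)"
   unfolding inner_vec_def using i1 by (subst Bochner_Integration.integral_sum) auto
  also have "... <= M n"
  proof -
   have "intg (\<lambda>x. ph x \<bullet> G n x)"
    unfolding inner_vec_def using i1 by (intro Bochner_Integration.integrable_sum) auto
   hence "ennreal (norm (LI x. ph x \<bullet> G n x)) <= (NN x. norm (ph x \<bullet> G n x))"
    by (rule integral_norm_bound_ennreal)
   also have "... <= (NN x. ind A x * ennreal (norm (G n x)))"
   proof (intro nn_integral_mono)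
    fix x
    have "norm (ph x \<bullet> G n x) <= norm (ph x) * norm (G n x)" by (simp add: Cauchy_Schwarz_ineq2)
    also have "... <= norm (G n x)" using ph1[of x] by (simp add: mult_left_le_one_le)
    finally show "ennreal (norm (ph x \<bullet> G n x)) <= ind A x * ennreal (norm (G n x))"
     using phA(1)[of x] by (cases "x \<in> A") (auto intro: ennreal_leI)
   qed
   also note M(1)[of n]
   finally show ?thesis using M(2)[of n] by (simp add: ennreal_le_iff)
  qed
  finally show ?thesis .
 qed
 moreover have "(\<lambda>n. LI x. f n x * div_field ph x) ----> (LI x. ind E x * div_field ph x)"
 proof (rule integral_dominated_convergence[where w="\<lambda>x. \<bar>div_field ph x\<bar>"])
  show "intg (\<lambda>x. \<bar>div_field ph x\<bar>)" unfolding div_field_def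
  proof (intro integrable_abs Bochner_Integration.integrable_sum)
   show "intg (\<lambda>x. partial_deriv i ph x $ i)" for i
    by (rule integrable_support[where r=r and B=B]) (use B(3,4) in auto)
  qed
  show "AE x in lborel. (\<lambda>n. f n x * div_field ph x) ----> ind E x * div_field ph x"
   using lim
  proof eventually_elim
   case (elim x)
   show ?case
   proof (cases "x \<in> A")
    case True
    thus ?thesis using elim by (intro tendsto_intros) auto
   next
    case False
    thus ?thesis by (simp add: div_field_def phA)
   qed
  qed
  show "AE x in lborel. norm (f n x * div_field ph x) <= \<bar>div_field ph x\<bar>" for n
   using f(1) by (auto simp: abs_mult intro!: mult_left_le_one_le)
 qed (simp_all add: div_field_def)
 ultimately have "(LI x. ind E x * div_field ph x) <= m"
  using M(3) by (intro LIMSEQ_le) auto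
 thus "ennreal (LINT x:E|lebesgue. div_field ph x) <= ennreal m"
  by (simp add: perimeter_borel[OF assms(1) ph] ennreal_leI)
qed

text \<open>The Lebesgue measure of the section of \<open>C\<close> by the interface, encoded as the
  volume of the cylinder of height 1 over it, so that no second dimension is needed.\<close>

definition area :: "'n::finite => (real^'n) set => ennreal" where
 "area k C = evol {x. upd x k 0 \<in> C \<and> x $ k \<in> {0..1}}"

definition disc :: "'n::finite => real => (real^'n) set" where
 "disc k r = {x. norm (upd x k 0) <= r}"

lemma borel_preimage:
 assumes "C \<in> sets borel" "meas f" shows "{x. f x \<in> C} \<in> sets borel"
 using measurable_sets[OF assms(2,1)] by (simp add: vimage_def)

lemma borel_disc [measurable]: "disc k r \<in> sets borel"
proof -
 have "{x \<in> space borel. norm (upd x k 0) <= r} \<in> sets borel" by measurable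
 thus ?thesis by (simp add: disc_def)
qed

text \<open>Fubini in the form suited to \<open>area\<close>: integration over a hyperplane becomes
  integration over a slab of width 1 in which coordinate \<open>k\<close> is overwritten.\<close>

lemma nn_integral_axis:
 fixes f :: "real^'n::finite => ennreal"
 assumes f [measurable]: "meas f"
 shows "(NN x. f x) = (NN h. NN x. f (upd x k h) * ind {0..1} (x $ k))"
proof -
 obtain rs where rs: "distinct (k # rs)" "set (k # rs) = (UNIV :: 'n set)" by (rule coord_list)
 have gen: "iint xs (\<lambda>x. f (upd x k h)) (upd z k s) = iint xs f (upd z k h)" if "k \<notin> set xs" for xs h s and z :: "real^'n"
  using that by (induction xs arbitrary: z) (auto simp: upd_commute[of k])
 have "(NN x. f (upd x k h) * ind {0..1} (x $ k)) = iint rs f (upd 0 k h)" for h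
 proof -
  have "iint rs (\<lambda>x. f (upd x k h) * ind {0..1} (x $ k)) (upd 0 k s) = iint rs f (upd 0 k h) * ind {0..1} s" for s
  proof -
   have "iint rs (\<lambda>x. f (upd x k h) * ind {0..1} (x $ k)) (upd 0 k s) = iint rs (\<lambda>x. ind {0..1} s * f (upd x k h)) (upd 0 k s)"
    using rs(1) by (intro iint_cong) (auto simp: mult.commute)
   also have "... = ind {0..1} s * iint rs f (upd 0 k h)"
    using rs(1) by (subst iint_cmult) (auto simp: gen)
   finally show ?thesis by (simp add: mult.commute)
  qed
  hence "iint (k # rs) (\<lambda>x. f (upd x k h) * ind {0..1} (x $ k)) 0 = iint rs f (upd 0 k h)"
   by (simp add: nn_integral_cmult)
  thus ?thesis by (subst (asm) iint_full[OF rs]) auto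
 qed
 moreover have "(NN x. f x) = iint (k # rs) f 0" by (rule iint_full[OF rs f, symmetric])
 ultimately show ?thesis by simp
qed

lemma borel_cylinder:
 assumes "C \<in> sets borel" shows "{x. upd x k 0 \<in> C \<and> x $ k \<in> {0..1}} \<in> sets borel"
proof -
 note [measurable] = assms
 have "{x \<in> space borel. upd x k 0 \<in> C \<and> x $ k \<in> {0..1}} \<in> sets borel" by measurable
 thus ?thesis by simp
qed

lemma area_nn_integral:
 assumes C: "C \<in> sets borel"
 shows "area k C = (NN x. ind C (upd x k 0) * ind {0..1} (x $ k))"
proof -
 have "area k C = (NN x. ind {x. upd x k 0 \<in> C \<and> x $ k \<in> {0..1}} x)"
  unfolding area_def using borel_cylinder[OF C] by simp
 also have "... = (NN x. ind C (upd x k 0) * ind {0..1} (x $ k))"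
  by (intro nn_integral_cong) (auto simp: indicator_def)
 finally show ?thesis .
qed

lemma area_product:
 fixes C :: "(real^'n::finite) set"
 assumes C [measurable]: "C \<in> sets borel" and w [measurable]: "meas w"
 shows "(NN x. ind C (upd x k 0) * w (x $ k)) = area k C * (NN s. w s)"
proof -
 have "(NN x. ind C (upd x k 0) * w h * ind {0..1} (x $ k)) = area k C * w h" for h
  unfolding area_nn_integral[OF C] by (subst nn_integral_multc[symmetric]) (auto simp: mult_ac)
 thus ?thesis by (subst nn_integral_axis[of _ k]) (auto simp: nn_integral_cmult)
qed

lemma emeasure_slices:
 fixes S :: "(real^'n::finite) set"
 assumes S [measurable]: "S \<in> sets borel"
 shows "evol S = (NN h. area k {x. upd x k h \<in> S})"
proof -
 have "{x. upd x k h \<in> S} \<in> sets borel" for h by (rule borel_preimage[OF S]) measurable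
 from area_nn_integral[OF this]
 have "area k {x. upd x k h \<in> S} = (NN x. ind S (upd x k h) * ind {0..1} (x $ k))" for h
  by (simp add: indicator_def)
 thus ?thesis using nn_integral_axis[of "ind S" k] by simp
qed

lemma nn_integral_diagonal:
 fixes f :: "real^'n::finite => ennreal" and c :: "'n => real"
 assumes [measurable]: "meas f" and c: "!!i. c i ~= 0"
 shows "(NN x. f x) = ennreal (\<Prod>i\<in>UNIV. \<bar>c i\<bar>) * (NN x. f (\<chi> i. c i * x $ i))"
proof -
 define T where "T x = 0 + (\<Sum>j\<in>Basis. ((\<Sum>i\<in>UNIV. c i * (j $ i)) * (x \<bullet> j)) *\<^sub>R j)" for x :: "real^'n"
 have B: "(Basis :: (real^'n) set) = (\<lambda>i. axis i 1) ` UNIV"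
  by (auto simp: Basis_vec_def)
 have inj: "inj (\<lambda>i::'n. axis i (1::real))"
  by (auto simp: inj_on_def axis_eq_axis)
 have ci: "(\<Sum>i\<in>UNIV. c i * axis j 1 $ i) = c j" for j by (simp add: axis_def if_distrib cong: if_cong)
 have T: "T x = (\<chi> i. c i * x $ i)" for x
  unfolding T_def B by (subst sum.reindex[OF inj], simp add: ci inner_axis, simp add: vec_eq_iff axis_def if_distrib cong: if_cong)
 have "(lborel :: (real^'n) measure) = density (distr lborel borel T) (\<lambda>_. (\<Prod>j\<in>Basis. \<bar>\<Sum>i\<in>UNIV. c i * (j $ i)\<bar>))"
  unfolding T_def[abs_def] by (rule lborel_affine_euclidean) (use c ci in \<open>auto simp: B\<close>)
 also have "(\<Prod>j\<in>Basis. \<bar>\<Sum>i\<in>UNIV. c i * ((j :: real^'n) $ i)\<bar>) = (\<Prod>i\<in>UNIV. \<bar>c i\<bar>)"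
  unfolding B by (subst prod.reindex[OF inj]) (simp add: ci)
 finally have l: "(lborel :: (real^'n) measure) = density (distr lborel borel T) (\<lambda>_. ennreal (\<Prod>i\<in>UNIV. \<bar>c i\<bar>))" .
 have [measurable]: "meas T" by (rule borel_measurable_vec) (simp add: T)
 show ?thesis by (subst l, subst nn_integral_density, simp, simp, subst nn_integral_distr) (simp_all add: nn_integral_cmult T[symmetric])
qed

lemma norm_upd: "(norm (upd x k h))\<^sup>2 = (norm (upd x k 0))\<^sup>2 + h\<^sup>2"
 unfolding power2_norm_eq_inner inner_vec_def
 by (subst (1 2) sum.remove[of _ k]) (auto simp: power2_eq_square)

lemma area_mono: "C \<subseteq> D ==> D \<in> sets borel ==> area k C <= area k D"
 unfolding area_def using borel_cylinder[of D k] by (intro emeasure_mono) auto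

lemma area_disc_scale:
 fixes k :: "'n::finite"
 assumes r: "0 < r"
 shows "area k (disc k r) = ennreal (r ^ (CARD('n) - 1)) * area k (disc k 1)"
proof -
 define c where "c i = (if i = k then 1 else r)" for i
 have eq: "area k (disc k s) = (NN x. ind (disc k s) (upd x k 0) * ind {0..1} (x $ k))" for s
  by (rule area_nn_integral) measurable
 have n: "norm (upd (upd (\<chi> i. c i * x $ i) k 0) k 0) = r * norm (upd (upd x k 0) k 0)" for x
 proof -
  have "upd (upd (\<chi> i. c i * x $ i) k 0) k 0 = r *\<^sub>R upd (upd x k 0) k 0" by (simp add: vec_eq_iff c_def)
  thus ?thesis using r by (simp only: norm_scaleR abs_of_pos)
 qed
 have "area k (disc k r) = ennreal (\<Prod>i\<in>UNIV. \<bar>c i\<bar>) *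
   (NN x. ind (disc k r) (upd (\<chi> i. c i * x $ i) k 0) * ind {0..1} ((\<chi> i. c i * x $ i) $ k))"
  unfolding eq by (rule nn_integral_diagonal) (use r in \<open>auto simp: c_def\<close>)
 also have "(\<lambda>x. ind (disc k r) (upd (\<chi> i. c i * x $ i) k 0) * ind {0..1} ((\<chi> i. c i * x $ i) $ k) :: ennreal)
   = (\<lambda>x. ind (disc k 1) (upd x k 0) * ind {0..1} (x $ k))"
  using r n by (auto simp: fun_eq_iff indicator_def disc_def c_def)
 also have "(\<Prod>i\<in>UNIV. \<bar>c i\<bar>) = r ^ (CARD('n) - 1)"
  using r by (subst prod.remove[of _ k]) (auto simp: c_def card_Diff_singleton)
 finally show ?thesis by (simp add: eq)
qed

text \<open>\<open>om\<close> is the volume of the cylinder over the unit disc. Radius 0 escapes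
  scaling and is squeezed under small radii, where \<open>r ^ (N - 1) <= r\<close> because the
  dimension \<open>N\<close> is at least 2.\<close>

lemma area_disc:
 fixes k :: "'n::finite"
 assumes N: "CARD('n) \<ge> 2"
 obtains om where "0 < om" "!!r. 0 <= r ==> area k (disc k r) = ennreal (om * r ^ (CARD('n) - 1))"
proof -
 define S where "S = {x::real^'n. upd x k 0 \<in> disc k 1 \<and> x $ k \<in> {0..1}}"
 have S [measurable]: "S \<in> sets borel" unfolding S_def by (intro borel_cylinder) measurable
 have "S \<subseteq> cball 0 2"
 proof
  fix x assume x: "x \<in> S"
  hence "(norm x)\<^sup>2 <= 1 + 1"
   using norm_upd[of x k "x $ k"] add_mono[of "(norm (upd x k 0))\<^sup>2" 1 "(x $ k)\<^sup>2" 1] by (simp add: S_def disc_def abs_square_le_1)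
  also have "... <= 2\<^sup>2" by simp
  finally show "x \<in> cball 0 2" using power2_le_imp_le[of "norm x" 2] by simp
 qed
 hence fin: "evol S < \<infinity>"
  by (rule le_less_trans[OF emeasure_mono emeasure_lborel_cball_finite]) auto
 have sub: "ball ((1/2) *\<^sub>R axis k 1) (1/2) \<subseteq> S"
 proof
  fix x assume "x \<in> ball ((1/2) *\<^sub>R axis k (1::real)) (1/2)"
  hence d: "norm (x - (1/2) *\<^sub>R axis k 1) < 1/2" by (simp add: dist_norm norm_minus_commute)
  have "\<bar>x $ k - 1/2\<bar> < 1/2" using component_le_norm_cart[of "x - (1/2) *\<^sub>R axis k 1" k] d by simp
  hence "0 <= x $ k \<and> x $ k <= 1" by linarith
  moreover have "norm (upd x k 0) <= 1"
  proof -
   have "upd (x - (1/2) *\<^sub>R axis k 1) k 0 = upd x k 0" by (simp add: vec_eq_iff axis_def)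
   hence "(norm (upd x k 0))\<^sup>2 <= (norm (x - (1/2) *\<^sub>R axis k 1))\<^sup>2"
    using norm_upd[of "x - (1/2) *\<^sub>R axis k 1" k "(x - (1/2) *\<^sub>R axis k 1) $ k"] unfolding upd_triv by simp
   hence "norm (upd x k 0) <= norm (x - (1/2) *\<^sub>R axis k 1)" by (rule power2_le_imp_le) simp
   thus ?thesis using d by simp
  qed
  ultimately show "x \<in> S" unfolding S_def disc_def by auto
 qed
 have pos: "0 < vol S"
 proof -
  have "0 < vol (ball ((1/2) *\<^sub>R axis k (1::real)) (1/2) :: (real^'n) set)" by (rule content_ball_pos) simp
  also have "... <= vol S" using sub fin by (intro measure_mono_fmeasurable) (auto simp: fmeasurable_def)
  finally show ?thesis .
 qed
 have S1: "area k (disc k 1) = ennreal (vol S)"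
  using fin unfolding area_def S_def[symmetric] by (intro emeasure_eq_ennreal_measure) auto
 have r: "area k (disc k r) = ennreal (vol S * r ^ (CARD('n) - 1))" if "0 < r" for r
  using that by (simp add: area_disc_scale S1 ennreal_mult[symmetric] mult.commute)
 have "area k (disc k 0) = 0"
 proof -
  have small: "area k (disc k 0) <= 0 + ennreal e" if e: "0 < e" for e
  proof -
   define r where "r = min 1 (e / vol S)"
   have r0: "0 < r" "r <= 1" using e pos by (auto simp: r_def)
   have "area k (disc k 0) <= area k (disc k r)" using r0 by (intro area_mono) (auto simp: disc_def)
   also have "... <= ennreal (vol S * r ^ 1)"
    unfolding r[OF r0(1)] using r0 N pos by (intro ennreal_leI mult_left_mono power_decreasing) auto
   also have "... <= ennreal e" using pos by (intro ennreal_leI) (simp add: r_def min_def field_simps)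
   finally show ?thesis by simp
  qed
  have "area k (disc k 0) <= 0" by (rule ennreal_le_epsilon[OF small])
  thus ?thesis by simp
 qed
 hence "area k (disc k r) = ennreal (vol S * r ^ (CARD('n) - 1))" if "0 <= r" for r
  using r[of r] that N by (cases "r = 0") auto
 thus ?thesis using that pos by blast
qed

text \<open>The area of the slice of the unit ball at height \<open>h\<close> when \<open>om\<close>
  is the area of the unit disc; the \<open>max\<close> makes it vanish outside the ball for positive
  \<open>m\<close>.\<close>

definition slice_area :: "real => nat => real => real" where
 "slice_area om m h = om * sqrt (max 0 (1 - h\<^sup>2)) ^ m"

lemma continuous_slice_area: "continuous_on S (slice_area om m)"
 unfolding slice_area_def by (intro continuous_intros)

lemma emeasure_capset:
 fixes k :: "'n::finite"
 assumes N: "0 < m" and sg: "sg = 1 \<or> sg = -1"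
  and om: "0 < om" "!!r. 0 <= r ==> area k (disc k r) = ennreal (om * r ^ m)"
 shows "evol (capset k sg a) = (NN h. ennreal (slice_area om m h) * ind {-a..} h)"
proof -
 let ?ap = "slice_area om m"
 have [measurable]: "meas (?ap)" by (rule cont_meas[OF continuous_slice_area])
 have [measurable]: "capset k sg a \<in> sets borel" by (rule borel_closed[OF closed_capset])
 have "area k {x. upd x k h \<in> capset k sg a} = ennreal (?ap h) * ind {-a..} (sg * h)" for h
 proof (cases "- a <= sg * h \<and> h\<^sup>2 <= 1")
  case True
  have "norm (upd x k h) <= 1 \<longleftrightarrow> norm (upd x k 0) <= sqrt (1 - h\<^sup>2)" for x
  proof -
   have "norm (upd x k h) <= 1 \<longleftrightarrow> (norm (upd x k h))\<^sup>2 <= 1" by (simp add: abs_square_le_1)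
   also have "... \<longleftrightarrow> (norm (upd x k 0))\<^sup>2 <= 1 - h\<^sup>2" using norm_upd[of x k h] by linarith
   also have "... \<longleftrightarrow> norm (upd x k 0) <= sqrt (1 - h\<^sup>2)" using True by (simp add: real_le_rsqrt sqrt_ge_absD real_le_lsqrt iffI)
   finally show ?thesis .
  qed
  hence "{x. upd x k h \<in> capset k sg a} = disc k (sqrt (1 - h\<^sup>2))"
   using True by (auto simp: capset_def disc_def)
  thus ?thesis using True by (simp add: om(2) slice_area_def max_def)
 next
  case False
  have "upd x k h \<notin> capset k sg a" for x
  proof
   assume "upd x k h \<in> capset k sg a"
   hence "norm (upd x k h) <= 1" "- a <= sg * h" by (simp_all add: capset_def)
   hence "(norm (upd x k h))\<^sup>2 <= 1" by (simp add: abs_square_le_1)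
   hence "h\<^sup>2 <= 1" using norm_upd[of x k h] zero_le_power2[of "norm (upd x k 0)"] by linarith
   thus False using False \<open>- a <= sg * h\<close> by simp
  qed
  hence "area k {x. upd x k h \<in> capset k sg a} = 0" by (simp add: area_def)
  moreover have "?ap h * ind {-a..} (sg * h) = 0"
   using False N by (auto simp: slice_area_def indicator_def max_def)
  ultimately show ?thesis by (auto simp: indicator_def)
 qed
 hence "evol (capset k sg a) = (NN h. ennreal (?ap h) * ind {-a..} (sg * h))"
  by (subst emeasure_slices[of _ k]) auto
 also have "... = (NN h. ennreal (?ap h) * ind {-a..} h)"
  using sg by (subst nn_integral_real_affine[where c=sg and t=0]) (auto simp: slice_area_def)
 finally show ?thesis .
qed

text \<open>The derivative is the fundamental theorem applied to Cavalieri. For the last bound, all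
  slices of a cap with \<open>a <= 0\<close> are no larger than its base, and its height is
  \<open>1 + a\<close>.\<close>

lemma capset_volume:
 fixes k :: "'n::finite"
 assumes N: "0 < m" and sg: "sg = 1 \<or> sg = -1"
  and om: "0 < om" "!!r. 0 <= r ==> area k (disc k r) = ennreal (om * r ^ m)"
 shows capset_volume_deriv: "\<bar>a\<bar> < 2 ==> ((\<lambda>a. vol (capset k sg a)) has_real_derivative slice_area om m a) (at a)"
  and capset_volume_pos: "- 1 < a ==> 0 < vol (capset k sg a)"
  and capset_volume_le: "- 1 <= a ==> a <= 0 ==> vol (capset k sg a) <= (1 + a) * slice_area om m a"
proof -
 let ?ap = "slice_area om m"
 have ap0: "0 <= ?ap h" for h using om(1) by (simp add: slice_area_def)
 have ap1: "?ap h = 0" if "1 < h" for h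
 proof -
  have "1 < h\<^sup>2" using that by (rule one_less_power) simp
  thus ?thesis using N by (simp add: slice_area_def)
 qed
 have em: "evol (capset k sg a) = (NN h. ennreal (?ap h) * ind {-a..} h)" for a
  by (rule emeasure_capset[OF N sg om])
 \<comment> \<open>Slices beyond height 1 are empty; the interval up to 4 leaves room for two-sided
   derivatives at all heights in use.\<close>
 obtain \<Phi> where \<Phi>': "!!x. x \<in> {-4..4} ==> (\<Phi> has_vector_derivative ?ap x) (at x within {-4..4})"
  using antiderivative_continuous[OF continuous_slice_area] by blast
 have \<Phi>: "(\<Phi> has_real_derivative ?ap x) (at x)" if "\<bar>x\<bar> <= 3" for x
  using \<Phi>'[of x] that by (auto simp: abs_le_iff has_real_derivative_iff_has_vector_derivative at_within_Icc_at)
 have v: "vol (capset k sg a) = \<Phi> 3 - \<Phi> (- a)" if "\<bar>a\<bar> < 3" for a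
 proof -
  have "evol (capset k sg a) = (NN h. ennreal (?ap h) * ind {-a..3} h)"
   unfolding em
  proof (intro nn_integral_cong)
   show "ennreal (?ap h) * ind {-a..} h = ennreal (?ap h) * ind {-a..3} h" for h
    using ap1[of h] by (auto simp: indicator_def)
  qed
  also have "... = ennreal (\<Phi> 3 - \<Phi> (- a))"
  proof (rule nn_integral_FTC_Icc)
   show "(\<Phi> has_real_derivative ?ap x) (at x)" if "x \<in> {- a..3}" for x
    using that \<open>\<bar>a\<bar> < 3\<close> by (intro \<Phi>) auto
  qed (use ap0 that continuous_slice_area in \<open>auto intro: cont_meas\<close>)
  moreover have "\<Phi> (- a) <= \<Phi> 3"
   by (rule deriv_nonneg_imp_mono[of "-a" 3 \<Phi> ?ap]) (use that in \<open>auto intro!: \<Phi> ap0\<close>)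
  ultimately show ?thesis by (simp add: measure_def)
 qed
 show "((\<lambda>a. vol (capset k sg a)) has_real_derivative ?ap a) (at a)" if a: "\<bar>a\<bar> < 2"
 proof -
  have "(\<Phi> has_real_derivative ?ap (- a)) (at (- a))"
   using a by (intro \<Phi>) simp
  hence "((\<lambda>a. \<Phi> 3 - \<Phi> (- a)) has_real_derivative ?ap a) (at a)"
   by (auto intro!: derivative_eq_intros DERIV_chain2[of \<Phi>] simp: slice_area_def)
  thus ?thesis
   by (rule has_field_derivative_transform_within_open[where S="{-2<..<2}"]) (use a v in auto)
 qed
 show "0 < vol (capset k sg a)" if "- 1 < a"
 proof -
  define b where "b = min a 1"
  have b: "- 1 < b" "b <= 1" "b <= a" using that by (auto simp: b_def)
  have "ball (((1 - b) / 2 * sg) *\<^sub>R axis k 1) ((1 + b) / 2) \<subseteq> capset k sg a"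
  proof
   let ?c = "((1 - b) / 2 * sg) *\<^sub>R axis k 1 :: real^'n"
   fix y assume "y \<in> ball ?c ((1 + b) / 2)"
   hence d: "norm (y - ?c) < (1 + b) / 2" by (simp add: dist_norm norm_minus_commute)
   have "norm ?c = (1 - b) / 2" using sg b by (auto simp: norm_axis_1 abs_mult)
   hence "norm y <= 1" using norm_triangle_sub[of y ?c] d by argo
   moreover have "\<bar>(y - ?c) $ k\<bar> < (1 + b) / 2" using component_le_norm_cart[of "y - ?c" k] d by linarith
   hence "- b <= sg * y $ k" using sg by (auto simp: abs_less_iff field_simps)
   ultimately show "y \<in> capset k sg a" using b by (simp add: capset_def)
  qed
  moreover have p: "0 < vol (ball (((1 - b) / 2 * sg) *\<^sub>R axis k 1 :: real^'n) ((1 + b) / 2))"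
   using b by (intro content_ball_pos) simp
  moreover have "capset k sg a \<in> fmeasurable lborel"
   using emeasure_compact_finite[OF compact_capset, of k sg a] borel_closed[OF closed_capset, of k sg a] by (simp add: fmeasurable_def)
  ultimately have "vol (ball (((1 - b) / 2 * sg) *\<^sub>R axis k 1 :: real^'n) ((1 + b) / 2)) <= vol (capset k sg a)"
   by (intro measure_mono_fmeasurable) auto
  thus ?thesis by (rule less_le_trans[OF p])
 qed
 show "vol (capset k sg a) <= (1 + a) * ?ap a" if a: "- 1 <= a" "a <= 0"
 proof -
  have "evol (capset k sg a) <= (NN h. ennreal (?ap a) * ind {-a..1} h)"
   unfolding em
  proof (intro nn_integral_mono)
   fix h
   have "?ap h <= ?ap a" if "- a <= h"
   proof -
    have "a\<^sup>2 <= h\<^sup>2" using that a by (simp add: abs_le_square_iff[symmetric])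
    thus ?thesis using om(1) by (auto simp: slice_area_def intro!: mult_left_mono power_mono)
   qed
   thus "ennreal (?ap h) * ind {-a..} h <= ennreal (?ap a) * ind {-a..1} h"
    using ap1[of h] by (auto simp: indicator_def intro: ennreal_leI)
  qed
  also have "... = ennreal (?ap a) * ennreal (1 + a)" using a by (subst nn_integral_cmult) (auto simp: add.commute)
  also have "... = ennreal ((1 + a) * ?ap a)" using ap0 a by (simp add: ennreal_mult[symmetric] mult.commute)
  finally show ?thesis using ap0 a by (simp add: measure_def enn2real_leI)
 qed
qed

section \<open>Perimeter of a cap as a Minkowski content\<close>

lemma null_sets_lborel_negligible: "S \<in> sets borel ==> negligible S ==> S \<in> null_sets lborel"
 unfolding negligible_iff_null_sets by (auto simp: null_sets_def)

text \<open>A Lipschitz substitute for the indicator of a ball: it falls linearly over a shell of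
  width \<open>dl\<close>, so its variation is the volume of the shell divided by
  \<open>dl\<close>.\<close>

definition profile :: "'a::real_inner => real => real => 'a => real" where
 "profile c s dl x = max 0 (min 1 (1 - (norm (x - c) - s) / dl))"

definition grad_profile :: "'a::real_inner => real => real => 'a => 'a" where
 "grad_profile c s dl x = (if s < norm (x - c) \<and> norm (x - c) < s + dl then - (1 / dl) *\<^sub>R sgn (x - c) else 0)"

lemma profile_range: "0 <= profile c s dl x" "profile c s dl x <= 1"
 by (auto simp: profile_def)

lemma profile_lipschitz:
 assumes "0 < dl" shows "\<bar>profile c s dl x - profile c s dl y\<bar> <= 1 / dl * norm (x - y)"
proof -
 have "\<bar>profile c s dl x - profile c s dl y\<bar> <= \<bar>(norm (x - c) - s) / dl - (norm (y - c) - s) / dl\<bar>"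
  by (auto simp: profile_def max_def min_def)
 also have "... = 1 / dl * \<bar>norm (x - c) - norm (y - c)\<bar>"
  using assms by (simp add: diff_divide_distrib[symmetric])
 also have "... <= 1 / dl * norm (x - y)"
  using norm_triangle_ineq3[of "x - c" "y - c"] assms by (intro mult_left_mono) auto
 finally show ?thesis .
qed

lemma profile_outside: "0 < dl ==> s + dl <= norm (x - c) ==> profile c s dl x = 0"
 by (auto simp: profile_def field_simps max_def min_def)

lemma profile_inside: "0 < dl ==> norm (x - c) <= s ==> profile c s dl x = 1"
 by (auto simp: profile_def field_simps max_def min_def)

lemma profile_derivative:
 fixes c :: "'a::euclidean_space"
 assumes dl: "0 < dl" and s: "0 <= s"
 shows "AE x in lborel. (profile c s dl has_derivative (\<lambda>h. grad_profile c s dl x \<bullet> h)) (at x)"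
proof -
 have "sphere c s \<union> sphere c (s + dl) \<in> null_sets lborel"
  by (intro null_sets.Un null_sets_lborel_negligible negligible_sphere) auto
 hence "AE x in lborel. x \<notin> sphere c s \<union> sphere c (s + dl)" by (rule AE_not_in)
 thus ?thesis
 proof eventually_elim
  case (elim x)
  hence ne: "norm (x - c) ~= s" "norm (x - c) ~= s + dl" by (auto simp: dist_norm norm_minus_commute)
  then consider "norm (x - c) < s" | "s < norm (x - c)" "norm (x - c) < s + dl" | "s + dl < norm (x - c)" by linarith
  thus ?case
  proof cases
   case 1
   have "((\<lambda>x. 1) has_derivative (\<lambda>h. 0)) (at x)" by simp
   hence "(profile c s dl has_derivative (\<lambda>h. 0)) (at x)"
    by (rule has_derivative_transform_within_open[where s="ball c s"])
     (use 1 dl in \<open>auto simp: dist_norm norm_minus_commute profile_inside\<close>)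
   thus ?thesis using 1 by (simp add: grad_profile_def)
  next
   case 2
   hence xc: "x - c ~= 0" using s by auto
   have "((\<lambda>x. norm (x - c)) has_derivative (\<lambda>h. sgn (x - c) \<bullet> h)) (at x)"
    by (rule has_derivative_compose[where f="\<lambda>x. x - c" and f'="\<lambda>h. h", OF _ has_derivative_norm[OF xc], unfolded inner_commute[of _ "sgn (x - c)"]])
     (auto intro!: derivative_eq_intros)
   hence "((\<lambda>x. 1 - (norm (x - c) - s) / dl) has_derivative (\<lambda>h. - ((sgn (x - c) \<bullet> h) / dl))) (at x)"
    using dl by (auto intro!: derivative_eq_intros)
   hence "(profile c s dl has_derivative (\<lambda>h. - ((sgn (x - c) \<bullet> h) / dl))) (at x)"
    by (rule has_derivative_transform_within_open[where s="ball c (s + dl) - cball c s"])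
     (use 2 dl in \<open>auto simp: dist_norm norm_minus_commute profile_def field_simps max_def min_def\<close>)
   thus ?thesis using 2 by (simp add: grad_profile_def)
  next
   case 3
   have "((\<lambda>x. 0) has_derivative (\<lambda>h. 0)) (at x)" by simp
   hence "(profile c s dl has_derivative (\<lambda>h. 0)) (at x)"
    by (rule has_derivative_transform_within_open[where s="- cball c (s + dl)"])
     (use 3 dl in \<open>auto simp: dist_norm norm_minus_commute profile_outside\<close>)
   thus ?thesis using 3 by (simp add: grad_profile_def)
  qed
 qed
qed

lemma profile_tendsto:
 assumes dl: "!!n. 0 < dl n" "dl ----> 0"
 shows "(\<lambda>n. profile c s (dl n) x) ----> ind (cball c s) x"
proof (cases "norm (x - c) <= s")
 case True
 thus ?thesis using dl by (simp add: profile_inside dist_norm norm_minus_commute)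
next
 case False
 hence "\<forall>\<^sub>F n in sequentially. dl n < norm (x - c) - s" using dl(2) by (intro order_tendstoD) auto
 hence "\<forall>\<^sub>F n in sequentially. profile c s (dl n) x = 0"
  by eventually_elim (use dl(1) in \<open>auto intro: profile_outside\<close>)
 thus ?thesis using False by (auto simp: dist_norm norm_minus_commute intro: tendsto_eventually)
qed

lemma norm_grad_profile:
 "0 < dl ==> 0 <= s ==> norm (grad_profile c s dl x) = 1 / dl * ind (cball c (s + dl) - cball c s - sphere c (s + dl)) x"
 by (auto simp: grad_profile_def indicator_def dist_norm norm_minus_commute norm_sgn)

text \<open>\<open>b\<close> is the signed height of the centre on the chosen side; up to null sets
  this is the scaled copy by \<open>s\<close> of \<open>capset\<close> with parameter
  \<open>b / s\<close>.\<close>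

definition cap :: "'n::finite => real => real => real => (real^'n) set" where
 "cap k sg b s = cball ((b * sg) *\<^sub>R axis k 1) s \<inter> halfspace k sg"

lemma borel_halfspace [measurable]: "halfspace k sg \<in> sets borel"
proof -
 have "{x \<in> space borel. 0 < sg * x $ k} \<in> sets borel" by measurable
 thus ?thesis by (simp add: halfspace_def)
qed

lemma borel_cap [measurable]: "cap k sg b s \<in> sets borel"
 unfolding cap_def by measurable

lemma null_interface: "interface k \<in> null_sets lborel"
proof (rule null_sets_lborel_negligible)
 show "interface k \<in> sets borel" unfolding interface_def
  by (intro borel_closed closed_Collect_eq continuous_intros)
 show "negligible (interface k)"
  using negligible_standard_hyperplane[of "axis k 1 :: real^'a" 0] axis_in_Basis_iff[of k "1::real"] by (simp add: interface_def inner_axis)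
qed

lemma cap_volume:
 fixes k :: "'n::finite"
 assumes sg: "sg = 1 \<or> sg = -1" and s: "0 < s"
 shows "evol (cap k sg b s) = ennreal (s ^ CARD('n) * vol (capset k sg (b / s)))"
proof -
 define c :: "real^'n" where "c = (b * sg) *\<^sub>R axis k 1"
 have [measurable]: "capset k sg (b / s) \<in> sets borel" by (rule borel_closed[OF closed_capset])
 have cap_iff: "(1 / s) *\<^sub>R (x - c) \<in> capset k sg (b / s) \<longleftrightarrow> dist c x <= s \<and> 0 <= sg * x $ k" for x
 proof -
  have "norm ((1 / s) *\<^sub>R (x - c)) <= 1 \<longleftrightarrow> dist c x <= s"
   unfolding norm_scaleR using s by (simp add: dist_norm norm_minus_commute field_simps)
  moreover have "sg * ((1 / s) *\<^sub>R (x - c)) $ k = (sg * x $ k - b) / s"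
   using sg by (auto simp: c_def diff_divide_distrib)
  ultimately show ?thesis using s by (simp add: capset_def del: norm_scaleR vector_scaleR_component) (simp add: field_simps)
 qed
 have "evol (cap k sg b s) = (NN x. ind (cap k sg b s) x)" by simp
 also have "... = (NN x. ind (capset k sg (b / s)) ((1 / s) *\<^sub>R (x - c)))"
 proof (rule nn_integral_cong_AE)
  show "AE x in lborel. ind (cap k sg b s) x = (ind (capset k sg (b / s)) ((1 / s) *\<^sub>R (x - c)) :: ennreal)"
   using AE_not_in[OF null_interface[of k]]
  proof eventually_elim
   case (elim x)
   thus ?case using sg unfolding indicator_def cap_iff by (auto simp: cap_def halfspace_def interface_def c_def)
  qed
 qed
 also have "... = ennreal (s ^ CARD('n)) * ((NN x. ind (capset k sg (b / s)) ((1 / s) *\<^sub>R (x - c))) * ennreal ((1 / s) ^ DIM(real^'n)))"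
 proof -
  have "ennreal (s ^ CARD('n)) * ennreal ((1 / s) ^ DIM(real^'n)) = 1"
   using s by (simp add: ennreal_mult[symmetric] power_mult_distrib[symmetric])
  hence "Z = ennreal (s ^ CARD('n)) * (Z * ennreal ((1 / s) ^ DIM(real^'n)))" for Z
   by (simp only: mult.left_commute[of _ Z] mult_1_right)
  thus ?thesis .
 qed
 also have "... = ennreal (s ^ CARD('n)) * evol (capset k sg (b / s))"
  using s by (subst nn_integral_affine) auto
 also have "evol (capset k sg (b / s)) = ennreal (vol (capset k sg (b / s)))"
  using emeasure_compact_finite[OF compact_capset, of k sg "b / s"] by (intro emeasure_eq_ennreal_measure) auto
 finally show ?thesis using s by (simp add: ennreal_mult[symmetric])
qed

lemma borel_grad_profile: "meas (grad_profile c s dl)" for c :: "'a::euclidean_space"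
 unfolding grad_profile_def[abs_def] sgn_div_norm by measurable

text \<open>The perimeter in the half-space is at most the derivative of the volume in the radius at
  fixed centre. The volume at radius \<open>\<rho>\<close> is \<open>\<rho> ^ Suc m\<close> times
  that of the unit cap with parameter \<open>b / \<rho>\<close>, and the product rule gives the two
  terms.\<close>

lemma perimeter_cap:
 fixes k :: "'n::finite"
 assumes sg: "sg = 1 \<or> sg = -1" and m: "0 < m" "CARD('n) = Suc m"
  and om: "0 < om" "!!r. 0 <= r ==> area k (disc k r) = ennreal (om * r ^ m)"
  and a: "- 1 < a" "a <= 1" and s: "0 < s"
 shows "0 <= s ^ m * (real (Suc m) * vol (capset k sg a) - a * slice_area om m a) \<and>
  perimeter (cap k sg (a * s) s) (halfspace k sg)
   <= ennreal (s ^ m * (real (Suc m) * vol (capset k sg a) - a * slice_area om m a))"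
proof -
 define b where "b = a * s"
 define c :: "real^'n" where "c = (b * sg) *\<^sub>R axis k 1"
 \<comment> \<open>The height \<open>b\<close> stays fixed while the radius varies, so the cap
   parameter \<open>b / \<rho>\<close> changes with it; this is the origin of the term with
   \<open>slice_area\<close>.\<close>
 define W where "W \<rho> = vol (cap k sg b \<rho>)" for \<rho>
 have W: "evol (cap k sg b \<rho>) = ennreal (W \<rho>)" "W \<rho> = \<rho> ^ Suc m * vol (capset k sg (b / \<rho>))" if "0 < \<rho>" for \<rho>
  using cap_volume[OF sg that, of k b] that unfolding m(2) by (auto simp: W_def measure_def)
 define M' where "M' = s ^ m * (real (Suc m) * vol (capset k sg a) - a * slice_area om m a)"
 have W': "(W has_real_derivative M') (at s)"
 proof -
  have "((\<lambda>a. vol (capset k sg a)) has_real_derivative slice_area om m a) (at (b / s))"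
   using capset_volume_deriv[OF m(1) sg om, of a] a s by (simp add: b_def)
  moreover have "((\<lambda>\<rho>. b / \<rho>) has_real_derivative - (b / s\<^sup>2)) (at s)"
   using s by (auto intro!: derivative_eq_intros simp: power2_eq_square)
  ultimately have "((\<lambda>\<rho>. vol (capset k sg (b / \<rho>))) has_real_derivative slice_area om m a * - (b / s\<^sup>2)) (at s)"
   by (rule DERIV_chain2)
  hence "((\<lambda>\<rho>. \<rho> ^ Suc m * vol (capset k sg (b / \<rho>))) has_real_derivative
    real (Suc m) * s ^ m * vol (capset k sg (b / s)) + slice_area om m a * - (b / s\<^sup>2) * s ^ Suc m) (at s)"
   using DERIV_pow[of "Suc m" s] by (intro DERIV_mult) auto
  hence "((\<lambda>\<rho>. \<rho> ^ Suc m * vol (capset k sg (b / \<rho>))) has_real_derivative M') (at s)"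
   using s by (simp add: M'_def b_def power2_eq_square algebra_simps)
  thus ?thesis
   by (rule has_field_derivative_transform_within_open[where S="{0<..}"]) (use s W(2) in auto)
 qed
 define dl where "dl n = s / real (Suc n)" for n
 have dl: "0 < dl n" "dl n <= s" for n using s by (auto simp: dl_def field_simps)
 have dl_lim: "dl ----> 0"
  using tendsto_mult_left[OF LIMSEQ_inverse_real_of_nat, of s] by (simp add: dl_def[abs_def] divide_inverse)
 define M where "M n = (W (s + dl n) - W s) / dl n" for n
 have M_lim: "M ----> M'"
 proof -
  have "filterlim dl (at 0) sequentially" using dl_lim dl(1) by (auto simp: filterlim_at less_imp_neq[symmetric])
  from filterlim_compose[OF DERIV_D[OF W'] this] show ?thesis by (simp add: M_def[abs_def])
 qed
 have shell: "(NN x. ind (halfspace k sg) x * ennreal (norm (grad_profile c s (dl n) x))) <= ennreal (M n)" and M0: "0 <= M n" for n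
 proof -
  have sub: "cap k sg b s \<subseteq> cap k sg b (s + dl n)" using dl(1)[of n] by (auto simp: cap_def)
  have "ennreal (W s) <= ennreal (W (s + dl n))"
   using s dl(1)[of n] by (subst (1 2) W(1)[symmetric]) (auto intro!: emeasure_mono sub)
  hence Wm: "W s <= W (s + dl n)" by (subst (asm) ennreal_le_iff) (auto simp: W_def)
  thus "0 <= M n" using dl(1)[of n] by (simp add: M_def)
  have "(NN x. ind (halfspace k sg) x * ennreal (norm (grad_profile c s (dl n) x)))
    <= (NN x. ennreal (1 / dl n) * ind (cap k sg b (s + dl n) - cap k sg b s) x)"
   using dl(1)[of n] s by (intro nn_integral_mono) (simp add: norm_grad_profile, simp add: indicator_def cap_def c_def)
  also have "... = ennreal (1 / dl n) * (ennreal (W (s + dl n)) - ennreal (W s))"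
   using s dl(1)[of n] sub by (subst nn_integral_cmult, simp, subst nn_integral_indicator, simp, subst emeasure_Diff) (auto simp: W(1))
  also have "... = ennreal (M n)"
   using Wm dl(1)[of n] by (subst ennreal_minus) (auto simp: W_def ennreal_mult[symmetric] M_def)
  finally show "(NN x. ind (halfspace k sg) x * ennreal (norm (grad_profile c s (dl n) x))) <= ennreal (M n)" .
 qed
 have nG: "norm (grad_profile c s (dl n) x) <= 1 / dl n" for n x
  using dl(1)[of n] s by (simp add: norm_grad_profile indicator_def)
 note [measurable] = borel_grad_profile
 have "perimeter (cap k sg b s) (halfspace k sg) <= ennreal M'"
 proof (rule perimeter_le_of_profiles[where f="\<lambda>n. profile c s (dl n)" and G="\<lambda>n. grad_profile c s (dl n)" and L="\<lambda>n. 1 / dl n" and M=M])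
  show "AE x in lborel. (profile c s (dl n) has_derivative (\<bullet>) (grad_profile c s (dl n) x)) (at x)" for n
   by (rule profile_derivative) (use dl s in auto)
  show "AE x in lborel. x \<in> halfspace k sg --> (\<lambda>n. profile c s (dl n) x) ----> ind (cap k sg b s) x"
  proof (intro AE_I2 impI)
   fix x :: "real^'n" assume "x \<in> halfspace k sg"
   hence "ind (cap k sg b s) x = (ind (cball c s) x :: real)" by (simp add: cap_def c_def indicator_def)
   thus "(\<lambda>n. profile c s (dl n) x) ----> ind (cap k sg b s) x"
    using profile_tendsto[OF dl(1) dl_lim, of c s x] by simp
  qed
  show "\<bar>profile c s (dl n) x\<bar> <= 1" for n x using profile_range[of c s "dl n" x] by simp
 qed (auto intro: profile_lipschitz[OF dl(1)] nG shell M0 M_lim simp del: times_divide_eq_left mult_1)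
 moreover have "0 <= M'" by (rule LIMSEQ_le_const[OF M_lim]) (use M0 in blast)
 ultimately show ?thesis unfolding b_def M'_def by (auto intro: le_less_trans)
qed

section \<open>Dependence of the perimeter on the set\<close>

lemma measurable_div_field:
 assumes "ph \<in> test_fields A" shows "meas (div_field ph)"
proof -
 obtain B r where c: "!!i. continuous_on UNIV (\<lambda>x. partial_deriv i ph x $ i)"
  using test_field_bounds[OF assms] by metis
 note [measurable] = cont_meas[OF c]
 show ?thesis unfolding div_field_def[abs_def] by measurable
qed

lemma div_field_outside:
 assumes "ph \<in> test_fields A" "x \<notin> A" shows "div_field ph x = 0"
proof -
 have "x \<notin> closure {x. ph x ~= 0}" using assms by (auto simp: test_fields_def)
 from test_field_outside(2)[OF this] show ?thesis by (simp add: div_field_def)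
qed

lemma perimeter_cong:
 assumes [measurable]: "\<Omega> \<in> sets lebesgue" "\<Omega>' \<in> sets lebesgue"
  and ae: "AE x in lebesgue. x \<in> A --> (x \<in> \<Omega> \<longleftrightarrow> x \<in> \<Omega>')"
 shows "perimeter \<Omega> A = perimeter \<Omega>' A"
 unfolding perimeter_def
proof (intro SUP_cong refl arg_cong[of _ _ ennreal])
 fix ph assume ph: "ph \<in> test_fields A"
 have [measurable]: "div_field ph \<in> borel_measurable lebesgue" using measurable_div_field[OF ph] by (intro measurable_completion) simp
 show "(LINT x:\<Omega>|lebesgue. div_field ph x) = (LINT x:\<Omega>'|lebesgue. div_field ph x)"
  unfolding set_int_def
 proof (rule integral_cong_AE)
  show "AE x in lebesgue. ind \<Omega> x *\<^sub>R div_field ph x = ind \<Omega>' x *\<^sub>R div_field ph x"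
   using ae by eventually_elim (auto simp: indicator_def div_field_outside[OF ph])
 qed measurable
qed

lemma integrable_div_field:
 assumes [measurable]: "E \<in> sets borel" and ph: "ph \<in> test_fields A"
 shows "intg (\<lambda>x. ind E x * div_field ph x)"
proof -
 obtain B r where B: "0 < B" "!!i x. r < norm x ==> partial_deriv i ph x = 0" "!!i x. \<bar>partial_deriv i ph x $ i\<bar> <= B"
  using test_field_bounds[OF ph] by metis
 have [measurable]: "meas (div_field ph)" by (rule measurable_div_field[OF ph])
 show ?thesis
 proof (rule integrable_support)
  show "norm (ind E x * div_field ph x) <= (\<Sum>i\<in>(UNIV :: 'a set). B)" for x
  proof -
   have "\<bar>div_field ph x\<bar> <= (\<Sum>i\<in>(UNIV :: 'a set). B)"
    unfolding div_field_def by (intro sum_abs[THEN order_trans] sum_mono B)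
   thus ?thesis by (auto simp: indicator_def)
  qed
  show "ind E x * div_field ph x = 0" if "r < norm x" for x using B(2)[OF that] by (simp add: div_field_def)
 qed simp
qed

lemma ennreal_add_le: "ennreal (a + b) <= ennreal a + ennreal b"
proof -
 have "ennreal (a + b) <= ennreal (max 0 a + max 0 b)" by (intro ennreal_leI) auto
 also have "... = ennreal a + ennreal b" by (subst ennreal_plus) auto
 finally show ?thesis .
qed

lemma perimeter_Un_le:
 assumes [measurable]: "C \<in> sets borel" "D \<in> sets borel" and disj: "C \<inter> D = {}"
 shows "perimeter (C \<union> D) A <= perimeter C A + perimeter D A"
 unfolding perimeter_def[of "C \<union> D"]
proof (rule SUP_least)
 fix ph assume ph: "ph \<in> test_fields A"
 have "(LI x. ind (C \<union> D) x * div_field ph x) = (LI x. ind C x * div_field ph x + ind D x * div_field ph x)"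
  by (intro Bochner_Integration.integral_cong) (use disj in \<open>auto simp: indicator_def\<close>)
 also have "... = (LI x. ind C x * div_field ph x) + (LI x. ind D x * div_field ph x)"
  by (intro Bochner_Integration.integral_add integrable_div_field[OF _ ph]) auto
 finally have "ennreal (LINT x:C \<union> D|lebesgue. div_field ph x) <= ennreal (LINT x:C|lebesgue. div_field ph x) + ennreal (LINT x:D|lebesgue. div_field ph x)"
  using ennreal_add_le by (simp add: perimeter_borel[OF _ ph])
 also have "... <= perimeter C A + perimeter D A" by (intro add_mono perimeter_ge_test[OF ph])
 finally show "ennreal (LINT x:C \<union> D|lebesgue. div_field ph x) <= perimeter C A + perimeter D A" .
qed

text \<open>The radius \<open>S b\<close> keeps the trace a disc of radius \<open>R\<close> for
  every centre height \<open>b\<close>, so only the volume is left to match, by the intermediate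
  value theorem. A vanishing trace is met by the full ball, \<open>a = 1\<close>.\<close>

lemma cap_exists:
 fixes k :: "'n::finite"
 assumes sg: "sg = 1 \<or> sg = -1" and m: "0 < m" "CARD('n) = Suc m"
  and om: "0 < om" "!!r. 0 <= r ==> area k (disc k r) = ennreal (om * r ^ m)"
  and V: "0 < V" and R: "0 <= R"
 obtains a s where "- 1 < a" "a <= 1" "0 < s" "s ^ Suc m * vol (capset k sg a) = V" "R = s * sqrt (1 - a\<^sup>2)"
proof (cases "R = 0")
 case True
 let ?v = "vol (capset k sg 1)"
 have v: "0 < ?v" using capset_volume_pos[OF m(1) sg om] by simp
 show ?thesis
 proof (rule that[of 1 "root (Suc m) (V / ?v)"])
  show "0 < root (Suc m) (V / ?v)" using V v by simp
  show "root (Suc m) (V / ?v) ^ Suc m * ?v = V"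
   using V v by (subst real_root_pow_pos2) auto
 qed (use True in auto)
next
 case False
 hence R0: "0 < R" using R by simp
 define v where "v a = vol (capset k sg a)" for a
 define S where "S b = sqrt (R\<^sup>2 + b\<^sup>2)" for b
 have S: "0 < S b" "(S b)\<^sup>2 = R\<^sup>2 + b\<^sup>2" "\<bar>b\<bar> < S b" for b
 proof -
  have p: "0 < R\<^sup>2 + b\<^sup>2" using R0 by (simp add: add_pos_nonneg)
  show "0 < S b" "(S b)\<^sup>2 = R\<^sup>2 + b\<^sup>2" using p by (simp_all add: S_def)
  have "sqrt (b\<^sup>2) < S b" unfolding S_def using R0 by (intro real_sqrt_less_mono) simp
  thus "\<bar>b\<bar> < S b" by simp
 qed
 have ab: "\<bar>b / S b\<bar> < 1" for b using S(1,3)[of b] by simp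
 have sq: "sqrt (1 - (b / S b)\<^sup>2) = R / S b" for b
 proof -
  have "1 - (b / S b)\<^sup>2 = (R / S b)\<^sup>2"
   unfolding power_divide S(2) using R0 by (simp add: field_simps add_pos_nonneg less_imp_neq[symmetric])
  thus ?thesis using R0 S(1)[of b] by simp
 qed
 have "isCont v a" if "\<bar>a\<bar> < 2" for a
  unfolding v_def[abs_def] by (rule DERIV_isCont[OF capset_volume_deriv[OF m(1) sg om that]])
 hence v_cont: "continuous_on {-2<..<2} v"
  by (intro continuous_at_imp_continuous_on) auto
 define g where "g b = S b ^ Suc m * v (b / S b)" for b
 have g_cont: "continuous_on T g" for T
 proof -
  have S_cont: "continuous_on T S" unfolding S_def[abs_def] by (intro continuous_intros)
  have q_cont: "continuous_on T (\<lambda>b. b / S b)"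
   using S(1) by (intro continuous_intros S_cont) (auto simp: less_imp_neq[symmetric])
  have "b / S b \<in> {-2<..<2}" for b using ab[of b] by (simp only: greaterThanLessThan_iff) linarith
  hence "continuous_on T (\<lambda>b. v (b / S b))" by (intro continuous_on_compose2[OF v_cont q_cont]) blast
  thus ?thesis unfolding g_def[abs_def] by (intro continuous_intros S_cont)
 qed
 \<comment> \<open>Solves the estimate \<open>om * R ^ (m + 2) / - b0 <= V\<close> for the volume of
   a flat cap, which comes from \<open>S b + b = R\<^sup>2 / (S b - b)\<close>.\<close>
 define b0 where "b0 = - (om * R ^ (m + 2) / V + 1)"
 have "0 < om * R ^ (m + 2) / V" using R0 om(1) V by (intro divide_pos_pos mult_pos_pos zero_less_power)
 hence b0: "b0 < 0" by (simp only: b0_def)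
 have lo: "g b0 <= V"
 proof -
  have "v (b0 / S b0) <= (1 + b0 / S b0) * slice_area om m (b0 / S b0)"
   unfolding v_def using ab[of b0] b0 S(1)[of b0] by (intro capset_volume_le[OF m(1) sg om]) (auto simp: divide_nonpos_pos abs_le_iff)
  also have "slice_area om m (b0 / S b0) = om * (R / S b0) ^ m"
   using sq[of b0] ab[of b0] by (simp add: slice_area_def max_def abs_square_le_1)
  finally have "g b0 <= S b0 ^ Suc m * ((1 + b0 / S b0) * (om * (R / S b0) ^ m))"
   unfolding g_def using S(1)[of b0] by (intro mult_left_mono) auto
  also have "... = om * R ^ m * (S b0 + b0)" using S(1)[of b0] by (simp add: field_simps)
  also have "... <= om * R ^ m * (R\<^sup>2 / - b0)"
  proof (intro mult_left_mono)
   have "(S b0 + b0) * - b0 <= (S b0 + b0) * (S b0 - b0)" using S(1,3)[of b0] by (intro mult_left_mono) auto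
   also have "... = R\<^sup>2" using S(2)[of b0] by (simp add: algebra_simps power2_eq_square)
   finally show "S b0 + b0 <= R\<^sup>2 / - b0" using b0 by (simp only: pos_le_divide_eq neg_0_less_iff_less)
  qed (use om(1) R0 in auto)
  also have "... = om * R ^ (m + 2) / - b0" by (simp add: power_add power2_eq_square)
  also have "... <= V"
  proof -
   have "om * R ^ (m + 2) <= V * - b0" using V by (simp add: b0_def distrib_left)
   thus ?thesis using b0 by (simp only: pos_divide_le_eq neg_0_less_iff_less)
  qed
  finally show ?thesis .
 qed
 have v0: "0 < v 0" unfolding v_def using capset_volume_pos[OF m(1) sg om] by simp
 \<comment> \<open>At this height the cap contains a scaled half ball and
   \<open>b1 * v 0 >= V\<close>; \<open>b1 >= 1\<close> lets the power of the radius be replaced by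
   the radius.\<close>
 define b1 where "b1 = 1 + V / v 0"
 have b1: "1 <= b1" "0 < b1" using V v0 by (simp_all add: b1_def add_pos_nonneg)
 have hi: "V <= g b1"
 proof -
  have "capset k sg (b1 / S b1) \<in> fmeasurable lborel"
   using emeasure_compact_finite[OF compact_capset, of k sg "b1 / S b1"] borel_closed[OF closed_capset, of k sg "b1 / S b1"] by (simp add: fmeasurable_def)
  moreover have "capset k sg 0 \<subseteq> capset k sg (b1 / S b1)"
   using divide_nonneg_pos[OF less_imp_le[OF b1(2)] S(1)[of b1]] by (auto simp: capset_def)
  ultimately have "v 0 <= v (b1 / S b1)" unfolding v_def by (intro measure_mono_fmeasurable) (auto intro!: borel_closed closed_capset)
  moreover have "b1 <= S b1 ^ Suc m"
  proof -
   have "b1 <= S b1" using S(3)[of b1] by simp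
   also have "... <= S b1 ^ Suc m" using b1 \<open>b1 <= S b1\<close> by (intro self_le_power) auto
   finally show ?thesis .
  qed
  ultimately have "b1 * v 0 <= g b1" unfolding g_def using b1 v0 S(1)[of b1] by (intro mult_mono) auto
  moreover have "V <= b1 * v 0" using v0 by (simp add: b1_def distrib_right)
  ultimately show ?thesis by simp
 qed
 have "\<exists>b\<ge>b0. b <= b1 \<and> g b = V"
  by (rule IVT') (use lo hi b0 b1 g_cont in auto)
 then obtain b where b: "g b = V" by blast
 show ?thesis
 proof (rule that[of "b / S b" "S b"])
  show "- 1 < b / S b" "b / S b <= 1" using ab[of b] by linarith+
  show "S b ^ Suc m * vol (capset k sg (b / S b)) = V" using b by (simp add: g_def v_def)
  show "R = S b * sqrt (1 - (b / S b)\<^sup>2)" unfolding sq using S(1)[of b] by simp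
 qed (rule S)
qed

section \<open>Hausdorff measure of the interface\<close>

lemma hausdorff_weight_empty [simp]: "hausdorff_weight m {} = 0"
 by (simp add: hausdorff_weight_def)

lemma hausdorff_pre_le_cover:
 "A \<subseteq> (\<Union>i. U i) ==> (!!i. bounded (U i)) ==> (!!i. diameter (U i) <= dl) ==> hausdorff_pre m dl A <= (\<Sum>i. hausdorff_weight m (U i))"
 unfolding hausdorff_pre_def by (rule INF_lower) auto

lemma hausdorff_pre_mono: "A \<subseteq> B ==> hausdorff_pre m dl A <= hausdorff_pre m dl B"
 unfolding hausdorff_pre_def by (rule INF_superset_mono) auto

lemma hausdorff_measure_mono: "A \<subseteq> B ==> hmeas m A <= hmeas m B"
 unfolding hausdorff_measure_def by (rule SUP_mono') (rule hausdorff_pre_mono)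

lemma hausdorff_pre_le_measure: "0 < dl ==> hausdorff_pre m dl A <= hmeas m A"
 unfolding hausdorff_measure_def by (rule SUP_upper) simp

lemma hausdorff_measure_le: "(!!dl. 0 < dl ==> hausdorff_pre m dl A <= b) ==> hmeas m A <= b"
 unfolding hausdorff_measure_def by (rule SUP_least) simp

text \<open>Nearly optimal covers of the pieces are interleaved by the pairing function; piece
  \<open>i\<close> may waste \<open>e / 2 ^ Suc i\<close>, in total \<open>e\<close>.\<close>

lemma hausdorff_pre_UN:
 fixes A :: "nat => 'a::metric_space set"
 shows "hausdorff_pre m dl (\<Union>i. A i) <= (\<Sum>i. hausdorff_pre m dl (A i))"
proof (rule ennreal_le_epsilon)
 fix e :: real assume fin: "(\<Sum>i. hausdorff_pre m dl (A i)) < \<top>" and e: "0 < e"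
 have fi: "hausdorff_pre m dl (A i) < \<top>" for i
  using fin by (metis ennreal_suminf_lessD less_top)
 have "\<exists>U. A i \<subseteq> (\<Union>j. U j) \<and> (\<forall>j. bounded (U j) \<and> diameter (U j) <= dl) \<and>
   (\<Sum>j. hausdorff_weight m (U j)) <= hausdorff_pre m dl (A i) + ennreal (e * (1 / 2) ^ Suc i)" for i
 proof -
  have "hausdorff_pre m dl (A i) < hausdorff_pre m dl (A i) + ennreal (e * (1 / 2) ^ Suc i)"
   using fi[of i] e by (simp add: ennreal_add_left_cancel_less[of _ 0, simplified] less_top)
  thus ?thesis unfolding hausdorff_pre_def[of m dl "A i"]
   by (subst (asm) INF_less_iff) (auto intro: less_imp_le)
 qed
 then obtain U where U: "!!i. A i \<subseteq> (\<Union>j. U i j)" "!!i j. bounded (U i j)" "!!i j. diameter (U i j) <= dl"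
  "!!i. (\<Sum>j. hausdorff_weight m (U i j)) <= hausdorff_pre m dl (A i) + ennreal (e * (1 / 2) ^ Suc i)"
  by metis
 define Z where "Z n = U (fst (prod_decode n)) (snd (prod_decode n))" for n
 have "(\<Union>i. A i) \<subseteq> (\<Union>n. Z n)"
 proof
  fix x assume "x \<in> (\<Union>i. A i)"
  then obtain i j where "x \<in> U i j" using U(1) by blast
  hence "x \<in> Z (prod_encode (i, j))" by (simp add: Z_def)
  thus "x \<in> (\<Union>n. Z n)" by blast
 qed
 hence "hausdorff_pre m dl (\<Union>i. A i) <= (\<Sum>n. hausdorff_weight m (Z n))"
  by (rule hausdorff_pre_le_cover) (auto simp: Z_def U)
 also have "... = (\<Sum>n. (\<lambda>(i, j). hausdorff_weight m (U i j)) (prod_decode n))"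
  by (simp add: Z_def case_prod_beta)
 also have "... = (\<Sum>i. \<Sum>j. hausdorff_weight m (U i j))"
  by (rule suminf_ennreal_2dimen[unfolded comp_def]) simp
 also have "... <= (\<Sum>i. hausdorff_pre m dl (A i) + ennreal (e * (1 / 2) ^ Suc i))"
  by (intro suminf_le U) auto
 also have "... = (\<Sum>i. hausdorff_pre m dl (A i)) + (\<Sum>i. ennreal (e * (1 / 2) ^ Suc i))"
  by (intro suminf_add[symmetric]) auto
 also have "(\<Sum>i. ennreal (e * (1 / 2) ^ Suc i)) = ennreal (e * 1)"
  using e by (intro suminf_ennreal_eq sums_mult power_half_series) auto
 finally show "hausdorff_pre m dl (\<Union>i. A i) <= (\<Sum>i. hausdorff_pre m dl (A i)) + ennreal e" by simp
qed

lemma hausdorff_measure_UN: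
 fixes A :: "nat => 'a::metric_space set"
 shows "hmeas m (\<Union>i. A i) <= (\<Sum>i. hmeas m (A i))"
proof (rule hausdorff_measure_le)
 fix dl :: real assume "0 < dl"
 thus "hausdorff_pre m dl (\<Union>i. A i) <= (\<Sum>i. hmeas m (A i))"
  by (intro order_trans[OF hausdorff_pre_UN] suminf_le hausdorff_pre_le_measure) auto
qed

lemma hausdorff_pre_le_weight:
 assumes "bounded A" "diameter A <= dl" "0 <= dl"
 shows "hausdorff_pre m dl A <= hausdorff_weight m A"
proof -
 have "hausdorff_pre m dl A <= (\<Sum>i. hausdorff_weight m (binaryset A {} i))"
  by (rule hausdorff_pre_le_cover) (use assms in \<open>auto simp: UN_binaryset_eq binaryset_def\<close>)
 also have "... = hausdorff_weight m A" by (subst suminf_binaryset_eq) auto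
 finally show ?thesis .
qed

lemma hausdorff_pre_empty: "0 <= dl ==> hausdorff_pre m dl ({} :: 'a::metric_space set) = 0"
 using hausdorff_pre_le_weight[of "{} :: 'a set" dl m] by simp

lemma hausdorff_measure_empty [simp]: "hmeas m ({} :: 'a::metric_space set) = 0"
proof -
 have "hmeas m ({} :: 'a set) <= 0" by (rule hausdorff_measure_le) (simp add: hausdorff_pre_empty)
 thus ?thesis by simp
qed

lemma hausdorff_measure_Un:
 "hmeas m (A \<union> B) <= hmeas m A + hmeas m B"
 using hausdorff_measure_UN[of m "binaryset A B"] by (simp add: UN_binaryset_eq suminf_binaryset_eq)

lemma hausdorff_pre_finite_UN:
 "finite I ==> 0 <= dl ==> hausdorff_pre m dl (\<Union>i\<in>I. A i) <= (\<Sum>i\<in>I. hausdorff_pre m dl (A i))"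
proof (induction I rule: finite_induct)
 case (insert i I)
 have "hausdorff_pre m dl (A i \<union> (\<Union>i\<in>I. A i)) <= hausdorff_pre m dl (A i) + hausdorff_pre m dl (\<Union>i\<in>I. A i)"
  using hausdorff_pre_UN[of m dl "binaryset (A i) (\<Union>i\<in>I. A i)"] insert.prems
  by (simp add: UN_binaryset_eq suminf_binaryset_eq hausdorff_pre_empty)
 also have "... <= hausdorff_pre m dl (A i) + (\<Sum>i\<in>I. hausdorff_pre m dl (A i))"
  using insert by (intro add_left_mono) auto
 finally show ?case using insert by simp
qed (simp add: hausdorff_pre_empty)

lemma hausdorff_measure_countable_UN:
 assumes "countable I"
 shows "hmeas m (\<Union>i\<in>I. A i) <= (\<integral>\<^sup>+i. hmeas m (A i) \<partial>count_space I)"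
proof -
 define J where "J = to_nat_on I ` I"
 have bij: "bij_betw (to_nat_on I) I J" using assms by (simp add: J_def bij_betw_def inj_on_to_nat_on)
 define A' where "A' n = (if n \<in> J then A (from_nat_into I n) else {})" for n
 have fn: "from_nat_into I (to_nat_on I i) = i" if "i \<in> I" for i using assms that by simp
 have "(\<Union>i\<in>I. A i) = (\<Union>n. A' n)"
  by (auto simp: A'_def J_def fn split: if_splits)
 hence "hmeas m (\<Union>i\<in>I. A i) <= (\<Sum>n. hmeas m (A' n))" by (simp add: hausdorff_measure_UN)
 also have "... = (\<integral>\<^sup>+n. hmeas m (A' n) \<partial>count_space UNIV)" by (simp add: nn_integral_count_space_nat)
 also have "... = (\<integral>\<^sup>+n. hmeas m (A' n) * ind J n \<partial>count_space UNIV)"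
  by (intro nn_integral_cong) (auto simp: A'_def indicator_def)
 also have "... = (\<integral>\<^sup>+n. hmeas m (A' n) \<partial>count_space J)"
  by (subst nn_integral_count_space_indicator) (auto simp: mult.commute)
 also have "... = (\<integral>\<^sup>+i. hmeas m (A' (to_nat_on I i)) \<partial>count_space I)"
  by (rule nn_integral_bij_count_space[OF bij, symmetric])
 also have "... = (\<integral>\<^sup>+i. hmeas m (A i) \<partial>count_space I)"
  by (intro nn_integral_cong) (auto simp: A'_def J_def fn)
 finally show ?thesis .
qed

text \<open>Covering sets are mapped after intersection with \<open>A\<close>, where the Lipschitz
  bound holds. The mesh \<open>dl\<close> of the image corresponds to \<open>dl / c\<close>
  upstairs, and the factor \<open>c ^ m\<close> is moved across by its inverse.\<close>

lemma hausdorff_measure_lipschitz_image: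
 fixes f :: "'a::metric_space => 'b::metric_space"
 assumes f: "!!x y. x \<in> A ==> y \<in> A ==> dist (f x) (f y) <= c * dist x y" and c: "0 < c"
 shows "hmeas m (f ` A) <= ennreal (c ^ m) * hmeas m A"
proof (rule hausdorff_measure_le)
 fix dl :: real assume dl: "0 < dl"
 let ?i = "ennreal ((1 / c) ^ m)"
 have ci: "ennreal (c ^ m) * (?i * X) = X" for X
 proof -
  have "ennreal (c ^ m) * ?i = 1" using c by (simp add: ennreal_mult[symmetric] power_mult_distrib[symmetric])
  thus ?thesis by (simp add: mult.assoc[symmetric])
 qed
 have "?i * hausdorff_pre m dl (f ` A) <= hausdorff_pre m (dl / c) A"
  unfolding hausdorff_pre_def[of m "dl / c" A]
 proof (rule INF_greatest)
  fix U assume "U \<in> {U :: nat => 'a set. A \<subseteq> (\<Union>i. U i) \<and> (\<forall>i. bounded (U i) \<and> diameter (U i) <= dl / c)}"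
  hence U: "A \<subseteq> (\<Union>i. U i)" "!!i. bounded (U i)" "!!i. diameter (U i) <= dl / c" by auto
  define Z where "Z i = f ` (U i \<inter> A)" for i
  have d: "dist (f x) (f y) <= c * diameter (U i)" if "x \<in> U i \<inter> A" "y \<in> U i \<inter> A" for x y i
   using f[of x y] that diameter_bounded_bound[OF U(2), of x i y] c by (auto intro: order_trans mult_left_mono)
  have bZ: "bounded (Z i)" for i
   unfolding bounded_two_points Z_def using d by blast
  have dZ: "diameter (Z i) <= c * diameter (U i)" for i
  proof (cases "Z i = {}")
   case True thus ?thesis using c by (simp add: diameter_ge_0 U(2))
  next
   case False
   hence "(SUP (x, y)\<in>Z i \<times> Z i. dist x y) <= c * diameter (U i)"
    using d by (intro cSUP_least) (auto simp: Z_def)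
   thus ?thesis using False by (simp add: diameter_def[of "Z i"])
  qed
  have w: "hausdorff_weight m (Z i) <= ennreal (c ^ m) * hausdorff_weight m (U i)" for i
  proof (cases "Z i = {}")
   case False
   hence ne: "U i ~= {}" by (auto simp: Z_def)
   have "diameter (Z i) / 2 <= c * (diameter (U i) / 2)" using dZ[of i] by simp
   hence "(diameter (Z i) / 2) ^ m <= (c * (diameter (U i) / 2)) ^ m"
    using diameter_ge_0[OF bZ, of i] by (intro power_mono) auto
   hence "unit_ball_vol (real m) * (diameter (Z i) / 2) ^ m <= c ^ m * (unit_ball_vol (real m) * (diameter (U i) / 2) ^ m)"
    unfolding power_mult_distrib by (subst mult.left_commute) (intro mult_left_mono, auto)
   thus ?thesis using False ne c by (simp add: hausdorff_weight_def ennreal_mult'[symmetric] ennreal_leI)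
  qed simp
  have "hausdorff_pre m dl (f ` A) <= (\<Sum>i. hausdorff_weight m (Z i))"
  proof (rule hausdorff_pre_le_cover)
   show "f ` A \<subseteq> (\<Union>i. Z i)" using U(1) unfolding Z_def by blast
   show "diameter (Z i) <= dl" for i
    using order_trans[OF dZ mult_left_mono[OF U(3), of c]] c by simp
  qed (rule bZ)
  also have "... <= (\<Sum>i. ennreal (c ^ m) * hausdorff_weight m (U i))" by (intro suminf_le w) auto
  also have "... = ennreal (c ^ m) * (\<Sum>i. hausdorff_weight m (U i))" by simp
  finally have "?i * hausdorff_pre m dl (f ` A) <= ?i * (ennreal (c ^ m) * (\<Sum>i. hausdorff_weight m (U i)))"
   by (rule mult_left_mono) simp
  thus "?i * hausdorff_pre m dl (f ` A) <= (\<Sum>i. hausdorff_weight m (U i))"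
   by (simp only: mult.left_commute[of ?i] ci)
 qed
 also have "... <= hmeas m A" using dl c by (intro hausdorff_pre_le_measure) simp
 finally have "ennreal (c ^ m) * (?i * hausdorff_pre m dl (f ` A)) <= ennreal (c ^ m) * hmeas m A"
  by (rule mult_left_mono) simp
 thus "hausdorff_pre m dl (f ` A) <= ennreal (c ^ m) * hmeas m A" by (simp only: ci)
qed

text \<open>An axis-parallel cube of side \<open>l\<close> inside the interface, of one dimension
  less; \<open>u $ k\<close> has no influence.\<close>

definition face :: "'n::finite => real^'n => real => (real^'n) set" where
 "face k u l = {x. x $ k = 0 \<and> (\<forall>i. i ~= k --> u $ i <= x $ i \<and> x $ i <= u $ i + l)}"

lemma face_diameter:
 fixes x :: "real^'n::finite"
 assumes "x \<in> face k u l" "y \<in> face k u l" "0 <= l"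
 shows "norm (x - y) <= real CARD('n) * l"
proof -
 have "\<bar>(x - y) $ i\<bar> <= l" for i
  using assms by (cases "i = k") (auto simp: face_def abs_le_iff algebra_simps dest!: spec[of _ i])
 hence "norm (x - y) <= (\<Sum>i\<in>(UNIV :: 'n set). l)" by (intro order_trans[OF norm_le_l1_cart] sum_mono) auto
 thus ?thesis by simp
qed

text \<open>Subdivision into \<open>n ^ m\<close> cubes of side \<open>1 / n\<close> gives a total
  weight that does not depend on \<open>n\<close>, while the mesh tends to 0.\<close>

lemma hausdorff_face_finite:
 fixes k :: "'n::finite"
 shows "hmeas (CARD('n) - 1) (face k 0 1) < \<infinity>"
proof -
 define m where "m = CARD('n) - 1"
 define N where "N = real CARD('n)"
 define C where "C = unit_ball_vol (real m) * (N / 2) ^ m"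
 have N: "0 < N" by (simp add: N_def)
 have "hmeas m (face k 0 1) <= ennreal C"
 proof (rule hausdorff_measure_le)
  fix dl :: real assume dl: "0 < dl"
  obtain n :: nat where n: "N / dl < real n" using reals_Archimedean2 by blast
  hence n0: "0 < real n" using N dl by (intro le_less_trans[OF _ n]) simp
  have nd: "N * (1 / real n) <= dl" using n n0 dl by (simp add: field_simps)
  define I where "I = (\<Pi>\<^sub>E i\<in>(UNIV::'n set). if i = k then {0} else {..<n})"
  have I: "finite I" "card I = n ^ m"
  proof -
   show "finite I" unfolding I_def by (intro finite_PiE) auto
   show "card I = n ^ m" unfolding I_def m_def
    by (subst card_PiE, simp, subst prod.remove[of _ k]) (auto simp: card_Diff_singleton)
  qed
  define F where "F j = face k (\<chi> i. real (j i) / real n) (1 / real n)" for j :: "'n => nat"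
  have "face k 0 1 \<subseteq> (\<Union>j\<in>I. F j)"
  proof
   fix x :: "real^'n" assume x: "x \<in> face k 0 1"
   \<comment> \<open>The cap at \<open>n - 1\<close> assigns the right edge \<open>x $ i = 1\<close>
     to the last cell.\<close>
   define j where "j i = (if i = k then 0 else min (n - 1) (nat \<lfloor>real n * x $ i\<rfloor>))" for i
   have "j \<in> I" using n0 by (auto simp: I_def j_def)
   moreover have "x \<in> F j"
    unfolding F_def face_def
   proof (intro CollectI conjI allI impI)
    show "x $ k = 0" using x by (simp add: face_def)
    fix i assume i: "i ~= k"
    hence xi: "0 <= x $ i" "x $ i <= 1" using x by (auto simp: face_def)
    have nx: "0 <= real n * x $ i" "real n * x $ i <= real n" using xi n0 by (auto simp: mult_left_le)
    have "real (nat \<lfloor>real n * x $ i\<rfloor>) <= real n * x $ i" using nx(1) by (simp add: of_nat_floor)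
    hence "real (j i) <= real n * x $ i" using i by (auto simp: j_def)
    thus "(\<chi> i. real (j i) / real n) $ i <= x $ i" using n0 by (simp add: field_simps)
    have "real n * x $ i <= real (j i) + 1"
    proof (cases "nat \<lfloor>real n * x $ i\<rfloor> <= n - 1")
     case True
     hence "j i = nat \<lfloor>real n * x $ i\<rfloor>" using i by (simp add: j_def)
     thus ?thesis using nx(1) by (simp add: le_nat_floor)
    next
     case False
     hence "j i = n - 1" using i by (simp add: j_def)
     thus ?thesis using nx n0 by (simp add: of_nat_diff)
    qed
    thus "x $ i <= (\<chi> i. real (j i) / real n) $ i + 1 / real n" using n0 by (simp add: field_simps)
   qed
   ultimately show "x \<in> (\<Union>j\<in>I. F j)" by blast
  qed
  hence "hausdorff_pre m dl (face k 0 1) <= hausdorff_pre m dl (\<Union>j\<in>I. F j)" by (rule hausdorff_pre_mono)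
  also have "... <= (\<Sum>j\<in>I. hausdorff_pre m dl (F j))" using I dl by (intro hausdorff_pre_finite_UN) auto
  also have "... <= (\<Sum>j\<in>I. ennreal (unit_ball_vol (real m) * (N / (2 * real n)) ^ m))"
  proof (rule sum_mono)
   fix j
   have d: "norm (x - y) <= N * (1 / real n)" if "x \<in> F j" "y \<in> F j" for x y
    using face_diameter[OF that[unfolded F_def]] n0 by (simp add: N_def)
   have b: "bounded (F j)" unfolding bounded_two_points dist_norm using d by blast
   have dm: "diameter (F j) <= N * (1 / real n)" using N n0 d by (intro diameter_le) auto
   have "hausdorff_pre m dl (F j) <= hausdorff_weight m (F j)"
    using b dm nd dl by (intro hausdorff_pre_le_weight) auto
   also have "... <= ennreal (unit_ball_vol (real m) * (N / (2 * real n)) ^ m)"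
   proof (cases "F j = {}")
    case False
    have "(diameter (F j) / 2) ^ m <= (N / (2 * real n)) ^ m"
     using dm diameter_ge_0[OF b] n0 by (intro power_mono) (auto simp: field_simps)
    thus ?thesis using False by (simp add: hausdorff_weight_def ennreal_leI mult_left_mono)
   qed simp
   finally show "hausdorff_pre m dl (F j) <= ennreal (unit_ball_vol (real m) * (N / (2 * real n)) ^ m)" .
  qed
  also have "... = ennreal (real n ^ m) * ennreal (unit_ball_vol (real m) * (N / (2 * real n)) ^ m)"
   by (simp add: I ennreal_of_nat_eq_real_of_nat)
  also have "... = ennreal C"
   using n0 N by (simp add: ennreal_mult[symmetric] C_def power_divide power_mult_distrib)
  finally show "hausdorff_pre m dl (face k 0 1) <= ennreal C" .
 qed
 thus ?thesis unfolding m_def by (rule le_less_trans) simp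
qed

lemma continuous_on_upd [continuous_intros]:
 fixes f :: "'a::t2_space => real^'n::finite"
 assumes "continuous_on S f" "continuous_on S g" shows "continuous_on S (\<lambda>x. upd (f x) k (g x))"
 unfolding upd_def
proof (rule continuous_on_vec_lambda)
 fix j show "continuous_on S (\<lambda>x. if j = k then g x else f x $ j)"
  using assms by (cases "j = k") (auto intro!: continuous_intros)
qed

text \<open>Dilation and its inverse are both Lipschitz with reciprocal constants, so the two image
  bounds combine to an equality.\<close>

lemma hausdorff_face_scale:
 fixes k :: "'n::finite"
 assumes l: "0 < l"
 shows "hmeas m (face k u l) = ennreal (l ^ m) * hmeas m (face k 0 1)"
proof -
 have "!!x y :: real^'n. dist (upd u k 0 + l *\<^sub>R x) (upd u k 0 + l *\<^sub>R y) <= l * dist x y"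
  using l by (simp add: dist_norm flip: scaleR_diff_right)
 moreover have "(\<lambda>x. upd u k 0 + l *\<^sub>R x) ` face k 0 1 = face k u l"
 proof (intro equalityI subsetI)
  fix y assume y: "y \<in> face k u l"
  let ?x = "(1 / l) *\<^sub>R (y - upd u k 0)"
  have "y = upd u k 0 + l *\<^sub>R ?x" using l by simp
  moreover have "?x \<in> face k 0 1" using y l by (auto simp: face_def field_simps)
  ultimately show "y \<in> (\<lambda>x. upd u k 0 + l *\<^sub>R x) ` face k 0 1" by blast
 qed (use l in \<open>auto simp: face_def mult_left_le\<close>)
 ultimately have le: "hmeas m (face k u l) <= ennreal (l ^ m) * hmeas m (face k 0 1)"
  using hausdorff_measure_lipschitz_image[of "face k 0 1" "\<lambda>x. upd u k 0 + l *\<^sub>R x" l m] l by simp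
 have "!!x y :: real^'n. dist ((1 / l) *\<^sub>R (x - upd u k 0)) ((1 / l) *\<^sub>R (y - upd u k 0)) <= 1 / l * dist x y"
  using l by (simp add: dist_norm flip: scaleR_diff_right)
 moreover have "(\<lambda>x. (1 / l) *\<^sub>R (x - upd u k 0)) ` face k u l = face k 0 1"
 proof (intro equalityI subsetI)
  fix x assume x: "x \<in> face k 0 1"
  let ?y = "upd u k 0 + l *\<^sub>R x"
  have "x = (1 / l) *\<^sub>R (?y - upd u k 0)" using l by simp
  moreover have "?y \<in> face k u l" using x l by (auto simp: face_def mult_left_le)
  ultimately show "x \<in> (\<lambda>x. (1 / l) *\<^sub>R (x - upd u k 0)) ` face k u l" by blast
 qed (use l in \<open>auto simp: face_def field_simps\<close>)
 ultimately have "hmeas m (face k 0 1) <= ennreal ((1 / l) ^ m) * hmeas m (face k u l)"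
  using hausdorff_measure_lipschitz_image[of "face k u l" "\<lambda>x. (1 / l) *\<^sub>R (x - upd u k 0)" "1 / l" m] l by simp
 hence "ennreal (l ^ m) * hmeas m (face k 0 1) <= ennreal (l ^ m) * (ennreal ((1 / l) ^ m) * hmeas m (face k u l))"
  by (rule mult_left_mono) simp
 also have "... = hmeas m (face k u l)"
 proof -
  have "ennreal (l ^ m) * ennreal ((1 / l) ^ m) = 1" using l by (simp add: ennreal_mult[symmetric] power_mult_distrib[symmetric])
  thus ?thesis by (simp add: mult.assoc[symmetric])
 qed
 finally show ?thesis using le by simp
qed

text \<open>Covering the cylinder over \<open>C\<close> by cubes and slicing at a random height compares the Hausdorff
 measure of an open set with its area, without any isodiametric inequality.\<close>

lemma hausdorff_open_le:
 fixes k :: "'n::finite"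
 assumes m: "CARD('n) = Suc m" and C: "open C" and bd: "bounded (C \<inter> interface k)"
 shows "hmeas m (C \<inter> interface k) <= hmeas m (face k 0 1) * area k C"
proof -
 let ?kp = "hmeas m (face k 0 1)"
 define T where "T = {x. upd x k 0 \<in> C \<and> 0 < x $ k \<and> x $ k < 1}"
 have "open ((\<lambda>x. upd x k 0) -` C)" by (rule open_vimage[OF C]) (intro continuous_intros)
 moreover have "open {x::real^'n. 0 < x $ k \<and> x $ k < 1}"
  by (intro open_Collect_conj open_Collect_less continuous_intros)
 ultimately have T: "open T" unfolding T_def by (auto simp: vimage_def Collect_conj_eq intro: open_Int)
 obtain L where L: "0 < L" "!!x. x \<in> C \<inter> interface k ==> norm x <= L" using bd unfolding bounded_pos by blast
 define a :: "real^'n" where "a = (\<chi> i. - (L + 1))"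
 define b :: "real^'n" where "b = (\<chi> i. L + 1)"
 have Tab: "T \<subseteq> cbox a b"
 proof
  fix x assume x: "x \<in> T"
  hence n: "norm (upd x k 0) <= L" by (intro L(2)) (simp add: T_def interface_def)
  have "- (L + 1) <= x $ i \<and> x $ i <= L + 1" for i
  proof (cases "i = k")
   case True thus ?thesis using x L(1) by (simp add: T_def)
  next
   case False
   hence "\<bar>x $ i\<bar> <= L" using component_le_norm_cart[of "upd x k 0" i] n by simp
   thus ?thesis by linarith
  qed
  thus "x \<in> cbox a b" by (simp add: mem_box_cart a_def b_def)
 qed
 have ne: "box a b ~= {}" using L(1) by (auto simp: box_ne_empty Basis_vec_def inner_axis a_def b_def)
 have "gauge (\<lambda>x. if x \<in> T then T else UNIV)" using T by (auto simp: gauge_def)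
 from covering_lemma[OF Tab ne this] obtain \<D> where \<D>: "countable \<D>"
  "!!K. K \<in> \<D> ==> interior K ~= {} \<and> (\<exists>c d. K = cbox c d)"
  "pairwise (\<lambda>A B. interior A \<inter> interior B = {}) \<D>"
  "!!K. K \<in> \<D> ==> \<exists>x\<in>T \<inter> K. K \<subseteq> (if x \<in> T then T else UNIV)"
  "!!u v. cbox u v \<in> \<D> ==> \<exists>n. \<forall>i\<in>Basis. v \<bullet> i - u \<bullet> i = (b \<bullet> i - a \<bullet> i) / 2 ^ n"
  "T \<subseteq> \<Union>\<D>" by metis
 have KT: "K \<subseteq> T" if "K \<in> \<D>" for K using \<D>(4)[OF that] by auto
 \<comment> \<open>The surrounding box is a cube, and the covering lemma halves all of its sides
   equally often; so every covering box is a cube.\<close>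
 have "\<exists>c l. K = cbox c (\<chi> i. c $ i + l) \<and> 0 < l" if K: "K \<in> \<D>" for K
 proof -
  obtain c d where cd: "K = cbox c d" using \<D>(2)[OF K] by blast
  then obtain n where n: "\<forall>i\<in>Basis. d \<bullet> i - c \<bullet> i = (b \<bullet> i - a \<bullet> i) / 2 ^ n" using \<D>(5) K by blast
  define l where "l = 2 * (L + 1) / 2 ^ n"
  have "d $ i - c $ i = l" for i
   using n[rule_format, of "axis i 1"] by (simp add: inner_axis a_def b_def l_def axis_in_Basis_iff)
  hence "d = (\<chi> i. c $ i + l)" by (simp add: vec_eq_iff algebra_simps)
  moreover have "0 < l" using L(1) by (simp add: l_def)
  ultimately show ?thesis using cd by blast
 qed
 then obtain c l where cl: "!!K. K \<in> \<D> ==> K = cbox (c K) (\<chi> i. c K $ i + l K)" "!!K. K \<in> \<D> ==> 0 < l K" by metis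
 have boxvol: "evol (interior K) = ennreal (l K ^ Suc m)" if K: "K \<in> \<D>" for K
 proof -
  have "evol (box (c K) (\<chi> i. c K $ i + l K)) = (\<Prod>b\<in>Basis. ((\<chi> i. c K $ i + l K) - c K) \<bullet> b)"
   using cl(2)[OF K] by (intro emeasure_lborel_box) (auto simp: Basis_vec_def inner_axis)
  also have "(\<Prod>b\<in>Basis. ((\<chi> i. c K $ i + l K) - c K) \<bullet> b) = (\<Prod>b\<in>(Basis :: (real^'n) set). l K)"
   by (intro prod.cong) (auto simp: Basis_vec_def inner_axis)
  also have "... = l K ^ Suc m" by (simp add: m)
  finally show ?thesis by (subst cl(1)[OF K]) (simp only: interior_cbox)
 qed
 have vol: "(\<integral>\<^sup>+K. ennreal (l K ^ Suc m) \<partial>count_space \<D>) <= area k C"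
 proof -
  have "(\<integral>\<^sup>+K. ennreal (l K ^ Suc m) \<partial>count_space \<D>) = (\<integral>\<^sup>+K. evol (interior K) \<partial>count_space \<D>)"
   by (intro nn_integral_cong) (simp add: boxvol)
  also have "... = evol (\<Union>K\<in>\<D>. interior K)"
   by (rule emeasure_UN_countable[symmetric])
    (use \<D>(1,3) in \<open>auto simp: disjoint_family_on_def pairwise_def\<close>)
  also have "... <= area k C"
   unfolding area_def
  proof (rule emeasure_mono)
   show "(\<Union>K\<in>\<D>. interior K) \<subseteq> {x. upd x k 0 \<in> C \<and> x $ k \<in> {0..1}}"
    using KT interior_subset by (fastforce simp: T_def)
   show "{x. upd x k 0 \<in> C \<and> x $ k \<in> {0..1}} \<in> sets lborel" using borel_cylinder[OF borel_open[OF C]] by simp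
  qed
  finally show ?thesis .
 qed
 \<comment> \<open>At every height in the open unit interval the cubes met there project onto faces
   that cover \<open>C \<inter> interface k\<close>. Averaging over the height turns the face of a
   cube into a multiple of its volume.\<close>
 have slice: "hmeas m (C \<inter> interface k) * ind {0<..<1} t
   <= (\<integral>\<^sup>+K. ennreal (l K ^ m) * ?kp * ind {c K $ k..c K $ k + l K} t \<partial>count_space \<D>)" for t
 proof (cases "0 < t \<and> t < 1")
  case True
  define A where "A K = (if c K $ k <= t \<and> t <= c K $ k + l K then face k (c K) (l K) else {})" for K
  have "C \<inter> interface k \<subseteq> (\<Union>K\<in>\<D>. A K)"
  proof
   fix x assume x: "x \<in> C \<inter> interface k"
   hence "upd x k 0 = x" by (simp add: vec_eq_iff interface_def)
   hence "upd x k t \<in> T" using x True by (simp add: T_def)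
   then obtain K where K: "K \<in> \<D>" "upd x k t \<in> K" using \<D>(6) by blast
   hence mem: "upd x k t \<in> cbox (c K) (\<chi> i. c K $ i + l K)" using cl(1) by blast
   have "x \<in> A K"
    unfolding A_def
   proof (subst if_P)
    show "c K $ k <= t \<and> t <= c K $ k + l K" using mem by (auto simp: mem_box_cart dest: spec[of _ k])
    show "x \<in> face k (c K) (l K)" using mem x
     by (auto simp: mem_box_cart face_def interface_def split: if_splits)
   qed
   thus "x \<in> (\<Union>K\<in>\<D>. A K)" using K by blast
  qed
  hence "hmeas m (C \<inter> interface k) <= hmeas m (\<Union>K\<in>\<D>. A K)" by (rule hausdorff_measure_mono)
  also have "... <= (\<integral>\<^sup>+K. hmeas m (A K) \<partial>count_space \<D>)" by (rule hausdorff_measure_countable_UN[OF \<D>(1)])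
  also have "... = (\<integral>\<^sup>+K. ennreal (l K ^ m) * ?kp * ind {c K $ k..c K $ k + l K} t \<partial>count_space \<D>)"
   by (intro nn_integral_cong) (auto simp: A_def hausdorff_face_scale[OF cl(2)] indicator_def)
  finally show ?thesis using True by simp
 qed (auto simp: indicator_def)
 have "hmeas m (C \<inter> interface k) = (NN t. hmeas m (C \<inter> interface k) * ind {0<..<1::real} t)"
  by (subst nn_integral_cmult) auto
 also have "... <= (NN t. (\<integral>\<^sup>+K. ennreal (l K ^ m) * ?kp * ind {c K $ k..c K $ k + l K} t \<partial>count_space \<D>))"
  by (intro nn_integral_mono slice)
 also have "... = (\<integral>\<^sup>+K. (NN t. ennreal (l K ^ m) * ?kp * ind {c K $ k..c K $ k + l K} t) \<partial>count_space \<D>)"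
  by (rule nn_integral_count_space_nn_integral[OF \<D>(1)]) measurable
 also have "... = (\<integral>\<^sup>+K. ?kp * ennreal (l K ^ Suc m) \<partial>count_space \<D>)"
 proof (intro nn_integral_cong)
  fix K assume "K \<in> space (count_space \<D>)"
  hence "0 < l K" using cl(2) by simp
  thus "(NN t. ennreal (l K ^ m) * ?kp * ind {c K $ k..c K $ k + l K} t) = ?kp * ennreal (l K ^ Suc m)"
   by (subst nn_integral_cmult) (auto simp: ennreal_mult mult_ac)
 qed
 also have "... = ?kp * (\<integral>\<^sup>+K. ennreal (l K ^ Suc m) \<partial>count_space \<D>)" by (rule nn_integral_cmult) simp
 also have "... <= ?kp * area k C" by (rule mult_left_mono[OF vol]) simp
 finally show ?thesis .
qed

lemma area_Un:
 assumes "C \<in> sets borel" "D \<in> sets borel" "C \<inter> D = {}"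
 shows "area k (C \<union> D) = area k C + area k D"
proof -
 have "{x. upd x k 0 \<in> C \<union> D \<and> x $ k \<in> {0..1}} = {x. upd x k 0 \<in> C \<and> x $ k \<in> {0..1}} \<union> {x. upd x k 0 \<in> D \<and> x $ k \<in> {0..1}}" by auto
 moreover have "{x. upd x k 0 \<in> C \<and> x $ k \<in> {0..1}} \<inter> {x. upd x k 0 \<in> D \<and> x $ k \<in> {0..1}} = {}" using assms(3) by auto
 ultimately show ?thesis
  unfolding area_def using borel_cylinder[OF assms(1)] borel_cylinder[OF assms(2)] by (simp add: plus_emeasure)
qed

text \<open>The closed annulus is enclosed in open ones that are wider by \<open>e\<close>, whose
  area is the difference of two discs; then \<open>e\<close> tends to 0.\<close>

lemma hausdorff_annulus_le:
 fixes k :: "'n::finite"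
 assumes m: "0 < m" "CARD('n) = Suc m"
  and om: "0 < om" "!!r. 0 <= r ==> area k (disc k r) = ennreal (om * r ^ m)" and R: "0 <= R1" "R1 <= R2"
 shows "hmeas m ({x. R1 <= norm x \<and> norm x <= R2} \<inter> interface k)
  <= hmeas m (face k 0 1) * ennreal (om * (R2 ^ m - R1 ^ m))"
proof -
 let ?S = "{x. R1 <= norm x \<and> norm x <= R2} \<inter> interface k"
 obtain kp where kp: "hmeas m (face k 0 1) = ennreal kp" "0 <= kp"
  using hausdorff_face_finite[of k] m(2) by (cases "hmeas m (face k 0 1)") auto
 define f where "f e = kp * (om * ((R2 + e) ^ m - max 0 (R1 - e) ^ m))" for e
 have le: "hmeas m ?S <= ennreal (f e)" if e: "0 < e" for e
 proof -
  define C where "C = {x::real^'n. R1 - e < norm (upd x k 0) \<and> norm (upd x k 0) < R2 + e}"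
  have oC: "open C" unfolding C_def
   by (intro open_Collect_conj open_Collect_less continuous_intros)
  have Ck: "norm (upd x k 0) = norm x" if "x \<in> interface k" for x
  proof -
   have "upd x k 0 = x" using that by (simp add: vec_eq_iff interface_def)
   thus ?thesis by simp
  qed
  have "?S \<subseteq> C \<inter> interface k" using e by (auto simp: C_def Ck)
  hence "hmeas m ?S <= hmeas m (C \<inter> interface k)" by (rule hausdorff_measure_mono)
  also have "... <= hmeas m (face k 0 1) * area k C"
  proof (rule hausdorff_open_le[OF m(2) oC])
   show "bounded (C \<inter> interface k)"
    by (rule bounded_subset[OF bounded_cball[of 0 "R2 + e"]]) (auto simp: C_def Ck)
  qed
  also have "area k C <= ennreal (om * ((R2 + e) ^ m - max 0 (R1 - e) ^ m))"
  proof (cases "0 <= R1 - e")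
   case True
   have "area k (C \<union> disc k (R1 - e)) <= area k (disc k (R2 + e))"
    using R e by (intro area_mono) (auto simp: C_def disc_def)
   moreover have "area k (C \<union> disc k (R1 - e)) = area k C + area k (disc k (R1 - e))"
    using oC by (intro area_Un) (auto simp: C_def disc_def)
   ultimately have "area k C + ennreal (om * (R1 - e) ^ m) <= ennreal (om * (R2 + e) ^ m)"
    using True R e by (simp add: om(2))
   hence "area k C <= ennreal (om * (R2 + e) ^ m) - ennreal (om * (R1 - e) ^ m)"
    by (intro ennreal_le_minus_iff[THEN iffD2]) (auto simp: add.commute)
   also have "... = ennreal (om * ((R2 + e) ^ m - max 0 (R1 - e) ^ m))"
    using True om(1) by (subst ennreal_minus) (auto simp: right_diff_distrib)
   finally show ?thesis .
  next
   case False
   have "area k C <= area k (disc k (R2 + e))" by (intro area_mono) (auto simp: C_def disc_def)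
   thus ?thesis using False R e m(1) by (simp add: om(2) max_def zero_power)
  qed
  finally show ?thesis using kp by (simp add: f_def ennreal_mult' mult_left_mono)
 qed
 have "(f \<longlongrightarrow> f 0) (at_right 0)"
  unfolding f_def by (intro tendsto_intros)
 hence lim: "((\<lambda>e. ennreal (f e)) \<longlongrightarrow> ennreal (f 0)) (at_right 0)" by (rule tendsto_ennrealI)
 have "hmeas m ?S <= ennreal (f 0)"
  by (rule tendsto_lowerbound[OF lim]) (auto simp: eventually_at_right_field intro!: exI[of _ 1] le)
 also have "... = ennreal kp * ennreal (om * (R2 ^ m - R1 ^ m))"
  using R kp(2) by (simp add: f_def ennreal_mult')
 finally show ?thesis by (simp add: kp)
qed

text \<open>A bounded window in the interface, extended along the axis: areas inside it are finite
  and may be subtracted.\<close>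

definition tube :: "'n::finite => real => (real^'n) set" where
 "tube k L = {x. \<forall>i. i ~= k --> \<bar>x $ i\<bar> < L}"

lemma open_tube: "open (tube k L)"
proof -
 have "open (\<Inter>i\<in>UNIV - {k}. {x::real^'a. \<bar>x $ i\<bar> < L})"
  by (intro open_INT ballI open_Collect_less continuous_intros) auto
 also have "(\<Inter>i\<in>UNIV - {k}. {x::real^'a. \<bar>x $ i\<bar> < L}) = tube k L" by (auto simp: tube_def)
 finally show ?thesis .
qed

lemma area_tube_le:
 fixes k :: "'n::finite"
 assumes m: "CARD('n) = Suc m" and L: "0 < L"
 shows "area k (tube k L) <= ennreal ((2 * L) ^ m)"
proof -
 define a :: "real^'n" where "a = (\<chi> i. if i = k then 0 else - L)"
 define b :: "real^'n" where "b = (\<chi> i. if i = k then 1 else L)"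
 have "area k (tube k L) <= evol (cbox a b)"
  unfolding area_def
 proof (rule emeasure_mono)
  show "{x. upd x k 0 \<in> tube k L \<and> x $ k \<in> {0..1}} \<subseteq> cbox a b"
   by (auto simp: tube_def mem_box_cart a_def b_def abs_less_iff) (smt (verit))+
 qed simp
 also have "... = ennreal (\<Prod>i\<in>UNIV. b $ i - a $ i)"
 proof -
  have "cbox a b ~= {}" using L by (auto simp: box_ne_empty Basis_vec_def inner_axis a_def b_def)
  moreover have "evol (cbox a b) ~= \<top>" using emeasure_lborel_cbox_finite[of a b] by simp
  ultimately show ?thesis by (metis emeasure_eq_ennreal_measure content_cbox_cart)
 qed
 also have "(\<Prod>i\<in>UNIV. b $ i - a $ i) = (2 * L) ^ m"
  by (subst prod.remove[of _ k]) (auto simp: a_def b_def card_Diff_singleton m)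
 finally show ?thesis .
qed

text \<open>The complement of \<open>K\<close> in the window is open, so the upper bound for open
  sets applies to it. A face of side \<open>l < 2 * L\<close> fits into the window, and as
  \<open>l\<close> tends to \<open>2 * L\<close> subtraction leaves the lower bound for
  \<open>K\<close>.\<close>

lemma hausdorff_closed_ge:
 fixes k :: "'n::finite"
 assumes m: "CARD('n) = Suc m" and K: "closed K" and L: "0 < L"
 shows "hmeas m (face k 0 1) * area k (tube k L \<inter> K) <= hmeas m (K \<inter> interface k)"
proof (cases "hmeas m (K \<inter> interface k)")
 case (real h)
 have fin: "\<exists>x\<ge>0. area k C = ennreal x" if "C \<subseteq> tube k L" for C
 proof -
  have "area k C <= ennreal ((2 * L) ^ m)"
   using area_mono[OF that borel_open[OF open_tube]] area_tube_le[OF m L] by (rule order_trans)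
  thus ?thesis by (cases "area k C") (auto simp: top_unique)
 qed
 obtain kp where kp: "hmeas m (face k 0 1) = ennreal kp" "0 <= kp"
  using hausdorff_face_finite[of k] m by (cases "hmeas m (face k 0 1)") auto
 obtain x where x: "0 <= x" "area k (tube k L - K) = ennreal x" using fin[of "tube k L - K"] by auto
 obtain y where y: "0 <= y" "area k (tube k L \<inter> K) = ennreal y" using fin[of "tube k L \<inter> K"] by auto
 have "tube k L = (tube k L - K) \<union> (tube k L \<inter> K)" by blast
 hence "area k (tube k L) = area k ((tube k L - K) \<union> (tube k L \<inter> K))" by simp
 also have "... = area k (tube k L - K) + area k (tube k L \<inter> K)"
  using K open_tube[of k L] by (intro area_Un) auto
 finally have xy: "x + y <= (2 * L) ^ m"
  using area_tube_le[OF m L, of k] x y L by (simp add: ennreal_plus[symmetric] del: ennreal_plus)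
 have Lface: "kp * l ^ m <= h + kp * x" if l: "0 < l" "l < 2 * L" for l
 proof -
  let ?u = "\<chi> i. - (l / 2)"
  have "ennreal (l ^ m) * ennreal kp = hmeas m (face k ?u l)" by (simp only: hausdorff_face_scale[OF l(1)] kp)
  also have "... <= hmeas m ((K \<inter> interface k) \<union> ((tube k L - K) \<inter> interface k))"
  proof (rule hausdorff_measure_mono)
   have "\<bar>z $ i\<bar> < L" if "z \<in> face k ?u l" "i ~= k" for z i
   proof -
    have "- (l / 2) <= z $ i" "z $ i <= - (l / 2) + l" using that by (auto simp: face_def)
    thus ?thesis using l by linarith
   qed
   thus "face k ?u l \<subseteq> (K \<inter> interface k) \<union> ((tube k L - K) \<inter> interface k)"
    by (auto simp: tube_def interface_def face_def)
  qed
  also have "... <= ennreal h + hmeas m ((tube k L - K) \<inter> interface k)"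
   using hausdorff_measure_Un real by metis
  also have "hmeas m ((tube k L - K) \<inter> interface k) <= ennreal kp * area k (tube k L - K)"
   unfolding kp(1)[symmetric]
  proof (rule hausdorff_open_le[OF m])
   show "open (tube k L - K)" using open_tube K by (rule open_Diff)
   have "norm z <= (\<Sum>i\<in>(UNIV::'n set). L)" if "z \<in> tube k L \<inter> interface k" for z
   proof -
    have "\<bar>z $ i\<bar> <= L" for i using that L by (cases "i = k") (auto simp: tube_def interface_def less_imp_le)
    thus ?thesis by (intro order_trans[OF norm_le_l1_cart] sum_mono) auto
   qed
   thus "bounded ((tube k L - K) \<inter> interface k)" unfolding bounded_iff by blast
  qed
  finally have "ennreal (l ^ m) * ennreal kp <= ennreal h + ennreal kp * area k (tube k L - K)" by (simp add: add_left_mono)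
  hence "ennreal (kp * l ^ m) <= ennreal (h + kp * x)"
   using kp(2) x l real by (simp add: ennreal_mult ennreal_plus mult.commute)
  thus ?thesis using kp(2) x real by (subst (asm) ennreal_le_iff) auto
 qed
 have "((\<lambda>l. kp * l ^ m) \<longlongrightarrow> kp * (2 * L) ^ m) (at_left (2 * L))" by (intro tendsto_intros)
 hence "kp * (2 * L) ^ m <= h + kp * x"
  by (rule tendsto_upperbound) (use L in \<open>auto simp: eventually_at_left_field intro!: exI[of _ 0] Lface\<close>)
 moreover have "kp * (x + y) <= kp * (2 * L) ^ m" using xy kp(2) by (rule mult_left_mono)
 ultimately have "kp * y <= h" by (simp add: distrib_left)
 thus ?thesis using kp y real by (simp add: ennreal_mult[symmetric] ennreal_leI)
qed simp

section \<open>Traces and the interface boundary\<close>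

lemma trace_avg_nn_integral:
 fixes E :: "(real^'n::finite) set"
 assumes [measurable]: "E \<in> sets borel" and fin: "evol E < \<infinity>" and dl: "0 < dl"
 shows "(NN x. ind E x * ennreal (wt dl (sg * x $ k))) = ennreal (trace_avg k sg E dl)" "0 <= trace_avg k sg E dl"
proof -
 have int: "intg (\<lambda>x. ind E x * wt dl (sg * x $ k))"
  by (rule integrable_indicator_mult[OF assms(1) _ fin, of _ "2 / dl"]) (use wt_nonneg[OF dl] wt_le[OF dl] in auto)
 have "(NN x. ennreal (ind E x * wt dl (sg * x $ k))) = ennreal (trace_avg k sg E dl)"
  unfolding trace_avg_def using wt_nonneg[OF dl] by (intro nn_integral_eq_integral[OF int]) auto
 thus "(NN x. ind E x * ennreal (wt dl (sg * x $ k))) = ennreal (trace_avg k sg E dl)"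
  by (simp add: ennreal_mult' ennreal_indicator)
 show "0 <= trace_avg k sg E dl" unfolding trace_avg_def using wt_nonneg[OF dl] by (intro Bochner_Integration.integral_nonneg) auto
qed

text \<open>The test field is the constant inward normal, whose normal component is 1, that is
  \<open>a = -1\<close>; its divergence vanishes and only the trace term remains.\<close>

lemma weighted_trace_le:
 fixes E :: "(real^'n::finite) set" and w :: "real^'n => real"
 assumes E [measurable]: "E \<in> sets borel" and fin: "evol E < \<infinity>" and dl: "0 < dl" and sg: "sg = 1 \<or> sg = -1"
  and w: "!!x. 0 <= w x" "!!x. w x <= 1" "!!x. (w has_derivative (\<lambda>h. dw x \<bullet> h)) (at x)" "continuous_on UNIV dw" "!!x. norm (dw x) <= c"
  and U: "closure {x. w x ~= 0} \<subseteq> U" and q: "perimeter E (halfspace k sg \<inter> U) <= ennreal q" "0 <= q"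
 shows "(LI x. ind E x * (w x * wt dl (sg * x $ k))) <= q + c * vol E"
 using slab_lower_bound[OF E fin dl sg w U q, where T="\<lambda>_. sg *\<^sub>R axis k 1" and a="-1" and g="\<lambda>_ _. 0" and M=0] sg
 by (auto simp: norm_axis_1)

lemma test_fields_mono: "A \<subseteq> B ==> test_fields A \<subseteq> test_fields B"
 by (auto simp: test_fields_def)

lemma perimeter_mono: "A \<subseteq> B ==> perimeter E A <= perimeter E B"
 unfolding perimeter_def by (rule SUP_subset_mono[OF test_fields_mono]) auto

lemma zero_test_field: "(\<lambda>x. 0) \<in> test_fields A"
proof -
 have "partial_deriv i (\<lambda>x::real^'a. 0 :: real^'a) = (\<lambda>x. 0)" for i
  by (rule ext, rule partial_derivI) simp
 thus ?thesis by (simp add: test_fields_def)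
qed

text \<open>At each point at most one of the two fields is nonzero, so the sum still has norm at
  most 1.\<close>

lemma test_fields_add:
 assumes ph: "ph \<in> test_fields A" and ps: "ps \<in> test_fields B" and "A \<inter> B = {}"
 shows "(\<lambda>x. ph x + ps x) \<in> test_fields (A \<union> B)" "div_field (\<lambda>x. ph x + ps x) x = div_field ph x + div_field ps x"
proof -
 have pd: "partial_deriv i (\<lambda>x. ph x + ps x) x = partial_deriv i ph x + partial_deriv i ps x" for i x
  unfolding partial_deriv_def[of i ph] partial_deriv_def[of i ps]
  using ph ps by (intro partial_derivI has_derivative_add) (auto simp: test_fields_def frechet_derivative_works)
 show "div_field (\<lambda>x. ph x + ps x) x = div_field ph x + div_field ps x"
  by (simp add: div_field_def pd sum.distrib)
 have "closure {x. ph x + ps x ~= 0} \<subseteq> closure ({x. ph x ~= 0} \<union> {x. ps x ~= 0})" by (intro closure_mono) auto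
 hence cl: "closure {x. ph x + ps x ~= 0} \<subseteq> closure {x. ph x ~= 0} \<union> closure {x. ps x ~= 0}" by simp
 have "norm (ph x + ps x) <= 1" for x
 proof (cases "x \<in> A")
  case True
  moreover have "closure {x. ps x ~= 0} \<subseteq> B" using ps by (simp add: test_fields_def)
  ultimately have "x \<notin> closure {x. ps x ~= 0}" using assms(3) by blast
  hence "ps x = 0" by (rule test_field_outside(1))
  thus ?thesis using ph by (simp add: test_fields_def)
 next
  case False
  moreover have "closure {x. ph x ~= 0} \<subseteq> A" using ph by (simp add: test_fields_def)
  ultimately have "x \<notin> closure {x. ph x ~= 0}" by blast
  hence "ph x = 0" by (rule test_field_outside(1))
  thus ?thesis using ps by (simp add: test_fields_def)
 qed
 moreover have "compact (closure {x. ph x ~= 0} \<union> closure {x. ps x ~= 0})" using ph ps by (auto simp: test_fields_def)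
 hence "compact (closure {x. ph x + ps x ~= 0})" using cl by (meson bounded_subset closed_closure compact_eq_bounded_closed)
 moreover have "partial_deriv i (\<lambda>x. ph x + ps x) = (\<lambda>x. partial_deriv i ph x + partial_deriv i ps x)" for i by (rule ext) (rule pd)
 ultimately show "(\<lambda>x. ph x + ps x) \<in> test_fields (A \<union> B)"
  using ph ps cl unfolding test_fields_def by (auto intro!: continuous_intros)
qed

text \<open>A field that nearly attains the perimeter has bounded support. Any field supported
  outside a large ball can be added to it, and the sum is still a test field; so the second field
  gains at most \<open>e\<close>.\<close>

lemma perimeter_tail:
 assumes [measurable]: "E \<in> sets borel" and fin: "perimeter E A < \<infinity>" and e: "0 < e"
 obtains R where "0 < R" "perimeter E (A \<inter> - cball 0 R) <= ennreal e"
proof -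
 obtain p where p: "perimeter E A = ennreal p" "0 <= p" using fin by (cases "perimeter E A") auto
 have "\<exists>ph\<in>test_fields A. ennreal p < ennreal (LINT x:E|lebesgue. div_field ph x) + ennreal e"
  by (rule SUP_approx_ennreal[OF e _ p(1)[unfolded perimeter_def, symmetric]]) (use zero_test_field[of A] in auto)
 then obtain ph where ph: "ph \<in> test_fields A" "ennreal p < ennreal (LINT x:E|lebesgue. div_field ph x) + ennreal e" by blast
 define I where "I = (LI x. ind E x * div_field ph x)"
 have I: "ennreal p < ennreal I + ennreal e" using ph(2) by (simp add: I_def perimeter_borel[OF assms(1) ph(1)])
 show ?thesis
 proof (cases "0 <= I")
  case False
  hence "perimeter E A <= ennreal e" using I p by (simp add: ennreal_neg less_imp_le)
  thus ?thesis using perimeter_mono[of "A \<inter> - cball 0 1" A E] by (intro that[of 1]) (auto intro: order_trans)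
 next
  case True
  have cl: "compact (closure {x. ph x ~= 0})" "closure {x. ph x ~= 0} \<subseteq> A" using ph(1) by (simp_all add: test_fields_def)
  then obtain r where "!!x. x \<in> closure {x. ph x ~= 0} ==> norm x <= r"
   using compact_imp_bounded[OF cl(1)] unfolding bounded_iff by blast
  hence r: "closure {x. ph x ~= 0} \<subseteq> A \<inter> cball 0 (max r 1)" using cl(2) by force
  have ph': "ph \<in> test_fields (A \<inter> cball 0 (max r 1))" using ph(1) r by (simp add: test_fields_def)
  show ?thesis
  proof (rule that[of "max r 1"])
   show "perimeter E (A \<inter> - cball 0 (max r 1)) <= ennreal e"
    unfolding perimeter_def
   proof (rule SUP_least)
    fix ps assume ps: "ps \<in> test_fields (A \<inter> - cball 0 (max r 1))"
    have sum: "(\<lambda>x. ph x + ps x) \<in> test_fields A"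
     using test_fields_add(1)[OF ph' ps] test_fields_mono[of "A \<inter> cball 0 (max r 1) \<union> A \<inter> - cball 0 (max r 1)" A] by blast
    have "(LI x. ind E x * div_field (\<lambda>x. ph x + ps x) x) = I + (LI x. ind E x * div_field ps x)"
     unfolding I_def using integrable_div_field[OF assms(1) ph(1)] integrable_div_field[OF assms(1) ps]
     by (simp add: test_fields_add(2)[OF ph' ps] distrib_left)
    hence "ennreal (I + (LI x. ind E x * div_field ps x)) <= ennreal p"
     using perimeter_ge_test[OF sum, of E] by (simp add: perimeter_borel[OF assms(1) sum] p)
    also have "ennreal p <= ennreal (I + e)" using I True e by (simp add: less_imp_le ennreal_plus)
    finally have "(LI x. ind E x * div_field ps x) <= e" using True e by (subst (asm) ennreal_le_iff) auto
    thus "ennreal (LINT x:E|lebesgue. div_field ps x) <= ennreal e"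
     by (simp add: perimeter_borel[OF assms(1) ps] ennreal_leI)
   qed
  qed simp
 qed
qed

lemma trace_avg_le:
 assumes "E \<in> sets borel" "evol E < \<infinity>" "0 < dl" "sg = 1 \<or> sg = -1"
  and "perimeter E (halfspace k sg) <= ennreal q" "0 <= q"
 shows "trace_avg k sg E dl <= q"
 using weighted_trace_le[OF assms(1-4), where w="\<lambda>_. 1" and dw="\<lambda>_. 0" and c=0 and U=UNIV and q=q and k=k] assms(5,6) by (simp add: trace_avg_def)

text \<open>Multiplying a test field by a ramp that vanishes at the interface costs one trace, and the
 trace is itself controlled by the perimeter in the open half-space.\<close>

lemma perimeter_UNIV_le:
 fixes k :: "'n::finite"
 assumes E [measurable]: "E \<in> sets borel" and sub: "E \<subseteq> halfspace k sg" and fin: "evol E < \<infinity>" and sg: "sg = 1 \<or> sg = -1"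
  and q: "perimeter E (halfspace k sg) <= ennreal q" "0 <= q"
 shows "perimeter E UNIV <= ennreal (2 * q)"
 unfolding perimeter_def
proof (rule SUP_least)
 fix ph assume ph: "ph \<in> test_fields (UNIV :: (real^'n) set)"
 obtain B r where "0 < B" "!!x. r < norm x ==> ph x = 0" "!!i x. r < norm x ==> partial_deriv i ph x = 0"
  "!!i x. \<bar>partial_deriv i ph x $ i\<bar> <= B" and phc: "continuous_on UNIV ph" "!!i. continuous_on UNIV (\<lambda>x. partial_deriv i ph x $ i)"
  by (rule test_field_bounds[OF ph], rule that) assumption+
 have [measurable]: "meas (div_field ph)" by (rule measurable_div_field[OF ph])
 note [measurable] = cont_meas[OF phc(1)]
 have ph1: "norm (ph x) <= 1" for x using ph by (simp add: test_fields_def)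
 have int: "intg (\<lambda>x. ind E x * div_field ph x)" by (rule integrable_div_field[OF E ph])
 \<comment> \<open>One \<open>q\<close> comes from the ramped field, which is admissible in the
   half-space, and the other from the bound on the trace.\<close>
 have step: "(LI x. ramp dl (sg * x $ k) * (ind E x * div_field ph x)) <= 2 * q" if dl: "0 < dl" for dl
 proof -
  define ps where "ps x = ramp dl (sg * x $ k) *\<^sub>R ph x" for x
  have ps': "(ps has_derivative (\<lambda>h. ramp dl (sg * x $ k) *\<^sub>R frechet_derivative ph (at x) h + (((sg * wt dl (sg * x $ k)) *\<^sub>R axis k 1) \<bullet> h) *\<^sub>R ph x)) (at x)" for x
   unfolding ps_def[abs_def] using ph
   by (intro has_derivative_scaleR ramp_slab_derivative[OF dl]) (simp add: test_fields_def frechet_derivative_works)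
  have pd: "partial_deriv i ps x = ramp dl (sg * x $ k) *\<^sub>R partial_deriv i ph x + ((sg * wt dl (sg * x $ k)) *\<^sub>R axis k (1::real) \<bullet> axis i 1) *\<^sub>R ph x" for i x
   using partial_derivI[OF ps'] by (simp add: partial_deriv_def)
  have div: "div_field ps x = ramp dl (sg * x $ k) * div_field ph x + sg * wt dl (sg * x $ k) * ph x $ k" for x
  proof -
   have "partial_deriv i ps x $ i = ramp dl (sg * x $ k) * partial_deriv i ph x $ i + (if i = k then sg * wt dl (sg * x $ k) * ph x $ k else 0)" for i
    by (simp add: pd inner_axis_axis)
   thus ?thesis by (simp add: div_field_def sum.distrib sum_distrib_left)
  qed
  have ps: "ps \<in> test_fields (halfspace k sg)"
  proof -
   have sub: "closure {x. ps x ~= 0} \<subseteq> closure {x. ph x ~= 0}" by (intro closure_mono) (auto simp: ps_def)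
   have "compact (closure {x. ps x ~= 0})"
    using ph sub unfolding test_fields_def by (auto intro: bounded_subset simp: compact_eq_bounded_closed simp del: closure_subset)
   moreover have "closure {x. ps x ~= 0} \<subseteq> halfspace k sg"
   proof -
    have "closure {x. ps x ~= 0} \<subseteq> closure {x. ramp dl (sg * x $ k) ~= 0}" by (intro closure_mono) (auto simp: ps_def)
    also have "... \<subseteq> halfspace k sg"
     by (rule closure_slab[OF dl]) (metis linear mem_Collect_eq ramp_outside(1)[OF dl])
    finally show ?thesis .
   qed
   moreover have "norm (ps x) <= 1" for x using ph1[of x] ramp_range[of dl "sg * x $ k"] by (simp add: ps_def mult_le_one)
   moreover have "continuous_on UNIV (partial_deriv i ps)" for i
    unfolding pd using ph
    by (intro continuous_intros phc continuous_on_compose2[OF continuous_ramp[of UNIV]] continuous_on_compose2[OF continuous_wt[of UNIV]]) (auto simp: test_fields_def)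
   ultimately show ?thesis using differentiableI[OF ps'] unfolding test_fields_def by auto
  qed
  have k1: "\<bar>ph x $ k\<bar> <= 1" for x using component_le_norm_cart[of "ph x" k] ph1[of x] by simp
  have i1: "intg (\<lambda>x. ramp dl (sg * x $ k) * (ind E x * div_field ph x))"
   by (rule int_bound[OF int]) (use ramp_range in \<open>auto simp: abs_mult abs_of_nonneg intro!: mult_left_le_one_le\<close>)
  have b: "\<bar>sg * wt dl (sg * x $ k) * ph x $ k\<bar> <= wt dl (sg * x $ k)" for x
   using sg mult_left_mono[OF k1[of x] wt_nonneg[OF dl]] wt_nonneg[OF dl] by (auto simp: abs_mult abs_of_nonneg)
  have i2: "intg (\<lambda>x. ind E x * (sg * wt dl (sg * x $ k) * ph x $ k))"
   by (rule integrable_indicator_mult[OF E _ fin, of _ "2 / dl"]) (use b order_trans[OF b wt_le[OF dl]] in measurable)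
  have i3: "intg (\<lambda>x. ind E x * wt dl (sg * x $ k))"
   by (rule integrable_indicator_mult[OF E _ fin, of _ "2 / dl"]) (use wt_nonneg[OF dl] wt_le[OF dl] in auto)
  have "ennreal (LI x. ind E x * div_field ps x) <= ennreal q"
   using perimeter_ge_test[OF ps, of E] q(1) by (simp add: perimeter_borel[OF E ps])
  hence "(LI x. ramp dl (sg * x $ k) * (ind E x * div_field ph x) + ind E x * (sg * wt dl (sg * x $ k) * ph x $ k)) <= q"
   using q(2) by (simp add: ennreal_le_iff div algebra_simps)
  moreover have "- (LI x. ind E x * (sg * wt dl (sg * x $ k) * ph x $ k)) <= trace_avg k sg E dl"
   unfolding trace_avg_def integral_minus[symmetric] using b
   by (intro integral_mono i3 integrable_minus i2) (auto simp: indicator_def abs_le_iff minus_le_iff)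
  moreover have "trace_avg k sg E dl <= q" by (rule trace_avg_le[OF E fin dl sg q])
  ultimately show ?thesis using i1 i2 by simp
 qed
 have "(\<lambda>n. LI x. ramp (inverse (real (Suc n))) (sg * x $ k) * (ind E x * div_field ph x)) ----> (LI x. ind E x * div_field ph x)"
 proof (rule integral_dominated_convergence[OF _ _ integrable_abs[OF int]])
  show "AE x in lborel. (\<lambda>n. ramp (inverse (real (Suc n))) (sg * x $ k) * (ind E x * div_field ph x)) ----> ind E x * div_field ph x"
  proof (rule AE_I2)
   fix x
   show "(\<lambda>n. ramp (inverse (real (Suc n))) (sg * x $ k) * (ind E x * div_field ph x)) ----> ind E x * div_field ph x"
   proof (cases "x \<in> E")
    case True
    hence "0 < sg * x $ k / 2" using sub by (auto simp: halfspace_def)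
    hence "\<forall>\<^sub>F n in sequentially. inverse (real (Suc n)) < sg * x $ k / 2" by (rule order_tendstoD(2)[OF LIMSEQ_inverse_real_of_nat])
    hence "\<forall>\<^sub>F n in sequentially. ramp (inverse (real (Suc n))) (sg * x $ k) * (ind E x * div_field ph x) = ind E x * div_field ph x"
     by eventually_elim (subst ramp_outside(2), auto)
    thus ?thesis by (rule tendsto_eventually)
   qed simp
  qed
 qed (use ramp_range in \<open>auto simp: abs_mult abs_of_nonneg intro!: mult_left_le_one_le\<close>)
 hence "(LI x. ind E x * div_field ph x) <= 2 * q"
  by (rule LIMSEQ_le_const2) (use step in auto)
 thus "ennreal (LINT x:E|lebesgue. div_field ph x) <= ennreal (2 * q)"
  by (simp add: perimeter_borel[OF E ph] ennreal_leI)
qed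

text \<open>Trace could be carried by parts of \<open>E\<close> far out along the interface. A
  radial weight compares it with the perimeter outside a large ball, which is small, uniformly in
  the scale \<open>dl\<close>.\<close>

lemma trace_tail:
 fixes k :: "'n::finite"
 assumes E [measurable]: "E \<in> sets borel" and fin: "evol E < \<infinity>" and sg: "sg = 1 \<or> sg = -1"
  and per: "perimeter E (halfspace k sg) < \<infinity>" and e: "0 < e"
 obtains L where "0 < L" "!!dl. 0 < dl ==> (NN x. ind E x * (ennreal (wt dl (sg * x $ k)) * ind (- tube k L) x)) <= ennreal e"
proof -
 obtain R0 where R0: "0 < R0" "perimeter E (halfspace k sg \<inter> - cball 0 R0) <= ennreal (e / 2)"
  using perimeter_tail[OF E per, of "e / 2"] e by auto
 \<comment> \<open>The first entry puts the support of the weight outside the ball of radius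
   \<open>R0\<close>; the second makes the gradient bound \<open>8 / R\<close> times the volume at
   most \<open>e / 2\<close>.\<close>
 define R where "R = max (2 * R0) (16 * (vol E + 1) / e)"
 have R: "2 * R0 <= R" "0 < R" "8 / R * vol E <= e / 2"
 proof -
  show "2 * R0 <= R" by (simp add: R_def)
  thus 0: "0 < R" using R0 by simp
  have "16 * (vol E + 1) / e <= R" by (simp add: R_def)
  hence "16 * (vol E + 1) <= R * e" using e by (simp add: pos_divide_le_eq)
  hence "16 * vol E <= R * e" by simp
  thus "8 / R * vol E <= e / 2" using 0 by (simp add: field_simps)
 qed
 define w where "w x = smooth_step ((x \<bullet> x) / R\<^sup>2 - 1)" for x :: "real^'n"
 define dw where "dw x = (tri ((x \<bullet> x) / R\<^sup>2 - 1) * (2 / R\<^sup>2)) *\<^sub>R x" for x :: "real^'n"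
 have w': "(w has_derivative (\<lambda>h. dw x \<bullet> h)) (at x)" for x
 proof -
  have "((\<lambda>x. (x \<bullet> x) / R\<^sup>2 - 1) has_derivative (\<lambda>h. 2 * (x \<bullet> h) / R\<^sup>2)) (at x)"
  proof -
   have "((\<lambda>x. inverse (R\<^sup>2) * (x \<bullet> x) - 1) has_derivative (\<lambda>h. inverse (R\<^sup>2) * (2 * (x \<bullet> h)))) (at x)"
    by (auto intro!: derivative_eq_intros simp: inner_commute)
   thus ?thesis by (simp add: divide_inverse mult.commute)
  qed
  from has_derivative_compose[OF this, of smooth_step "(*) (tri ((x \<bullet> x) / R\<^sup>2 - 1))"] DERIV_smooth_step[of "(x \<bullet> x) / R\<^sup>2 - 1"]
  have "(w has_derivative (\<lambda>h. tri ((x \<bullet> x) / R\<^sup>2 - 1) * (2 * (x \<bullet> h) / R\<^sup>2))) (at x)"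
   by (simp add: has_field_derivative_def w_def[abs_def])
  thus ?thesis by (rule has_derivative_eq_rhs) (simp add: dw_def fun_eq_iff)
 qed
 have dw_cont: "continuous_on UNIV dw"
  unfolding dw_def using R(2) by (intro continuous_intros continuous_on_compose2[OF continuous_tri[of UNIV]]) auto
 have dw_bound: "norm (dw x) <= 8 / R" for x
 proof (cases "norm x <= 2 * R")
  case True
  have "norm (dw x) = tri ((x \<bullet> x) / R\<^sup>2 - 1) * (2 / R\<^sup>2) * norm x"
   using tri_nonneg by (simp add: dw_def abs_mult abs_of_nonneg)
  also have "... <= 2 * (2 / R\<^sup>2) * (2 * R)"
   using tri_nonneg tri_le R(2) True by (intro mult_mono) auto
  also have "... = 8 / R" using R(2) by (simp add: power2_eq_square)
  finally show ?thesis .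
 next
  case False
  hence "(2 * R)\<^sup>2 <= (norm x)\<^sup>2" using R(2) by (intro power_mono) auto
  hence "2 * R\<^sup>2 <= x \<bullet> x" using zero_le_power2[of R] unfolding power2_norm_eq_inner power_mult_distrib power2_eq_square[of "2::real"] by linarith
  hence "1 <= (x \<bullet> x) / R\<^sup>2 - 1" using R(2) by (simp add: field_simps)
  hence "tri ((x \<bullet> x) / R\<^sup>2 - 1) = 0" by (intro tri_outside) simp
  thus ?thesis using R(2) by (simp add: dw_def)
 qed
 have w0: "w x = 0" if "norm x <= R" for x
 proof -
  have "(norm x)\<^sup>2 <= R\<^sup>2" using that by (intro power_mono) auto
  thus ?thesis unfolding w_def using R(2) by (intro smooth_step_outside) (simp add: power2_norm_eq_inner field_simps)
 qed
 have w1: "w x = 1" if "2 * R <= norm x" for x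
 proof -
  have "(2 * R)\<^sup>2 <= (norm x)\<^sup>2" using that R(2) by (intro power_mono) auto
  hence "2 * R\<^sup>2 <= x \<bullet> x" using zero_le_power2[of R] unfolding power2_norm_eq_inner power_mult_distrib power2_eq_square[of "2::real"] by linarith
  thus ?thesis unfolding w_def using R(2) by (intro smooth_step_outside) (simp add: power2_norm_eq_inner field_simps)
 qed
 have w_meas [measurable]: "meas w"
  using w' by (intro cont_meas) (meson differentiableI differentiable_imp_continuous_within continuous_at_imp_continuous_on)
 have cl: "closure {x. w x ~= 0} \<subseteq> - cball 0 R0"
 proof -
  have "closure {x. w x ~= 0} \<subseteq> {x. R <= norm x}"
   using w0 linorder_linear by (intro closure_minimal closed_Collect_le continuous_intros) blast
  thus ?thesis using R R0(1) by force
 qed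
 have main: "(NN x. ind E x * (ennreal (wt dl (sg * x $ k)) * ind (- tube k (2 * R)) x)) <= ennreal e" if dl: "0 < dl" for dl
 proof -
  have "(LI x. ind E x * (w x * wt dl (sg * x $ k))) <= e / 2 + 8 / R * vol E"
   by (rule weighted_trace_le[OF E fin dl sg _ _ w' dw_cont dw_bound cl R0(2)]) (use e in \<open>auto simp: w_def smooth_step_range\<close>)
  hence le: "(LI x. ind E x * (w x * wt dl (sg * x $ k))) <= e" using R(3) by linarith
  have int: "intg (\<lambda>x. ind E x * (w x * wt dl (sg * x $ k)))"
  proof (rule integrable_indicator_mult[OF E _ fin])
   show "\<bar>w x * wt dl (sg * x $ k)\<bar> <= 1 * (2 / dl)" for x
    unfolding abs_mult using smooth_step_range wt_nonneg[OF dl] wt_le[OF dl] by (intro mult_mono) (auto simp: w_def abs_of_nonneg)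
  qed measurable
  have "(NN x. ind E x * (ennreal (wt dl (sg * x $ k)) * ind (- tube k (2 * R)) x))
   <= (NN x. ennreal (ind E x * (w x * wt dl (sg * x $ k))))"
  proof (intro nn_integral_mono)
   fix x
   have "w x = 1" if out: "x \<notin> tube k (2 * R)"
   proof -
    obtain i where "2 * R <= \<bar>x $ i\<bar>" using out by (auto simp: tube_def not_less)
    thus ?thesis using component_le_norm_cart[of x i] by (intro w1) simp
   qed
   thus "ind E x * (ennreal (wt dl (sg * x $ k)) * ind (- tube k (2 * R)) x) <= ennreal (ind E x * (w x * wt dl (sg * x $ k)))"
    by (auto simp: indicator_def)
  qed
  also have "... = ennreal (LI x. ind E x * (w x * wt dl (sg * x $ k)))"
   using wt_nonneg[OF dl] smooth_step_range by (intro nn_integral_eq_integral[OF int]) (auto simp: w_def)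
  also have "... <= ennreal e" by (rule ennreal_leI[OF le])
  finally show ?thesis .
 qed
 show ?thesis by (rule that[of "2 * R"]) (use R(2) main in auto)
qed

section \<open>Comparison of the two traces across the interface\<close>

lemma nn_integral_reflect_axis:
 fixes f :: "real^'n::finite => ennreal"
 assumes "meas f"
 shows "(NN x. f (upd x k (- x $ k))) = (NN x. f x)"
proof -
 have "(\<chi> i. (if i = k then - 1 else 1) * x $ i) = upd x k (- x $ k)" for x :: "real^'n"
  by (simp add: vec_eq_iff)
 thus ?thesis
  using nn_integral_diagonal[OF assms, of "\<lambda>i. if i = k then - 1 else 1"] by (simp add: if_distrib cong: if_cong)
qed

lemma AE_reflect_axis:
 assumes "AE x in lborel. P x" shows "AE x in lborel. P (upd x k (- x $ k) :: real^'n::finite)"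
proof -
 obtain N where N: "{x. \<not> P x} \<subseteq> N" "evol N = 0" and [measurable]: "N \<in> sets borel"
  using assms by (auto elim!: AE_E)
 have "(NN x. ind N (upd x k (- x $ k))) = 0"
  using N(2) by (subst nn_integral_reflect_axis) auto
 hence "AE x in lborel. (ind N (upd x k (- x $ k)) :: ennreal) = 0"
  by (subst (asm) nn_integral_0_iff_AE) auto
 thus ?thesis by eventually_elim (use N(1) in \<open>auto simp: indicator_def split: if_splits\<close>)
qed

text \<open>The points from which a vertical segment of half-length \<open>d\<close> meets
  \<open>F\<close>.\<close>

definition thicken :: "'n::finite => real => (real^'n) set => (real^'n) set" where
 "thicken k d F = {x. \<exists>t\<in>{- d..d}. x + t *\<^sub>R axis k 1 \<in> F}"

lemma closed_thicken: "closed F ==> closed (thicken k d F)"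
proof -
 assume F: "closed F"
 have "thicken k d F = (\<Union>x\<in>F. \<Union>y\<in>(\<lambda>t. t *\<^sub>R axis k 1) ` {- d..d}. {x + y})"
 proof (intro equalityI subsetI)
  fix x assume "x \<in> thicken k d F"
  then obtain t where t: "t \<in> {- d..d}" "x + t *\<^sub>R axis k 1 \<in> F" by (auto simp: thicken_def)
  hence "x = (x + t *\<^sub>R axis k 1) + (- t) *\<^sub>R axis k 1" "- t \<in> {- d..d}" by auto
  thus "x \<in> (\<Union>x\<in>F. \<Union>y\<in>(\<lambda>t. t *\<^sub>R axis k 1) ` {- d..d}. {x + y})" using t by blast
 next
  fix x assume "x \<in> (\<Union>x\<in>F. \<Union>y\<in>(\<lambda>t. t *\<^sub>R axis k 1) ` {- d..d}. {x + y})"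
  then obtain y t where "y \<in> F" "t \<in> {- d..d}" "x = y + t *\<^sub>R axis k 1" by auto
  hence "- t \<in> {- d..d}" "x + (- t) *\<^sub>R axis k 1 \<in> F" by auto
  thus "x \<in> thicken k d F" unfolding thicken_def by blast
 qed
 moreover have "compact ((\<lambda>t. t *\<^sub>R axis k 1 :: real^'a) ` {- d..d})"
  by (intro compact_continuous_image continuous_intros) auto
 ultimately show ?thesis using closed_compact_sums[OF F] by metis
qed

lemma nn_integral_wt_axis:
 assumes "0 < dl" "sg = 1 \<or> sg = -1" shows "(NN t. ennreal (wt dl (sg * t))) = 1"
 using nn_integral_real_affine[of "\<lambda>t. ennreal (wt dl t)" sg 0] assms nn_integral_wt[OF assms(1)] by auto

text \<open>Over a base point away from the thickened boundary, the vertical segment does not cross the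
 boundary, so both sides see the same trace.\<close>

lemma trace_compare:
 fixes k :: "'n::finite"
 assumes E [measurable]: "E \<in> sets borel" and ae: "AE x in lborel. x \<in> E \<longleftrightarrow> x \<in> \<Omega>"
  and dl: "0 < dl" and sg: "sg = 1 \<or> sg = -1"
 shows "(NN x. ind E x * (ennreal (wt dl (sg * x $ k)) * ind (tube k L) x))
  <= (NN x. ind E x * ennreal (wt dl (- sg * x $ k))) + area k (tube k L \<inter> thicken k (2 * dl) (frontier \<Omega>))"
proof -
 define C where "C = thicken k (2 * dl) (frontier \<Omega>)"
 have "closed C" unfolding C_def by (intro closed_thicken) simp
 hence [measurable]: "C \<in> sets borel" by (rule borel_closed)
 have [measurable]: "tube k L \<in> sets borel" using open_tube by (rule borel_open)
 \<comment> \<open>The part of the slab integral over base points away from \<open>C\<close>; the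
   part over \<open>C\<close> is bounded by an area, since \<open>wt\<close> has integral 1 along
   each vertical line.\<close>
 define J where "J ta x = ind E x * (ind (- C) (upd x k 0) * ennreal (wt dl (ta * x $ k)))" for ta x
 have [measurable]: "meas (J ta)" for ta unfolding J_def[abs_def] by measurable
 have "(NN x. ind E x * (ennreal (wt dl (sg * x $ k)) * ind (tube k L) x))
  <= (NN x. J sg x + ind (tube k L \<inter> C) (upd x k 0) * ennreal (wt dl (sg * x $ k)))"
 proof (intro nn_integral_mono)
  fix x :: "real^'n"
  have "upd x k 0 \<in> tube k L \<longleftrightarrow> x \<in> tube k L" by (auto simp: tube_def)
  thus "ind E x * (ennreal (wt dl (sg * x $ k)) * ind (tube k L) x) <= J sg x + ind (tube k L \<inter> C) (upd x k 0) * ennreal (wt dl (sg * x $ k))"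
   by (auto simp: J_def indicator_def)
 qed
 also have "... = (NN x. J sg x) + (NN x. ind (tube k L \<inter> C) (upd x k 0) * ennreal (wt dl (sg * x $ k)))"
  by (intro nn_integral_add) measurable
 also have "(NN x. ind (tube k L \<inter> C) (upd x k 0) * ennreal (wt dl (sg * x $ k))) = area k (tube k L \<inter> C)"
  using nn_integral_wt_axis[OF dl sg] by (subst area_product) auto
 also have "(NN x. J sg x) <= (NN x. ind E x * ennreal (wt dl (- sg * x $ k)))"
 proof -
  have "(NN x. J sg x) = (NN x. J sg (upd x k (- x $ k)))" by (rule nn_integral_reflect_axis[symmetric]) measurable
  also have "... <= (NN x. ind E x * ennreal (wt dl (- sg * x $ k)))"
  proof (rule nn_integral_mono_AE)
   show "AE x in lborel. J sg (upd x k (- x $ k)) <= ind E x * ennreal (wt dl (- sg * x $ k))"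
    using ae AE_reflect_axis[OF ae, of k]
   proof eventually_elim
    case (elim x)
    show ?case
    proof (cases "upd x k 0 \<notin> C \<and> wt dl (- sg * x $ k) ~= 0")
     case True
     hence "\<not> (- sg * x $ k <= dl \<or> 2 * dl <= - sg * x $ k)" using wt_outside[OF dl, of "- sg * x $ k"] by blast
     hence xk: "\<bar>x $ k\<bar> <= 2 * dl" using sg dl by auto
     \<comment> \<open>The vertical segment through \<open>x\<close> contains the mirror image of
       \<open>x\<close>. It is connected and misses the frontier, so both points lie in
       \<open>\<Omega>\<close> or neither does.\<close>
     define S where "S = (\<lambda>t. upd x k t) ` {- (2 * dl)..2 * dl}"
     have "connected S" unfolding S_def by (intro connected_continuous_image continuous_intros) auto
     moreover have "S \<inter> frontier \<Omega> = {}"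
     proof -
      have "upd x k t \<notin> frontier \<Omega>" if "t \<in> {- (2 * dl)..2 * dl}" for t
       using True that upd_add_axis[of "upd x k 0" k t] by (auto simp: C_def thicken_def)
      thus ?thesis by (auto simp: S_def)
     qed
     ultimately have "S \<inter> \<Omega> = {} \<or> S - \<Omega> = {}" using connected_Int_frontier by blast
     moreover have S: "upd x k t \<in> S" if "\<bar>t\<bar> <= 2 * dl" for t unfolding S_def using that by (intro imageI) auto
     moreover have "x \<in> S" "upd x k (- x $ k) \<in> S" using S[of "x $ k"] S[of "- x $ k"] xk by simp_all
     ultimately have "x \<in> \<Omega> \<longleftrightarrow> upd x k (- x $ k) \<in> \<Omega>" by blast
     thus ?thesis using elim by (auto simp: J_def indicator_def)
    qed (auto simp: J_def indicator_def)
   qed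
  qed
  finally show ?thesis .
 qed
 finally show ?thesis by (simp add: C_def add_right_mono)
qed

text \<open>Continuity from above along shrinking thickenings: their intersection is
  \<open>F\<close> because \<open>F\<close> is closed, and the window makes the areas
  finite.\<close>

lemma area_thicken_tendsto:
 fixes k :: "'n::finite"
 assumes m: "CARD('n) = Suc m" and F: "closed F" and L: "0 < L"
 shows "(\<lambda>j. area k (tube k L \<inter> thicken k (1 / real (Suc j)) F)) ----> area k (tube k L \<inter> F)"
proof -
 define S where "S j = {x. upd x k 0 \<in> tube k L \<inter> thicken k (1 / real (Suc j)) F \<and> x $ k \<in> {0..1}}" for j
 have "(\<lambda>j. evol (S j)) ----> evol (\<Inter>j. S j)"
 proof (rule Lim_emeasure_decseq)
  have "S j \<in> sets borel" for j
   unfolding S_def by (intro borel_cylinder sets.Int borel_open[OF open_tube] borel_closed closed_thicken F)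
  thus "range S \<subseteq> sets lborel" by auto
  have "thicken k (1 / real (Suc (Suc j))) F \<subseteq> thicken k (1 / real (Suc j)) F" for j
  proof -
   have "1 / real (Suc (Suc j)) <= 1 / real (Suc j)" by (intro divide_left_mono) auto
   thus ?thesis unfolding thicken_def by fastforce
  qed
  thus "decseq S" unfolding S_def by (intro decseq_SucI) blast
  have "evol (S j) <= area k (tube k L)" for j
   unfolding S_def area_def[symmetric] by (intro area_mono borel_open open_tube) auto
  thus "evol (S j) ~= \<infinity>" for j
   using area_tube_le[OF m L, of k] by (metis ennreal_less_top infinity_ennreal_def leD order_trans)
 qed
 moreover have "(\<Inter>j. S j) = {x. upd x k 0 \<in> tube k L \<inter> F \<and> x $ k \<in> {0..1}}"
 proof (intro equalityI subsetI)
  fix x assume x: "x \<in> (\<Inter>j. S j)"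
  have "upd x k 0 \<in> closure F"
   unfolding closure_approachable
  proof (intro allI impI)
   fix e :: real assume "0 < e"
   then obtain j where j: "1 / real (Suc j) < e" using reals_Archimedean[of e] by (auto simp: inverse_eq_divide)
   have "upd x k 0 \<in> thicken k (1 / real (Suc j)) F" using x by (auto simp: S_def)
   then obtain t where t: "t \<in> {- (1 / real (Suc j))..1 / real (Suc j)}" "upd x k 0 + t *\<^sub>R axis k 1 \<in> F"
    unfolding thicken_def by blast
   hence "\<bar>t\<bar> <= 1 / real (Suc j)" unfolding atLeastAtMost_iff by linarith
   thus "\<exists>y\<in>F. dist y (upd x k 0) < e"
    using j t by (intro bexI[of _ "upd x k 0 + t *\<^sub>R axis k 1"]) (auto simp: dist_norm norm_axis_1)
  qed
  thus "x \<in> {x. upd x k 0 \<in> tube k L \<inter> F \<and> x $ k \<in> {0..1}}" using F x by (auto simp: S_def)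
 next
  fix x assume x: "x \<in> {x. upd x k 0 \<in> tube k L \<inter> F \<and> x $ k \<in> {0..1}}"
  hence "upd x k 0 \<in> thicken k (1 / real (Suc j)) F" for j unfolding thicken_def by (auto intro!: bexI[of _ 0])
  thus "x \<in> (\<Inter>j. S j)" using x by (auto simp: S_def)
 qed
 ultimately show ?thesis unfolding S_def area_def by simp
qed

text \<open>The two limits are taken in order: the scale tends to 0 at a fixed thickening, which
  eventually contains the thickening tied to the scale, and then the thickening shrinks to the
  frontier.\<close>

lemma trace_gap:
 fixes k :: "'n::finite"
 assumes m: "CARD('n) = Suc m" and E [measurable]: "E \<in> sets borel" and fin: "evol E < \<infinity>"
  and ae: "AE x in lborel. x \<in> E \<longleftrightarrow> x \<in> \<Omega>" and sg: "sg = 1 \<or> sg = -1"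
  and per: "perimeter E (halfspace k sg) < \<infinity>" and ds: "!!n. 0 < ds n" "ds ----> 0"
  and A: "(\<lambda>n. trace_avg k sg E (ds n)) ----> A" "(\<lambda>n. trace_avg k (- sg) E (ds n)) ----> A'" and e: "0 < e"
 obtains L where "0 < L" "ennreal A <= ennreal A' + area k (tube k L \<inter> frontier \<Omega>) + ennreal e"
proof -
 obtain L where L: "0 < L" "!!dl. 0 < dl ==> (NN x. ind E x * (ennreal (wt dl (sg * x $ k)) * ind (- tube k L) x)) <= ennreal e"
  using trace_tail[OF E fin sg per e] by blast
 have [measurable]: "tube k L \<in> sets borel" using open_tube by (rule borel_open)
 have le: "ennreal (trace_avg k sg E dl) <= ennreal (trace_avg k (- sg) E dl) + area k (tube k L \<inter> thicken k (2 * dl) (frontier \<Omega>)) + ennreal e" if dl: "0 < dl" for dl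
 proof -
  have "ennreal (trace_avg k sg E dl) = (NN x. ind E x * ennreal (wt dl (sg * x $ k)))"
   by (rule trace_avg_nn_integral(1)[OF E fin dl, symmetric])
  also have "... = (NN x. ind E x * (ennreal (wt dl (sg * x $ k)) * ind (tube k L) x) + ind E x * (ennreal (wt dl (sg * x $ k)) * ind (- tube k L) x))"
   by (intro nn_integral_cong) (auto simp: indicator_def)
  also have "... = (NN x. ind E x * (ennreal (wt dl (sg * x $ k)) * ind (tube k L) x)) + (NN x. ind E x * (ennreal (wt dl (sg * x $ k)) * ind (- tube k L) x))"
   by (intro nn_integral_add) measurable
  also have "... <= ((NN x. ind E x * ennreal (wt dl (- sg * x $ k))) + area k (tube k L \<inter> thicken k (2 * dl) (frontier \<Omega>))) + ennreal e"
   by (intro add_mono trace_compare[OF E ae dl sg] L(2)[OF dl])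
  also have "(NN x. ind E x * ennreal (wt dl (- sg * x $ k))) = ennreal (trace_avg k (- sg) E dl)"
   by (rule trace_avg_nn_integral(1)[OF E fin dl])
  finally show ?thesis .
 qed
 have "ennreal A <= ennreal A' + area k (tube k L \<inter> thicken k (1 / real (Suc j)) (frontier \<Omega>)) + ennreal e" for j
 proof (rule tendsto_le[OF sequentially_bot])
  show "(\<lambda>n. ennreal (trace_avg k sg E (ds n))) ----> ennreal A" by (intro tendsto_ennrealI A)
  show "(\<lambda>n. ennreal (trace_avg k (- sg) E (ds n)) + area k (tube k L \<inter> thicken k (1 / real (Suc j)) (frontier \<Omega>)) + ennreal e)
    ----> ennreal A' + area k (tube k L \<inter> thicken k (1 / real (Suc j)) (frontier \<Omega>)) + ennreal e"
   by (intro tendsto_add tendsto_const tendsto_ennrealI A)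
  have "\<forall>\<^sub>F n in sequentially. ds n < 1 / (2 * real (Suc j))" using ds(2) by (intro order_tendstoD) auto
  thus "\<forall>\<^sub>F n in sequentially. ennreal (trace_avg k sg E (ds n)) <= ennreal (trace_avg k (- sg) E (ds n)) + area k (tube k L \<inter> thicken k (1 / real (Suc j)) (frontier \<Omega>)) + ennreal e"
  proof eventually_elim
   case (elim n)
   have "2 * ds n <= 1 / real (Suc j)" using elim by (simp add: field_simps)
   hence "thicken k (2 * ds n) (frontier \<Omega>) \<subseteq> thicken k (1 / real (Suc j)) (frontier \<Omega>)" unfolding thicken_def by fastforce
   hence "area k (tube k L \<inter> thicken k (2 * ds n) (frontier \<Omega>)) <= area k (tube k L \<inter> thicken k (1 / real (Suc j)) (frontier \<Omega>))"
    by (intro area_mono sets.Int borel_open[OF open_tube] borel_closed closed_thicken) auto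
   thus ?case using le[OF ds(1), of n] by (meson add_left_mono add_right_mono order_trans)
  qed
 qed
 moreover have "(\<lambda>j. ennreal A' + area k (tube k L \<inter> thicken k (1 / real (Suc j)) (frontier \<Omega>)) + ennreal e) ----> ennreal A' + area k (tube k L \<inter> frontier \<Omega>) + ennreal e"
  by (intro tendsto_add tendsto_const area_thicken_tendsto[OF m _ L(1)]) simp
 ultimately have "ennreal A <= ennreal A' + area k (tube k L \<inter> frontier \<Omega>) + ennreal e"
  by (intro LIMSEQ_le_const) auto
 thus ?thesis using that L(1) by blast
qed

section \<open>Minimizers\<close>

context half_set

begin

text \<open>For the cap with the same volume and trace, the isoperimetric bound equals its own value
  plus \<open>a * A\<close>. Comparison with \<open>E\<close> cancels \<open>a * A\<close>, and the
  reverse inequality is the equality case handled by \<open>rigidity\<close>.\<close>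

lemma matched_cap:
 assumes m: "0 < m" "CARD('n) = Suc m" and om: "0 < om" "!!r. 0 <= r ==> area k (disc k r) = ennreal (om * r ^ m)"
  and V: "0 < vol E" and A0: "0 <= A"
 obtains a s where "- 1 < a" "a <= 1" "0 < s" "s ^ Suc m * vol (capset k sg a) = vol E"
  "A = om * (s * sqrt (1 - a\<^sup>2)) ^ m"
  "s ^ m * (real (Suc m) * vol (capset k sg a) - a * slice_area om m a) <= p"
  "p <= s ^ m * (real (Suc m) * vol (capset k sg a) - a * slice_area om m a) ==>
   \<exists>t. (AE x in lborel. x \<in> halfspace k sg --> (x \<in> E \<longleftrightarrow> dist t x <= s)) \<and> a * s <= sg * t $ k \<and> (a < 1 --> sg * t $ k = a * s)"
proof -
 define R where "R = root m (A / om)"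
 have R: "0 <= R" "A = om * R ^ m" using A0 om(1) m(1) by (simp_all add: R_def)
 obtain a s where a: "- 1 < a" "a <= 1" and s: "0 < s" and vol: "s ^ Suc m * vol (capset k sg a) = vol E"
  and Rs: "R = s * sqrt (1 - a\<^sup>2)"
  by (rule cap_exists[OF sigma m om V R(1)]) blast
 let ?K = "capset k sg a" and ?V = "vol E"
 let ?q = "s ^ m * (real (Suc m) * vol ?K - a * slice_area om m a)"
 have K: "compact ?K" "0 < vol ?K" "!!y. y \<in> ?K ==> norm y <= 1" "!!y. y \<in> ?K ==> - a <= sg * y $ k"
  using compact_capset capset_volume_pos[OF m(1) sigma om a(1)] by (auto simp: capset_def)
 have dil: "dilation TYPE('n) (vol ?K) ?V = 1 / s"
 proof -
  have "vol ?K / ?V = (1 / s) ^ CARD('n)"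
   unfolding vol[symmetric] m(2) using s K(2) by (simp add: power_divide)
  thus ?thesis unfolding dilation_def using s by (simp add: real_root_power_cancel)
 qed
 have a2: "a\<^sup>2 <= 1" using a by (simp add: abs_square_le_1 abs_le_iff)
 have aA: "a * A = s ^ m * (a * slice_area om m a)"
  unfolding R(2) Rs slice_area_def using a2 by (simp add: power_mult_distrib max_def)
 hence iso: "iso_bound TYPE('n) (vol ?K) ?V = ?q + a * A"
  unfolding iso_bound_def dil aA unfolding m(2) vol[symmetric] using s by (simp add: right_diff_distrib)
 have le: "?q <= p" using isoperimetric[OF K V] iso by simp
 have rig: "\<exists>t. (AE x in lborel. x \<in> halfspace k sg --> (x \<in> E \<longleftrightarrow> dist t x <= s)) \<and> a * s <= sg * t $ k \<and> (a < 1 --> sg * t $ k = a * s)"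
  if "p <= ?q"
 proof -
  interpret equality_case k sg E p A ds ?K a
   by unfold_locales (use K V convex_capset that iso in auto)
  have fac: "fac = 1 / s" unfolding fac_def dil ..
  obtain t where t: "E - {x. fac *\<^sub>R (x - t) \<in> ?K} \<in> null_sets lborel" "{x. fac *\<^sub>R (x - t) \<in> ?K} - E \<in> null_sets lborel"
   "a / fac <= sg * t $ k" "A ~= 0 ==> sg * t $ k = a / fac"
   by (rule rigidity[OF refl a]) blast
  have at: "a * s <= sg * t $ k" using t(3) by (simp add: fac)
  \<comment> \<open>A proper cap has a nonzero trace and must sit on the interface; the full ball,
    \<open>a = 1\<close>, may float in the half-space.\<close>
  have eqt: "sg * t $ k = a * s" if "a < 1"
  proof -
   have "a\<^sup>2 < 1" using a(1) that by (simp add: abs_square_less_1 abs_less_iff)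
   hence "A ~= 0" using s om(1) by (simp add: R(2) Rs)
   thus ?thesis using t(4) by (simp add: fac)
  qed
  have inK: "fac *\<^sub>R (x - t) \<in> ?K \<longleftrightarrow> dist t x <= s" if x: "x \<in> halfspace k sg" for x
  proof -
   have n: "norm (fac *\<^sub>R (x - t)) = dist t x / s" using s by (simp add: fac dist_norm norm_minus_commute)
   have "- a <= sg * (fac *\<^sub>R (x - t)) $ k" if d: "dist t x <= s"
   proof (cases "a < 1")
    case True
    have "sg * (fac *\<^sub>R (x - t)) $ k = (sg * x $ k - sg * t $ k) / s" by (simp add: fac algebra_simps diff_divide_distrib)
    also have "... = sg * x $ k / s - a" using eqt[OF True] s by (simp add: diff_divide_distrib)
    also have "- a <= ..." using x s by (simp add: halfspace_def)
    finally show ?thesis .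
   next
    case False
    have "\<bar>sg * (fac *\<^sub>R (x - t)) $ k\<bar> <= norm (fac *\<^sub>R (x - t))"
     using sigma component_le_norm_cart[of "fac *\<^sub>R (x - t)" k] by auto
    also have "... <= 1" unfolding n using d s by simp
    finally show ?thesis using False a by linarith
   qed
   moreover have "y \<in> ?K \<longleftrightarrow> norm y <= 1 \<and> - a <= sg * y $ k" for y by (simp add: capset_def)
   ultimately show ?thesis using s n by (simp only: pos_divide_le_eq mult_1) blast
  qed
  have "AE x in lborel. x \<in> halfspace k sg --> (x \<in> E \<longleftrightarrow> dist t x <= s)"
   using AE_not_in[OF t(1)] AE_not_in[OF t(2)] by eventually_elim (use inK in auto)
  thus ?thesis using at eqt by blast
 qed
 show ?thesis using that[OF a s vol R(2)[unfolded Rs] le rig] .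
qed

end

section \<open>Measure-theoretic boundaries of the minimizer and the competitor\<close>

lemma bdry_iff:
 assumes \<Omega>: "\<Omega> \<in> sets lebesgue"
 shows "x \<in> bdry \<Omega> \<longleftrightarrow> (\<forall>r>0. \<not> negligible (\<Omega> \<inter> ball x r) \<and> \<not> negligible (ball x r - \<Omega>))"
proof -
 have "0 < emeasure lebesgue (\<Omega> \<inter> ball x r) \<longleftrightarrow> \<not> negligible (\<Omega> \<inter> ball x r)"
  and "emeasure lebesgue (\<Omega> \<inter> ball x r) < emeasure lebesgue (ball x r) \<longleftrightarrow> \<not> negligible (ball x r - \<Omega>)" for r
 proof -
  have m: "\<Omega> \<inter> ball x r \<in> sets lebesgue" "ball x r - \<Omega> \<in> sets lebesgue" using \<Omega> by auto
  show "0 < emeasure lebesgue (\<Omega> \<inter> ball x r) \<longleftrightarrow> \<not> negligible (\<Omega> \<inter> ball x r)"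
   using m(1) by (auto simp: negligible_iff_null_sets null_sets_def zero_less_iff_neq_zero)
  have "ball x r = (\<Omega> \<inter> ball x r) \<union> (ball x r - \<Omega>)" by blast
  hence sp: "emeasure lebesgue (ball x r) = emeasure lebesgue (\<Omega> \<inter> ball x r) + emeasure lebesgue (ball x r - \<Omega>)"
   using m by (metis Diff_disjoint Int_commute inf_assoc Int_empty_right plus_emeasure inf.absorb_iff2 Diff_Int_distrib2)
  have "emeasure lebesgue (\<Omega> \<inter> ball x r) < \<top>"
   using emeasure_mono[of "\<Omega> \<inter> ball x r" "ball x r" lebesgue] emeasure_lborel_ball_finite[of x r] by (auto intro: le_less_trans)
  hence "emeasure lebesgue (\<Omega> \<inter> ball x r) < emeasure lebesgue (ball x r) \<longleftrightarrow> emeasure lebesgue (ball x r - \<Omega>) ~= 0"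
   unfolding sp using ennreal_add_left_cancel_less[of "emeasure lebesgue (\<Omega> \<inter> ball x r)" 0 "emeasure lebesgue (ball x r - \<Omega>)"]
   by (auto simp: zero_less_iff_neq_zero)
  thus "emeasure lebesgue (\<Omega> \<inter> ball x r) < emeasure lebesgue (ball x r) \<longleftrightarrow> \<not> negligible (ball x r - \<Omega>)"
   using m(2) by (auto simp: negligible_iff_null_sets null_sets_def)
 qed
 thus ?thesis by (simp add: bdry_def)
qed

text \<open>\<open>bdry\<close> sees only the null class of the set near each point, so
  almost-everywhere agreement with a ball inside an open set decides it there.\<close>

lemma bdry_ball_side:
 fixes \<Omega> :: "(real^'n) set"
 assumes \<Omega>: "\<Omega> \<in> sets lebesgue" and H: "open H" and s: "0 < s"
  and ae: "AE x in lborel. x \<in> H --> (x \<in> \<Omega> \<longleftrightarrow> dist t x <= s)"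
 shows "bdry \<Omega> \<inter> H = sphere t s \<inter> H"
proof (rule set_eqI)
 fix x
 show "x \<in> bdry \<Omega> \<inter> H \<longleftrightarrow> x \<in> sphere t s \<inter> H"
 proof (cases "x \<in> H")
  case True
  obtain r0 where r0: "0 < r0" "ball x r0 \<subseteq> H" using H True open_contains_ball by blast
  obtain N where N: "{x \<in> space lborel. \<not> (x \<in> H --> (x \<in> \<Omega> \<longleftrightarrow> dist t x <= s))} \<subseteq> N" "evol N = 0" "N \<in> sets lborel"
   using AE_E[OF ae] by blast
  have negN: "negligible N" using N(2,3) by (simp add: negligible_iff_null_sets null_sets_completionI null_sets_def)
  have opn: "\<not> negligible S" if "open U" "x \<in> closure U" "!!y. y \<in> U ==> dist x y < min r r0 ==> y \<in> S \<union> N" "0 < r" for U S r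
  proof
   assume "negligible S"
   hence "negligible (S \<union> N)" using negN by (rule negligible_Un)
   moreover have "open (U \<inter> ball x (min r r0))" using that(1) by auto
   moreover have "U \<inter> ball x (min r r0) ~= {}"
    using that(2,4) r0(1) by (auto simp: closure_approachable dist_commute dest!: spec[of _ "min r r0"])
   moreover have "U \<inter> ball x (min r r0) \<subseteq> S \<union> N"
   proof
    show "y \<in> S \<union> N" if y: "y \<in> U \<inter> ball x (min r r0)" for y
     using y \<open>!!y. y \<in> U ==> dist x y < min r r0 ==> y \<in> S \<union> N\<close>[of y] by simp
   qed
   ultimately show False using open_not_negligible negligible_subset by metis
  qed
  have "x \<in> sphere t s" if "x \<in> bdry \<Omega>"
  proof (rule ccontr)
   assume "x \<notin> sphere t s"
   then consider "x \<in> ball t s" | "x \<in> - cball t s" by fastforce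
   thus False
   proof cases
    case 1
    then obtain r where r: "0 < r" "ball x r \<subseteq> ball t s" using open_contains_ball open_ball by metis
    have "ball x (min r r0) - \<Omega> \<subseteq> N" using r(2) r0(2) N(1) by force
    hence "negligible (ball x (min r r0) - \<Omega>)" using negN negligible_subset by blast
    thus False using \<open>x \<in> bdry \<Omega>\<close> r(1) r0(1) unfolding bdry_iff[OF \<Omega>] by (meson min_less_iff_conj)
   next
    case 2
    then obtain r where r: "0 < r" "ball x r \<subseteq> - cball t s" using open_contains_ball[of "- cball t s"] by (metis open_Compl closed_cball)
    have "\<Omega> \<inter> ball x (min r r0) \<subseteq> N" using r(2) r0(2) N(1) by force
    hence "negligible (\<Omega> \<inter> ball x (min r r0))" using negN negligible_subset by blast
    thus False using \<open>x \<in> bdry \<Omega>\<close> r(1) r0(1) unfolding bdry_iff[OF \<Omega>] by (meson min_less_iff_conj)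
   qed
  qed
  moreover have "x \<in> bdry \<Omega>" if x: "x \<in> sphere t s"
   unfolding bdry_iff[OF \<Omega>]
  proof (intro allI impI conjI)
   fix r :: real assume r: "0 < r"
   show "\<not> negligible (\<Omega> \<inter> ball x r)"
   proof (rule opn[of "ball t s" r])
    show "x \<in> closure (ball t s)" using s x by auto
    show "y \<in> \<Omega> \<inter> ball x r \<union> N" if "y \<in> ball t s" "dist x y < min r r0" for y using that r0(2) N(1) by force
   qed (use r in auto)
   show "\<not> negligible (ball x r - \<Omega>)"
   proof (rule opn[of "- cball t s" r])
    have "x \<in> frontier (cball t s)" using x by simp
    thus "x \<in> closure (- cball t s)" by (simp add: frontier_closures)
    show "y \<in> ball x r - \<Omega> \<union> N" if "y \<in> - cball t s" "dist x y < min r r0" for y using that r0(2) N(1) by force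
   qed (use r in auto)
  qed
  ultimately show ?thesis using True by blast
 qed auto
qed

text \<open>Points of the interface inside both discs have a neighbourhood filled by the two caps up
  to the null interface; points outside both discs have a neighbourhood that misses the
  caps.\<close>

lemma bdry_caps_subset:
 fixes k :: "'n::finite"
 assumes s: "0 < s1" "0 < s2" and a: "\<bar>a1\<bar> <= 1" "\<bar>a2\<bar> <= 1"
  and R: "R1 = s1 * sqrt (1 - a1\<^sup>2)" "R2 = s2 * sqrt (1 - a2\<^sup>2)"
 shows "bdry (cap k (-1) (a1 * s1) s1 \<union> cap k 1 (a2 * s2) s2) \<inter> interface k
  \<subseteq> {x. min R1 R2 <= norm x \<and> norm x <= max R1 R2} \<inter> interface k"
proof
 let ?C = "cap k (-1) (a1 * s1) s1 \<union> cap k 1 (a2 * s2) s2"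
 define c1 c2 :: "real^'n" where "c1 = (a1 * s1 * - 1) *\<^sub>R axis k 1" and "c2 = (a2 * s2 * 1) *\<^sub>R axis k 1"
 have Ceq: "?C = (cball c1 s1 \<inter> halfspace k (-1)) \<union> (cball c2 s2 \<inter> halfspace k 1)" by (simp only: cap_def c1_def c2_def)
 have C: "?C \<in> sets lebesgue" using borel_cap by auto
 fix x assume x: "x \<in> bdry ?C \<inter> interface k"
 hence xk: "x $ k = 0" by (simp add: interface_def)
 have d: "(dist (u *\<^sub>R axis k 1) x)\<^sup>2 = (norm x)\<^sup>2 + u\<^sup>2" for u
 proof -
  have "upd (x - u *\<^sub>R axis k 1) k 0 = x" "(x - u *\<^sub>R axis k 1) $ k = - u" using xk by (simp_all add: vec_eq_iff axis_def)
  hence "(norm (x - u *\<^sub>R axis k 1))\<^sup>2 = (norm x)\<^sup>2 + (- u)\<^sup>2"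
   using norm_upd[of "x - u *\<^sub>R axis k 1" k "(x - u *\<^sub>R axis k 1) $ k"] unfolding upd_triv by simp
  thus ?thesis by (simp add: dist_norm norm_minus_commute)
 qed
 have sR: "R\<^sup>2 + (a * s)\<^sup>2 = s\<^sup>2" "0 <= R" if "R = s * sqrt (1 - a\<^sup>2)" "\<bar>a\<bar> <= 1" "0 < s" for R s a
 proof -
  have "a\<^sup>2 <= 1" using that(2) by (simp add: abs_square_le_1)
  thus "R\<^sup>2 + (a * s)\<^sup>2 = s\<^sup>2" "0 <= R" using that by (simp_all add: power_mult_distrib algebra_simps)
 qed
 have ins: "dist ((a * s * sg) *\<^sub>R axis k 1) x < s" if "norm x < R" "R = s * sqrt (1 - a\<^sup>2)" "\<bar>a\<bar> <= 1" "0 < s" "sg\<^sup>2 = 1" for R s a sg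
 proof (rule power2_less_imp_less)
  have "(norm x)\<^sup>2 < R\<^sup>2" using that(1) by (intro power_strict_mono) auto
  thus "(dist ((a * s * sg) *\<^sub>R axis k 1) x)\<^sup>2 < s\<^sup>2" unfolding d using sR(1)[OF that(2-4)] that(5) by (simp add: power_mult_distrib)
 qed (use that in simp)
 have out: "s < dist ((a * s * sg) *\<^sub>R axis k 1) x" if "R < norm x" "R = s * sqrt (1 - a\<^sup>2)" "\<bar>a\<bar> <= 1" "0 < s" "sg\<^sup>2 = 1" for R s a sg
 proof (rule power2_less_imp_less)
  have "R\<^sup>2 < (norm x)\<^sup>2" using that(1) sR(2)[OF that(2-4)] by (intro power_strict_mono) auto
  thus "s\<^sup>2 < (dist ((a * s * sg) *\<^sub>R axis k 1) x)\<^sup>2" unfolding d using sR(1)[OF that(2-4)] that(5) by (simp add: power_mult_distrib)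
 qed simp
 have "min R1 R2 <= norm x"
 proof (rule ccontr)
  assume "\<not> min R1 R2 <= norm x"
  hence "x \<in> ball c1 s1 \<inter> ball c2 s2"
   using ins[OF _ R(1) a(1) s(1), of "-1"] ins[OF _ R(2) a(2) s(2), of 1] by (simp add: c1_def c2_def)
  moreover have "open (ball c1 s1 \<inter> ball c2 s2)" by auto
  ultimately obtain r where r: "0 < r" "ball x r \<subseteq> ball c1 s1 \<inter> ball c2 s2" using open_contains_ball by metis
  have "y \<in> interface k" if "y \<in> ball x r" "y \<notin> ?C" for y
  proof -
   have "dist c1 y <= s1" "dist c2 y <= s2" using r(2) that(1) by force+
   thus ?thesis using that(2) unfolding Ceq by (auto simp: halfspace_def interface_def)
  qed
  hence "ball x r - ?C \<subseteq> interface k" by blast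
  moreover have "negligible (interface k)" using null_sets_completionI[OF null_interface] by (simp add: negligible_iff_null_sets)
  ultimately have "negligible (ball x r - ?C)" using negligible_subset by blast
  thus False using x r(1) bdry_iff[OF C, of x] by blast
 qed
 moreover have "norm x <= max R1 R2"
 proof (rule ccontr)
  assume "\<not> norm x <= max R1 R2"
  hence "R1 < norm x" "R2 < norm x" by (simp_all only: le_max_iff_disj not_le de_Morgan_disj)
  hence "x \<in> - (cball c1 s1 \<union> cball c2 s2)"
   using out[OF _ R(1) a(1) s(1), of "-1"] out[OF _ R(2) a(2) s(2), of 1] by (simp add: c1_def c2_def)
  moreover have "open (- (cball c1 s1 \<union> cball c2 s2))" by (intro open_Compl closed_Un closed_cball)
  ultimately obtain r where r: "0 < r" "ball x r \<subseteq> - (cball c1 s1 \<union> cball c2 s2)" using open_contains_ball by metis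
  have "?C \<subseteq> cball c1 s1 \<union> cball c2 s2" unfolding Ceq by blast
  hence "?C \<inter> ball x r = {}" using r(2) by blast
  thus False using x r(1) bdry_iff[OF C, of x] by auto
 qed
 ultimately show "x \<in> {x. min R1 R2 <= norm x \<and> norm x <= max R1 R2} \<inter> interface k" using x by auto
qed

text \<open>If \<open>a < 1\<close>, the centre is closer to the interface than the radius and the
  sphere crosses it; if \<open>a = 1\<close>, the distance is at least the radius and the sphere
  stays on its side.\<close>

lemma cap_or_sphere:
 fixes k :: "'n::finite"
 assumes sg: "sg = 1 \<or> sg = -1" and a: "- 1 < a" "a <= 1" and s: "0 < s"
  and t: "a * s <= sg * t $ k" "a < 1 --> sg * t $ k = a * s"
 shows "spherical_cap k (halfspace k sg) (sphere t s \<inter> halfspace k sg) \<or> sphere_in_side k (halfspace k sg) (sphere t s \<inter> halfspace k sg)"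
proof (cases "a < 1")
 case True
 have "\<bar>sg * t $ k\<bar> < s"
 proof -
  have "\<bar>a\<bar> * s < 1 * s" using a(1) True s by (intro mult_strict_right_mono) auto
  thus ?thesis using t(2) True s by (simp add: abs_mult)
 qed
 hence tk: "\<bar>t $ k\<bar> < s" using sg by auto
 have "t - s *\<^sub>R axis k 1 \<in> sphere t s \<inter> neg_side k" "t + s *\<^sub>R axis k 1 \<in> sphere t s \<inter> pos_side k"
  using tk s by (auto simp: dist_norm norm_axis_1 neg_side_def pos_side_def)
 thus ?thesis unfolding spherical_cap_def by blast
next
 case False
 hence ts: "s <= sg * t $ k" using t(1) a by simp
 have sub: "sphere t s \<subseteq> {x. 0 <= sg * x $ k}"
 proof
  fix x assume "x \<in> sphere t s"
  hence "\<bar>(x - t) $ k\<bar> <= s" using component_le_norm_cart[of "x - t" k] by (simp add: dist_norm norm_minus_commute)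
  hence "\<bar>sg * x $ k - sg * t $ k\<bar> <= s" using sg by auto
  thus "x \<in> {x. 0 <= sg * x $ k}" using ts by auto
 qed
 have "closure (halfspace k sg) = {x. 0 <= sg * x $ k}"
  using closure_halfspace_gt[of "sg *\<^sub>R axis k 1 :: real^'n" 0] sg
  by (auto simp: halfspace_def inner_axis' axis_eq_0_iff)
 moreover have "sphere t s \<inter> halfspace k sg = sphere t s - interface k"
  using sub sg by (force simp: halfspace_def interface_def)
 ultimately show ?thesis using sub s unfolding sphere_in_side_def by blast
qed

lemma exists_borel_version:
 assumes "\<Omega> \<in> sets lebesgue"
 obtains E where "E \<in> sets borel" "AE x in lborel. x \<in> E \<longleftrightarrow> x \<in> \<Omega>"
proof -
 obtain S N N' where S: "\<Omega> = S \<union> N" "N \<subseteq> N'" "N' \<in> null_sets lborel" "S \<in> sets lborel"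
  using assms by (rule sets_completionE)
 have "AE x in lborel. x \<in> S \<longleftrightarrow> x \<in> \<Omega>"
  using AE_not_in[OF S(3)] by eventually_elim (use S in auto)
 thus ?thesis using that S(4) by simp
qed

text \<open>One subsequence must serve both sides, because the two traces are compared at the same
  scale.\<close>

lemma bounded_pair_convergent:
 fixes f g :: "nat => real"
 assumes "!!n. f n \<in> {a..b}" "!!n. g n \<in> {c..d}"
 obtains r x y where "strict_mono r" "(\<lambda>n. f (r n)) ----> x" "(\<lambda>n. g (r n)) ----> y"
proof -
 have "seq_compact ({a..b} \<times> {c..d})" by (simp add: compact_Times flip: compact_eq_seq_compact_metric)
 moreover have "\<forall>n. (f n, g n) \<in> {a..b} \<times> {c..d}" using assms by blast
 ultimately obtain l r where lr: "strict_mono r" "((\<lambda>n. (f n, g n)) \<circ> r) ----> l" by (rule seq_compactE)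
 show ?thesis using that[OF lr(1)] tendsto_fst[OF lr(2)] tendsto_snd[OF lr(2)] by (simp add: o_def)
qed

lemma ennreal_mult_eqD:
 assumes "ennreal \<rho> * x = ennreal V" "0 < \<rho>" shows "x = ennreal (V / \<rho>)"
proof -
 have "x = ennreal (1 / \<rho>) * (ennreal \<rho> * x)"
  using assms(2) by (simp add: mult.assoc[symmetric] ennreal_mult[symmetric])
 also have "... = ennreal (V / \<rho>)" using assms(2) by (simp add: assms(1) ennreal_mult'[symmetric])
 finally show ?thesis .
qed

lemma hausdorff_trace_gap:
 fixes k :: "'n::finite"
 assumes m: "CARD('n) = Suc m" and E: "E \<in> sets borel" "evol E < \<infinity>"
  and ae: "AE x in lborel. x \<in> E \<longleftrightarrow> x \<in> \<Omega>" and sg: "sg = 1 \<or> sg = -1"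
  and per: "perimeter E (halfspace k sg) < \<infinity>" and ds: "!!n. 0 < ds n" "ds ----> 0"
  and A: "(\<lambda>n. trace_avg k sg E (ds n)) ----> A" "(\<lambda>n. trace_avg k (- sg) E (ds n)) ----> A'"
  and A0: "0 <= A'" and kp: "hmeas m (face k 0 1) = ennreal kp" "0 <= kp"
 shows "ennreal (kp * (A - A')) <= hmeas m (frontier \<Omega> \<inter> interface k)"
proof (rule ennreal_le_epsilon)
 fix e :: real assume e: "0 < e"
 \<comment> \<open>Rescaled so that the error is at most \<open>e\<close> after multiplication with
   \<open>kp\<close>; the added 1 covers \<open>kp = 0\<close>.\<close>
 define e' where "e' = e / (kp + 1)"
 have e': "0 < e'" "kp * e' <= e" using e kp(2) by (simp_all add: e'_def field_simps)
 obtain L where L: "0 < L" "ennreal A <= ennreal A' + area k (tube k L \<inter> frontier \<Omega>) + ennreal e'"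
  by (rule trace_gap[OF m E ae sg per ds A e'(1)]) blast
 have "ennreal kp * ennreal A <= ennreal kp * (ennreal A' + area k (tube k L \<inter> frontier \<Omega>) + ennreal e')"
  by (rule mult_left_mono[OF L(2)]) simp
 also have "... = ennreal kp * ennreal A' + ennreal kp * area k (tube k L \<inter> frontier \<Omega>) + ennreal kp * ennreal e'"
  by (simp add: distrib_left)
 also have "... <= ennreal (kp * A') + hmeas m (frontier \<Omega> \<inter> interface k) + ennreal e"
  using hausdorff_closed_ge[OF m frontier_closed L(1), of k \<Omega>] kp A0 e'
  by (intro add_mono) (auto simp: ennreal_mult[symmetric] ennreal_leI)
 finally have *: "ennreal (kp * A) <= ennreal (kp * A') + (hmeas m (frontier \<Omega> \<inter> interface k) + ennreal e)"
  using kp(2) by (simp add: ennreal_mult' add.assoc)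
 have "ennreal (kp * (A - A')) = ennreal (kp * A) - ennreal (kp * A')"
  using kp(2) A0 by (subst ennreal_minus) (auto simp: right_diff_distrib)
 also have "... <= hmeas m (frontier \<Omega> \<inter> interface k) + ennreal e"
  using * by (intro ennreal_minus_le_iff[THEN iffD2]) auto
 finally show "ennreal (kp * (A - A')) <= hmeas m (frontier \<Omega> \<inter> interface k) + ennreal e" .
qed

lemma side_eq: "neg_side k = halfspace k (-1)" "pos_side k = halfspace k 1"
 by (auto simp: neg_side_def pos_side_def halfspace_def)

theorem theorem2p2:
 fixes k :: "'n::finite"
  and Vm Vp \<rho>m \<rho>p \<gamma> :: real
  and \<Omega> :: "(real^'n) set"
 assumes "CARD('n) \<ge> 2"
  and "Vm > 0" and "Vp > 0"
  and "\<rho>m > 0" and "\<rho>p > 0"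
  and "\<gamma> \<ge> 0"
  and "is_arg_min (energy k \<rho>m \<rho>p \<gamma>) (admissible k \<rho>m \<rho>p Vm Vp) \<Omega>"
 shows "(spherical_cap k (neg_side k) (bdry \<Omega> \<inter> neg_side k) \<or>
     sphere_in_side k (neg_side k) (bdry \<Omega> \<inter> neg_side k)) \<and>
     (spherical_cap k (pos_side k) (bdry \<Omega> \<inter> pos_side k) \<or>
     sphere_in_side k (pos_side k) (bdry \<Omega> \<inter> pos_side k))"
proof -
 define m where "m = CARD('n) - 1"
 have m: "0 < m" "CARD('n) = Suc m" using assms(1) by (simp_all add: m_def)
 obtain om where om: "0 < om" "!!r. 0 <= r ==> area k (disc k r) = ennreal (om * r ^ m)"
  using area_disc[OF assms(1), of k] unfolding m_def by blast
 obtain kp where kp: "hmeas m (face k 0 1) = ennreal kp" "0 <= kp"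
  using hausdorff_face_finite[of k] unfolding m_def[symmetric] by (cases "hmeas m (face k 0 1)") auto
 let ?H = "halfspace k :: real => (real^'n) set"
 have adm: "\<Omega> \<in> sets lebesgue" "perimeter \<Omega> UNIV < \<infinity>"
  "emeasure lebesgue (\<Omega> \<inter> ?H (-1)) = ennreal (Vm / \<rho>m)" "emeasure lebesgue (\<Omega> \<inter> ?H 1) = ennreal (Vp / \<rho>p)"
  using assms(7) assms(4,5) ennreal_mult_eqD
  unfolding is_arg_min_def admissible_def finite_perimeter_def side_eq by blast+
 obtain E where E [measurable]: "E \<in> sets borel" and aeE: "AE x in lborel. x \<in> E \<longleftrightarrow> x \<in> \<Omega>"
  by (rule exists_borel_version[OF adm(1)])
 \<comment> \<open>The trace comparison uses a topological frontier, so the representative whose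
   frontier is \<open>bdry \<Omega>\<close> is needed alongside the Borel version
   \<open>E\<close>.\<close>
 obtain \<Omega>' where \<Omega>': "\<Omega>' \<in> sets lebesgue" "(\<Omega> - \<Omega>') \<union> (\<Omega>' - \<Omega>) \<in> null_sets lebesgue" "frontier \<Omega>' = bdry \<Omega>'" "bdry \<Omega>' = bdry \<Omega>"
  by (rule exists_normalized_representative[OF adm(1)])
 have "AE x in lborel. x \<notin> (\<Omega> - \<Omega>') \<union> (\<Omega>' - \<Omega>)"
  using AE_not_in[OF \<Omega>'(2)] by (simp add: AE_completion_iff)
 with aeE have aeE': "AE x in lborel. x \<in> E \<longleftrightarrow> x \<in> \<Omega>'" by eventually_elim auto
 have per_eq: "perimeter E (?H sg) = perimeter \<Omega> (?H sg)" "perimeter (E \<inter> ?H sg) (?H sg) = perimeter \<Omega> (?H sg)" for sg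
 proof -
  have "AE x in lebesgue. x \<in> E \<longleftrightarrow> x \<in> \<Omega>" using aeE by (simp add: AE_completion_iff)
  thus "perimeter E (?H sg) = perimeter \<Omega> (?H sg)" "perimeter (E \<inter> ?H sg) (?H sg) = perimeter \<Omega> (?H sg)"
   using adm(1) by (auto intro!: perimeter_cong elim: eventually_mono)
 qed
 define p where "p sg = enn2real (perimeter \<Omega> (?H sg))" for sg
 have per_fin: "perimeter \<Omega> (?H sg) < \<infinity>" for sg
  by (rule le_less_trans[OF perimeter_mono adm(2)]) simp
 hence p: "perimeter \<Omega> (?H sg) = ennreal (p sg)" "0 <= p sg" for sg by (simp_all add: p_def less_top)
 have vol: "evol (E \<inter> ?H sg) = emeasure lebesgue (\<Omega> \<inter> ?H sg)" for sg
 proof -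
  have "evol (E \<inter> ?H sg) = emeasure lebesgue (E \<inter> ?H sg)" by simp
  also have "... = emeasure lebesgue (\<Omega> \<inter> ?H sg)"
  proof (rule emeasure_eq_AE)
   have "AE x in lebesgue. x \<in> E \<longleftrightarrow> x \<in> \<Omega>" using aeE by (simp add: AE_completion_iff)
   thus "AE x in lebesgue. (x \<in> E \<inter> ?H sg) = (x \<in> \<Omega> \<inter> ?H sg)" by eventually_elim auto
  qed (use adm(1) in auto)
  finally show ?thesis .
 qed
 note vols = adm(3,4)[folded vol]
 have E_fin: "evol E < \<infinity>"
 proof -
  have "E \<subseteq> (E \<inter> ?H (-1)) \<union> (E \<inter> ?H 1) \<union> interface k" by (auto simp: halfspace_def interface_def)
  hence "evol E <= evol ((E \<inter> ?H (-1)) \<union> (E \<inter> ?H 1) \<union> interface k)"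
   using null_interface[of k] by (intro emeasure_mono) auto
  also have "... <= evol (E \<inter> ?H (-1)) + evol (E \<inter> ?H 1) + evol (interface k)"
   using null_interface[of k] by (intro order_trans[OF emeasure_subadditive] add_right_mono emeasure_subadditive) auto
  also have "... < \<infinity>" using null_interface[of k] by (simp add: vols null_sets_def)
  finally show ?thesis .
 qed
 define d where "d n = inverse (real (Suc n))" for n
 have d: "0 < d n" for n by (simp add: d_def)
 have tr: "trace_avg k sg E (d n) \<in> {0..p sg}" if "sg = 1 \<or> sg = -1" for sg n
  using trace_avg_nn_integral(2)[OF E E_fin d, of k sg n] trace_avg_le[OF E E_fin d that, of k "p sg" n] p by (simp add: per_eq)
 obtain r A1 A2 where r: "strict_mono r" and A: "(\<lambda>n. trace_avg k (-1) E (d (r n))) ----> A1" "(\<lambda>n. trace_avg k 1 E (d (r n))) ----> A2"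
  by (rule bounded_pair_convergent[OF tr[of "-1"] tr[of 1]]) auto
 have A0: "0 <= A1" "0 <= A2"
  using tr[of "-1"] tr[of 1] by (auto intro: LIMSEQ_le_const[OF A(1)] LIMSEQ_le_const[OF A(2)])
 define ds where "ds n = d (r n)" for n
 have ds: "0 < ds n" "ds ----> 0" for n
  using d LIMSEQ_subseq_LIMSEQ[OF LIMSEQ_inverse_real_of_nat r] by (simp_all add: ds_def[abs_def] d_def o_def)
 \<comment> \<open>Restriction to one side leaves the averages unchanged, since the weight vanishes
   on the other side.\<close>
 have side: "half_set k sg (E \<inter> ?H sg) (p sg) B ds"
  if "sg = 1 \<or> sg = -1" "(\<lambda>n. trace_avg k sg E (d (r n))) ----> B" for sg B
 proof
  have "trace_avg k sg (E \<inter> ?H sg) (ds n) = trace_avg k sg E (ds n)" for n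
   unfolding trace_avg_def
  proof (intro Bochner_Integration.integral_cong refl)
   fix x :: "real^'n"
   have "wt (ds n) (sg * x $ k) = 0" if "x \<notin> ?H sg"
    using that ds(1)[of n] by (intro wt_outside) (auto simp: halfspace_def)
   thus "ind (E \<inter> ?H sg) x * wt (ds n) (sg * x $ k) = ind E x * wt (ds n) (sg * x $ k)"
    by (auto simp: indicator_def)
  qed
  thus "(\<lambda>n. trace_avg k sg (E \<inter> ?H sg) (ds n)) ----> B" using that(2) by (simp add: ds_def)
  show "evol (E \<inter> ?H sg) < \<infinity>" by (rule le_less_trans[OF emeasure_mono E_fin]) auto
 qed (use that ds p per_eq in auto)
 have mV: "vol (E \<inter> ?H (-1)) = Vm / \<rho>m" "vol (E \<inter> ?H 1) = Vp / \<rho>p"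
  using assms(2-5) vols by (simp_all add: measure_def)
 define q where "q sg a s = s ^ m * (real (Suc m) * vol (capset k sg a) - a * slice_area om m a)" for sg a s
 \<comment> \<open>The conclusion of the equality case for one side; it is available only under
   \<open>p <= q\<close>, which the comparison of energies supplies.\<close>
 define touch where "touch sg a s t \<longleftrightarrow> (AE x in lborel. x \<in> ?H sg --> (x \<in> E \<inter> ?H sg \<longleftrightarrow> dist t x <= s)) \<and>
  a * s <= sg * t $ k \<and> (a < 1 --> sg * t $ k = a * s)" for sg a s and t :: "real^'n"
 obtain a1 s1 where c1: "- 1 < a1" "a1 <= 1" "0 < s1" "s1 ^ Suc m * vol (capset k (-1) a1) = Vm / \<rho>m"
  "A1 = om * (s1 * sqrt (1 - a1\<^sup>2)) ^ m" "q (-1) a1 s1 <= p (-1)" "p (-1) <= q (-1) a1 s1 ==> \<exists>t. touch (-1) a1 s1 t"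
  by (rule half_set.matched_cap[OF side[OF _ A(1)] m om _ A0(1)]) (use assms(2-5) in \<open>auto simp: mV q_def touch_def\<close>)
 obtain a2 s2 where c2: "- 1 < a2" "a2 <= 1" "0 < s2" "s2 ^ Suc m * vol (capset k 1 a2) = Vp / \<rho>p"
  "A2 = om * (s2 * sqrt (1 - a2\<^sup>2)) ^ m" "q 1 a2 s2 <= p 1" "p 1 <= q 1 a2 s2 ==> \<exists>t. touch 1 a2 s2 t"
  by (rule half_set.matched_cap[OF side[OF _ A(2)] m om _ A0(2)]) (use assms(2-5) in \<open>auto simp: mV q_def touch_def\<close>)
 define C1 C2 where "C1 = cap k (-1) (a1 * s1) s1" and "C2 = cap k 1 (a2 * s2) s2"
 have [measurable]: "C1 \<in> sets borel" "C2 \<in> sets borel" by (simp_all add: C1_def C2_def)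
 have CH: "(C1 \<union> C2) \<inter> ?H (-1) = C1" "(C1 \<union> C2) \<inter> ?H 1 = C2" "C1 \<inter> C2 = {}"
  by (auto simp: C1_def C2_def cap_def halfspace_def)
 note pc1 = perimeter_cap[of "-1" m, OF _ m om c1(1-3), folded q_def C1_def]
  and pc2 = perimeter_cap[of 1 m, OF _ m om c2(1-3), folded q_def C2_def]
 have "admissible k \<rho>m \<rho>p Vm Vp (C1 \<union> C2)"
  unfolding admissible_def finite_perimeter_def side_eq
 proof (intro conjI)
  have C_fin: "evol C1 < \<infinity>" "evol C2 < \<infinity>"
   unfolding C1_def C2_def using c1(3) c2(3) by (simp_all add: cap_volume)
  have "perimeter (C1 \<union> C2) UNIV <= perimeter C1 UNIV + perimeter C2 UNIV" by (rule perimeter_Un_le[OF _ _ CH(3)]) measurable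
  also have "... <= ennreal (2 * q (-1) a1 s1) + ennreal (2 * q 1 a2 s2)"
   using CH(1,2) pc1 pc2 C_fin by (intro add_mono perimeter_UNIV_le[where k=k and sg="-1"] perimeter_UNIV_le[where k=k and sg=1]) auto
  also have "... < \<infinity>" by simp
  finally show "perimeter (C1 \<union> C2) UNIV < \<infinity>" .
  have "evol C1 = ennreal (Vm / \<rho>m)" "evol C2 = ennreal (Vp / \<rho>p)"
   unfolding C1_def C2_def using c1(3,4) c2(3,4) by (simp_all add: cap_volume m(2))
  thus "ennreal \<rho>m * emeasure lebesgue ((C1 \<union> C2) \<inter> ?H (-1)) = ennreal Vm" "ennreal \<rho>p * emeasure lebesgue ((C1 \<union> C2) \<inter> ?H 1) = ennreal Vp"
   unfolding CH using assms(2-5) by (simp_all add: ennreal_mult[symmetric])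
 qed simp
 hence "\<not> energy k \<rho>m \<rho>p \<gamma> (C1 \<union> C2) < energy k \<rho>m \<rho>p \<gamma> \<Omega>"
  using assms(7) unfolding is_arg_min_def by blast
 hence min: "energy k \<rho>m \<rho>p \<gamma> \<Omega> <= energy k \<rho>m \<rho>p \<gamma> (C1 \<union> C2)" by simp
 define D where "D = kp * \<bar>A1 - A2\<bar>"
 have D0: "0 <= D" using kp(2) by (simp add: D_def)
 \<comment> \<open>The trace gap is applied in both directions, which produces the absolute value in
   \<open>D\<close>.\<close>
 have lower: "ennreal D <= hmeas m (bdry \<Omega> \<inter> interface k)"
 proof -
  have "ennreal (kp * (A1 - A2)) <= hmeas m (frontier \<Omega>' \<inter> interface k)"
   by (rule hausdorff_trace_gap[OF m(2) E E_fin aeE' _ _ ds _ _ A0(2) kp, where sg="-1"])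
    (use A per_fin in \<open>simp_all add: per_eq ds_def\<close>)
  moreover have "ennreal (kp * (A2 - A1)) <= hmeas m (frontier \<Omega>' \<inter> interface k)"
   by (rule hausdorff_trace_gap[OF m(2) E E_fin aeE' _ _ ds _ _ A0(1) kp, where sg=1])
    (use A per_fin in \<open>simp_all add: per_eq ds_def\<close>)
  ultimately show ?thesis unfolding \<Omega>'(3,4) D_def by (cases "A1 <= A2") (simp_all add: abs_if)
 qed
 \<comment> \<open>The boundary of the competitor meets the interface only between the two discs,
   whose areas are \<open>A1\<close> and \<open>A2\<close>; so the same \<open>D\<close> appears as
   in the lower bound.\<close>
 have upper: "hmeas m (bdry (C1 \<union> C2) \<inter> interface k) <= ennreal D"
 proof -
  define R1 R2 where "R1 = s1 * sqrt (1 - a1\<^sup>2)" and "R2 = s2 * sqrt (1 - a2\<^sup>2)"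
  have "a1\<^sup>2 <= 1" "a2\<^sup>2 <= 1" using c1(1,2) c2(1,2) by (simp_all add: abs_square_le_1 abs_le_iff)
  hence R: "0 <= R1" "0 <= R2" using c1(3) c2(3) by (simp_all add: R1_def R2_def)
  have "bdry (C1 \<union> C2) \<inter> interface k \<subseteq> {x. min R1 R2 <= norm x \<and> norm x <= max R1 R2} \<inter> interface k"
   unfolding C1_def C2_def
   by (rule bdry_caps_subset) (use c1(1-3) c2(1-3) in \<open>auto simp: R1_def R2_def abs_le_iff\<close>)
  hence "hmeas m (bdry (C1 \<union> C2) \<inter> interface k)
    <= hmeas m ({x. min R1 R2 <= norm x \<and> norm x <= max R1 R2} \<inter> interface k)"
   by (rule hausdorff_measure_mono)
  also have "... <= hmeas m (face k 0 1) * ennreal (om * (max R1 R2 ^ m - min R1 R2 ^ m))"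
   by (rule hausdorff_annulus_le[OF m om]) (use R in auto)
  also have "... = ennreal D"
  proof -
   have "om * (max R1 R2 ^ m - min R1 R2 ^ m) = \<bar>A1 - A2\<bar>"
   proof (cases "R1 <= R2")
    case True
    hence "R1 ^ m <= R2 ^ m" using R by (intro power_mono)
    thus ?thesis using True om(1) unfolding c1(5) c2(5) R1_def[symmetric] R2_def[symmetric]
     by (simp add: abs_if right_diff_distrib)
   next
    case False
    hence "R2 ^ m <= R1 ^ m" using R by (intro power_mono) auto
    thus ?thesis using False om(1) unfolding c1(5) c2(5) R1_def[symmetric] R2_def[symmetric]
     by (simp add: abs_if right_diff_distrib)
   qed
   thus ?thesis unfolding kp(1) D_def using kp(2) by (simp add: ennreal_mult')
  qed
  finally show ?thesis .
 qed
 have "ennreal (\<rho>m * p (-1) + \<rho>p * p 1 + \<gamma> * D) <= energy k \<rho>m \<rho>p \<gamma> \<Omega>"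
  unfolding energy_def side_eq p(1) m_def[symmetric] using lower assms(4-6) p(2) D0
  by (simp add: ennreal_plus ennreal_mult add_left_mono mult_left_mono)
 also have "... <= energy k \<rho>m \<rho>p \<gamma> (C1 \<union> C2)" by (rule min)
 also have "... <= ennreal (\<rho>m * q (-1) a1 s1 + \<rho>p * q 1 a2 s2 + \<gamma> * D)"
 proof -
  have "perimeter (C1 \<union> C2) (?H (-1)) = perimeter C1 (?H (-1))" "perimeter (C1 \<union> C2) (?H 1) = perimeter C2 (?H 1)"
   using CH by (auto intro!: perimeter_cong AE_I2)
  thus ?thesis
   unfolding energy_def side_eq m_def[symmetric] using upper pc1 pc2 assms(4-6) D0
   by (simp add: ennreal_plus ennreal_mult add_mono mult_left_mono)
 qed
 \<comment> \<open>The interface terms are identical and cancel. Since each side separately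
   satisfies \<open>q <= p\<close> with a positive weight, neither inequality can be strict.\<close>
 finally have "\<rho>m * p (-1) + \<rho>p * p 1 <= \<rho>m * q (-1) a1 s1 + \<rho>p * q 1 a2 s2"
  using pc1 pc2 assms(4-6) D0 by (subst (asm) ennreal_le_iff) auto
 moreover have "\<rho>m * q (-1) a1 s1 <= \<rho>m * p (-1)" "\<rho>p * q 1 a2 s2 <= \<rho>p * p 1"
  using c1(6) c2(6) assms(4,5) by simp_all
 ultimately have "\<rho>m * p (-1) <= \<rho>m * q (-1) a1 s1" "\<rho>p * p 1 <= \<rho>p * q 1 a2 s2" by linarith+
 hence "p (-1) <= q (-1) a1 s1" "p 1 <= q 1 a2 s2" using assms(4,5) by simp_all
 then obtain t1 t2 where t: "touch (-1) a1 s1 t1" "touch 1 a2 s2 t2" using c1(7) c2(7) by blast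
 have concl: "spherical_cap k (?H sg) (bdry \<Omega> \<inter> ?H sg) \<or> sphere_in_side k (?H sg) (bdry \<Omega> \<inter> ?H sg)"
  if t: "touch sg a s t" and sg: "sg = 1 \<or> sg = -1" and a: "- 1 < a" "a <= 1" and s: "0 < s" for sg a s t
 proof -
  have "AE x in lborel. x \<in> ?H sg --> (x \<in> E \<inter> ?H sg \<longleftrightarrow> dist t x <= s)" using t by (simp add: touch_def)
  with aeE have "AE x in lborel. x \<in> ?H sg --> (x \<in> \<Omega> \<longleftrightarrow> dist t x <= s)" by eventually_elim auto
  moreover have "open (?H sg)" unfolding halfspace_def by (intro open_Collect_less continuous_intros)
  ultimately have "bdry \<Omega> \<inter> ?H sg = sphere t s \<inter> ?H sg" by (intro bdry_ball_side[OF adm(1) _ s])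
  thus ?thesis using cap_or_sphere[OF sg a s, of t k] t by (simp add: touch_def)
 qed
 show ?thesis
  unfolding side_eq using concl[OF t(1) _ c1(1-3)] concl[OF t(2) _ c2(1-3)] by simp
qed

end
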